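(* Let $\lambda$ be an infinite cardinal and let $\mathfrak s=(\mathfrak k,S^{bs},\mathrm{nf})$ be a good $\lambda$-frame minus stability with conjugation, such that the existence property is satisfied by $K^{3,uq}$. All models below are in $K_\lambda$. Then: (a) Independence is finite independence: for all $M\preceq M_0\preceq M^+$ and every $J\subseteq |M^+|$, $J$ is independent in $(M,M_0,M^+)$ if and only if $J$ is finitely independent in $(M,M_0,M^+)$. (b) If $M\preceq M_0\preceq N$, the set $J$ is independent in $(M,M_0,N)$ and $\{a_\alpha:\alpha<\alpha^*\}$ is an enumeration of $J$ without repetitions ($\alpha^*$ an ordinal), then the sequence $\langle a_\alpha:\alpha<\alpha^*\rangle$ is independent in $(M,M_0,N)$. (c) The independence relation has continuity: if $\delta$ is a limit ordinal, $\langle M_\alpha:\alpha\le\delta\rangle$ is an increasing continuous sequence with $M\preceq M_0$ and $M_\delta\preceq M^+$, $J\subseteq |M^+|$, and $J$ is independent in $(M,M_\alpha,M^+)$ for every $\alpha<\delta$, then $J$ is independent in $(M,M_\delta,M^+)$. (d) Let $M\preceq N$, $P\subseteq S^{bs}(M)$ and $J\subseteq |N|$ be such that $\mathrm{tp}(a,M,N)\in P$ for all $a\in J$, $J$ is independent in $(M,M,N)$, and $J$ is maximal (under inclusion) among subsets of $|N|$ with these properties. Then $\dim(P,N)=|J|$ or $\dim(P,N)+|J|<\aleph_0$.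
   Context: A.e.c. For a model $M$, $|M|$ is its universe and $\|M\|$ its cardinality. A pair $\mathfrak k=(K,\preceq)$, with $K$ a class of models of a fixed vocabulary and $\preceq$ a binary relation on $K$, is an abstract elementary class (a.e.c.) if: (a) $K$ and $\preceq$ are closed under isomorphisms; (b) $\preceq$ is a partial order contained in the submodel relation $\subseteq$; (c) if $\langle M_\alpha:\alpha<\delta\rangle$ is $\preceq$-increasing and continuous, then $M_0\preceq\bigcup_{\alpha<\delta}M_\alpha\in K$; (d) (smoothness) if moreover $M_\alpha\preceq N$ for all $\alpha<\delta$, then $\bigcup_{\alpha<\delta}M_\alpha\preceq N$; (e) if $M_0\subseteq M_1\subseteq M_2$, $M_0\preceq M_2$ and $M_1\preceq M_2$, then $M_0\preceq M_1$; (f) there is a least cardinal $LST(\mathfrak k)$ such that for every $N\in K$ and $A\subseteq |N|$ there is $M\in K$ with $A\subseteq M\preceq N$ and $\|M\|\le LST(\mathfrak k)+|A|$. $K_\lambda=\{M\in K:\|M\|=\lambda\}$; $M\prec N$ means $M\preceq N$ and $M\ne N$. An embedding $f:M\to N$ is an isomorphism of $M$ onto some $f[M]\preceq N$; it is over $A$ if it is the identity on $A$. An amalgamation of $M_1,M_2$ over $M_0$ (where $M_0\preceq M_1,M_2$) is $(f_1,f_2,M_3)$ with $f_n:M_n\to M_3$ embeddings over $M_0$. Types. On triples $(M,N,a)$ with $M\preceq N$ in $K$, $a\in N$, let $(M_0,N_0,a_0)E^*(M_1,N_1,a_1)$ iff $M_0=M_1$ and for some $N_2\succeq N_1$ there is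 an embedding $f:N_0\to N_2$ over $M_0$ with $f(a_0)=a_1$. $E$ is the transitive closure of $E^*$ and $\mathrm{tp}(a,M,N)$ is the $E$-class of $(M,N,a)$. $S(M)$ is the set of all types over $M$; for $p=\mathrm{tp}(a,M_1,N)$ and $M_0\preceq M_1$, $p\restriction M_0=\mathrm{tp}(a,M_0,N)$. For $p=\mathrm{tp}(a,M,N)$ and an isomorphism $f:M\to M^*$, $f(p)=\mathrm{tp}(f^+(a),f[M],f^+[N])$ for any isomorphism $f^+\supseteq f$ with domain $N$. Frame. $\mathfrak s=(\mathfrak k,S^{bs},\mathrm{nf})$ is a good $\lambda$-frame minus stability if (models below are in $K_\lambda$): (1) $\mathfrak k$ is an a.e.c., $LST(\mathfrak k)\le\lambda$, $K_\lambda$ has joint embedding and amalgamation, and no $\preceq$-maximal model. (2) $S^{bs}$ is a function on $K_\lambda$, respecting isomorphisms, with $S^{bs}(M)\subseteq\{\mathrm{tp}(a,M,N):M\prec N\in K_\lambda,\ a\in N-M\}$, and (density) whenever $M\prec N$ there is $a\in N-M$ with $\mathrm{tp}(a,M,N)\in S^{bs}(M)$. (3) $\mathrm{nf}$ is a 4-place relation, invariant under isomorphisms, such that: (a) $\mathrm{nf}(M_0,M_1,a,M_3)$ implies $M_0\preceq M_1\preceq M_3$, $a\in M_3-M_1$, and $\mathrm{tp}(a,M_n,M_3)\in S^{bs}(M_n)$ for $n<2$. (b) Monotonicity: if $M_0\preceq M_0^*\preceq M_1^*\preceq M_1\preceq M_3\preceq M_3^*$ and $M_1^*\cup\{a\}\subseteq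 M_3^{**}\preceq M_3^*$, then $\mathrm{nf}(M_0,M_1,a,M_3)$ implies $\mathrm{nf}(M_0^*,M_1^*,a,M_3^{**})$. One says "$\mathrm{tp}(a,M_1,M_3)$ does not fork over $M_0$" for $\mathrm{nf}(M_0,M_1,a,M_3)$. (c) Local character: if $\delta$ is limit, $\langle M_\alpha:\alpha\le\delta\rangle$ is increasing continuous, $M_\delta\preceq M_{\delta+1}$ and $\mathrm{tp}(a,M_\delta,M_{\delta+1})\in S^{bs}(M_\delta)$, then this type does not fork over $M_\alpha$ for some $\alpha<\delta$. (d) Uniqueness: if $p,q\in S^{bs}(N)$ do not fork over $M$ and $p\restriction M=q\restriction M$, then $p=q$. (e) Symmetry: if $M_0\preceq M_1\preceq M_3$, $a_1\in M_1$, $\mathrm{tp}(a_1,M_0,M_3)\in S^{bs}(M_0)$ and $\mathrm{tp}(a_2,M_1,M_3)$ does not fork over $M_0$, then for some $M_2,M_3^*$: $a_2\in M_2$, $M_0\preceq M_2\preceq M_3^*$, $M_3\preceq M_3^*$ and $\mathrm{tp}(a_1,M_2,M_3^* )$ does not fork over $M_0$. (f) Extension: if $p\in S^{bs}(M)$ and $M\prec N$, some $q\in S^{bs}(N)$ does not fork over $M$ and satisfies $q\restriction M=p$. (g) Continuity: if $\delta$ is limit, $\langle M_\alpha:\alpha\le\delta\rangle$ is increasing continuous, $p\in S(M_\delta)$ and $p\restriction M_\alpha$ does not fork over $M_0$ for all $\alpha<\delta$, then $p\in S^{bs}(M_\delta)$ and $p$ does not fork over $M_0$. Conjugation: $\mathfrak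 s$ has conjugation when for all $M_0\preceq M_1$ in $K_\lambda$ and $p\in S^{bs}(M_1)$ not forking over $M_0$, there is an isomorphism $f:M_0\to M_1$ with $f(p\restriction M_0)=p$. Independence (all models in $K_\lambda$). $\langle M_\alpha,a_\alpha:\alpha<\alpha^*\rangle^\frown\langle M_{\alpha^*}\rangle$ is independent over $M$ when $\langle M_\alpha:\alpha\le\alpha^*\rangle$ is an increasing continuous sequence of models in $K_\lambda$, $M\preceq M_0$, and for every $\alpha<\alpha^*$ the type $\mathrm{tp}(a_\alpha,M_\alpha,M_{\alpha+1})$ does not fork over $M$. A sequence $\langle a_\alpha:\alpha<\alpha^*\rangle$ is independent in $(M,M_0,M^+)$ when there are models $\langle M_\alpha:0<\alpha\le\alpha^*\rangle$ and $M^{++}$ such that $\langle M_\alpha,a_\alpha:\alpha<\alpha^*\rangle^\frown\langle M_{\alpha^*}\rangle$ (starting with the given $M_0$) is independent over $M$, $M^+\preceq M^{++}$ and $M_{\alpha^*}\preceq M^{++}$. A set $J$ is independent in $(M,A,N)$ ($A$ a set or a model) when there is a sequence $\langle M'_\alpha,a_\alpha:\alpha<\alpha^*\rangle^\frown\langle M'_{\alpha^*}\rangle$ independent over $M$ with $J=\{a_\alpha:\alpha<\alpha^*\}$, $A\subseteq M'_0$, and a model $N^+$ with $M'_{\alpha^*}\preceq N^+$ and $N\preceq N^+$. $J$ is finitely independent in $(M,A,N)$ when every finite subset of $J$ is independent in $(M,A,N)$. Dimension. For $M\preceq N$ in $K_\lambda$ and $P\subseteq S^{bs}(M)$, $\dim(P,N)$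 is the minimum of $|J|$ over all sets $J\subseteq |N|$ which are maximal (under inclusion) among the sets $J\subseteq|N|$ such that $\mathrm{tp}(a,M,N)\in P$ for all $a\in J$ and $J$ is independent in $(M,M,N)$. Uniqueness triples. $K^{3,bs}$ is the class of triples $(M,N,a)$ with $M\preceq N$ in $K_\lambda$, $a\in N-M$, $\mathrm{tp}(a,M,N)\in S^{bs}(M)$. Two amalgamations $(f_1^x,f_2^x,M_3^x)$, $x=a,b$, of $M_1,M_2$ over $M_0$ are equivalent over $M_0$ (relation $E_{M_0}$) if there are a model $M_3$ and embeddings $f^x:M_3^x\to M_3$ with $f^a\circ f_n^a=f^b\circ f_n^b$ for $n=1,2$. $K^{3,uq}$ (uniqueness triples) is the class of triples $(M_{0,0},M_{1,0},a)\in K^{3,bs}$ such that for every $M_{0,1}\succ M_{0,0}$ in $K_\lambda$ there is, up to $E_{M_{0,0}}$, a unique amalgamation $(f_{1,0},f_{0,1},M_{1,1})$ (with $M_{1,1}\in K_\lambda$) of $M_{1,0},M_{0,1}$ over $M_{0,0}$ such that $\mathrm{tp}(f_{1,0}(a),f_{0,1}[M_{0,1}],M_{1,1})$ does not fork over $M_{0,0}$. The existence property is satisfied by $K^{3,uq}$ when for every $M\in K_\lambda$ and $p\in S^{bs}(M)$ there is $(M,N,a)\in K^{3,uq}$ with $\mathrm{tp}(a,M,N)=p$. *)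

theory Defs
  imports Main
begin

unbundle cardinal_syntax

section \<open>Ordinals\<close>

text \<open>
  Ordinals are the elements of a type \<open>'o :: wellorder\<close>; the element \<open>\<alpha>\<close> stands for the order type
  of \<open>{..<\<alpha>}\<close>. Notions that quantify over ordinals take \<open>TYPE('o)\<close> as an argument.

  The elements of all models lie in one type \<open>'a\<close>, so that a class of models is a set. The two
  types are meant to satisfy \<open>lam <o |UNIV :: 'a set|\<close> and \<open>|UNIV :: 'a set| <o |UNIV :: 'o set|\<close>
  for the cardinal \<open>lam\<close> of a frame. The first leaves room for isomorphic copies of models of
  size \<open>lam\<close> outside a given one; by the second, \<open>'o\<close> contains the order type of every strictly
  increasing chain of subsets of \<open>'a\<close> and of every enumeration of such a subset without repetitions.
\<close>

definition ozero :: "'o::wellorder" where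
  "ozero = (LEAST \<alpha>. True)"

definition osuc :: "'o::wellorder \<Rightarrow> 'o" where
  "osuc \<alpha> = (LEAST \<beta>. \<alpha> < \<beta>)"

definition olimit :: "'o::wellorder \<Rightarrow> bool" where
  "olimit \<delta> \<longleftrightarrow> (\<exists>\<alpha>. \<alpha> < \<delta>) \<and> (\<forall>\<alpha><\<delta>. \<exists>\<beta>. \<alpha> < \<beta> \<and> \<beta> < \<delta>)"


definition ord_min :: "'b rel set \<Rightarrow> 'b rel" where
  "ord_min C = (SOME \<kappa>. \<kappa> \<in> C \<and> (\<forall>\<mu>\<in>C. \<kappa> \<le>o \<mu>))"


section \<open>Models of a vocabulary\<close>

record ('f, 'r) vocabulary =
  fsyms :: "'f set"
  rsyms :: "'r set"
  farity :: "'f \<Rightarrow> nat"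
  rarity :: "'r \<Rightarrow> nat"

text \<open>
  A function symbol is interpreted by its graph. Hence equality of models is plain equality, and
  images and unions of models can be formed componentwise.
\<close>

record ('a, 'f, 'r) model =
  univ :: "'a set"
  fint :: "'f \<Rightarrow> ('a list \<times> 'a) set"
  rint :: "'r \<Rightarrow> 'a list set"

definition tuples :: "'a set \<Rightarrow> nat \<Rightarrow> 'a list set" where
  "tuples A n = {xs. set xs \<subseteq> A \<and> length xs = n}"

definition is_model :: "('f, 'r) vocabulary \<Rightarrow> ('a, 'f, 'r) model \<Rightarrow> bool" where
  "is_model \<tau> M \<longleftrightarrow>
     univ M \<noteq> {} \<and>
     (\<forall>g\<in>fsyms \<tau>. fint M g \<subseteq> tuples (univ M) (farity \<tau> g) \<times> univ M \<and>
        (\<forall>xs\<in>tuples (univ M) (farity \<tau> g). \<exists>!y. (xs, y) \<in> fint M g)) \<and>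
     (\<forall>g. g \<notin> fsyms \<tau> \<longrightarrow> fint M g = {}) \<and>
     (\<forall>R\<in>rsyms \<tau>. rint M R \<subseteq> tuples (univ M) (rarity \<tau> R)) \<and>
     (\<forall>R. R \<notin> rsyms \<tau> \<longrightarrow> rint M R = {})"

definition submodel ::
  "('f, 'r) vocabulary \<Rightarrow> ('a, 'f, 'r) model \<Rightarrow> ('a, 'f, 'r) model \<Rightarrow> bool" where
  "submodel \<tau> M N \<longleftrightarrow>
     is_model \<tau> M \<and> is_model \<tau> N \<and> univ M \<subseteq> univ N \<and>
     (\<forall>g\<in>fsyms \<tau>. fint M g = fint N g \<inter> (tuples (univ M) (farity \<tau> g) \<times> univ M)) \<and>
     (\<forall>R\<in>rsyms \<tau>. rint M R = rint N R \<inter> tuples (univ M) (rarity \<tau> R))"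

text \<open>Maps between models are total functions; only their values on the universe of the domain matter.\<close>

definition is_iso ::
  "('f, 'r) vocabulary \<Rightarrow> ('a \<Rightarrow> 'a) \<Rightarrow> ('a, 'f, 'r) model \<Rightarrow> ('a, 'f, 'r) model \<Rightarrow> bool" where
  "is_iso \<tau> f M N \<longleftrightarrow>
     is_model \<tau> M \<and> is_model \<tau> N \<and> bij_betw f (univ M) (univ N) \<and>
     (\<forall>g\<in>fsyms \<tau>. \<forall>xs\<in>tuples (univ M) (farity \<tau> g). \<forall>y\<in>univ M.
        (xs, y) \<in> fint M g \<longleftrightarrow> (map f xs, f y) \<in> fint N g) \<and>
     (\<forall>R\<in>rsyms \<tau>. \<forall>xs\<in>tuples (univ M) (rarity \<tau> R).
        xs \<in> rint M R \<longleftrightarrow> map f xs \<in> rint N R)"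

definition img :: "('a \<Rightarrow> 'a) \<Rightarrow> ('a, 'f, 'r) model \<Rightarrow> ('a, 'f, 'r) model" where
  "img f M = \<lparr>univ = f ` univ M,
              fint = (\<lambda>g. (\<lambda>(xs, y). (map f xs, f y)) ` fint M g),
              rint = (\<lambda>R. map f ` rint M R)\<rparr>"

definition union_model :: "('a, 'f, 'r) model set \<Rightarrow> ('a, 'f, 'r) model" where
  "union_model C = \<lparr>univ = (\<Union>M\<in>C. univ M),
                    fint = (\<lambda>g. \<Union>M\<in>C. fint M g),
                    rint = (\<lambda>R. \<Union>M\<in>C. rint M R)\<rparr>"


section \<open>Abstract elementary classes\<close>

record ('a, 'f, 'r) ec =
  voc :: "('f, 'r) vocabulary"
  K :: "('a, 'f, 'r) model set"
  le :: "('a, 'f, 'r) model \<Rightarrow> ('a, 'f, 'r) model \<Rightarrow> bool"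

definition K_at :: "('a, 'f, 'r, 'z) ec_scheme \<Rightarrow> 'l rel \<Rightarrow> ('a, 'f, 'r) model set" where
  "K_at k lam = {M \<in> K k. |univ M| =o lam}"

definition prec ::
  "('a, 'f, 'r, 'z) ec_scheme \<Rightarrow> ('a, 'f, 'r) model \<Rightarrow> ('a, 'f, 'r) model \<Rightarrow> bool" where
  "prec k M N \<longleftrightarrow> le k M N \<and> M \<noteq> N"

definition inc_cont ::
  "('a, 'f, 'r, 'z) ec_scheme \<Rightarrow> 'o::wellorder set \<Rightarrow> ('o \<Rightarrow> ('a, 'f, 'r) model) \<Rightarrow> bool" where
  "inc_cont k I M \<longleftrightarrow>
     (\<forall>\<beta>\<in>I. \<forall>\<alpha>\<in>I. \<alpha> \<le> \<beta> \<longrightarrow> le k (M \<alpha>) (M \<beta>)) \<and>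
     (\<forall>\<beta>\<in>I. olimit \<beta> \<longrightarrow> M \<beta> = union_model (M ` {..<\<beta>}))"

definition LST_bound :: "('a, 'f, 'r, 'z) ec_scheme \<Rightarrow> 'a rel \<Rightarrow> bool" where
  "LST_bound k \<kappa> \<longleftrightarrow>
     (\<forall>N\<in>K k. \<forall>A\<subseteq>univ N. \<exists>M\<in>K k. A \<subseteq> univ M \<and> le k M N \<and> |univ M| \<le>o \<kappa> +c |A| )"

text \<open>
  Cardinals up to the size of \<open>'a\<close> suffice here: no model is larger, so \<open>|UNIV :: 'a set|\<close> always
  satisfies \<open>LST_bound\<close>.
\<close>

definition LST :: "('a, 'f, 'r, 'z) ec_scheme \<Rightarrow> 'a rel" where
  "LST k = ord_min {\<kappa>. Card_order \<kappa> \<and> LST_bound k \<kappa>}"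

definition aec :: "'o::wellorder itself \<Rightarrow> ('a, 'f, 'r, 'z) ec_scheme \<Rightarrow> bool" where
  "aec _ k \<longleftrightarrow>
     (\<forall>M\<in>K k. is_model (voc k) M) \<and>
     (\<forall>M N f. M \<in> K k \<and> is_iso (voc k) f M N \<longrightarrow> N \<in> K k) \<and>
     (\<forall>M N M' N' f. le k M N \<and> is_iso (voc k) f N N' \<and> is_iso (voc k) f M M' \<longrightarrow> le k M' N') \<and>
     partial_order_on (K k) {(M, N). le k M N} \<and>
     (\<forall>M N. le k M N \<longrightarrow> submodel (voc k) M N) \<and>
     (\<forall>(\<delta>::'o) M. ozero < \<delta> \<and> inc_cont k {..<\<delta>} M \<longrightarrow>
        union_model (M ` {..<\<delta>}) \<in> K k \<and> le k (M ozero) (union_model (M ` {..<\<delta>}))) \<and>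
     (\<forall>(\<delta>::'o) M N. ozero < \<delta> \<and> inc_cont k {..<\<delta>} M \<and> (\<forall>\<alpha><\<delta>. le k (M \<alpha>) N) \<longrightarrow>
        le k (union_model (M ` {..<\<delta>})) N) \<and>
     (\<forall>M0 M1 M2. submodel (voc k) M0 M1 \<and> submodel (voc k) M1 M2 \<and> le k M0 M2 \<and> le k M1 M2 \<longrightarrow>
        le k M0 M1) \<and>
     (\<exists>\<kappa>. Card_order \<kappa> \<and> LST_bound k \<kappa>)"

definition embedding ::
  "('a, 'f, 'r, 'z) ec_scheme \<Rightarrow> ('a \<Rightarrow> 'a) \<Rightarrow> ('a, 'f, 'r) model \<Rightarrow> ('a, 'f, 'r) model \<Rightarrow> bool" where
  "embedding k f M N \<longleftrightarrow> (\<exists>M'. is_iso (voc k) f M M' \<and> le k M' N)"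

definition over :: "'a set \<Rightarrow> ('a \<Rightarrow> 'a) \<Rightarrow> bool" where
  "over A f \<longleftrightarrow> (\<forall>x\<in>A. f x = x)"

definition amalgamation ::
  "('a, 'f, 'r, 'z) ec_scheme \<Rightarrow> ('a, 'f, 'r) model \<Rightarrow> ('a, 'f, 'r) model \<Rightarrow> ('a, 'f, 'r) model \<Rightarrow>
   ('a \<Rightarrow> 'a) \<Rightarrow> ('a \<Rightarrow> 'a) \<Rightarrow> ('a, 'f, 'r) model \<Rightarrow> bool" where
  "amalgamation k M0 M1 M2 f1 f2 M3 \<longleftrightarrow>
     le k M0 M1 \<and> le k M0 M2 \<and>
     embedding k f1 M1 M3 \<and> over (univ M0) f1 \<and>
     embedding k f2 M2 M3 \<and> over (univ M0) f2"


section \<open>Galois types\<close>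

type_synonym ('a, 'f, 'r) triple = "('a, 'f, 'r) model \<times> ('a, 'f, 'r) model \<times> 'a"

type_synonym ('a, 'f, 'r) gtype = "('a, 'f, 'r) triple set"

definition triples :: "('a, 'f, 'r, 'z) ec_scheme \<Rightarrow> ('a, 'f, 'r) triple set" where
  "triples k = {(M, N, a). le k M N \<and> a \<in> univ N}"

definition Estar :: "('a, 'f, 'r, 'z) ec_scheme \<Rightarrow> ('a, 'f, 'r) triple rel" where
  "Estar k = {((M0, N0, a0), (M1, N1, a1)).
     (M0, N0, a0) \<in> triples k \<and> (M1, N1, a1) \<in> triples k \<and> M0 = M1 \<and>
     (\<exists>N2 f. le k N1 N2 \<and> embedding k f N0 N2 \<and> over (univ M0) f \<and> f a0 = a1)}"

definition tp ::
  "('a, 'f, 'r, 'z) ec_scheme \<Rightarrow> 'a \<Rightarrow> ('a, 'f, 'r) model \<Rightarrow> ('a, 'f, 'r) model \<Rightarrow>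
   ('a, 'f, 'r) gtype" where
  "tp k a M N = (Estar k)\<^sup>+ `` {(M, N, a)}"

definition types :: "('a, 'f, 'r, 'z) ec_scheme \<Rightarrow> ('a, 'f, 'r) model \<Rightarrow> ('a, 'f, 'r) gtype set" where
  "types k M = {tp k a M N | a N. (M, N, a) \<in> triples k}"

definition tp_restr ::
  "('a, 'f, 'r, 'z) ec_scheme \<Rightarrow> ('a, 'f, 'r) gtype \<Rightarrow> ('a, 'f, 'r) model \<Rightarrow>
   ('a, 'f, 'r) gtype" where
  "tp_restr k p M0 =
     (THE q. \<exists>M1 N a. (M1, N, a) \<in> triples k \<and> p = tp k a M1 N \<and> le k M0 M1 \<and> q = tp k a M0 N)"

definition tp_image ::
  "('a, 'f, 'r, 'z) ec_scheme \<Rightarrow> ('a \<Rightarrow> 'a) \<Rightarrow> ('a, 'f, 'r) gtype \<Rightarrow> ('a, 'f, 'r) gtype" where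
  "tp_image k f p =
     (THE q. \<exists>M N a g. (M, N, a) \<in> triples k \<and> p = tp k a M N \<and>
        (\<forall>x\<in>univ M. g x = f x) \<and> is_iso (voc k) g N (img g N) \<and>
        q = tp k (g a) (img f M) (img g N))"


section \<open>Good frames minus stability\<close>

record ('a, 'f, 'r) frame = "('a, 'f, 'r) ec" +
  Sbs :: "('a, 'f, 'r) model \<Rightarrow> ('a, 'f, 'r) gtype set"
  nf :: "('a, 'f, 'r) model \<Rightarrow> ('a, 'f, 'r) model \<Rightarrow> 'a \<Rightarrow> ('a, 'f, 'r) model \<Rightarrow> bool"

text \<open>\<open>dnf s M N p\<close>: the type \<open>p\<close> over \<open>N\<close> does not fork over \<open>M\<close>.\<close>

definition dnf ::
  "('a, 'f, 'r) frame \<Rightarrow> ('a, 'f, 'r) model \<Rightarrow> ('a, 'f, 'r) model \<Rightarrow> ('a, 'f, 'r) gtype \<Rightarrow> bool" where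
  "dnf s M N p \<longleftrightarrow> (\<exists>a N'. p = tp s a N N' \<and> nf s M N a N')"

definition frame_ec :: "'o::wellorder itself \<Rightarrow> 'l rel \<Rightarrow> ('a, 'f, 'r) frame \<Rightarrow> bool" where
  "frame_ec ord lam s \<longleftrightarrow>
     aec ord s \<and> LST s \<le>o lam \<and>
     (\<forall>M1\<in>K_at s lam. \<forall>M2\<in>K_at s lam. \<exists>M3\<in>K_at s lam. \<exists>f1 f2.
        embedding s f1 M1 M3 \<and> embedding s f2 M2 M3) \<and>
     (\<forall>M0\<in>K_at s lam. \<forall>M1\<in>K_at s lam. \<forall>M2\<in>K_at s lam. le s M0 M1 \<and> le s M0 M2 \<longrightarrow>
        (\<exists>M3\<in>K_at s lam. \<exists>f1 f2. amalgamation s M0 M1 M2 f1 f2 M3)) \<and>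
     (\<forall>M\<in>K_at s lam. \<exists>N\<in>K_at s lam. prec s M N)"

definition frame_Sbs :: "'l rel \<Rightarrow> ('a, 'f, 'r) frame \<Rightarrow> bool" where
  "frame_Sbs lam s \<longleftrightarrow>
     (\<forall>M\<in>K_at s lam. \<forall>N\<in>K_at s lam. \<forall>f. is_iso (voc s) f M N \<longrightarrow>
        (\<forall>p\<in>Sbs s M. tp_image s f p \<in> Sbs s N)) \<and>
     (\<forall>M\<in>K_at s lam.
        Sbs s M \<subseteq> {tp s a M N | a N. N \<in> K_at s lam \<and> prec s M N \<and> a \<in> univ N - univ M}) \<and>
     (\<forall>M\<in>K_at s lam. \<forall>N\<in>K_at s lam. prec s M N \<longrightarrow>
        (\<exists>a\<in>univ N - univ M. tp s a M N \<in> Sbs s M))"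

definition nf_invariant :: "('a, 'f, 'r) frame \<Rightarrow> bool" where
  "nf_invariant s \<longleftrightarrow>
     (\<forall>M0 M1 a M3 f N. nf s M0 M1 a M3 \<and> is_iso (voc s) f M3 N \<longrightarrow>
        nf s (img f M0) (img f M1) (f a) N)"

definition nf_basic :: "'l rel \<Rightarrow> ('a, 'f, 'r) frame \<Rightarrow> bool" where
  "nf_basic lam s \<longleftrightarrow>
     (\<forall>M0 M1 a M3. nf s M0 M1 a M3 \<longrightarrow>
        M0 \<in> K_at s lam \<and> M1 \<in> K_at s lam \<and> M3 \<in> K_at s lam \<and>
        le s M0 M1 \<and> le s M1 M3 \<and> a \<in> univ M3 - univ M1 \<and>
        tp s a M0 M3 \<in> Sbs s M0 \<and> tp s a M1 M3 \<in> Sbs s M1)"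

definition nf_monotonicity :: "'l rel \<Rightarrow> ('a, 'f, 'r) frame \<Rightarrow> bool" where
  "nf_monotonicity lam s \<longleftrightarrow>
     (\<forall>M0\<in>K_at s lam. \<forall>M0'\<in>K_at s lam. \<forall>M1'\<in>K_at s lam. \<forall>M1\<in>K_at s lam.
      \<forall>M3\<in>K_at s lam. \<forall>M3'\<in>K_at s lam. \<forall>M3''\<in>K_at s lam. \<forall>a.
        le s M0 M0' \<and> le s M0' M1' \<and> le s M1' M1 \<and> le s M1 M3 \<and> le s M3 M3' \<and>
        univ M1' \<union> {a} \<subseteq> univ M3'' \<and> le s M3'' M3' \<and> nf s M0 M1 a M3 \<longrightarrow>
        nf s M0' M1' a M3'')"

definition nf_local_character ::
  "'o::wellorder itself \<Rightarrow> 'l rel \<Rightarrow> ('a, 'f, 'r) frame \<Rightarrow> bool" where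
  "nf_local_character _ lam s \<longleftrightarrow>
     (\<forall>(\<delta>::'o) M N a. olimit \<delta> \<and> inc_cont s {..\<delta>} M \<and> (\<forall>\<alpha>\<le>\<delta>. M \<alpha> \<in> K_at s lam) \<and>
        N \<in> K_at s lam \<and> le s (M \<delta>) N \<and> a \<in> univ N \<and> tp s a (M \<delta>) N \<in> Sbs s (M \<delta>) \<longrightarrow>
        (\<exists>\<alpha><\<delta>. nf s (M \<alpha>) (M \<delta>) a N))"

definition nf_uniqueness :: "'l rel \<Rightarrow> ('a, 'f, 'r) frame \<Rightarrow> bool" where
  "nf_uniqueness lam s \<longleftrightarrow>
     (\<forall>M\<in>K_at s lam. \<forall>N\<in>K_at s lam. \<forall>p\<in>Sbs s N. \<forall>q\<in>Sbs s N.
        dnf s M N p \<and> dnf s M N q \<and> tp_restr s p M = tp_restr s q M \<longrightarrow> p = q)"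

definition nf_symmetry :: "'l rel \<Rightarrow> ('a, 'f, 'r) frame \<Rightarrow> bool" where
  "nf_symmetry lam s \<longleftrightarrow>
     (\<forall>M0\<in>K_at s lam. \<forall>M1\<in>K_at s lam. \<forall>M3\<in>K_at s lam. \<forall>a1 a2.
        le s M0 M1 \<and> le s M1 M3 \<and> a1 \<in> univ M1 \<and> tp s a1 M0 M3 \<in> Sbs s M0 \<and> nf s M0 M1 a2 M3 \<longrightarrow>
        (\<exists>M2\<in>K_at s lam. \<exists>M3'\<in>K_at s lam.
           a2 \<in> univ M2 \<and> le s M0 M2 \<and> le s M2 M3' \<and> le s M3 M3' \<and> nf s M0 M2 a1 M3'))"

definition nf_extension :: "'l rel \<Rightarrow> ('a, 'f, 'r) frame \<Rightarrow> bool" where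
  "nf_extension lam s \<longleftrightarrow>
     (\<forall>M\<in>K_at s lam. \<forall>N\<in>K_at s lam. \<forall>p\<in>Sbs s M. prec s M N \<longrightarrow>
        (\<exists>q\<in>Sbs s N. dnf s M N q \<and> tp_restr s q M = p))"

definition nf_continuity ::
  "'o::wellorder itself \<Rightarrow> 'l rel \<Rightarrow> ('a, 'f, 'r) frame \<Rightarrow> bool" where
  "nf_continuity _ lam s \<longleftrightarrow>
     (\<forall>(\<delta>::'o) M p. olimit \<delta> \<and> inc_cont s {..\<delta>} M \<and> (\<forall>\<alpha>\<le>\<delta>. M \<alpha> \<in> K_at s lam) \<and>
        p \<in> types s (M \<delta>) \<and> (\<forall>\<alpha><\<delta>. dnf s (M ozero) (M \<alpha>) (tp_restr s p (M \<alpha>))) \<longrightarrow>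
        p \<in> Sbs s (M \<delta>) \<and> dnf s (M ozero) (M \<delta>) p)"

definition good_frame_minus_stability ::
  "'o::wellorder itself \<Rightarrow> 'l rel \<Rightarrow> ('a, 'f, 'r) frame \<Rightarrow> bool" where
  "good_frame_minus_stability ord lam s \<longleftrightarrow>
     frame_ec ord lam s \<and> frame_Sbs lam s \<and> nf_invariant s \<and> nf_basic lam s \<and>
     nf_monotonicity lam s \<and> nf_local_character ord lam s \<and> nf_uniqueness lam s \<and>
     nf_symmetry lam s \<and> nf_extension lam s \<and> nf_continuity ord lam s"

definition conjugation :: "'l rel \<Rightarrow> ('a, 'f, 'r) frame \<Rightarrow> bool" where
  "conjugation lam s \<longleftrightarrow>
     (\<forall>M0\<in>K_at s lam. \<forall>M1\<in>K_at s lam. \<forall>p\<in>Sbs s M1. le s M0 M1 \<and> dnf s M0 M1 p \<longrightarrow>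
        (\<exists>f. is_iso (voc s) f M0 M1 \<and> tp_image s f (tp_restr s p M0) = p))"


section \<open>Independence and dimension\<close>

definition indep_over ::
  "'l rel \<Rightarrow> ('a, 'f, 'r) frame \<Rightarrow> ('a, 'f, 'r) model \<Rightarrow>
   ('o::wellorder \<Rightarrow> ('a, 'f, 'r) model) \<Rightarrow> ('o \<Rightarrow> 'a) \<Rightarrow> 'o \<Rightarrow> bool" where
  "indep_over lam s M Ms a \<alpha>s \<longleftrightarrow>
     M \<in> K_at s lam \<and> (\<forall>\<alpha>\<le>\<alpha>s. Ms \<alpha> \<in> K_at s lam) \<and> inc_cont s {..\<alpha>s} Ms \<and> le s M (Ms ozero) \<and>
     (\<forall>\<alpha><\<alpha>s. nf s M (Ms \<alpha>) (a \<alpha>) (Ms (osuc \<alpha>)))"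

definition indep_seq ::
  "'l rel \<Rightarrow> ('a, 'f, 'r) frame \<Rightarrow> ('o::wellorder \<Rightarrow> 'a) \<Rightarrow> 'o \<Rightarrow>
   ('a, 'f, 'r) model \<Rightarrow> ('a, 'f, 'r) model \<Rightarrow> ('a, 'f, 'r) model \<Rightarrow> bool" where
  "indep_seq lam s a \<alpha>s M M0 N \<longleftrightarrow>
     (\<exists>Ms. \<exists>N'\<in>K_at s lam. Ms ozero = M0 \<and> indep_over lam s M Ms a \<alpha>s \<and>
        le s N N' \<and> le s (Ms \<alpha>s) N')"

text \<open>The set \<open>A\<close> is \<open>univ M0\<close> where the independence notion is used with a model \<open>M0\<close>.\<close>

definition indep_set ::
  "'o::wellorder itself \<Rightarrow> 'l rel \<Rightarrow> ('a, 'f, 'r) frame \<Rightarrow> 'a set \<Rightarrow>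
   ('a, 'f, 'r) model \<Rightarrow> 'a set \<Rightarrow> ('a, 'f, 'r) model \<Rightarrow> bool" where
  "indep_set _ lam s J M A N \<longleftrightarrow>
     (\<exists>(\<alpha>s::'o) Ms a. \<exists>N'\<in>K_at s lam. indep_over lam s M Ms a \<alpha>s \<and> J = a ` {..<\<alpha>s} \<and>
        A \<subseteq> univ (Ms ozero) \<and> le s (Ms \<alpha>s) N' \<and> le s N N')"

definition fin_indep_set ::
  "'o::wellorder itself \<Rightarrow> 'l rel \<Rightarrow> ('a, 'f, 'r) frame \<Rightarrow> 'a set \<Rightarrow>
   ('a, 'f, 'r) model \<Rightarrow> 'a set \<Rightarrow> ('a, 'f, 'r) model \<Rightarrow> bool" where
  "fin_indep_set ord lam s J M A N \<longleftrightarrow>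
     (\<forall>J0. finite J0 \<and> J0 \<subseteq> J \<longrightarrow> indep_set ord lam s J0 M A N)"

definition indep_subset_in ::
  "'o::wellorder itself \<Rightarrow> 'l rel \<Rightarrow> ('a, 'f, 'r) frame \<Rightarrow> ('a, 'f, 'r) model \<Rightarrow>
   ('a, 'f, 'r) gtype set \<Rightarrow> ('a, 'f, 'r) model \<Rightarrow> 'a set \<Rightarrow> bool" where
  "indep_subset_in ord lam s M P N J \<longleftrightarrow>
     J \<subseteq> univ N \<and> (\<forall>a\<in>J. tp s a M N \<in> P) \<and> indep_set ord lam s J M (univ M) N"

definition max_indep_subset_in ::
  "'o::wellorder itself \<Rightarrow> 'l rel \<Rightarrow> ('a, 'f, 'r) frame \<Rightarrow> ('a, 'f, 'r) model \<Rightarrow>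
   ('a, 'f, 'r) gtype set \<Rightarrow> ('a, 'f, 'r) model \<Rightarrow> 'a set \<Rightarrow> bool" where
  "max_indep_subset_in ord lam s M P N J \<longleftrightarrow>
     indep_subset_in ord lam s M P N J \<and>
     (\<forall>J'. indep_subset_in ord lam s M P N J' \<and> J \<subseteq> J' \<longrightarrow> J' = J)"

definition dim ::
  "'o::wellorder itself \<Rightarrow> 'l rel \<Rightarrow> ('a, 'f, 'r) frame \<Rightarrow> ('a, 'f, 'r) model \<Rightarrow>
   ('a, 'f, 'r) gtype set \<Rightarrow> ('a, 'f, 'r) model \<Rightarrow> 'a rel" where
  "dim ord lam s M P N = ord_min {|J| | J. max_indep_subset_in ord lam s M P N J}"


section \<open>Uniqueness triples\<close>

definition K3bs :: "'l rel \<Rightarrow> ('a, 'f, 'r) frame \<Rightarrow> ('a, 'f, 'r) triple set" where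
  "K3bs lam s = {(M, N, a). M \<in> K_at s lam \<and> N \<in> K_at s lam \<and> le s M N \<and>
     a \<in> univ N - univ M \<and> tp s a M N \<in> Sbs s M}"

definition equivalent_amalgamations ::
  "('a, 'f, 'r, 'z) ec_scheme \<Rightarrow> ('a, 'f, 'r) model \<Rightarrow> ('a, 'f, 'r) model \<Rightarrow>
   ('a \<Rightarrow> 'a) \<times> ('a \<Rightarrow> 'a) \<times> ('a, 'f, 'r) model \<Rightarrow>
   ('a \<Rightarrow> 'a) \<times> ('a \<Rightarrow> 'a) \<times> ('a, 'f, 'r) model \<Rightarrow> bool" where
  "equivalent_amalgamations k M1 M2 = (\<lambda>(f1, f2, M3) (g1, g2, N3).
     \<exists>M f g. M \<in> K k \<and> embedding k f M3 M \<and> embedding k g N3 M \<and>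
       (\<forall>x\<in>univ M1. f (f1 x) = g (g1 x)) \<and> (\<forall>x\<in>univ M2. f (f2 x) = g (g2 x)))"

definition nf_amalgamation ::
  "'l rel \<Rightarrow> ('a, 'f, 'r) frame \<Rightarrow> ('a, 'f, 'r) model \<Rightarrow> ('a, 'f, 'r) model \<Rightarrow> 'a \<Rightarrow>
   ('a, 'f, 'r) model \<Rightarrow> ('a \<Rightarrow> 'a) \<times> ('a \<Rightarrow> 'a) \<times> ('a, 'f, 'r) model \<Rightarrow> bool" where
  "nf_amalgamation lam s M00 M10 a M01 = (\<lambda>(f10, f01, M11).
     M11 \<in> K_at s lam \<and> amalgamation s M00 M10 M01 f10 f01 M11 \<and>
     nf s M00 (img f01 M01) (f10 a) M11)"

definition K3uq :: "'l rel \<Rightarrow> ('a, 'f, 'r) frame \<Rightarrow> ('a, 'f, 'r) triple set" where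
  "K3uq lam s = {(M00, M10, a). (M00, M10, a) \<in> K3bs lam s \<and>
     (\<forall>M01\<in>K_at s lam. prec s M00 M01 \<longrightarrow>
        (\<exists>A. nf_amalgamation lam s M00 M10 a M01 A) \<and>
        (\<forall>A B. nf_amalgamation lam s M00 M10 a M01 A \<and> nf_amalgamation lam s M00 M10 a M01 B \<longrightarrow>
           equivalent_amalgamations s M10 M01 A B))}"

definition K3uq_existence :: "'l rel \<Rightarrow> ('a, 'f, 'r) frame \<Rightarrow> bool" where
  "K3uq_existence lam s \<longleftrightarrow>
     (\<forall>M\<in>K_at s lam. \<forall>p\<in>Sbs s M. \<exists>N a. (M, N, a) \<in> K3uq lam s \<and> tp s a M N = p)"

end

theory Submission
  imports Defs
begin

text \<open>
  A single element \<open>a\<close> over \<open>M\<close> is easily made independent of a model containing \<open>M\<close>; the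
  difficulty is a whole sequence. Uniqueness triples provide a symmetric and transitive notion of
  freeness for squares of models: a square is free when one side is built by a tower of uniqueness
  triples that stays non-forking over the other side, and such a square is free with respect to
  every non-forking chain on the other side as well. Hence finite independent sequences lift along
  free squares. Moreover, by a closing-off argument, every extension of the union of a chain
  resolves, after a further extension, into a chain built freely over the given one. A finite set
  lies in a single member of such a resolution, so independence of finite sequences passes to unions
  of chains. This lets a finitely independent set be enumerated along a chain of uniqueness triples
  in any order, which gives (a)--(c). For (d), a resolution shows that no finite set depends on
  infinitely many elements of an independent set, so an infinite maximal independent set cannot be
  larger than another maximal one.
\<close>

section \<open>Ordinals and transfinite recursion\<close>

text \<open>The symmetry axiom concerns two single elements and gives no control over the models it
  produces, whereas infinite independence needs models that fit together at limits. Squares of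
  models supply the control. Two free completions of one tower of uniqueness triples can be
  amalgamated with the towers identified, so a given completion can be compared with a grid built
  against any non-forking chain; this is why the existential form of freeness implies the universal
  one. Finite character comes from local character: over the top of a chain of limit length, a basic
  type does not fork over an earlier member, so elements of a larger model can be absorbed one by
  one into a chain above the given one. The constructions have to move models, and moved models have
  to be compared literally. Hence recursion states carry a permutation of the whole element type,
  coherent on what has been built; its inverse finally returns the given models to their place. An
  element type larger than \<open>lam\<close> leaves room for this, and chains are kept shorter than
  \<open>lam\<^sup>+\<close>, so that unions stay of size \<open>lam\<close>.\<close>

lemma ozero_le: "ozero \<le> (\<alpha>::'o::wellorder)"
  unfolding ozero_def by (rule Least_le) simp

lemma not_less_ozero [simp]: "\<not> (\<alpha>::'o::wellorder) < ozero"
  using ozero_le leD by blast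

lemma osuc_greater: "(\<alpha>::'o::wellorder) < \<beta> \<Longrightarrow> \<alpha> < osuc \<alpha>"
  unfolding osuc_def by (rule LeastI)

lemma osuc_le: "(\<alpha>::'o::wellorder) < \<beta> \<Longrightarrow> osuc \<alpha> \<le> \<beta>"
  unfolding osuc_def by (rule Least_le)

lemma less_osuc_iff: "(\<alpha>::'o::wellorder) < osuc \<alpha> \<Longrightarrow> \<beta> < osuc \<alpha> \<longleftrightarrow> \<beta> \<le> \<alpha>"
  using osuc_le[of \<alpha> \<beta>] by (meson leD le_less_trans not_le)

lemma olimit_osuc: "olimit (\<delta>::'o::wellorder) \<Longrightarrow> \<alpha> < \<delta> \<Longrightarrow> osuc \<alpha> < \<delta>"
  unfolding olimit_def by (meson osuc_le le_less_trans)

lemma olimit_pos: "olimit (\<delta>::'o::wellorder) \<Longrightarrow> ozero < \<delta>"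
  unfolding olimit_def by (meson ozero_le le_less_trans)

lemma not_olimit_ozero [simp]: "\<not> olimit (ozero :: 'o::wellorder)"
  using olimit_pos by blast

lemma not_olimit_osuc: "(\<alpha>::'o::wellorder) < osuc \<alpha> \<Longrightarrow> \<not> olimit (osuc \<alpha>)"
  using olimit_osuc by blast

lemma ord_cases:
  fixes \<alpha> :: "'o::wellorder"
  obtains "\<alpha> = ozero" | \<beta> where "\<beta> < \<alpha>" "\<alpha> = osuc \<beta>" "\<beta> < osuc \<beta>" | "olimit \<alpha>"
proof (cases "\<alpha> = ozero \<or> olimit \<alpha>")
  case False
  then have "ozero < \<alpha>" using ozero_le[of \<alpha>] by auto
  with False obtain \<beta> where b: "\<beta> < \<alpha>" "\<And>\<gamma>. \<beta> < \<gamma> \<Longrightarrow> \<alpha> \<le> \<gamma>"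
    unfolding olimit_def using not_le by blast
  have "\<alpha> = osuc \<beta>" using osuc_le[OF b(1)] b(2)[OF osuc_greater[OF b(1)]] by (rule order.antisym[rotated])
  with b osuc_greater[OF b(1)] that(2) show ?thesis by blast
qed (use that in blast)

text \<open>\<open>cong\<close> says that \<open>P \<alpha>\<close> sees only the values of
  \<open>f\<close> below \<alpha>, so the truncated function that \<open>wfrec\<close> supplies at
  \<alpha> is as good as \<open>f\<close> itself. Restricting \<open>ex\<close> to the initial
  segment \<open>D\<close> permits recursions that can be continued only up to a bounded
  length.\<close>

lemma transfinite_choice:
  fixes P :: "'o::wellorder \<Rightarrow> ('o \<Rightarrow> 's) \<Rightarrow> 's \<Rightarrow> bool"
  assumes cong: "\<And>\<alpha> f g x. (\<And>\<beta>. \<beta> < \<alpha> \<Longrightarrow> f \<beta> = g \<beta>) \<Longrightarrow> P \<alpha> f x \<Longrightarrow> P \<alpha> g x"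
    and D: "\<And>\<alpha> \<beta>. \<alpha> \<in> D \<Longrightarrow> \<beta> < \<alpha> \<Longrightarrow> \<beta> \<in> D"
    and ex: "\<And>\<alpha> f. \<alpha> \<in> D \<Longrightarrow> (\<And>\<beta>. \<beta> < \<alpha> \<Longrightarrow> P \<beta> f (f \<beta>)) \<Longrightarrow> \<exists>x. P \<alpha> f x"
  shows "\<exists>f. \<forall>\<alpha>\<in>D. P \<alpha> f (f \<alpha>)"
proof -
  define R where "R = {(x, y::'o). x < y}"
  have wf: "wf R" unfolding R_def by (rule wf)
  define f where "f = wfrec R (\<lambda>f \<alpha>. SOME x. P \<alpha> f x)"
  have f: "f \<alpha> = (SOME x. P \<alpha> (cut f R \<alpha>) x)" for \<alpha>
    unfolding f_def by (subst wfrec[OF wf]) simp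
  have c: "P \<alpha> (cut f R \<alpha>) x \<longleftrightarrow> P \<alpha> f x" for \<alpha> x
    using cong[of \<alpha> f "cut f R \<alpha>" x] cong[of \<alpha> "cut f R \<alpha>" f x] by (auto simp: cut_apply R_def)
  have "P \<alpha> f (f \<alpha>)" if "\<alpha> \<in> D" for \<alpha>
    using that
  proof (induction \<alpha> rule: less_induct)
    case (less \<alpha>)
    then have "\<exists>x. P \<alpha> f x" using ex D by blast
    then show ?case unfolding f[of \<alpha>] c by (rule someI_ex)
  qed
  then show ?thesis by blast
qed

text \<open>
  The relation \<open>rel\<close> collects what has to be monotone along the recursion, so that at a limit stage
  the earlier states are known to be coherent.
\<close>

lemma chain_recursion:
  fixes Inv :: "'o::wellorder \<Rightarrow> 's \<Rightarrow> bool" and rel :: "'o \<Rightarrow> 'o \<Rightarrow> 's \<Rightarrow> 's \<Rightarrow> bool"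
    and LimR :: "'o \<Rightarrow> ('o \<Rightarrow> 's) \<Rightarrow> 's \<Rightarrow> bool"
  assumes D: "\<And>\<alpha> \<beta>. \<alpha> \<in> D \<Longrightarrow> \<beta> < \<alpha> \<Longrightarrow> \<beta> \<in> D"
    and trans: "\<And>\<alpha> \<beta> \<gamma> x y z. \<alpha> < \<beta> \<Longrightarrow> \<beta> < \<gamma> \<Longrightarrow> \<gamma> \<in> D \<Longrightarrow> rel \<alpha> \<beta> x y \<Longrightarrow> rel \<beta> \<gamma> y z \<Longrightarrow> rel \<alpha> \<gamma> x z"
    and cong: "\<And>\<alpha> f g x. (\<And>\<beta>. \<beta> < \<alpha> \<Longrightarrow> f \<beta> = g \<beta>) \<Longrightarrow> LimR \<alpha> f x \<Longrightarrow> LimR \<alpha> g x"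
    and base: "Inv ozero s0"
    and succ: "\<And>\<beta> x. \<beta> < osuc \<beta> \<Longrightarrow> osuc \<beta> \<in> D \<Longrightarrow> Inv \<beta> x \<Longrightarrow>
      \<exists>y. Inv (osuc \<beta>) y \<and> rel \<beta> (osuc \<beta>) x y"
    and lim: "\<And>\<alpha> f. olimit \<alpha> \<Longrightarrow> \<alpha> \<in> D \<Longrightarrow> (\<And>\<beta>. \<beta> < \<alpha> \<Longrightarrow> Inv \<beta> (f \<beta>)) \<Longrightarrow>
      (\<And>\<beta> \<gamma>. \<beta> < \<gamma> \<Longrightarrow> \<gamma> < \<alpha> \<Longrightarrow> rel \<beta> \<gamma> (f \<beta>) (f \<gamma>)) \<Longrightarrow>
      (\<And>\<beta>. \<beta> < \<alpha> \<Longrightarrow> olimit \<beta> \<Longrightarrow> LimR \<beta> f (f \<beta>)) \<Longrightarrow>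
      \<exists>x. Inv \<alpha> x \<and> (\<forall>\<beta><\<alpha>. rel \<beta> \<alpha> (f \<beta>) x) \<and> LimR \<alpha> f x"
  obtains f where "f ozero = s0" "\<And>\<alpha>. \<alpha> \<in> D \<Longrightarrow> Inv \<alpha> (f \<alpha>)"
    "\<And>\<alpha> \<beta>. \<alpha> < \<beta> \<Longrightarrow> \<beta> \<in> D \<Longrightarrow> rel \<alpha> \<beta> (f \<alpha>) (f \<beta>)"
    "\<And>\<alpha>. \<alpha> \<in> D \<Longrightarrow> olimit \<alpha> \<Longrightarrow> LimR \<alpha> f (f \<alpha>)"
proof -
  define P where "P \<alpha> f x \<longleftrightarrow> Inv \<alpha> x \<and> (\<forall>\<beta><\<alpha>. rel \<beta> \<alpha> (f \<beta>) x) \<and> (\<alpha> = ozero \<longrightarrow> x = s0) \<and>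
      (olimit \<alpha> \<longrightarrow> LimR \<alpha> f x)" for \<alpha> f x
  have cg: "P \<alpha> g x" if "\<And>\<beta>. \<beta> < \<alpha> \<Longrightarrow> f \<beta> = g \<beta>" "P \<alpha> f x" for \<alpha> f g x
    using that cong[of \<alpha> f g x] unfolding P_def by simp
  have ex: "\<exists>x. P \<alpha> f x" if aD: "\<alpha> \<in> D" and prev: "\<And>\<beta>. \<beta> < \<alpha> \<Longrightarrow> P \<beta> f (f \<beta>)" for \<alpha> f
  proof (cases \<alpha> rule: ord_cases)
    case 1
    then show ?thesis using base unfolding P_def by auto
  next
    case (2 \<beta>)
    then have "Inv \<beta> (f \<beta>)" using prev unfolding P_def by blast
    then obtain y where y: "Inv (osuc \<beta>) y" "rel \<beta> (osuc \<beta>) (f \<beta>) y"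
      using succ[of \<beta> "f \<beta>"] 2 aD by auto
    \<comment> \<open>\<open>succ\<close> relates only the immediate predecessor to the new state;
      all earlier states are related to it by \<open>trans\<close>.\<close>
    have "rel \<gamma> \<alpha> (f \<gamma>) y" if "\<gamma> < \<alpha>" for \<gamma>
    proof (cases "\<gamma> = \<beta>")
      case True
      then show ?thesis using y 2 by simp
    next
      case False
      then have "\<gamma> < \<beta>" using that less_osuc_iff[OF 2(3), of \<gamma>] unfolding 2(2) by (simp add: order.strict_iff_order)
      moreover have "rel \<gamma> \<beta> (f \<gamma>) (f \<beta>)" using prev[of \<beta>] 2 \<open>\<gamma> < \<beta>\<close> unfolding P_def by blast
      ultimately show ?thesis using trans[of \<gamma> \<beta> \<alpha>] y 2 aD by blast
    qed
    then have "P \<alpha> f y" using y 2 not_olimit_osuc[of \<beta>] unfolding P_def by auto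
    then show ?thesis by blast
  next
    case 3
    have "\<exists>x. Inv \<alpha> x \<and> (\<forall>\<beta><\<alpha>. rel \<beta> \<alpha> (f \<beta>) x) \<and> LimR \<alpha> f x"
      by (rule lim[OF 3 aD]) (use prev in \<open>auto simp: P_def\<close>)
    moreover have "\<alpha> \<noteq> ozero" using 3 by auto
    ultimately show ?thesis unfolding P_def by blast
  qed
  show ?thesis
  proof (cases "D = {}")
    case True
    then show ?thesis using that[of "\<lambda>_. s0"] by simp
  next
    case False
    then obtain \<alpha> where "\<alpha> \<in> D" by blast
    then have zD: "ozero \<in> D" using D[of \<alpha> ozero] ozero_le[of \<alpha>] by (auto simp: le_less)
    have "\<exists>f. \<forall>\<alpha>\<in>D. P \<alpha> f (f \<alpha>)"
    proof (rule transfinite_choice)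
      show "P \<alpha> g x" if "\<And>\<beta>. \<beta> < \<alpha> \<Longrightarrow> f \<beta> = g \<beta>" "P \<alpha> f x" for \<alpha> f g x
        using cg that by blast
      show "\<beta> \<in> D" if "\<alpha> \<in> D" "\<beta> < \<alpha>" for \<alpha> \<beta> using D that by blast
      show "\<exists>x. P \<alpha> f x" if "\<alpha> \<in> D" "\<And>\<beta>. \<beta> < \<alpha> \<Longrightarrow> P \<beta> f (f \<beta>)" for \<alpha> f
        using ex that by blast
    qed
    then obtain f where f: "\<And>\<alpha>. \<alpha> \<in> D \<Longrightarrow> P \<alpha> f (f \<alpha>)" by blast
    show ?thesis
    proof (rule that[of f])
      show "f ozero = s0" using f[OF zD] unfolding P_def by blast
      show "Inv \<alpha> (f \<alpha>)" if "\<alpha> \<in> D" for \<alpha> using f[OF that] unfolding P_def by blast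
      show "rel \<alpha> \<beta> (f \<alpha>) (f \<beta>)" if "\<alpha> < \<beta>" "\<beta> \<in> D" for \<alpha> \<beta>
        using f[OF that(2)] that(1) unfolding P_def by blast
      show "LimR \<alpha> f (f \<alpha>)" if "\<alpha> \<in> D" "olimit \<alpha>" for \<alpha>
        using f[OF that(1)] that(2) unfolding P_def by blast
    qed
  qed
qed

section \<open>Cardinals\<close>

text \<open>These are the ordinals below \<open>lam\<^sup>+\<close>. The type \<open>'o\<close> goes
  beyond them, but they are the lengths for which unions of chains of models of size
  \<open>lam\<close> are sure to have size \<open>lam\<close> again.\<close>

definition small :: "'l rel \<Rightarrow> 'o::wellorder \<Rightarrow> bool" where
  "small lam \<alpha> \<longleftrightarrow> |{..<\<alpha>}| \<le>o lam"

lemma small_mono: "small lam \<beta> \<Longrightarrow> \<alpha> \<le> \<beta> \<Longrightarrow> small lam \<alpha>"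
  unfolding small_def by (meson card_of_mono1 lessThan_subset_iff ordLeq_transitive)

lemma finite_ordLeq_Cinfinite: "Cinfinite lam \<Longrightarrow> finite A \<Longrightarrow> |A| \<le>o lam"
proof -
  assume lam: "Cinfinite lam" and A: "finite A"
  then have "|A| <o |Field lam|"
    using finite_ordLess_infinite[of "|A|" "|Field lam|"] by (auto simp: cinfinite_def Field_card_of card_of_well_order_on)
  then show ?thesis
    using lam by (meson card_of_Field_ordIso ordLess_imp_ordLeq ordLeq_ordIso_trans)
qed

lemma Un_ordLeq_Cinfinite: "Cinfinite lam \<Longrightarrow> |A| \<le>o lam \<Longrightarrow> |B| \<le>o lam \<Longrightarrow> |A \<union> B| \<le>o lam"
  by (rule card_of_Un_ordLeq_infinite_Field) (auto simp: cinfinite_def)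

lemma UN_ordLeq_Cinfinite:
  "Cinfinite lam \<Longrightarrow> |I| \<le>o lam \<Longrightarrow> (\<And>i. i \<in> I \<Longrightarrow> |A i| \<le>o lam) \<Longrightarrow> |\<Union>i\<in>I. A i| \<le>o lam"
  by (rule card_of_UNION_ordLeq_infinite_Field) (auto simp: cinfinite_def)

lemma subset_ordLeq: "A \<subseteq> B \<Longrightarrow> |B| \<le>o lam \<Longrightarrow> |A| \<le>o lam"
  by (meson card_of_mono1 ordLeq_transitive)

lemma image_ordLeq: "|A| \<le>o lam \<Longrightarrow> |f ` A| \<le>o lam"
  by (meson card_of_image ordLeq_transitive)

lemma small_atMost: "Cinfinite lam \<Longrightarrow> small lam \<alpha> \<Longrightarrow> |{..\<alpha>}| \<le>o lam"
proof -
  assume "Cinfinite lam" "small lam \<alpha>"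
  moreover have "{..\<alpha>} = {..<\<alpha>} \<union> {\<alpha>}" by auto
  ultimately show ?thesis
    unfolding small_def using Un_ordLeq_Cinfinite finite_ordLeq_Cinfinite by (metis finite.simps)
qed

text \<open>This is regularity of \<open>lam\<^sup>+\<close>: the initial segments up to the members
  of \<open>S\<close> cover at most \<open>lam\<close> ordinals, hence not all of \<open>'o\<close>,
  and the least ordinal not covered is the bound.\<close>

lemma small_sup:
  fixes S :: "'o::wellorder set"
  assumes lam: "Cinfinite lam" "lam <o |UNIV :: 'o set|" and S: "|S| \<le>o lam" "\<And>\<alpha>. \<alpha> \<in> S \<Longrightarrow> small lam \<alpha>"
  shows "\<exists>\<delta>. small lam \<delta> \<and> (\<forall>\<alpha>\<in>S. \<alpha> < \<delta>)"
proof -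
  let ?U = "\<Union>\<alpha>\<in>S. {..\<alpha>}"
  have U: "|?U| \<le>o lam"
    by (rule UN_ordLeq_Cinfinite[OF lam(1) S(1)]) (rule small_atMost[OF lam(1) S(2)])
  then have "?U \<noteq> UNIV" using lam(2) by (metis not_ordLess_ordLeq)
  then obtain \<gamma> where g: "\<gamma> \<notin> ?U" by blast
  define \<delta> where "\<delta> = (LEAST \<gamma>. \<gamma> \<notin> ?U)"
  have d: "\<delta> \<notin> ?U" unfolding \<delta>_def using g by (rule LeastI)
  have "{..<\<delta>} \<subseteq> ?U" unfolding \<delta>_def using not_less_Least by blast
  then have "small lam \<delta>" unfolding small_def by (rule subset_ordLeq[OF _ U])
  moreover have "\<alpha> < \<delta>" if "\<alpha> \<in> S" for \<alpha> using d that by (auto simp: not_le)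
  ultimately show ?thesis by blast
qed

lemma small_ozero: "Cinfinite lam \<Longrightarrow> small lam (ozero::'o::wellorder)"
proof -
  assume "Cinfinite lam"
  moreover have "{..<(ozero::'o)} = {}" by auto
  ultimately show ?thesis unfolding small_def using finite_ordLeq_Cinfinite by (metis finite.emptyI)
qed

text \<open>\<open>osuc\<close> is meaningless at a greatest element of \<open>'o\<close>; a small
  ordinal is never the greatest, because \<open>'o\<close> has more than \<open>lam\<close>
  elements.\<close>

lemma small_greater:
  fixes \<alpha> :: "'o::wellorder"
  assumes "Cinfinite lam" "lam <o |UNIV :: 'o set|" "small lam \<alpha>"
  shows "\<alpha> < osuc \<alpha>" "small lam (osuc \<alpha>)"
proof -
  obtain \<delta> where d: "small lam \<delta>" "\<alpha> < \<delta>"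
    using small_sup[OF assms(1,2) finite_ordLeq_Cinfinite[OF assms(1)], of "{\<alpha>}"] assms(3) by auto
  then show "\<alpha> < osuc \<alpha>" using osuc_greater by blast
  show "small lam (osuc \<alpha>)" using d osuc_le small_mono by blast
qed

lemma small_omega_sup:
  fixes g :: "nat \<Rightarrow> 'o::wellorder"
  assumes lam: "Cinfinite lam" "lam <o |UNIV :: 'o set|"
    and g: "\<And>n. small lam (g n)" "\<And>n. g n < g (Suc n)"
  shows "\<exists>\<delta>. small lam \<delta> \<and> olimit \<delta> \<and> (\<forall>n. g n < \<delta>) \<and> (\<forall>\<alpha><\<delta>. \<exists>n. \<alpha> < g n)"
proof -
  have "|range g| \<le>o lam"
    by (rule image_ordLeq)
      (use lam(1) in \<open>meson card_of_nat natLeq_ordLeq_cinfinite ordIso_ordLeq_trans\<close>)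
  then obtain \<delta>' where d': "small lam \<delta>'" "\<And>n. g n < \<delta>'" using small_sup[OF lam, of "range g"] g(1) by auto
  define \<delta> where "\<delta> = (LEAST \<delta>. \<forall>n. g n < \<delta>)"
  have d: "\<forall>n. g n < \<delta>" unfolding \<delta>_def by (rule LeastI[of _ \<delta>']) (use d' in blast)
  have "\<delta> \<le> \<delta>'" unfolding \<delta>_def using d' by (blast intro: Least_le)
  then have sm: "small lam \<delta>" using d' small_mono by blast
  have cof: "\<exists>n. \<alpha> < g n" if "\<alpha> < \<delta>" for \<alpha>
  proof -
    have "\<not> (\<forall>n. g n < \<alpha>)" using not_less_Least that unfolding \<delta>_def by blast
    then show ?thesis using g(2) by (metis le_less_trans not_le_imp_less)
  qed
  then have "olimit \<delta>" unfolding olimit_def using d by blast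
  then show ?thesis using sm d cof by blast
qed

text \<open>
  The closing-off argument: below some ordinal of size at most \<open>lam\<close> whose cofinality is \<open>\<omega>\<close>,
  every element of \<open>C j\<close> that ever enters the sets \<open>T i\<close> has already entered.
\<close>

lemma exhaustion:
  fixes T C :: "'o::wellorder \<Rightarrow> 'a set"
  assumes lam: "Cinfinite lam" "lam <o |UNIV :: 'o set|"
    and C: "\<And>i. small lam i \<Longrightarrow> |C i| \<le>o lam"
    and CM: "\<And>i j. i \<le> j \<Longrightarrow> small lam j \<Longrightarrow> C i \<subseteq> C j"
    and T: "\<And>i j. i \<le> j \<Longrightarrow> small lam j \<Longrightarrow> T i \<subseteq> T j"
    and CL: "\<And>i. small lam i \<Longrightarrow> olimit i \<Longrightarrow> C i = (\<Union>j<i. C j)"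
    and step: "\<And>i. small lam i \<Longrightarrow> T i \<noteq> C i \<Longrightarrow> \<exists>c. c \<in> C i \<and> c \<in> T (osuc i) \<and> c \<notin> T i"
  shows "\<exists>i. small lam i \<and> T i = C i"
proof (rule ccontr)
  assume "\<nexists>i. small lam i \<and> T i = C i"
  with step have step': "\<exists>c. c \<in> C i \<and> c \<in> T (osuc i) \<and> c \<notin> T i" if "small lam i" for i
    using that by blast
  \<comment> \<open>Each element of \<open>C i\<close> that ever enters has a first stage of entry
    \<open>\<phi> x\<close>. There are at most \<open>lam\<close> such stages, so some small
    \<open>k\<close> lies beyond all of them.\<close>
  have ex_k: "\<exists>k. small lam k \<and> i < k \<and> (\<forall>x\<in>C i. \<forall>j. small lam j \<longrightarrow> x \<in> T j \<longrightarrow> x \<in> T k)" if i: "small lam i" for i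
  proof -
    define \<phi> where "\<phi> x = (LEAST j. small lam j \<and> x \<in> T j)" for x
    let ?X = "{x \<in> C i. \<exists>j. small lam j \<and> x \<in> T j}"
    have ph: "small lam (\<phi> x) \<and> x \<in> T (\<phi> x)" if "x \<in> ?X" for x
      unfolding \<phi>_def by (rule LeastI_ex) (use that in blast)
    have "|\<phi> ` ?X \<union> {i}| \<le>o lam"
      by (intro Un_ordLeq_Cinfinite lam image_ordLeq subset_ordLeq[OF _ C[OF i]] finite_ordLeq_Cinfinite) auto
    then obtain k where k: "small lam k" "\<And>j. j \<in> \<phi> ` ?X \<union> {i} \<Longrightarrow> j < k"
      using small_sup[OF lam, of "\<phi> ` ?X \<union> {i}"] ph i by fastforce
    have "x \<in> T k" if "x \<in> C i" "small lam j" "x \<in> T j" for x j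
    proof -
      have "x \<in> ?X" using that by blast
      then have "x \<in> T (\<phi> x)" "\<phi> x < k" using ph k(2) by blast+
      then show ?thesis using T[of "\<phi> x" k] k(1) by (meson less_imp_le subsetD)
    qed
    then show ?thesis using k by blast
  qed
  define \<psi> where "\<psi> i = (SOME k. small lam k \<and> i < k \<and>
      (\<forall>x\<in>C i. \<forall>j. small lam j \<longrightarrow> x \<in> T j \<longrightarrow> x \<in> T k))" for i
  have psi: "small lam (\<psi> i) \<and> i < \<psi> i \<and>
      (\<forall>x\<in>C i. \<forall>j. small lam j \<longrightarrow> x \<in> T j \<longrightarrow> x \<in> T (\<psi> i))" if "small lam i" for i
    unfolding \<psi>_def by (rule someI_ex) (rule ex_k[OF that])
  define g where "g n = (\<psi> ^^ n) ozero" for n :: nat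
  have g0: "small lam (g n)" for n
    unfolding g_def by (induction n) (use psi small_ozero lam in auto)
  have gS: "g (Suc n) = \<psi> (g n)" for n unfolding g_def by simp
  obtain \<delta> where d: "small lam \<delta>" "olimit \<delta>" "\<And>n. g n < \<delta>" "\<And>\<alpha>. \<alpha> < \<delta> \<Longrightarrow> \<exists>n. \<alpha> < g n"
    using small_omega_sup[OF lam, of g] gS psi g0 by auto
  \<comment> \<open>A contradiction at the limit \<delta>: continuity of \<open>C\<close> places the
    late entrant \<open>c\<close> in some \<open>C (g n)\<close>, and everything in
    \<open>C (g n)\<close> that ever enters has entered by stage \<open>g (Suc n)\<close>.\<close>
  obtain c where c: "c \<in> C \<delta>" "c \<in> T (osuc \<delta>)" "c \<notin> T \<delta>" using step'[OF d(1)] by blast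
  obtain j where j: "j < \<delta>" "c \<in> C j" using c(1) CL[OF d(1,2)] by blast
  have sj: "small lam j" "small lam (osuc \<delta>)" using j d small_mono small_greater[OF lam] by (blast intro: less_imp_le)+
  obtain n where n: "j < g n" using d(4) j by blast
  have "c \<in> C (g n)" using j n CM[of j "g n"] g0 by (meson less_imp_le subsetD)
  then have "c \<in> T (g (Suc n))" unfolding gS using psi[OF g0] c sj by blast
  then show False using T[of "g (Suc n)" \<delta>] d c by (meson less_imp_le subsetD)
qed

text \<open>Complements of sets of size at most \<open>lam\<close> have full size, so a bijection
  between the complements of \<open>A\<close> and of its image completes \<open>f\<close>.
  Embeddings of models of size \<open>lam\<close> thereby become permutations, which compose and
  invert without regard to domains.\<close>

lemma extend_to_bij:
  fixes f :: "'a \<Rightarrow> 'a"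
  assumes lam: "Cinfinite lam" "lam <o |UNIV :: 'a set|" and A: "|A| \<le>o lam" and f: "inj_on f A"
  shows "\<exists>\<pi>. bij \<pi> \<and> (\<forall>x\<in>A. \<pi> x = f x)"
proof -
  have "|Field lam| \<le>o |UNIV :: 'a set|"
    using lam by (meson card_of_Field_ordIso ordIso_ordLess_trans ordLess_imp_ordLeq)
  then have inf: "infinite (UNIV :: 'a set)"
    using lam(1) card_of_ordLeq_finite unfolding cinfinite_def by blast
  have *: "|- B| =o |UNIV :: 'a set|" if "|B| \<le>o lam" for B :: "'a set"
  proof (rule ccontr)
    assume "\<not> |- B| =o |UNIV :: 'a set|"
    then have "|- B| <o |UNIV :: 'a set|"
      using card_of_mono1[of "- B" UNIV] ordLeq_iff_ordLess_or_ordIso by auto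
    moreover have "|B| <o |UNIV :: 'a set|" using that lam(2) by (rule ordLeq_ordLess_trans)
    ultimately have "|- B \<union> B| <o |UNIV :: 'a set|" using inf card_of_Un_ordLess_infinite by blast
    then show False by (simp add: ordLess_irreflexive)
  qed
  have "|- A| =o |- (f ` A)|"
    using *[OF A] *[OF image_ordLeq[OF A]] ordIso_transitive ordIso_symmetric by blast
  then obtain g where g: "bij_betw g (- A) (- (f ` A))" using card_of_ordIso by blast
  define \<pi> where "\<pi> x = (if x \<in> A then f x else g x)" for x
  have "bij_betw \<pi> (A \<union> - A) (f ` A \<union> - (f ` A))"
  proof (rule bij_betw_combine)
    show "bij_betw \<pi> A (f ` A)"
      using f by (auto simp: \<pi>_def bij_betw_def inj_on_def)
    show "bij_betw \<pi> (- A) (- (f ` A))"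
      using g by (subst bij_betw_cong[of _ _ g]) (auto simp: \<pi>_def)
  qed auto
  then show ?thesis unfolding \<pi>_def by auto
qed

section \<open>Images of models\<close>

lemma univ_img [simp]: "univ (img f M) = f ` univ M"
  by (simp add: img_def)

lemma img_comp: "img g (img f M) = img (g \<circ> f) M"
  by (auto simp: img_def image_image split_def comp_def)

lemma model_fint: "is_model \<tau> M \<Longrightarrow> (xs, y) \<in> fint M g \<Longrightarrow>
    g \<in> fsyms \<tau> \<and> xs \<in> tuples (univ M) (farity \<tau> g) \<and> y \<in> univ M"
  unfolding is_model_def by blast

lemma model_total: "is_model \<tau> M \<Longrightarrow> g \<in> fsyms \<tau> \<Longrightarrow> xs \<in> tuples (univ M) (farity \<tau> g) \<Longrightarrow>
    \<exists>!y. (xs, y) \<in> fint M g"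
  unfolding is_model_def by (elim conjE) (drule (1) bspec, elim conjE, erule (1) bspec)

lemma model_rint: "is_model \<tau> M \<Longrightarrow> xs \<in> rint M R \<Longrightarrow>
    R \<in> rsyms \<tau> \<and> xs \<in> tuples (univ M) (rarity \<tau> R)"
  unfolding is_model_def by blast

lemma img_cong:
  assumes M: "is_model \<tau> M" and fg: "\<And>x. x \<in> univ M \<Longrightarrow> f x = g x"
  shows "img f M = img g M"
proof -
  have mp: "map f xs = map g xs" if "xs \<in> tuples (univ M) n" for xs n
    using that fg by (auto simp: tuples_def subset_iff)
  have "(\<lambda>(xs, y). (map f xs, f y)) ` fint M h = (\<lambda>(xs, y). (map g xs, g y)) ` fint M h" for h
    by (rule image_cong) (auto dest!: model_fint[OF M] simp: fg mp)
  moreover have "map f ` rint M R = map g ` rint M R" for R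
    by (rule image_cong) (use model_rint[OF M] mp in blast)+
  moreover have "f ` univ M = g ` univ M" using fg by (rule image_cong[OF refl])
  ultimately show ?thesis by (simp add: img_def)
qed

lemma img_id: "img id M = M"
  by (simp add: img_def)

lemma img_fix: "is_model \<tau> M \<Longrightarrow> (\<And>x. x \<in> univ M \<Longrightarrow> f x = x) \<Longrightarrow> img f M = M"
  using img_cong[of \<tau> M f id] by (simp add: img_id)

lemma map_tuples: "xs \<in> tuples A n \<Longrightarrow> map f xs \<in> tuples (f ` A) n"
  by (auto simp: tuples_def)

lemma tuples_image: "ys \<in> tuples (f ` A) n \<Longrightarrow> \<exists>xs\<in>tuples A n. ys = map f xs"
proof -
  assume "ys \<in> tuples (f ` A) n"
  then have "ys \<in> lists (f ` A)" "length ys = n" by (auto simp: tuples_def)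
  then obtain xs where "xs \<in> lists A" "ys = map f xs" by (auto simp: lists_image)
  then show ?thesis using \<open>length ys = n\<close> by (auto simp: tuples_def)
qed

lemma map_inj_tuples: "inj_on f A \<Longrightarrow> xs \<in> tuples A n \<Longrightarrow> ys \<in> tuples A m \<Longrightarrow> map f xs = map f ys \<Longrightarrow> xs = ys"
  by (rule map_inj_on[of f]) (auto simp: tuples_def inj_on_def)

lemma iso_img:
  assumes M: "is_model \<tau> M" and f: "inj_on f (univ M)"
  shows "is_iso \<tau> f M (img f M)"
proof -
  have fi: "(map f xs, f y) \<in> fint (img f M) g \<longleftrightarrow> (xs, y) \<in> fint M g"
    if "xs \<in> tuples (univ M) n" "y \<in> univ M" for xs y g n
  proof
    assume "(map f xs, f y) \<in> fint (img f M) g"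
    then obtain xs' y' where "(xs', y') \<in> fint M g" "map f xs = map f xs'" "f y = f y'"
      by (auto simp: img_def)
    moreover from this have "xs = xs'" "y = y'"
      using model_fint[OF M] map_inj_tuples[OF f that(1)] inj_onD[OF f] that by metis+
    ultimately show "(xs, y) \<in> fint M g" by simp
  next
    assume "(xs, y) \<in> fint M g"
    then show "(map f xs, f y) \<in> fint (img f M) g" by (auto simp: img_def intro: rev_image_eqI)
  qed
  have ri: "map f xs \<in> rint (img f M) R \<longleftrightarrow> xs \<in> rint M R" if "xs \<in> tuples (univ M) n" for xs R n
    using that map_inj_tuples[OF f that] model_rint[OF M] by (force simp: img_def)
  have "is_model \<tau> (img f M)"
    unfolding is_model_def
  proof (intro conjI ballI allI impI)
    show "univ (img f M) \<noteq> {}" using M by (simp add: is_model_def)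
    fix g assume g: "g \<in> fsyms \<tau>"
    show "fint (img f M) g \<subseteq> tuples (univ (img f M)) (farity \<tau> g) \<times> univ (img f M)"
    proof
      fix p assume "p \<in> fint (img f M) g"
      then obtain xs y where "p = (map f xs, f y)" "(xs, y) \<in> fint M g" by (auto simp: img_def)
      then show "p \<in> tuples (univ (img f M)) (farity \<tau> g) \<times> univ (img f M)"
        using model_fint[OF M, of xs y g] map_tuples[of xs "univ M" "farity \<tau> g" f] by simp
    qed
    fix ys assume "ys \<in> tuples (univ (img f M)) (farity \<tau> g)"
    then obtain xs where xs: "xs \<in> tuples (univ M) (farity \<tau> g)" "ys = map f xs"
      using tuples_image[of ys f "univ M"] by auto
    have ex1: "\<exists>!y. (xs, y) \<in> fint M g" using model_total[OF M g xs(1)] .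
    define y where "y = (THE y. (xs, y) \<in> fint M g)"
    have y1: "(xs, y) \<in> fint M g" unfolding y_def by (rule theI'[OF ex1])
    have y2: "z = y" if "(xs, z) \<in> fint M g" for z
      unfolding y_def using ex1 that by (rule the1_equality[symmetric])
    show "\<exists>!z. (ys, z) \<in> fint (img f M) g"
    proof
      show "(ys, f y) \<in> fint (img f M) g" 
        unfolding xs(2) using fi[OF xs(1), of y g] model_fint[OF M y1] y1 by simp
      fix z assume "(ys, z) \<in> fint (img f M) g"
      then obtain xs' z' where "(xs', z') \<in> fint M g" "map f xs = map f xs'" "z = f z'"
        using xs by (auto simp: img_def)
      moreover from this have "xs = xs'" using model_fint[OF M] map_inj_tuples[OF f xs(1)] by metis
      ultimately show "z = f y" using y2 by simp
    qed
  next
    fix g assume "g \<notin> fsyms \<tau>"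
    then show "fint (img f M) g = {}" using M by (simp add: img_def is_model_def)
  next
    fix R assume "R \<in> rsyms \<tau>"
    show "rint (img f M) R \<subseteq> tuples (univ (img f M)) (rarity \<tau> R)"
    proof
      fix ys assume "ys \<in> rint (img f M) R"
      then obtain xs where "ys = map f xs" "xs \<in> rint M R" by (auto simp: img_def)
      then show "ys \<in> tuples (univ (img f M)) (rarity \<tau> R)"
        using model_rint[OF M, of xs R] map_tuples[of xs "univ M" "rarity \<tau> R" f] by simp
    qed
  next
    fix R assume "R \<notin> rsyms \<tau>"
    then show "rint (img f M) R = {}" using M by (simp add: img_def is_model_def)
  qed
  then show ?thesis
    unfolding is_iso_def using M f fi ri by (simp add: inj_on_imp_bij_betw)
qed

text \<open>Functions and relations are interpreted by their graphs, so an isomorphism determines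
  its target outright. Targets can therefore be eliminated in favour of \<open>img\<close>.\<close>

lemma iso_eq_img:
  assumes "is_iso \<tau> f M N"
  shows "N = img f M"
proof -
  have M: "is_model \<tau> M" and N: "is_model \<tau> N" and b: "f ` univ M = univ N" "inj_on f (univ M)"
    and fi: "\<And>g xs y. g \<in> fsyms \<tau> \<Longrightarrow> xs \<in> tuples (univ M) (farity \<tau> g) \<Longrightarrow> y \<in> univ M \<Longrightarrow>
        (xs, y) \<in> fint M g \<longleftrightarrow> (map f xs, f y) \<in> fint N g"
    and ri: "\<And>R xs. R \<in> rsyms \<tau> \<Longrightarrow> xs \<in> tuples (univ M) (rarity \<tau> R) \<Longrightarrow>
        xs \<in> rint M R \<longleftrightarrow> map f xs \<in> rint N R"
    using assms unfolding is_iso_def bij_betw_def by auto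
  have "fint N g = fint (img f M) g" for g
  proof (intro set_eqI iffI)
    fix p assume "p \<in> fint N g"
    obtain ys z where p: "p = (ys, z)" by (cases p)
    then have n: "g \<in> fsyms \<tau>" "ys \<in> tuples (f ` univ M) (farity \<tau> g)" "z \<in> f ` univ M"
      using model_fint[OF N] \<open>p \<in> fint N g\<close> b by auto
    then obtain xs y where "xs \<in> tuples (univ M) (farity \<tau> g)" "ys = map f xs" "y \<in> univ M" "z = f y"
      using tuples_image by blast
    then show "p \<in> fint (img f M) g" using fi n \<open>p \<in> fint N g\<close> p by (auto simp: img_def intro: rev_image_eqI)
  next
    fix p assume "p \<in> fint (img f M) g"
    then obtain xs y where "p = (map f xs, f y)" "(xs, y) \<in> fint M g" by (auto simp: img_def)
    then show "p \<in> fint N g" using fi model_fint[OF M] by metis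
  qed
  moreover have "rint N R = rint (img f M) R" for R
  proof (intro set_eqI iffI)
    fix ys assume ys: "ys \<in> rint N R"
    then have n: "R \<in> rsyms \<tau>" "ys \<in> tuples (f ` univ M) (rarity \<tau> R)"
      using model_rint[OF N] b by auto
    then obtain xs where "xs \<in> tuples (univ M) (rarity \<tau> R)" "ys = map f xs"
      using tuples_image by blast
    then show "ys \<in> rint (img f M) R" using ri n ys by (auto simp: img_def)
  next
    fix ys assume "ys \<in> rint (img f M) R"
    then obtain xs where "ys = map f xs" "xs \<in> rint M R" by (auto simp: img_def)
    then show "ys \<in> rint N R" using ri model_rint[OF M] by metis
  qed
  ultimately show ?thesis using b by (intro model.equality) auto
qed

lemma img_union_model: "img f (union_model C) = union_model (img f ` C)"
  by (simp add: img_def union_model_def image_UN)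

lemma univ_union_model [simp]: "univ (union_model C) = (\<Union>M\<in>C. univ M)"
  by (simp add: union_model_def)

lemma union_model_single [simp]: "union_model {M} = (M :: ('a, 'f, 'r) model)"
  by (simp add: union_model_def)

section \<open>Models of size \<open>lam\<close>\<close>

locale frame_with_uq =
  fixes lam :: "'l rel" and s :: "('a, 'f, 'r) frame" and ord :: "'o::wellorder itself"
  assumes lam: "Cinfinite lam"
    and lam_a: "lam <o |UNIV :: 'a set|"
    and a_o: "|UNIV :: 'a set| <o |UNIV :: 'o set|"
    and frame: "good_frame_minus_stability ord lam s"
    and uq_exists: "K3uq_existence lam s"
begin

abbreviation KL :: "('a, 'f, 'r) model set" where "KL \<equiv> K_at s lam"
abbreviation leK :: "('a, 'f, 'r) model \<Rightarrow> ('a, 'f, 'r) model \<Rightarrow> bool" (infix "\<preceq>" 50)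
  where "M \<preceq> N \<equiv> le s M N"

lemma lam_o: "lam <o |UNIV :: 'o set|"
  using lam_a a_o by (rule ordLess_transitive)

lemma aec: "aec ord s"
  using frame unfolding good_frame_minus_stability_def frame_ec_def by blast

lemmas aec_conj = aec[unfolded aec_def]
lemmas aec_1 = aec_conj[THEN conjunct1] and aec_r1 = aec_conj[THEN conjunct2]
lemmas aec_2 = aec_r1[THEN conjunct1] and aec_r2 = aec_r1[THEN conjunct2]
lemmas aec_3 = aec_r2[THEN conjunct1] and aec_r3 = aec_r2[THEN conjunct2]
lemmas aec_4 = aec_r3[THEN conjunct1] and aec_r4 = aec_r3[THEN conjunct2]
lemmas aec_5 = aec_r4[THEN conjunct1] and aec_r5 = aec_r4[THEN conjunct2]
lemmas aec_6 = aec_r5[THEN conjunct1] and aec_r6 = aec_r5[THEN conjunct2]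
lemmas aec_7 = aec_r6[THEN conjunct1] and aec_r7 = aec_r6[THEN conjunct2]
lemmas aec_8 = aec_r7[THEN conjunct1] and aec_9 = aec_r7[THEN conjunct2]

lemma K_model: "M \<in> K s \<Longrightarrow> is_model (voc s) M"
  using aec_1 by blast

lemma K_iso: "M \<in> K s \<Longrightarrow> is_iso (voc s) f M N \<Longrightarrow> N \<in> K s"
  using aec_2 by blast

lemma le_iso: "M \<preceq> N \<Longrightarrow> is_iso (voc s) f N N' \<Longrightarrow> is_iso (voc s) f M M' \<Longrightarrow> M' \<preceq> N'"
  using aec_3 by blast

lemmas le_order = aec_4

lemma le_submodel: "M \<preceq> N \<Longrightarrow> submodel (voc s) M N"
  using aec_5 by blast

lemma le_K: "M \<preceq> N \<Longrightarrow> M \<in> K s \<and> N \<in> K s"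
  using le_order unfolding partial_order_on_def preorder_on_def refl_on_def by auto

lemma le_refl: "M \<in> K s \<Longrightarrow> M \<preceq> M"
  using le_order unfolding partial_order_on_def preorder_on_def refl_on_def by auto

lemma le_trans: "M \<preceq> N \<Longrightarrow> N \<preceq> N' \<Longrightarrow> M \<preceq> N'"
  using le_order unfolding partial_order_on_def preorder_on_def trans_def by auto

lemma le_antisym: "M \<preceq> N \<Longrightarrow> N \<preceq> M \<Longrightarrow> M = N"
  using le_order unfolding partial_order_on_def antisym_def by auto

lemma le_univ: "M \<preceq> N \<Longrightarrow> univ M \<subseteq> univ N"
  using le_submodel unfolding submodel_def by blast

text \<open>Both models inherit their structure from \<open>N\<close>, so inclusion of universes
  already gives the submodel relation that the coherence axiom requires.\<close>

lemma le_coherent: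
  assumes "M0 \<preceq> N" "M1 \<preceq> N" "univ M0 \<subseteq> univ M1"
  shows "M0 \<preceq> M1"
proof -
  have t: "tuples (univ M0) n \<subseteq> tuples (univ M1) n" for n using assms(3) by (auto simp: tuples_def)
  have "submodel (voc s) M0 M1"
    using le_submodel[OF assms(1)] le_submodel[OF assms(2)] assms(3) t unfolding submodel_def by fast
  then show ?thesis using aec_8 le_submodel[OF assms(2)] assms(1,2) by blast
qed

lemma le_eqI: "M \<preceq> N \<Longrightarrow> univ M = univ N \<Longrightarrow> M = N"
  using le_coherent[of N N M] le_refl le_K le_antisym by blast

lemma KL_K: "M \<in> KL \<Longrightarrow> M \<in> K s" and KL_card: "M \<in> KL \<Longrightarrow> |univ M| =o lam"
  by (auto simp: K_at_def)

lemma KL_ordLeq: "M \<in> KL \<Longrightarrow> |univ M| \<le>o lam"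
  using KL_card ordIso_imp_ordLeq by blast

lemma KL_refl: "M \<in> KL \<Longrightarrow> M \<preceq> M"
  using KL_K le_refl by blast

lemma img_K: "M \<in> K s \<Longrightarrow> inj_on \<pi> (univ M) \<Longrightarrow> img \<pi> M \<in> K s"
  using K_iso iso_img K_model by blast

lemma img_le: "M \<preceq> N \<Longrightarrow> inj_on \<pi> (univ N) \<Longrightarrow> img \<pi> M \<preceq> img \<pi> N"
  by (rule le_iso[of M N \<pi>]) (auto intro!: iso_img K_model dest: le_K le_univ intro: inj_on_subset)

lemma bij_inj_on: "bij \<pi> \<Longrightarrow> inj_on \<pi> A"
  by (meson bij_is_inj inj_on_subset subset_UNIV)

lemma img_KL:
  assumes "M \<in> KL" "bij \<pi>"
  shows "img \<pi> M \<in> KL"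
proof -
  have "bij_betw \<pi> (univ M) (\<pi> ` univ M)"
    using bij_inj_on[OF assms(2)] by (rule inj_on_imp_bij_betw)
  then have "|univ M| =o |\<pi> ` univ M|" using card_of_ordIso by blast
  then have "|univ (img \<pi> M)| =o lam"
    using KL_card[OF assms(1)] ordIso_symmetric ordIso_transitive by fastforce
  then show ?thesis using img_K[OF KL_K[OF assms(1)] bij_inj_on[OF assms(2)]] by (simp add: K_at_def)
qed

lemma img_le': "M \<preceq> N \<Longrightarrow> bij \<pi> \<Longrightarrow> img \<pi> M \<preceq> img \<pi> N"
  by (rule img_le) (auto intro: bij_inj_on)

lemma img_eq: "M \<in> K s \<Longrightarrow> (\<And>x. x \<in> univ M \<Longrightarrow> f x = g x) \<Longrightarrow> img f M = img g M"
  using img_cong K_model by blast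

lemma img_over: "M \<in> K s \<Longrightarrow> over (univ M) f \<Longrightarrow> img f M = M"
  using img_fix K_model unfolding over_def by blast

lemma img_inv: "bij \<pi> \<Longrightarrow> img (inv \<pi>) (img \<pi> M) = M"
  by (simp add: img_comp bij_is_inj img_id)

lemma img_inv': "bij \<pi> \<Longrightarrow> img \<pi> (img (inv \<pi>) M) = M"
  by (simp add: img_comp bij_is_surj surj_iff[THEN iffD1] img_id)

text \<open>Only the values of \<open>f\<close> on \<open>univ M\<close> matter, and
  \<open>univ M\<close> is small compared with the element type; hence a permutation can stand in
  for \<open>f\<close>.\<close>

lemma embeddingE:
  assumes "embedding s f M N" "M \<in> KL"
  obtains \<pi> where "bij \<pi>" "\<forall>x\<in>univ M. \<pi> x = f x" "img \<pi> M \<preceq> N"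
proof -
  obtain M' where M': "is_iso (voc s) f M M'" "M' \<preceq> N" using assms(1) unfolding embedding_def by blast
  then have "inj_on f (univ M)" unfolding is_iso_def bij_betw_def by blast
  then obtain \<pi> where pi: "bij \<pi>" "\<forall>x\<in>univ M. \<pi> x = f x"
    using extend_to_bij[OF lam lam_a KL_ordLeq[OF assms(2)]] by blast
  then have "img \<pi> M = M'" using iso_eq_img[OF M'(1)] img_eq[of M \<pi> f] KL_K[OF assms(2)] by simp
  then show ?thesis using that pi M'(2) by blast
qed

lemma embeddingI:
  assumes "img f M \<preceq> N" "inj_on f (univ M)" "M \<in> K s"
  shows "embedding s f M N"
  unfolding embedding_def using assms iso_img K_model by blast

text \<open>Conjugating an arbitrary amalgamation back by its first embedding turns that embedding
  into inclusion: \<open>M1\<close> stays in place and only \<open>M2\<close> is moved.\<close>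

lemma amalgam:
  assumes "M0 \<in> KL" "M1 \<in> KL" "M2 \<in> KL" "M0 \<preceq> M1" "M0 \<preceq> M2"
  obtains N \<pi> where "N \<in> KL" "M1 \<preceq> N" "bij \<pi>" "over (univ M0) \<pi>" "img \<pi> M2 \<preceq> N"
proof -
  obtain M3 f1 f2 where M3: "M3 \<in> KL" and am: "amalgamation s M0 M1 M2 f1 f2 M3"
    using frame assms unfolding good_frame_minus_stability_def frame_ec_def by blast
  obtain p1 where p1: "bij p1" "\<forall>x\<in>univ M1. p1 x = f1 x" "img p1 M1 \<preceq> M3"
    using am embeddingE assms(2) unfolding amalgamation_def by blast
  obtain p2 where p2: "bij p2" "\<forall>x\<in>univ M2. p2 x = f2 x" "img p2 M2 \<preceq> M3"
    using am embeddingE assms(3) unfolding amalgamation_def by blast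
  have b: "bij (inv p1)" using p1(1) by (rule bij_imp_bij_inv)
  show ?thesis
  proof (rule that)
    show "img (inv p1) M3 \<in> KL" using img_KL M3 b by blast
    show "M1 \<preceq> img (inv p1) M3" using img_le'[OF p1(3) b] unfolding img_inv[OF p1(1)] .
    show "bij (inv p1 \<circ> p2)" using b p2(1) by (simp add: bij_comp)
    show "img (inv p1 \<circ> p2) M2 \<preceq> img (inv p1) M3" using img_le'[OF p2(3) b] by (simp add: img_comp)
    have "p1 x = x" "p2 x = x" if "x \<in> univ M0" for x
      using that am le_univ[OF assms(4)] le_univ[OF assms(5)] p1(2) p2(2)
      unfolding amalgamation_def over_def by auto
    then show "over (univ M0) (inv p1 \<circ> p2)"
      unfolding over_def using p1(1) by (metis bij_inv_eq_iff comp_apply)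
  qed
qed

text \<open>The axiom bounds the size from above by \<open>lam\<close>; the model \<open>M\<close>
  inside \<open>A\<close> supplies the lower bound, which puts \<open>N'\<close> into
  \<open>KL\<close>.\<close>

lemma LST_lam:
  assumes N: "N \<in> K s" and A: "A \<subseteq> univ N" "|A| \<le>o lam" and M: "M \<in> KL" "univ M \<subseteq> A"
  obtains N' where "N' \<in> KL" "A \<subseteq> univ N'" "N' \<preceq> N"
proof -
  \<comment> \<open>\<open>LST s\<close> is chosen as a minimum; it has the defining properties
    because a nonempty set of cardinals has a least member.\<close>
  have "\<exists>\<kappa>. \<kappa> \<in> {\<kappa>. Card_order \<kappa> \<and> LST_bound s \<kappa>} \<and> (\<forall>\<mu>\<in>{\<kappa>. Card_order \<kappa> \<and> LST_bound s \<kappa>}. \<kappa> \<le>o \<mu>)"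
    (is "\<exists>\<kappa>. \<kappa> \<in> ?C \<and> _")
  proof -
    have "?C \<noteq> {}" using aec_9 by blast
    then have "\<exists>r\<in>?C. \<forall>r'\<in>?C. r \<le>o r'" by (intro exists_minim_Card_order) auto
    then show ?thesis by blast
  qed
  then have "LST s \<in> ?C" unfolding LST_def ord_min_def by (rule someI2_ex) blast
  then have L: "Card_order (LST s)" "LST_bound s (LST s)" by auto
  have Ls: "LST s \<le>o lam" using frame unfolding good_frame_minus_stability_def frame_ec_def by blast
  obtain N' where N': "N' \<in> K s" "A \<subseteq> univ N'" "N' \<preceq> N" "|univ N'| \<le>o LST s +c |A|"
    using L(2) N A(1) unfolding LST_bound_def by blast
  have "LST s +c |A| \<le>o lam"
    using csum_cinfinite_bound[OF Ls A(2) L(1) card_of_Card_order lam] .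
  then have "|univ N'| \<le>o lam" using N'(4) ordLeq_transitive by blast
  moreover have "lam \<le>o |univ N'|"
    using KL_card[OF M(1)] M(2) N'(2)
    by (meson card_of_mono1 ordIso_ordLeq_trans ordIso_symmetric order_trans)
  ultimately have "|univ N'| =o lam" by (simp add: ordIso_iff_ordLeq)
  then show ?thesis using that N' unfolding K_at_def by blast
qed

section \<open>Unions of chains\<close>

lemma submodel_fint: "submodel \<tau> M N \<Longrightarrow> fint M g \<subseteq> fint N g"
  unfolding submodel_def is_model_def by (cases "g \<in> fsyms \<tau>") auto

lemma submodel_rint: "submodel \<tau> M N \<Longrightarrow> rint M R \<subseteq> rint N R"
  unfolding submodel_def is_model_def by (cases "R \<in> rsyms \<tau>") auto

lemma UN_subset_cofinal: "(\<And>M. M \<in> C \<Longrightarrow> \<exists>N\<in>C'. F M \<subseteq> F N) \<Longrightarrow> (\<Union>M\<in>C. F M) \<subseteq> (\<Union>M\<in>C'. F M)"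
  by blast

lemma union_model_mono:
  assumes "\<And>M. M \<in> C \<Longrightarrow> \<exists>N\<in>C'. M \<preceq> N"
  shows "univ (union_model C) \<subseteq> univ (union_model C')" "fint (union_model C) g \<subseteq> fint (union_model C') g"
    "rint (union_model C) R \<subseteq> rint (union_model C') R"
proof -
  have *: "\<exists>N\<in>C'. univ M \<subseteq> univ N \<and> fint M g \<subseteq> fint N g \<and> rint M R \<subseteq> rint N R" if "M \<in> C" for M
    using assms[OF that] le_univ submodel_fint[OF le_submodel] submodel_rint[OF le_submodel] by blast
  show "univ (union_model C) \<subseteq> univ (union_model C')" "fint (union_model C) g \<subseteq> fint (union_model C') g"
    "rint (union_model C) R \<subseteq> rint (union_model C') R"
    unfolding union_model_def model.simps by (rule UN_subset_cofinal; use * in blast)+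
qed

lemma union_model_cofinal:
  assumes "\<And>M. M \<in> C \<Longrightarrow> \<exists>N\<in>C'. M \<preceq> N" "\<And>M. M \<in> C' \<Longrightarrow> \<exists>N\<in>C. M \<preceq> N"
  shows "union_model C = union_model C'"
proof (rule model.equality)
  show "univ (union_model C) = univ (union_model C')"
    using union_model_mono(1)[OF assms(1)] union_model_mono(1)[OF assms(2)] by (rule subset_antisym)
  show "fint (union_model C) = fint (union_model C')"
    using union_model_mono(2)[OF assms(1)] union_model_mono(2)[OF assms(2)] by (intro ext subset_antisym)
  show "rint (union_model C) = rint (union_model C')"
    using union_model_mono(3)[OF assms(1)] union_model_mono(3)[OF assms(2)] by (intro ext subset_antisym)
qed simp

lemma inc_cont_le: "inc_cont s I T \<Longrightarrow> \<alpha> \<in> I \<Longrightarrow> \<beta> \<in> I \<Longrightarrow> \<alpha> \<le> \<beta> \<Longrightarrow> T \<alpha> \<preceq> T \<beta>"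
  unfolding inc_cont_def by blast

lemma inc_cont_lim: "inc_cont s I T \<Longrightarrow> \<beta> \<in> I \<Longrightarrow> olimit \<beta> \<Longrightarrow> T \<beta> = union_model (T ` {..<\<beta>})"
  unfolding inc_cont_def by blast

text \<open>Freezing a chain below \<alpha> is the substitute for starting it at \<alpha>: no
  subtraction of ordinals is required, and limits up to \<alpha> become unions of a constant
  family.\<close>

lemma inc_cont_max:
  fixes T :: "'p::wellorder \<Rightarrow> ('a, 'f, 'r) model"
  assumes T: "inc_cont s I T" and I: "\<And>\<beta> \<gamma>. \<beta> \<in> I \<Longrightarrow> \<gamma> \<le> \<beta> \<Longrightarrow> \<gamma> \<in> I" and a: "\<alpha> \<in> I"
  shows "inc_cont s I (\<lambda>i. T (max \<alpha> i))"
  unfolding inc_cont_def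
proof (intro conjI ballI impI)
  fix \<beta> \<gamma> assume "\<beta> \<in> I" "\<gamma> \<in> I" "\<gamma> \<le> \<beta>"
  then show "T (max \<alpha> \<gamma>) \<preceq> T (max \<alpha> \<beta>)"
    using inc_cont_le[OF T, of "max \<alpha> \<gamma>" "max \<alpha> \<beta>"] a by (auto simp: max_def)
next
  fix \<beta> assume b: "\<beta> \<in> I" "olimit \<beta>"
  show "T (max \<alpha> \<beta>) = union_model ((\<lambda>i. T (max \<alpha> i)) ` {..<\<beta>})"
  proof (cases "\<beta> \<le> \<alpha>")
    case True
    then have "(\<lambda>i. T (max \<alpha> i)) ` {..<\<beta>} = {T \<alpha>}"
      using olimit_pos[OF b(2)] by (auto simp: max_def image_iff intro: less_le_trans)
    then show ?thesis using True by (simp add: max_def)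
  next
    case False
    have "T \<beta> = union_model (T ` {..<\<beta>})" using inc_cont_lim[OF T b] .
    also have "\<dots> = union_model ((\<lambda>i. T (max \<alpha> i)) ` {..<\<beta>})"
    proof (rule union_model_cofinal)
      fix M assume "M \<in> T ` {..<\<beta>}"
      then obtain i where i: "i < \<beta>" "M = T i" by blast
      then have "i \<in> I" "max \<alpha> i \<in> I" using I b a by (auto simp: max_def intro: less_imp_le)
      then have "M \<preceq> T (max \<alpha> i)" using inc_cont_le[OF T, of i "max \<alpha> i"] i by simp
      then show "\<exists>N\<in>(\<lambda>i. T (max \<alpha> i)) ` {..<\<beta>}. M \<preceq> N" using i by blast
    next
      fix M assume "M \<in> (\<lambda>i. T (max \<alpha> i)) ` {..<\<beta>}"
      then obtain i where i: "i < \<beta>" "M = T (max \<alpha> i)" by blast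
      then have m: "max \<alpha> i < \<beta>" using False by simp
      then have "M \<preceq> T (max \<alpha> i)"
        using inc_cont_le[OF T, of "max \<alpha> i" "max \<alpha> i"] I[OF b(1)] i by (auto simp: less_imp_le)
      then show "\<exists>N\<in>T ` {..<\<beta>}. M \<preceq> N" using m by blast
    qed
    finally show ?thesis using False by (simp add: max_def)
  qed
qed

text \<open>The axiom places only the first member below the union. For \<open>T \<alpha>\<close> it
  is applied to the chain frozen below \<alpha>, whose first member is \<open>T \<alpha>\<close> and
  whose union is the same.\<close>

lemma chain_union:
  fixes T :: "'o \<Rightarrow> ('a, 'f, 'r) model"
  assumes T: "inc_cont s {..<\<delta>} T" and d: "ozero < \<delta>"
  shows "union_model (T ` {..<\<delta>}) \<in> K s"
    and "\<And>\<alpha>. \<alpha> < \<delta> \<Longrightarrow> T \<alpha> \<preceq> union_model (T ` {..<\<delta>})"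
    and "\<And>N. (\<And>\<alpha>. \<alpha> < \<delta> \<Longrightarrow> T \<alpha> \<preceq> N) \<Longrightarrow> union_model (T ` {..<\<delta>}) \<preceq> N"
proof -
  show U: "union_model (T ` {..<\<delta>}) \<in> K s" using aec_6 T d by blast
  show "union_model (T ` {..<\<delta>}) \<preceq> N" if "\<And>\<alpha>. \<alpha> < \<delta> \<Longrightarrow> T \<alpha> \<preceq> N" for N
    using aec_7 T d that by blast
  fix \<alpha> assume a: "\<alpha> < \<delta>"
  have T': "inc_cont s {..<\<delta>} (\<lambda>i. T (max \<alpha> i))"
    by (rule inc_cont_max[OF T]) (use a in auto)
  then have "T (max \<alpha> ozero) \<preceq> union_model ((\<lambda>i. T (max \<alpha> i)) ` {..<\<delta>})"
    using aec_6 d by blast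
  moreover have "max \<alpha> ozero = \<alpha>" using ozero_le by (rule max.absorb1)
  moreover have "union_model ((\<lambda>i. T (max \<alpha> i)) ` {..<\<delta>}) = union_model (T ` {..<\<delta>})"
  proof (rule union_model_cofinal)
    fix M assume "M \<in> T ` {..<\<delta>}"
    then obtain i where i: "i < \<delta>" "M = T i" by blast
    then have "M \<preceq> T (max \<alpha> i)" using inc_cont_le[OF T, of i "max \<alpha> i"] a by simp
    then show "\<exists>N\<in>(\<lambda>i. T (max \<alpha> i)) ` {..<\<delta>}. M \<preceq> N" using i by blast
  next
    fix M assume "M \<in> (\<lambda>i. T (max \<alpha> i)) ` {..<\<delta>}"
    then obtain i where i: "i < \<delta>" "M = T (max \<alpha> i)" by blast
    then have "M \<preceq> T (max \<alpha> i)" using inc_cont_le[OF T, of "max \<alpha> i" "max \<alpha> i"] a by simp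
    moreover have "max \<alpha> i < \<delta>" using i a by simp
    ultimately show "\<exists>N\<in>T ` {..<\<delta>}. M \<preceq> N" by blast
  qed
  ultimately show "T \<alpha> \<preceq> union_model (T ` {..<\<delta>})" by simp
qed

lemma chain_union_KL:
  fixes T :: "'o \<Rightarrow> ('a, 'f, 'r) model"
  assumes T: "inc_cont s {..<\<delta>} T" and d: "ozero < \<delta>" "small lam \<delta>"
    and KL: "\<And>\<alpha>. \<alpha> < \<delta> \<Longrightarrow> T \<alpha> \<in> KL"
  shows "union_model (T ` {..<\<delta>}) \<in> KL"
proof -
  let ?U = "union_model (T ` {..<\<delta>})"
  have U: "?U \<in> K s" "T ozero \<preceq> ?U" using chain_union[OF T d(1)] d(1) by blast+
  have "|univ ?U| \<le>o lam"
    using UN_ordLeq_Cinfinite[OF lam d(2)[unfolded small_def], of "\<lambda>\<alpha>. univ (T \<alpha>)"] KL KL_ordLeq by simp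
  moreover have "lam \<le>o |univ ?U|"
    using KL_card[OF KL[OF d(1)]] card_of_mono1[OF le_univ[OF U(2)]]
    by (meson ordIso_ordLeq_trans ordIso_symmetric)
  ultimately show ?thesis using U(1) unfolding K_at_def by (simp add: ordIso_iff_ordLeq)
qed

section \<open>Equality of types\<close>

text \<open>A single \<open>Estar\<close> step between models of size \<open>lam\<close>, with the
  embedding replaced by a permutation. Amalgamation will show that it already decides equality of
  types.\<close>

definition same_type where
  "same_type M a N b N' \<longleftrightarrow>
     (\<exists>N''\<in>KL. \<exists>\<pi>. N' \<preceq> N'' \<and> bij \<pi> \<and> over (univ M) \<pi> \<and> img \<pi> N \<preceq> N'' \<and> \<pi> a = b)"

lemma over_le: "over (univ N) \<pi> \<Longrightarrow> M \<preceq> N \<Longrightarrow> over (univ M) \<pi>"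
  using le_univ unfolding over_def by blast

lemma over_id [simp]: "over A id" by (simp add: over_def)

lemma over_comp: "over A f \<Longrightarrow> over A g \<Longrightarrow> over A (f \<circ> g)"
  by (simp add: over_def)

lemma over_inv: "bij \<pi> \<Longrightarrow> over A \<pi> \<Longrightarrow> over A (inv \<pi>)"
  unfolding over_def by (metis bij_inv_eq_iff)

lemma img_over_le: "M \<preceq> N \<Longrightarrow> over (univ M) \<pi> \<Longrightarrow> img \<pi> M = M"
  using img_over le_K by blast

lemma Estar_fst: "((M, N, a), t) \<in> (Estar s)\<^sup>* \<Longrightarrow> \<exists>N' a'. t = (M, N', a')"
  by (induction rule: rtrancl_induct) (auto simp: Estar_def)

text \<open>The intermediate models of an \<open>Estar\<close> path may be larger than
  \<open>lam\<close>, where amalgamation is not assumed. Each is replaced by a submodel of size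
  \<open>lam\<close> containing the base and the element; the claim is therefore made for all such
  submodels \<open>N1'\<close> of the last model, which is what the induction needs.\<close>

lemma Estar_path_same_type:
  assumes "((M, N0, a0), (M, N1, a1)) \<in> (Estar s)\<^sup>*" "M \<in> KL" "N0 \<in> KL" "(M, N0, a0) \<in> triples s"
    and "N1' \<in> KL" "M \<preceq> N1'" "N1' \<preceq> N1" "a1 \<in> univ N1'"
  shows "same_type M a0 N0 a1 N1'"
  using assms
proof (induction "(M, N1, a1)" arbitrary: N1 a1 N1' rule: rtrancl_induct)
  case base
  then show ?case unfolding same_type_def by (intro bexI[of _ N0] exI[of _ id]) (auto simp: img_id KL_refl)
next
  case (step t)
  obtain N a where t: "t = (M, N, a)" using Estar_fst step.hyps(1) by blast
  obtain N2 f where f: "M \<preceq> N" "a \<in> univ N" "N1 \<preceq> N2" "embedding s f N N2" "over (univ M) f" "f a = a1"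
    using step.hyps(2) unfolding t Estar_def triples_def by auto
  have NK: "N \<in> K s" using le_K f(1) by blast
  have ca: "|univ M \<union> {a}| \<le>o lam"
    using Un_ordLeq_Cinfinite[OF lam KL_ordLeq finite_ordLeq_Cinfinite[OF lam]] step.prems(1) by blast
  obtain N' where N': "N' \<in> KL" "univ M \<union> {a} \<subseteq> univ N'" "N' \<preceq> N"
    by (rule LST_lam[OF NK _ ca step.prems(1)]) (use f(2) le_univ[OF f(1)] in auto)
  have MN': "M \<preceq> N'" using le_coherent[OF f(1) N'(3)] N'(2) by blast
  have IH: "same_type M a0 N0 a N'"
    using step.hyps(3)[OF t step.prems(1-3) N'(1) MN' N'(3)] N'(2) by blast
  obtain fN where fN: "is_iso (voc s) f N fN" "fN \<preceq> N2" using f(4) unfolding embedding_def by blast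
  have fi: "inj_on f (univ N)" using fN(1) unfolding is_iso_def bij_betw_def by blast
  have "img f N' \<preceq> img f N" using img_le[OF N'(3) fi] .
  then have fN': "img f N' \<preceq> N2" using iso_eq_img[OF fN(1)] fN(2) le_trans by blast
  obtain \<phi> where phi: "bij \<phi>" "\<forall>x\<in>univ N'. \<phi> x = f x"
    using extend_to_bij[OF lam lam_a KL_ordLeq[OF N'(1)]] inj_on_subset[OF fi le_univ[OF N'(3)]] by blast
  have phi_img: "img \<phi> N' = img f N'" using img_eq[OF KL_K[OF N'(1)]] phi(2) by blast
  have phN: "img \<phi> N' \<in> KL" "img \<phi> N' \<preceq> N2" using img_KL[OF N'(1) phi(1)] phi_img fN' by simp_all
  have N1'2: "N1' \<preceq> N2" using step.prems(6) f(3) le_trans by blast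
  have cu: "|univ (img \<phi> N') \<union> univ N1'| \<le>o lam"
    using Un_ordLeq_Cinfinite[OF lam KL_ordLeq[OF phN(1)] KL_ordLeq[OF step.prems(4)]] .
  obtain N2' where N2': "N2' \<in> KL" "univ (img \<phi> N') \<union> univ N1' \<subseteq> univ N2'" "N2' \<preceq> N2"
    by (rule LST_lam[OF conjunct2[OF le_K[OF f(3)]] _ cu step.prems(4)])
      (use le_univ[OF phN(2)] le_univ[OF N1'2] in auto)
  have l1: "img \<phi> N' \<preceq> N2'" "N1' \<preceq> N2'"
    using le_coherent[OF phN(2) N2'(3)] le_coherent[OF N1'2 N2'(3)] N2'(2) by blast+
  obtain N'' \<pi> where pi: "N'' \<in> KL" "N' \<preceq> N''" "bij \<pi>" "over (univ M) \<pi>" "img \<pi> N0 \<preceq> N''" "\<pi> a0 = a"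
    using IH unfolding same_type_def by blast
  \<comment> \<open>The earlier identification ends in an extension \<open>N''\<close> of
    \<open>N'\<close>, the last step in \<open>N2'\<close>, which contains a copy of
    \<open>N'\<close>. Amalgamating over that copy composes the two.\<close>
  obtain N3 \<sigma> where N3: "N3 \<in> KL" "N2' \<preceq> N3" "bij \<sigma>" "over (univ (img \<phi> N')) \<sigma>"
      "img \<sigma> (img \<phi> N'') \<preceq> N3"
    by (rule amalgam[OF phN(1) N2'(1) img_KL[OF pi(1) phi(1)] l1(1) img_le'[OF pi(2) phi(1)]])
  have phM: "\<phi> x = x" if "x \<in> univ M" for x
    using bspec[OF phi(2), of x] f(5) that N'(2) by (auto simp: over_def)
  have sM: "\<sigma> x = x" if "x \<in> univ M" for x
  proof -
    have "x \<in> univ (img \<phi> N')" using phM[OF that] that N'(2) by (force simp: image_iff)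
    then show ?thesis using N3(4) unfolding over_def by blast
  qed
  have "over (univ M) (\<sigma> \<circ> \<phi> \<circ> \<pi>)"
    using pi(4) phM sM unfolding over_def by simp
  moreover have "bij (\<sigma> \<circ> \<phi> \<circ> \<pi>)" using N3(3) phi(1) pi(3) by (intro bij_comp)
  moreover have "img (\<sigma> \<circ> \<phi> \<circ> \<pi>) N0 \<preceq> N3"
    using le_trans[OF img_le'[OF img_le'[OF pi(5) phi(1)] N3(3)] N3(5)] by (simp add: img_comp o_assoc)
  moreover have "(\<sigma> \<circ> \<phi> \<circ> \<pi>) a0 = a1"
  proof -
    have "\<phi> a = a1" using phi(2) N'(2) f(6) by auto
    moreover have "\<phi> a \<in> univ (img \<phi> N')" using N'(2) by simp
    ultimately show ?thesis using pi(6) N3(4) unfolding over_def by (metis comp_apply)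
  qed
  ultimately show ?case unfolding same_type_def using N3(1) le_trans[OF l1(2) N3(2)] by blast
qed

lemma tp_refl: "M \<preceq> N \<Longrightarrow> a \<in> univ N \<Longrightarrow> (M, N, a) \<in> tp s a M N"
proof -
  assume a: "M \<preceq> N" "a \<in> univ N"
  then have "img id N \<preceq> N" using le_K le_refl by (simp add: img_id)
  then have "embedding s id N N" using embeddingI a le_K by fastforce
  then have "((M, N, a), (M, N, a)) \<in> Estar s"
    using a le_K le_refl unfolding Estar_def triples_def by fastforce
  then show ?thesis unfolding tp_def by blast
qed

text \<open>A type is the forward image of a triple under the closure of \<open>Estar\<close>, so
  equality of two types calls for paths in both directions.\<close>

lemma tp_eqI:
  assumes "((M, N, a), (M, N', b)) \<in> (Estar s)\<^sup>+" "((M, N', b), (M, N, a)) \<in> (Estar s)\<^sup>+"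
  shows "tp s a M N = tp s b M N'"
  using assms unfolding tp_def by (auto intro: trancl_trans)

lemma tp_eqD:
  assumes "tp s a M N = tp s b M' N'" "M \<preceq> N" "a \<in> univ N" "M' \<preceq> N'" "b \<in> univ N'"
  shows "((M, N, a), (M', N', b)) \<in> (Estar s)\<^sup>+" "((M', N', b), (M, N, a)) \<in> (Estar s)\<^sup>+"
  using tp_refl[OF assms(2,3)] tp_refl[OF assms(4,5)] assms(1) unfolding tp_def by auto

lemma same_type_sym:
  assumes st: "same_type M a N b N'" and "N \<in> KL" "N' \<in> KL" "M \<preceq> N" "M \<preceq> N'"
  shows "same_type M b N' a N"
proof -
  obtain N'' \<pi> where pi: "N'' \<in> KL" "N' \<preceq> N''" "bij \<pi>" "over (univ M) \<pi>" "img \<pi> N \<preceq> N''" "\<pi> a = b"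
    using st unfolding same_type_def by blast
  have b: "bij (inv \<pi>)" using pi(3) by (rule bij_imp_bij_inv)
  show ?thesis unfolding same_type_def
  proof (intro bexI exI conjI)
    show "N \<preceq> img (inv \<pi>) N''" using img_le'[OF pi(5) b] unfolding img_inv[OF pi(3)] .
    show "over (univ M) (inv \<pi>)" using over_inv pi by blast
    show "img (inv \<pi>) N' \<preceq> img (inv \<pi>) N''" using img_le'[OF pi(2) b] .
    show "inv \<pi> b = a" using inv_f_f[OF bij_is_inj[OF pi(3)], of a] pi(6) by simp
    show "img (inv \<pi>) N'' \<in> KL" using img_KL[OF pi(1) b] .
  qed (rule b)
qed

lemma same_type_Estar:
  assumes st: "same_type M a N b N'" and KL: "N \<in> KL" "N' \<in> KL" "M \<preceq> N" "M \<preceq> N'" "a \<in> univ N" "b \<in> univ N'"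
  shows "((M, N, a), (M, N', b)) \<in> Estar s"
proof -
  obtain N'' \<pi> where pi: "N'' \<in> KL" "N' \<preceq> N''" "bij \<pi>" "over (univ M) \<pi>" "img \<pi> N \<preceq> N''" "\<pi> a = b"
    using st unfolding same_type_def by blast
  have "embedding s \<pi> N N''" using embeddingI[OF pi(5) bij_inj_on[OF pi(3)] KL_K[OF KL(1)]] .
  then show ?thesis using pi KL unfolding Estar_def triples_def by auto
qed

lemma same_type_iff:
  assumes KL: "M \<in> KL" "N \<in> KL" "N' \<in> KL" "M \<preceq> N" "M \<preceq> N'" "a \<in> univ N" "b \<in> univ N'"
  shows "tp s a M N = tp s b M N' \<longleftrightarrow> same_type M a N b N'"
proof
  assume "tp s a M N = tp s b M N'"
  then have "((M, N, a), (M, N', b)) \<in> (Estar s)\<^sup>+" using tp_eqD KL by blast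
  then show "same_type M a N b N'"
    by (intro Estar_path_same_type[of M N a N' b N'])
      (use KL KL_refl in \<open>auto simp: triples_def intro: trancl_into_rtrancl\<close>)
next
  assume st: "same_type M a N b N'"
  show "tp s a M N = tp s b M N'"
    using same_type_Estar[OF st] same_type_Estar[OF same_type_sym[OF st]] KL
    by (intro tp_eqI) blast+
qed

lemma Estar_restrict:
  assumes "((M1, N, a), (M1, N', b)) \<in> (Estar s)\<^sup>+" "M0 \<preceq> M1"
  shows "((M0, N, a), (M0, N', b)) \<in> (Estar s)\<^sup>+"
proof -
  define r where "r = (\<lambda>t :: ('a, 'f, 'r) triple. (M0, snd t))"
  have st: "(r x, r y) \<in> Estar s" if "(x, y) \<in> Estar s" "fst x = M1" for x y
    using that le_trans[OF assms(2)] le_univ[OF assms(2)] unfolding Estar_def triples_def r_def over_def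
    by (cases x; cases y) (auto; blast)
  have "fst y = M1 \<and> (r (M1, N, a), r y) \<in> (Estar s)\<^sup>+" if "((M1, N, a), y) \<in> (Estar s)\<^sup>+" for y
    using that
  proof (induction rule: trancl_induct)
    case (base y)
    then have "fst y = M1" by (auto simp: Estar_def)
    then show ?case using st[OF base] by (simp add: r_into_trancl)
  next
    case (step y z)
    have "(r y, r z) \<in> Estar s" using st[OF step.hyps(2)] step.IH by blast
    moreover have "fst z = M1" using step.hyps(2) step.IH by (auto simp: Estar_def)
    ultimately show ?case using step.IH trancl_into_trancl[of "r (M1, N, a)" "r y" "Estar s" "r z"] by blast
  qed
  from this[OF assms(1)] show ?thesis by (simp add: r_def)
qed

text \<open>The definite description is well defined: any other representation of the type is joined
  to this one by \<open>Estar\<close> paths in both directions, these preserve the base, and they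
  remain paths when the base shrinks.\<close>

lemma tp_restr:
  assumes "M1 \<preceq> N" "a \<in> univ N" "M0 \<preceq> M1"
  shows "tp_restr s (tp s a M1 N) M0 = tp s a M0 N"
  unfolding tp_restr_def
proof (rule the_equality)
  show "\<exists>M1' N' a'. (M1', N', a') \<in> triples s \<and> tp s a M1 N = tp s a' M1' N' \<and> M0 \<preceq> M1' \<and>
      tp s a M0 N = tp s a' M0 N'"
    using assms unfolding triples_def by blast
next
  fix q assume "\<exists>M1' N' a'. (M1', N', a') \<in> triples s \<and> tp s a M1 N = tp s a' M1' N' \<and> M0 \<preceq> M1' \<and>
      q = tp s a' M0 N'"
  then obtain M1' N' a' where q: "M1' \<preceq> N'" "a' \<in> univ N'" "tp s a M1 N = tp s a' M1' N'" "M0 \<preceq> M1'"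
      "q = tp s a' M0 N'" unfolding triples_def by auto
  note p = tp_eqD[OF q(3) assms(1,2) q(1,2)]
  have "M1' = M1" using Estar_fst[OF trancl_into_rtrancl[OF p(1)]] by simp
  then show "q = tp s a M0 N"
    using tp_eqI[OF Estar_restrict[of M1 N a N' a' M0] Estar_restrict[of M1 N' a' N a M0]] p assms(3) q(5)
    by simp
qed

section \<open>Non-forking without types\<close>

text \<open>
  Types are eliminated: \<open>nf s M M a N\<close> says that \<open>a\<close> realizes a basic type over \<open>M\<close>, and embeddings
  are replaced by permutations of the whole element type.
\<close>

lemmas gf = frame[unfolded good_frame_minus_stability_def]
lemmas gf_ec = gf[THEN conjunct1] and gf_r1 = gf[THEN conjunct2]
lemmas gf_Sbs = gf_r1[THEN conjunct1] and gf_r2 = gf_r1[THEN conjunct2]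
lemmas gf_inv = gf_r2[THEN conjunct1] and gf_r3 = gf_r2[THEN conjunct2]
lemmas gf_basic = gf_r3[THEN conjunct1] and gf_r4 = gf_r3[THEN conjunct2]
lemmas gf_mono = gf_r4[THEN conjunct1] and gf_r5 = gf_r4[THEN conjunct2]
lemmas gf_lc = gf_r5[THEN conjunct1] and gf_r6 = gf_r5[THEN conjunct2]
lemmas gf_uniq = gf_r6[THEN conjunct1] and gf_r7 = gf_r6[THEN conjunct2]
lemmas gf_sym = gf_r7[THEN conjunct1] and gf_r8 = gf_r7[THEN conjunct2]
lemmas gf_ext = gf_r8[THEN conjunct1] and gf_cont = gf_r8[THEN conjunct2]

lemma nfD:
  assumes "nf s A B a N"
  shows "A \<in> KL" "B \<in> KL" "N \<in> KL" "A \<preceq> B" "B \<preceq> N" "a \<in> univ N" "a \<notin> univ B"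
    "tp s a A N \<in> Sbs s A" "tp s a B N \<in> Sbs s B"
  using gf_basic[unfolded nf_basic_def] assms by blast+

lemma nf_img:
  assumes "nf s A B a N" "bij \<pi>"
  shows "nf s (img \<pi> A) (img \<pi> B) (\<pi> a) (img \<pi> N)"
proof -
  have "is_iso (voc s) \<pi> N (img \<pi> N)"
    using iso_img[OF K_model[OF KL_K[OF nfD(3)[OF assms(1)]]] bij_inj_on[OF assms(2)]] .
  then show ?thesis using gf_inv[unfolded nf_invariant_def] assms(1) by blast
qed

lemma nf_mono:
  assumes "nf s A B a N" "A \<preceq> A'" "A' \<preceq> B'" "B' \<preceq> B" "N \<preceq> N'" "N'' \<preceq> N'" "univ B' \<subseteq> univ N''" "a \<in> univ N''"
    "A' \<in> KL" "B' \<in> KL" "N' \<in> KL" "N'' \<in> KL"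
  shows "nf s A' B' a N''"
  using gf_mono[unfolded nf_monotonicity_def, rule_format,
      OF nfD(1)[OF assms(1)] assms(9,10) nfD(2)[OF assms(1)] nfD(3)[OF assms(1)] assms(11,12)]
    nfD(5)[OF assms(1)] assms by blast

lemma nf_up: "nf s A B a N \<Longrightarrow> N \<preceq> N' \<Longrightarrow> N' \<in> KL \<Longrightarrow> nf s A B a N'"
  using nf_mono[of A B a N A B N' N'] nfD[of A B a N] KL_refl[of A] KL_refl[of B] KL_refl[of N']
    le_univ[of B N] le_univ[of N N'] by blast

lemma nf_down: "nf s A B a N' \<Longrightarrow> N \<preceq> N' \<Longrightarrow> N \<in> KL \<Longrightarrow> B \<preceq> N \<Longrightarrow> a \<in> univ N \<Longrightarrow> nf s A B a N"
  using nf_mono[of A B a N' A B N' N] nfD[of A B a N'] KL_refl[of A] KL_refl[of B] KL_refl[of N']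
    le_univ[of B N] by blast

lemma nf_base: "nf s A B a N \<Longrightarrow> A \<preceq> A' \<Longrightarrow> A' \<preceq> B \<Longrightarrow> A' \<in> KL \<Longrightarrow> nf s A' B a N"
  using nf_mono[of A B a N A' B N N] nfD[of A B a N] KL_refl[of B] KL_refl[of N] le_univ[of B N] by blast

lemma nf_top: "nf s A B a N \<Longrightarrow> A \<preceq> B' \<Longrightarrow> B' \<preceq> B \<Longrightarrow> B' \<in> KL \<Longrightarrow> nf s A B' a N"
  using nf_mono[of A B a N A B' N N] nfD[of A B a N] KL_refl[of A] KL_refl[of N]
    le_univ[of B' B] le_univ[of B N] by blast

text \<open>The permutation witnessing \<open>same_type\<close> fixes \<open>B\<close> and hence
  \<open>A\<close>, so invariance carries non-forking to the image of \<open>N1\<close>;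
  monotonicity passes it up to the common extension and down to \<open>N\<close>.\<close>

lemma nf_same_type:
  assumes "nf s A B b N1" "same_type B b N1 a N" "N \<in> KL" "B \<preceq> N" "a \<in> univ N"
  shows "nf s A B a N"
proof -
  obtain N'' \<pi> where pi: "N'' \<in> KL" "N \<preceq> N''" "bij \<pi>" "over (univ B) \<pi>" "img \<pi> N1 \<preceq> N''" "\<pi> b = a"
    using assms(2) unfolding same_type_def by blast
  note n = nfD[OF assms(1)]
  have "img \<pi> A = A" "img \<pi> B = B"
    using img_over[OF KL_K[OF n(2)] pi(4)] img_over[OF KL_K[OF n(1)] over_le[OF pi(4) n(4)]] by auto
  then have "nf s A B a (img \<pi> N1)" using nf_img[OF assms(1) pi(3)] pi(6) by simp
  then have "nf s A B a N''" using nf_up pi(1,5) by blast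
  then show ?thesis using nf_down pi(2) assms(3-5) by blast
qed

lemma nf_extension_axiom:
  assumes "M \<in> KL" "N \<in> KL" "M \<preceq> N" "M \<noteq> N" "p \<in> Sbs s M"
  obtains b N1 where "nf s M N b N1" "tp s b M N1 = p"
proof -
  obtain q where q: "q \<in> Sbs s N" "dnf s M N q" "tp_restr s q M = p"
    using gf_ext[unfolded nf_extension_def, rule_format, OF assms(1,2,5)] assms(3,4) unfolding prec_def by blast
  obtain b N1 where b: "q = tp s b N N1" "nf s M N b N1" using q(2) unfolding dnf_def by blast
  have "tp s b M N1 = p" using tp_restr[OF nfD(5,6)[OF b(2)] assms(3)] q(3) b(1) by simp
  then show ?thesis using that b(2) by blast
qed

lemma nf_unique:
  assumes "nf s A B a N" "nf s A B b N'" "tp s a A N = tp s b A N'"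
  shows "same_type B a N b N'"
proof -
  note n1 = nfD[OF assms(1)] and n2 = nfD[OF assms(2)]
  have "tp_restr s (tp s a B N) A = tp_restr s (tp s b B N') A"
    using tp_restr[OF n1(5,6,4)] tp_restr[OF n2(5,6,4)] assms(3) by simp
  moreover have "dnf s A B (tp s a B N)" "dnf s A B (tp s b B N')"
    using assms(1,2) unfolding dnf_def by blast+
  ultimately have "tp s a B N = tp s b B N'"
    using gf_uniq[unfolded nf_uniqueness_def] n1(1,2,9) n2(9) by blast
  then show ?thesis using same_type_iff[OF n1(2,3) n2(3) n1(5) n2(5) n1(6) n2(6)] by blast
qed

text \<open>Derived from extension and uniqueness: a realization \<open>b\<close> of the non-forking
  extension to \<open>C\<close> of the type over \<open>A\<close> agrees with \<open>a\<close> first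
  over \<open>B\<close> and then over \<open>C\<close>.\<close>

lemma nf_trans:
  assumes "nf s A B a N" "nf s B C a N"
  shows "nf s A C a N"
\<comment> \<open>The extension axiom concerns proper extensions only.\<close>
proof (cases "A = C")
  case True
  then have "A = B" using le_antisym nfD(4)[OF assms(1)] nfD(4)[OF assms(2)] by blast
  then show ?thesis using assms(2) by simp
next
  case False
  note n1 = nfD[OF assms(1)] and n2 = nfD[OF assms(2)]
  have AC: "A \<preceq> C" using le_trans n1(4) n2(4) by blast
  obtain b N1 where b: "nf s A C b N1" "tp s b A N1 = tp s a A N"
    using nf_extension_axiom[OF n1(1) n2(2) AC False n1(8)] by blast
  note m = nfD[OF b(1)]
  have BN1: "B \<preceq> N1" using le_trans n2(4) m(5) by blast
  have b2: "nf s A B b N1" using nf_top[OF b(1) n1(4) n2(4) n1(2)] .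
  have st: "same_type B b N1 a N" using nf_unique[OF b2 assms(1) b(2)] .
  then have "tp s b B N1 = tp s a B N"
    using same_type_iff[OF n1(2) m(3) n1(3) BN1 n1(5) m(6) n1(6)] by blast
  then have "same_type C b N1 a N"
    using nf_unique[OF nf_base[OF b(1) n1(4) n2(4) n1(2)] assms(2)] by blast
  then show ?thesis using nf_same_type[OF b(1)] n2(3,5,6) by blast
qed

text \<open>The type is extended without forking to a proper extension \<open>M2\<close>, which
  exists since no model is maximal, and monotonicity restricts it back to \<open>M\<close>.\<close>

lemma nf_self:
  assumes "M \<in> KL" "N \<in> KL" "M \<preceq> N" "a \<in> univ N" "tp s a M N \<in> Sbs s M"
  shows "nf s M M a N"
proof -
  obtain M2 where M2: "M2 \<in> KL" "M \<preceq> M2" "M \<noteq> M2"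
    using gf_ec[unfolded frame_ec_def] assms(1) unfolding prec_def by blast
  obtain b N1 where b: "nf s M M2 b N1" "tp s b M N1 = tp s a M N"
    using nf_extension_axiom[OF assms(1) M2 assms(5)] by blast
  note m = nfD[OF b(1)]
  have MN1: "M \<preceq> N1" using le_trans M2(2) m(5) by blast
  have "same_type M b N1 a N"
    using b(2) same_type_iff[OF assms(1) m(3) assms(2) MN1 assms(3) m(6) assms(4)] by blast
  then show ?thesis
    using nf_same_type[OF nf_top[OF b(1) KL_refl[OF assms(1)] M2(2) assms(1)]] assms by blast
qed

lemma nf_selfD: "nf s A B a N \<Longrightarrow> nf s B B a N"
  using nf_base[of A B a N B] nfD[of A B a N] KL_refl[of B] by blast

lemma nf_density:
  assumes "M \<in> KL" "N \<in> KL" "M \<preceq> N" "M \<noteq> N"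
  obtains a where "nf s M M a N"
proof -
  obtain a where "a \<in> univ N - univ M" "tp s a M N \<in> Sbs s M"
    using gf_Sbs[unfolded frame_Sbs_def, THEN conjunct2, THEN conjunct2, rule_format, OF assms(1,2)]
      assms(3,4) unfolding prec_def by blast
  then show ?thesis using that nf_self[OF assms(1-3)] by blast
qed

text \<open>The abstract non-forking extension is realized by some \<open>b\<close> in a model above
  \<open>C\<close>. Since \<open>b\<close> and \<open>a\<close> have the same type over
  \<open>B\<close>, \<open>N\<close> can be moved over \<open>B\<close> so that \<open>a\<close>
  lands on \<open>b\<close>.\<close>

lemma nf_extend':
  assumes nf: "nf s A B a N" and C: "C \<in> KL" "B \<preceq> C"
  obtains N' \<sigma> where "N' \<in> KL" "C \<preceq> N'" "bij \<sigma>" "over (univ B) \<sigma>" "img \<sigma> N \<preceq> N'" "nf s A C (\<sigma> a) N'"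
proof (cases "B = C")
  case True
  have "N \<preceq> N" "N \<in> KL" "C \<preceq> N" using nfD[OF nf] KL_refl True by auto
  then show ?thesis using that[of N id] nf True by (simp add: img_id)
next
  case False
  note n = nfD[OF nf]
  obtain b N1 where b: "nf s B C b N1" "tp s b B N1 = tp s a B N"
    using nf_extension_axiom[OF n(2) C False n(9)] by blast
  note m = nfD[OF b(1)]
  have BN1: "B \<preceq> N1" using le_trans C(2) m(5) by blast
  have st: "same_type B a N b N1"
    using same_type_iff[OF n(2) n(3) m(3) n(5) BN1 n(6) m(6)] b(2) by simp
  then obtain N' \<pi> where pi: "N' \<in> KL" "N1 \<preceq> N'" "bij \<pi>" "over (univ B) \<pi>" "img \<pi> N \<preceq> N'" "\<pi> a = b"
    unfolding same_type_def by blast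
  have "nf s A B b N1" using nf_same_type[OF nf st m(3) BN1 m(6)] .
  then have "nf s A C b N'" using nf_up[OF nf_trans[OF _ b(1)] pi(2,1)] by blast
  then show ?thesis using that[of N' \<pi>] pi le_trans[OF m(5) pi(2)] by blast
qed

lemma nf_extend:
  assumes nf: "nf s A B a N" and C: "C \<in> KL" "B \<preceq> C"
  obtains N' \<sigma> where "N' \<in> KL" "N \<preceq> N'" "bij \<sigma>" "over (univ B) \<sigma>" "img \<sigma> C \<preceq> N'" "nf s A (img \<sigma> C) a N'"
proof -
  obtain N' \<sigma> where N': "N' \<in> KL" "C \<preceq> N'" "bij \<sigma>" "over (univ B) \<sigma>" "img \<sigma> N \<preceq> N'" "nf s A C (\<sigma> a) N'"
    by (rule nf_extend'[OF assms])
  have b: "bij (inv \<sigma>)" using N'(3) by (rule bij_imp_bij_inv)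
  have ov: "over (univ B) (inv \<sigma>)" using over_inv N' by blast
  have A: "img (inv \<sigma>) A = A" using img_over[OF KL_K[OF nfD(1)[OF nf]] over_le[OF ov nfD(4)[OF nf]]] .
  show ?thesis
  proof (rule that)
    show "img (inv \<sigma>) N' \<in> KL" using img_KL N'(1) b by blast
    show "N \<preceq> img (inv \<sigma>) N'" using img_le'[OF N'(5) b] unfolding img_inv[OF N'(3)] .
    show "img (inv \<sigma>) C \<preceq> img (inv \<sigma>) N'" using img_le'[OF N'(2) b] .
    show "nf s A (img (inv \<sigma>) C) a (img (inv \<sigma>) N')"
      using nf_img[OF N'(6) b] unfolding A inv_f_f[OF bij_is_inj[OF N'(3)]] .
  qed (rule b, rule ov)
qed

lemma nf_symmetric:
  assumes "nf s A A a N" "A \<preceq> B" "a \<in> univ B" "nf s A B b N"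
  obtains C N' where "C \<in> KL" "N' \<in> KL" "b \<in> univ C" "A \<preceq> C" "C \<preceq> N'" "N \<preceq> N'" "nf s A C a N'"
  using gf_sym[unfolded nf_symmetry_def] assms(2,3,4) nfD[OF assms(1)] nfD[OF assms(4)] that by meson

text \<open>The symmetry axiom only yields some model \<open>M2\<close> containing the realization
  of \<open>y\<close> and free from \<open>x\<close>. Extending \<open>M2\<close> to a copy of the
  whole ambient model that is still free from \<open>x\<close> brings in a copy of \<open>Y\<close>,
  while the realization of \<open>y\<close>, lying in \<open>M2\<close>, stays where it was.\<close>

lemma symmetric_amalgam:
  assumes x: "nf s R R x X" and y: "nf s R R y Y"
  obtains Z \<pi> where "Z \<in> KL" "X \<preceq> Z" "bij \<pi>" "over (univ R) \<pi>" "img \<pi> Y \<preceq> Z"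
    "nf s R X (\<pi> y) Z" "nf s R (img \<pi> Y) x Z"
proof -
  note nx = nfD[OF x] and ny = nfD[OF y]
  obtain Z1 \<sigma> where Z1: "Z1 \<in> KL" "X \<preceq> Z1" "bij \<sigma>" "over (univ R) \<sigma>" "img \<sigma> Y \<preceq> Z1" "nf s R X (\<sigma> y) Z1"
    by (rule nf_extend'[OF y nx(3,5)])
  obtain M2 Z2 where Z2: "M2 \<in> KL" "Z2 \<in> KL" "\<sigma> y \<in> univ M2" "R \<preceq> M2" "M2 \<preceq> Z2" "Z1 \<preceq> Z2" "nf s R M2 x Z2"
    by (rule nf_symmetric[OF nf_up[OF x Z1(2,1)] nx(5,6) Z1(6)])
  obtain Z3 \<rho> where Z3: "Z3 \<in> KL" "Z2 \<preceq> Z3" "bij \<rho>" "over (univ M2) \<rho>" "img \<rho> Z2 \<preceq> Z3" "nf s R (img \<rho> Z2) x Z3"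
    by (rule nf_extend[OF Z2(7,2,5)])
  have ov: "over (univ R) (\<rho> \<circ> \<sigma>)" using over_comp over_le[OF Z3(4) Z2(4)] Z1(4) by blast
  have yy: "(\<rho> \<circ> \<sigma>) y = \<sigma> y" using Z3(4) Z2(3) unfolding over_def by simp
  have l: "img (\<rho> \<circ> \<sigma>) Y \<preceq> img \<rho> Z2"
    using img_le'[OF le_trans[OF Z1(5) Z2(6)] Z3(3)] by (simp add: img_comp)
  have bj: "bij (\<rho> \<circ> \<sigma>)" using Z1(3) Z3(3) by (rule bij_comp)
  have YK: "img (\<rho> \<circ> \<sigma>) Y \<in> KL" using img_KL[OF ny(3) bj] .
  have RY: "R \<preceq> img (\<rho> \<circ> \<sigma>) Y" using img_le'[OF ny(5) bj] img_over_le[OF ny(5) ov] by simp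
  show ?thesis
  proof (rule that[OF Z3(1) _ bj ov])
    show "X \<preceq> Z3" using le_trans[OF le_trans[OF Z1(2) Z2(6)] Z3(2)] .
    show "img (\<rho> \<circ> \<sigma>) Y \<preceq> Z3" using le_trans[OF l Z3(5)] .
    show "nf s R X ((\<rho> \<circ> \<sigma>) y) Z3" unfolding yy using nf_up[OF Z1(6) le_trans[OF Z2(6) Z3(2)] Z3(1)] .
    show "nf s R (img (\<rho> \<circ> \<sigma>) Y) x Z3" using nf_top[OF Z3(6) RY l YK] .
  qed
qed

text \<open>The continuity axiom takes the first member of the chain as its base; transitivity then
  replaces that base by the smaller \<open>A\<close>.\<close>

lemma nf_continuous:
  fixes T :: "'o \<Rightarrow> ('a, 'f, 'r) model"
  assumes d: "olimit \<delta>" and T: "inc_cont s {..\<delta>} T" "\<And>\<alpha>. \<alpha> \<le> \<delta> \<Longrightarrow> T \<alpha> \<in> KL"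
    and N: "N \<in> KL" "T \<delta> \<preceq> N" and nf: "\<And>\<alpha>. \<alpha> < \<delta> \<Longrightarrow> nf s A (T \<alpha>) a N"
  shows "nf s A (T \<delta>) a N"
proof -
  have z: "ozero < \<delta>" using olimit_pos d by blast
  have le: "T \<alpha> \<preceq> T \<beta>" if "\<alpha> \<le> \<beta>" "\<beta> \<le> \<delta>" for \<alpha> \<beta>
    using inc_cont_le[OF T(1), of \<alpha> \<beta>] that by auto
  have aN: "a \<in> univ N" using nfD[OF nf[OF z]] by blast
  have base: "nf s (T ozero) (T \<alpha>) a N" if "\<alpha> < \<delta>" for \<alpha>
    using nf_base[OF nf[OF that] nfD(4)[OF nf[OF z]] le[OF ozero_le less_imp_le[OF that]] T(2)[OF ozero_le]] .
  let ?p = "tp s a (T \<delta>) N"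
  have "?p \<in> types s (T \<delta>)" unfolding types_def triples_def using N(2) aN by blast
  moreover have "dnf s (T ozero) (T \<alpha>) (tp_restr s ?p (T \<alpha>))" if "\<alpha> < \<delta>" for \<alpha>
    using tp_restr[OF N(2) aN le[of \<alpha> \<delta>]] base[OF that] that unfolding dnf_def by (auto simp: less_imp_le)
  ultimately have "dnf s (T ozero) (T \<delta>) ?p"
    using gf_cont[unfolded nf_continuity_def] d T by blast
  then obtain b N1 where b: "?p = tp s b (T \<delta>) N1" "nf s (T ozero) (T \<delta>) b N1" unfolding dnf_def by blast
  note m = nfD[OF b(2)]
  have "same_type (T \<delta>) b N1 a N"
    using same_type_iff[OF m(2,3) N(1) m(5) N(2) m(6) aN] b(1) by simp
  then have "nf s (T ozero) (T \<delta>) a N" using nf_same_type[OF b(2)] N aN by blast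
  then show ?thesis using nf_trans[OF nf[OF z]] by blast
qed

lemma nf_local:
  fixes T :: "'o \<Rightarrow> ('a, 'f, 'r) model"
  assumes "olimit \<delta>" "inc_cont s {..\<delta>} T" "\<And>\<alpha>. \<alpha> \<le> \<delta> \<Longrightarrow> T \<alpha> \<in> KL" "nf s (T \<delta>) (T \<delta>) a N"
  shows "\<exists>\<alpha><\<delta>. nf s (T \<alpha>) (T \<delta>) a N"
  using gf_lc[unfolded nf_local_character_def] assms nfD[OF assms(4)] by blast

section \<open>Uniqueness triples\<close>

lemma uqD:
  assumes "(M, U, a) \<in> K3uq lam s"
  shows "nf s M M a U" "M \<in> KL" "U \<in> KL" "M \<preceq> U"
proof -
  have "(M, U, a) \<in> K3bs lam s" using assms unfolding K3uq_def by blast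
  then have *: "M \<in> KL" "U \<in> KL" "M \<preceq> U" "a \<in> univ U" "tp s a M U \<in> Sbs s M"
    unfolding K3bs_def by blast+
  show "nf s M M a U" using nf_self * by blast
  show "M \<in> KL" "U \<in> KL" "M \<preceq> U" using * by blast+
qed

lemma embeddingD:
  assumes "embedding s f M N"
  shows "img f M \<preceq> N" "inj_on f (univ M)"
proof -
  obtain M' where M': "is_iso (voc s) f M M'" "M' \<preceq> N" using assms unfolding embedding_def by blast
  show "img f M \<preceq> N" using iso_eq_img[OF M'(1)] M'(2) by simp
  show "inj_on f (univ M)" using M'(1) unfolding is_iso_def bij_betw_def by blast
qed

lemma embedding_conj:
  assumes "embedding s f M N" "bij \<pi>" "M \<in> KL"
  shows "embedding s (\<pi> \<circ> f \<circ> inv \<pi>) (img \<pi> M) (img \<pi> N)"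
proof (rule embeddingI)
  have e: "(\<pi> \<circ> f \<circ> inv \<pi>) \<circ> \<pi> = \<pi> \<circ> f" using assms(2) by (simp add: fun_eq_iff bij_is_inj)
  show "img (\<pi> \<circ> f \<circ> inv \<pi>) (img \<pi> M) \<preceq> img \<pi> N"
    unfolding img_comp e using img_le'[OF embeddingD(1)[OF assms(1)] assms(2)] by (simp add: img_comp)
  show "inj_on (\<pi> \<circ> f \<circ> inv \<pi>) (univ (img \<pi> M))"
  proof (intro comp_inj_on)
    have "inv \<pi> ` univ (img \<pi> M) = univ M" using assms(2) by (simp add: image_comp bij_is_inj)
    then show "inj_on f (inv \<pi> ` univ (img \<pi> M))" using embeddingD(2)[OF assms(1)] by simp
  qed (rule bij_inj_on[OF assms(2)] bij_inj_on[OF bij_imp_bij_inv[OF assms(2)]])+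
  show "img \<pi> M \<in> K s" using img_KL[OF assms(3,2)] KL_K by blast
qed

lemma over_conj: "bij \<pi> \<Longrightarrow> over (univ M) f \<Longrightarrow> over (univ (img \<pi> M)) (\<pi> \<circ> f \<circ> inv \<pi>)"
  by (auto simp: over_def bij_is_inj)

lemma nf_amalgamation_conj:
  assumes A: "nf_amalgamation lam s M U a F (f, g, N)" and p: "bij \<pi>" and KL: "U \<in> KL" "F \<in> KL"
  shows "nf_amalgamation lam s (img \<pi> M) (img \<pi> U) (\<pi> a) (img \<pi> F)
    (\<pi> \<circ> f \<circ> inv \<pi>, \<pi> \<circ> g \<circ> inv \<pi>, img \<pi> N)"
proof -
  have N: "N \<in> KL" and am: "M \<preceq> U" "M \<preceq> F" "embedding s f U N" "over (univ M) f" "embedding s g F N" "over (univ M) g"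
    and nf: "nf s M (img g F) (f a) N"
    using A unfolding nf_amalgamation_def amalgamation_def by auto
  have e: "img (\<pi> \<circ> g \<circ> inv \<pi>) (img \<pi> F) = img \<pi> (img g F)"
    using p by (simp add: img_comp comp_assoc bij_is_inj)
  have fa: "(\<pi> \<circ> f \<circ> inv \<pi>) (\<pi> a) = \<pi> (f a)" using p by (simp add: bij_is_inj)
  have "amalgamation s (img \<pi> M) (img \<pi> U) (img \<pi> F) (\<pi> \<circ> f \<circ> inv \<pi>) (\<pi> \<circ> g \<circ> inv \<pi>) (img \<pi> N)"
    unfolding amalgamation_def
    by (intro conjI img_le'[OF am(1) p] img_le'[OF am(2) p] embedding_conj[OF am(3) p KL(1)]
        embedding_conj[OF am(5) p KL(2)] over_conj[OF p am(4)] over_conj[OF p am(6)])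
  then show ?thesis
    unfolding nf_amalgamation_def prod.case e fa using img_KL[OF N p] nf_img[OF nf p] by blast
qed

text \<open>Every extension of the image of \<open>M\<close> is the image of an extension of
  \<open>M\<close>, so amalgamations can be conjugated back, compared there, and the comparison
  conjugated forward.\<close>

lemma uq_img:
  assumes uq: "(M, U, a) \<in> K3uq lam s" and p: "bij \<pi>"
  shows "(img \<pi> M, img \<pi> U, \<pi> a) \<in> K3uq lam s"
proof -
  note u = uqD[OF uq]
  have q: "bij (inv \<pi>)" using p by (rule bij_imp_bij_inv)
  have ip: "img (inv \<pi>) (img \<pi> X) = X" for X :: "('a, 'f, 'r) model" using img_inv[OF p] .
  have pi: "img \<pi> (img (inv \<pi>) X) = X" for X :: "('a, 'f, 'r) model" using img_inv'[OF p] .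
  have n: "nf s (img \<pi> M) (img \<pi> M) (\<pi> a) (img \<pi> U)" using nf_img[OF u(1) p] .
  have K3: "(img \<pi> M, img \<pi> U, \<pi> a) \<in> K3bs lam s" unfolding K3bs_def using nfD[OF n] by blast
  have ex: "\<exists>A. nf_amalgamation lam s M U a F A"
    and un: "\<And>A B. nf_amalgamation lam s M U a F A \<Longrightarrow> nf_amalgamation lam s M U a F B \<Longrightarrow>
      equivalent_amalgamations s U F A B" if "F \<in> KL" "prec s M F" for F
    using uq that unfolding K3uq_def by blast+
  have "(\<exists>A. nf_amalgamation lam s (img \<pi> M) (img \<pi> U) (\<pi> a) F' A) \<and>
      (\<forall>A B. nf_amalgamation lam s (img \<pi> M) (img \<pi> U) (\<pi> a) F' A \<and>
         nf_amalgamation lam s (img \<pi> M) (img \<pi> U) (\<pi> a) F' B \<longrightarrow>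
         equivalent_amalgamations s (img \<pi> U) F' A B)"
    if F': "F' \<in> KL" "prec s (img \<pi> M) F'" for F'
  proof (intro conjI allI impI)
    let ?F = "img (inv \<pi>) F'"
    have F: "?F \<in> KL" using img_KL[OF F'(1) q] .
    have "M \<preceq> ?F" using img_le'[of "img \<pi> M" F' "inv \<pi>"] F'(2) q unfolding prec_def ip by blast
    moreover have "M \<noteq> ?F" using F'(2) pi unfolding prec_def by metis
    ultimately have MF: "prec s M ?F" unfolding prec_def by blast
    obtain f g N where "nf_amalgamation lam s M U a ?F (f, g, N)" using ex[OF F MF] by (metis prod_cases3)
    from nf_amalgamation_conj[OF this p u(3) F]
    show "\<exists>A. nf_amalgamation lam s (img \<pi> M) (img \<pi> U) (\<pi> a) F' A" unfolding pi by blast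
    fix A B
    assume AB: "nf_amalgamation lam s (img \<pi> M) (img \<pi> U) (\<pi> a) F' A \<and>
      nf_amalgamation lam s (img \<pi> M) (img \<pi> U) (\<pi> a) F' B"
    obtain f1 g1 N1 f2 g2 N2 where A: "A = (f1, g1, N1)" and B: "B = (f2, g2, N2)"
      by (metis prod_cases3)
    have ia: "inv \<pi> (\<pi> x) = x" for x using p by (simp add: bij_is_inj)
    have ii: "inv (inv \<pi>) = \<pi>" using p by (rule inv_inv_eq)
    note c1 = nf_amalgamation_conj[OF AB[THEN conjunct1, unfolded A] q img_KL[OF u(3) p] F'(1), unfolded ip ia ii]
    note c2 = nf_amalgamation_conj[OF AB[THEN conjunct2, unfolded B] q img_KL[OF u(3) p] F'(1), unfolded ip ia ii]
    obtain M' v w where M': "M' \<in> K s" "embedding s v (img (inv \<pi>) N1) M'" "embedding s w (img (inv \<pi>) N2) M'"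
      and v1: "\<forall>x\<in>univ U. v ((inv \<pi> \<circ> f1 \<circ> \<pi>) x) = w ((inv \<pi> \<circ> f2 \<circ> \<pi>) x)"
      and v2: "\<forall>x\<in>univ ?F. v ((inv \<pi> \<circ> g1 \<circ> \<pi>) x) = w ((inv \<pi> \<circ> g2 \<circ> \<pi>) x)"
      using un[OF F MF c1 c2] unfolding equivalent_amalgamations_def by auto
    have NK: "N1 \<in> K s" "N2 \<in> K s" using AB KL_K unfolding A B nf_amalgamation_def by auto
    have em: "embedding s (h \<circ> inv \<pi>) N M'" if "embedding s h (img (inv \<pi>) N) M'" "N \<in> K s" for h N
    proof (rule embeddingI)
      show "img (h \<circ> inv \<pi>) N \<preceq> M'" using embeddingD(1)[OF that(1)] by (simp add: img_comp)
      show "inj_on (h \<circ> inv \<pi>) (univ N)"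
        using embeddingD(2)[OF that(1)] bij_inj_on[OF q] by (auto intro: comp_inj_on)
    qed (rule that)
    have pF: "\<pi> (inv \<pi> x) = x" for x using p by (meson bij_inv_eq_iff)
    show "equivalent_amalgamations s (img \<pi> U) F' A B"
      unfolding equivalent_amalgamations_def A B prod.case
    proof (intro exI conjI ballI)
      show "embedding s (v \<circ> inv \<pi>) N1 M'" "embedding s (w \<circ> inv \<pi>) N2 M'" using em M' NK by blast+
      show "(v \<circ> inv \<pi>) (f1 x) = (w \<circ> inv \<pi>) (f2 x)" if "x \<in> univ (img \<pi> U)" for x
        using v1 that by auto
      show "(v \<circ> inv \<pi>) (g1 x) = (w \<circ> inv \<pi>) (g2 x)" if "x \<in> univ F'" for x
        using bspec[OF v2, of "inv \<pi> x"] that pF by simp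
    qed (rule M'(1))
  qed
  then show ?thesis unfolding K3uq_def using K3 by blast
qed

text \<open>The existence property provides a triple of the right type with some element; equality
  of types allows moving it so that its element is the given \<open>a\<close>.\<close>

lemma uq_in_extension:
  assumes "nf s M M a N"
  obtains U N' where "N' \<in> KL" "N \<preceq> N'" "U \<preceq> N'" "(M, U, a) \<in> K3uq lam s"
proof -
  note n = nfD[OF assms]
  obtain U b where U: "(M, U, b) \<in> K3uq lam s" "tp s b M U = tp s a M N"
    using uq_exists n(1,8) unfolding K3uq_existence_def by blast
  note u = uqD[OF U(1)]
  have "same_type M b U a N"
    using same_type_iff[OF n(1) u(3) n(3) u(4) n(5) nfD(6)[OF u(1)] n(6)] U(2) by simp
  then obtain N' \<pi> where pi: "N' \<in> KL" "N \<preceq> N'" "bij \<pi>" "over (univ M) \<pi>" "img \<pi> U \<preceq> N'" "\<pi> b = a"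
    unfolding same_type_def by blast
  have "(M, img \<pi> U, a) \<in> K3uq lam s"
    using uq_img[OF U(1) pi(3)] img_over[OF KL_K[OF n(1)] pi(4)] pi(6) by simp
  then show ?thesis using that pi by blast
qed

text \<open>The defining property, put into the form used along towers: two copies of
  \<open>U\<close> are placed by permutations, \<open>F\<close> and \<open>K1\<close> stay in place,
  and undoing the map of \<open>K1\<close> leaves a single \<open>v\<close> that moves
  \<open>K2\<close>.\<close>

lemma uq_unique:
  assumes uq: "(M, U, a) \<in> K3uq lam s" and p: "bij p1" "bij p2" "over (univ M) p1" "over (univ M) p2"
    and nf: "nf s M F (p1 a) K1" "nf s M F (p2 a) K2" and le: "img p1 U \<preceq> K1" "img p2 U \<preceq> K2"
  obtains K v where "K \<in> KL" "K1 \<preceq> K" "bij v" "over (univ F) v" "img v K2 \<preceq> K"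
    "\<forall>x\<in>univ U. v (p2 x) = p1 x"
proof (cases "M = F")
  case False
  note n1 = nfD[OF nf(1)] and n2 = nfD[OF nf(2)] and u = uqD[OF uq]
  have am: "nf_amalgamation lam s M U a F (p, id, K')"
    if "bij p" "over (univ M) p" "nf s M F (p a) K'" "img p U \<preceq> K'" for p K'
  proof -
    note n = nfD[OF that(3)]
    have "embedding s id F K'" using embeddingI[of id F K'] n(5) KL_K[OF n(2)] by (simp add: img_id)
    moreover have "embedding s p U K'" using embeddingI[OF that(4) bij_inj_on[OF that(1)] KL_K[OF u(3)]] .
    ultimately show ?thesis
      unfolding nf_amalgamation_def amalgamation_def using that n u by (simp add: img_id)
  qed
  have "prec s M F" using n1(4) False unfolding prec_def by blast
  then have "equivalent_amalgamations s U F (p1, id, K1) (p2, id, K2)"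
    using uq n1(2) am[OF p(1,3) nf(1) le(1)] am[OF p(2,4) nf(2) le(2)] unfolding K3uq_def by blast
  then obtain M' f g where M': "M' \<in> K s" "embedding s f K1 M'" "embedding s g K2 M'"
      "\<forall>x\<in>univ U. f (p1 x) = g (p2 x)" "\<forall>x\<in>univ F. f x = g x"
    unfolding equivalent_amalgamations_def by auto
  obtain q1 where q1: "bij q1" "\<forall>x\<in>univ K1. q1 x = f x" "img q1 K1 \<preceq> M'"
    by (rule embeddingE[OF M'(2) n1(3)])
  obtain q2 where q2: "bij q2" "\<forall>x\<in>univ K2. q2 x = g x" "img q2 K2 \<preceq> M'"
    by (rule embeddingE[OF M'(3) n2(3)])
  have kl: "img q1 K1 \<in> KL" "img q2 K2 \<in> KL" using img_KL n1(3) n2(3) q1(1) q2(1) by blast+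
  \<comment> \<open>The model witnessing the equivalence can have any size, so it is cut down to one
    of size \<open>lam\<close> around the two images.\<close>
  obtain K' where K': "K' \<in> KL" "univ (img q1 K1) \<union> univ (img q2 K2) \<subseteq> univ K'" "K' \<preceq> M'"
    by (rule LST_lam[OF M'(1) _ Un_ordLeq_Cinfinite[OF lam KL_ordLeq[OF kl(1)] KL_ordLeq[OF kl(2)]] kl(1)])
      (use le_univ[OF q1(3)] le_univ[OF q2(3)] in auto)
  have l: "img q1 K1 \<preceq> K'" "img q2 K2 \<preceq> K'"
    using le_coherent[OF q1(3) K'(3)] le_coherent[OF q2(3) K'(3)] K'(2) by blast+
  have b: "bij (inv q1)" using q1(1) by (rule bij_imp_bij_inv)
  have iq: "inv q1 (q1 x) = x" for x using q1(1) by (simp add: bij_is_inj)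
  show ?thesis
  proof (rule that)
    show "img (inv q1) K' \<in> KL" using img_KL[OF K'(1) b] .
    show "K1 \<preceq> img (inv q1) K'" using img_le'[OF l(1) b] unfolding img_inv[OF q1(1)] .
    show "bij (inv q1 \<circ> q2)" using q2(1) b by (rule bij_comp)
    show "img (inv q1 \<circ> q2) K2 \<preceq> img (inv q1) K'" using img_le'[OF l(2) b] by (simp add: img_comp)
    have "q2 x = q1 x" if "x \<in> univ F" for x
      using bspec[OF M'(5) that] bspec[OF q1(2) subsetD[OF le_univ[OF n1(5)] that]]
        bspec[OF q2(2) subsetD[OF le_univ[OF n2(5)] that]] by simp
    then show "over (univ F) (inv q1 \<circ> q2)" unfolding over_def by (simp add: iq)
    show "\<forall>x\<in>univ U. (inv q1 \<circ> q2) (p2 x) = p1 x"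
    proof
    fix x assume x: "x \<in> univ U"
    have "p1 x \<in> univ K1" "p2 x \<in> univ K2" using le_univ[OF le(1)] le_univ[OF le(2)] x by auto
    then have "q2 (p2 x) = q1 (p1 x)"
      using bspec[OF M'(4) x] bspec[OF q1(2), of "p1 x"] bspec[OF q2(2), of "p2 x"] by simp
    then show "(inv q1 \<circ> q2) (p2 x) = p1 x" by (simp add: iq)
    qed
  qed
next
  \<comment> \<open>\<open>K3uq\<close> promises uniqueness over proper extensions of
    \<open>M\<close> only. For \<open>M = F\<close> nothing beyond \<open>M\<close> has to be fixed,
    and amalgamating over the copy of \<open>U\<close> is enough.\<close>
  case True
  note n1 = nfD[OF nf(1)] and n2 = nfD[OF nf(2)] and u = uqD[OF uq]
  let ?r = "p1 \<circ> inv p2"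
  have br: "bij ?r" using p(1) bij_imp_bij_inv[OF p(2)] by (simp add: bij_comp)
  have ip: "inv p2 (p2 x) = x" for x using p(2) by (simp add: bij_is_inj)
  have rU: "img ?r (img p2 U) = img p1 U" by (simp add: img_comp comp_assoc bij_is_inj[OF p(2)])
  obtain N \<rho> where N: "N \<in> KL" "K1 \<preceq> N" "bij \<rho>" "over (univ (img p1 U)) \<rho>" "img \<rho> (img ?r K2) \<preceq> N"
    by (rule amalgam[OF img_KL[OF u(3) p(1)] n1(3) img_KL[OF n2(3) br] le(1) img_le'[OF le(2) br, unfolded rU]])
  show ?thesis
  proof (rule that[OF N(1,2)])
    show "bij (\<rho> \<circ> ?r)" using br N(3) by (rule bij_comp)
    show "img (\<rho> \<circ> ?r) K2 \<preceq> N" using N(5) by (simp add: img_comp o_assoc)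
    show v: "\<forall>x\<in>univ U. (\<rho> \<circ> ?r) (p2 x) = p1 x"
      using N(4) unfolding over_def by (simp add: ip)
    show "over (univ F) (\<rho> \<circ> ?r)"
      unfolding over_def True[symmetric]
    proof
      fix x assume x: "x \<in> univ M"
      then have "p1 x = x" "p2 x = x" "x \<in> univ U" using p(3,4) le_univ[OF u(4)] unfolding over_def by auto
      then show "(\<rho> \<circ> ?r) x = x" using bspec[OF v, of x] by simp
    qed
  qed
qed

section \<open>Non-forking chains\<close>

definition chain :: "'o \<Rightarrow> ('o \<Rightarrow> ('a, 'f, 'r) model) \<Rightarrow> bool" where
  "chain \<kappa> T \<longleftrightarrow> small lam \<kappa> \<and> (\<forall>k\<le>\<kappa>. T k \<in> KL) \<and> inc_cont s {..\<kappa>} T"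

lemma chainD:
  assumes "chain \<kappa> T"
  shows "small lam \<kappa>" "\<And>k. k \<le> \<kappa> \<Longrightarrow> T k \<in> KL" "\<And>k l. k \<le> l \<Longrightarrow> l \<le> \<kappa> \<Longrightarrow> T k \<preceq> T l"
    "\<And>k. k \<le> \<kappa> \<Longrightarrow> olimit k \<Longrightarrow> T k = union_model (T ` {..<k})"
  using assms unfolding chain_def inc_cont_def by auto

lemma chainI:
  assumes "small lam \<kappa>" "\<And>k. k \<le> \<kappa> \<Longrightarrow> T k \<in> KL" "\<And>k l. k < l \<Longrightarrow> l \<le> \<kappa> \<Longrightarrow> T k \<preceq> T l"
    "\<And>k. k \<le> \<kappa> \<Longrightarrow> olimit k \<Longrightarrow> T k = union_model (T ` {..<k})"
  shows "chain \<kappa> T"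
  using assms KL_refl unfolding chain_def inc_cont_def by (auto simp: le_less)

lemma chain_mono: "chain \<kappa> T \<Longrightarrow> \<kappa>' \<le> \<kappa> \<Longrightarrow> chain \<kappa>' T"
  using chainD[of \<kappa> T] small_mono[of lam \<kappa> \<kappa>'] by (intro chainI) auto

lemma succ_less:
  assumes "small lam \<kappa>" "k < \<kappa>"
  shows "k < osuc k" "osuc k \<le> \<kappa>"
  using assms osuc_greater osuc_le by auto

text \<open>Collects what the recursions need at a limit stage; the hypotheses have the form in
  which \<open>chain_recursion\<close> hands over the earlier states.\<close>

lemma chain_limit:
  fixes T :: "'o \<Rightarrow> ('a, 'f, 'r) model"
  assumes d: "olimit \<delta>" "small lam \<delta>" and KL: "\<And>\<beta>. \<beta> < \<delta> \<Longrightarrow> T \<beta> \<in> KL"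
    and le: "\<And>\<beta> \<gamma>. \<beta> < \<gamma> \<Longrightarrow> \<gamma> < \<delta> \<Longrightarrow> T \<beta> \<preceq> T \<gamma>"
    and lim: "\<And>\<beta>. \<beta> < \<delta> \<Longrightarrow> olimit \<beta> \<Longrightarrow> T \<beta> = union_model (T ` {..<\<beta>})"
  defines "U \<equiv> union_model (T ` {..<\<delta>})"
  shows "U \<in> KL" "\<And>\<beta>. \<beta> < \<delta> \<Longrightarrow> T \<beta> \<preceq> U" "\<And>N. (\<And>\<beta>. \<beta> < \<delta> \<Longrightarrow> T \<beta> \<preceq> N) \<Longrightarrow> U \<preceq> N"
    "chain \<delta> (T(\<delta> := U))"
proof -
  have ic: "inc_cont s {..<\<delta>} T"
    unfolding inc_cont_def using le lim KL KL_refl by (auto simp: le_less)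
  have z: "ozero < \<delta>" using olimit_pos d(1) by blast
  show U: "U \<in> KL" unfolding U_def by (rule chain_union_KL[OF ic z d(2) KL])
  show leU: "T \<beta> \<preceq> U" if "\<beta> < \<delta>" for \<beta> unfolding U_def using chain_union(2)[OF ic z that] .
  show "U \<preceq> N" if "\<And>\<beta>. \<beta> < \<delta> \<Longrightarrow> T \<beta> \<preceq> N" for N
    unfolding U_def using chain_union(3)[OF ic z that] .
  have im: "(T(\<delta> := U)) ` {..<k} = T ` {..<k}" if "k \<le> \<delta>" for k
    using that by (intro image_cong) auto
  show "chain \<delta> (T(\<delta> := U))"
  proof (rule chainI)
    show "(T(\<delta> := U)) k = union_model ((T(\<delta> := U)) ` {..<k})" if "k \<le> \<delta>" "olimit k" for k
      unfolding im[OF that(1)] using lim[of k] that by (auto simp: U_def)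
  qed (use d KL U leU le in auto)
qed

lemma chain_le_union:
  assumes "chain \<kappa> T" "olimit \<alpha>" "\<alpha> \<le> \<kappa>" "\<And>\<beta>. \<beta> < \<alpha> \<Longrightarrow> T \<beta> \<preceq> N"
  shows "T \<alpha> \<preceq> N"
proof -
  note c = chainD[OF assms(1)]
  have "union_model (T ` {..<\<alpha>}) \<preceq> N"
    by (rule chain_limit(3)[OF assms(2) small_mono[OF c(1) assms(3)]])
      (use c assms in auto)
  then show ?thesis using c(4)[OF assms(3,2)] by simp
qed

lemma univ_chain_limit:
  assumes "chain \<kappa> T" "olimit \<alpha>" "\<alpha> \<le> \<kappa>"
  shows "univ (T \<alpha>) = (\<Union>\<beta><\<alpha>. univ (T \<beta>))"
  using chainD(4)[OF assms(1,3,2)] by simp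

lemma chain_img:
  assumes "chain \<kappa> T" "bij \<pi>"
  shows "chain \<kappa> (\<lambda>k. img \<pi> (T k))"
proof (rule chainI)
  note c = chainD[OF assms(1)]
  show "small lam \<kappa>" by (rule c)
  show "img \<pi> (T k) \<in> KL" if "k \<le> \<kappa>" for k using img_KL[OF c(2)[OF that] assms(2)] .
  show "img \<pi> (T k) \<preceq> img \<pi> (T l)" if "k < l" "l \<le> \<kappa>" for k l
    using img_le'[OF c(3)[OF less_imp_le[OF that(1)] that(2)] assms(2)] .
  show "img \<pi> (T k) = union_model ((\<lambda>k. img \<pi> (T k)) ` {..<k})" if "k \<le> \<kappa>" "olimit k" for k
    by (subst c(4)[OF that]) (simp add: img_union_model image_image)
qed

lemma chain_cont:
  assumes c: "chain \<kappa> T" "olimit \<alpha>" "\<alpha> \<le> \<kappa>" and N: "N \<in> KL" "T \<alpha> \<preceq> N"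
    and nf: "\<And>\<beta>. \<beta> < \<alpha> \<Longrightarrow> nf s A (T \<beta>) a N"
  shows "nf s A (T \<alpha>) a N"
proof (rule nf_continuous[of \<alpha> T])
  show "inc_cont s {..\<alpha>} T" using chain_mono[OF c(1,3)] unfolding chain_def by blast
  show "T \<beta> \<in> KL" if "\<beta> \<le> \<alpha>" for \<beta> using chainD(2)[OF c(1)] c(3) that by auto
qed (use c N nf in auto)

text \<open>The permutations cohere only on the models built so far, so together they give merely an
  injection on the union, which is then extended to a permutation afresh.\<close>

lemma glue_perms:
  fixes f :: "'o \<Rightarrow> 'a \<Rightarrow> 'a"
  assumes c: "chain \<kappa> R" "olimit \<alpha>" "\<alpha> \<le> \<kappa>" and b: "\<And>\<beta>. \<beta> < \<alpha> \<Longrightarrow> bij (f \<beta>)"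
    and e: "\<And>\<beta> \<gamma> y. \<beta> < \<gamma> \<Longrightarrow> \<gamma> < \<alpha> \<Longrightarrow> y \<in> univ (R \<beta>) \<Longrightarrow> f \<gamma> y = f \<beta> y"
  obtains \<pi> where "bij \<pi>" "\<forall>\<beta><\<alpha>. \<forall>y\<in>univ (R \<beta>). \<pi> y = f \<beta> y"
proof -
  define h where "h y = f (LEAST \<beta>. y \<in> univ (R \<beta>)) y" for y
  have h: "h y = f \<beta> y" if "\<beta> < \<alpha>" "y \<in> univ (R \<beta>)" for \<beta> y
  proof -
    let ?l = "LEAST \<beta>. y \<in> univ (R \<beta>)"
    have "?l \<le> \<beta>" "y \<in> univ (R ?l)" using that(2) by (rule Least_le, rule LeastI)
    then show ?thesis unfolding h_def using e[of ?l \<beta> y] that(1) by (cases "?l = \<beta>") auto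
  qed
  have "inj_on h (univ (R \<alpha>))"
  proof (rule inj_onI)
    fix x y assume xy: "x \<in> univ (R \<alpha>)" "y \<in> univ (R \<alpha>)" "h x = h y"
    obtain \<beta> \<gamma> where bg: "\<beta> < \<alpha>" "x \<in> univ (R \<beta>)" "\<gamma> < \<alpha>" "y \<in> univ (R \<gamma>)"
      using xy(1,2) unfolding univ_chain_limit[OF c] by blast
    let ?m = "max \<beta> \<gamma>"
    have m: "?m < \<alpha>" using bg by simp
    have "univ (R \<beta>) \<subseteq> univ (R ?m)" "univ (R \<gamma>) \<subseteq> univ (R ?m)"
      by (intro le_univ chainD(3)[OF c(1)]; use bg c(3) in auto)+
    then have "x \<in> univ (R ?m)" "y \<in> univ (R ?m)" using bg by auto
    then have "f ?m x = f ?m y" using h[OF m] xy(3) by simp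
    then show "x = y" using bij_is_inj[OF b[OF m]] by (rule injD[rotated])
  qed
  from extend_to_bij[OF lam lam_a KL_ordLeq[OF chainD(2)[OF c(1,3)]] this]
  obtain \<pi> where pi: "bij \<pi>" "\<forall>x\<in>univ (R \<alpha>). \<pi> x = h x" by blast
  have "\<pi> y = f \<beta> y" if "\<beta> < \<alpha>" "y \<in> univ (R \<beta>)" for \<beta> y
    using pi(2) h[OF that] univ_chain_limit[OF c] that by auto
  then show ?thesis using that pi(1) by blast
qed

lemma img_agree: "M \<in> KL \<Longrightarrow> \<forall>y\<in>univ M. f y = g y \<Longrightarrow> img f M = img g M"
  using img_eq KL_K by blast

text \<open>
  \<open>nfchain \<kappa> T I c\<close>: for the marked steps \<open>k \<in> I\<close>, the element \<open>c k\<close> of \<open>T (k + 1)\<close> realizes a basic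
  type over \<open>T k\<close>; \<open>free \<kappa> T I c E\<close>: these types extend to \<open>E k\<close> without forking.
\<close>

definition nfchain where
  "nfchain \<kappa> T I c \<longleftrightarrow> chain \<kappa> T \<and> (\<forall>k<\<kappa>. k \<in> I \<longrightarrow> nf s (T k) (T k) (c k) (T (osuc k)))"

definition free where
  "free \<kappa> T I c E \<longleftrightarrow> chain \<kappa> E \<and> (\<forall>k\<le>\<kappa>. T k \<preceq> E k) \<and>
     (\<forall>k<\<kappa>. k \<in> I \<longrightarrow> nf s (T k) (E k) (c k) (E (osuc k)))"

lemma freeD:
  assumes "free \<kappa> T I c E"
  shows "chain \<kappa> E" "\<And>k. k \<le> \<kappa> \<Longrightarrow> T k \<preceq> E k"
    "\<And>k. k < \<kappa> \<Longrightarrow> k \<in> I \<Longrightarrow> nf s (T k) (E k) (c k) (E (osuc k))"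
  using assms unfolding free_def by auto

lemma nfchainD:
  assumes "nfchain \<kappa> T I c"
  shows "chain \<kappa> T" "\<And>k. k < \<kappa> \<Longrightarrow> k \<in> I \<Longrightarrow> nf s (T k) (T k) (c k) (T (osuc k))"
  using assms unfolding nfchain_def by auto

lemma free_refl: "nfchain \<kappa> T I c \<Longrightarrow> free \<kappa> T I c T"
  unfolding nfchain_def free_def using chainD[of \<kappa> T] by (auto intro: KL_refl)

lemma free_nfchain: "free \<kappa> T I c E \<Longrightarrow> nfchain \<kappa> E I c"
  unfolding nfchain_def free_def using nf_selfD by blast

lemma free_trans:
  assumes "free \<kappa> T I c E" "free \<kappa> E I c E'"
  shows "free \<kappa> T I c E'"
  unfolding free_def
proof (intro conjI allI impI)
  note a = freeD[OF assms(1)] and b = freeD[OF assms(2)]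
  show "chain \<kappa> E'" by (rule b)
  show "T k \<preceq> E' k" if "k \<le> \<kappa>" for k using le_trans[OF a(2)[OF that] b(2)[OF that]] .
  fix k assume k: "k < \<kappa>" "k \<in> I"
  have sk: "osuc k \<le> \<kappa>" using osuc_le[OF k(1)] .
  have "nf s (T k) (E k) (c k) (E' (osuc k))"
    using nf_up[OF a(3)[OF k] b(2)[OF sk] chainD(2)[OF b(1) sk]] .
  then show "nf s (T k) (E' k) (c k) (E' (osuc k))" using nf_trans b(3)[OF k] by blast
qed

section \<open>Copies of free chains and changes of the first member\<close>

lemma free_img:
  assumes "free \<kappa> T I c E" "bij \<pi>"
  shows "free \<kappa> (\<lambda>k. img \<pi> (T k)) I (\<lambda>k. \<pi> (c k)) (\<lambda>k. img \<pi> (E k))"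
  unfolding free_def using freeD[OF assms(1)] chain_img[OF _ assms(2)] img_le'[OF _ assms(2)]
    nf_img[OF _ assms(2)] by blast

lemma nfchain_img:
  assumes "nfchain \<kappa> T I c" "bij \<pi>"
  shows "nfchain \<kappa> (\<lambda>k. img \<pi> (T k)) I (\<lambda>k. \<pi> (c k))"
  using free_nfchain[OF free_img[OF free_refl[OF assms(1)] assms(2)]] .

text \<open>Unions at limit stages do not notice a smaller first member, since stage zero is
  absorbed by its successor.\<close>

lemma chain_replace_zero:
  assumes T: "chain \<kappa> T" and C: "C \<in> KL" "C \<preceq> T ozero"
  shows "chain \<kappa> (T(ozero := C))"
proof (rule chainI)
  note c = chainD[OF T]
  have CT: "C \<preceq> T l" if "l \<le> \<kappa>" for l
    using le_trans[OF C(2) c(3)[OF ozero_le that]] .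
  show "small lam \<kappa>" by (rule c)
  show "(T(ozero := C)) k \<in> KL" if "k \<le> \<kappa>" for k using c(2)[OF that] C by auto
  show "(T(ozero := C)) k \<preceq> (T(ozero := C)) l" if "k < l" "l \<le> \<kappa>" for k l
    using c(3)[of k l] CT that by auto
  fix k assume k: "k \<le> \<kappa>" "olimit k"
  have "union_model (T ` {..<k}) = union_model ((T(ozero := C)) ` {..<k})"
  proof (rule union_model_cofinal)
    fix M assume "M \<in> T ` {..<k}"
    then obtain i where i: "i < k" "M = T i" by blast
    then have "osuc i < k" "i < osuc i" using olimit_osuc[OF k(2)] osuc_greater by blast+
    then have "M \<preceq> (T(ozero := C)) (osuc i)" using i c(3)[of i "osuc i"] k(1) by auto
    then show "\<exists>N\<in>(T(ozero := C)) ` {..<k}. M \<preceq> N" using \<open>osuc i < k\<close> by blast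
  next
    fix M assume "M \<in> (T(ozero := C)) ` {..<k}"
    then obtain i where i: "i < k" "M = (T(ozero := C)) i" by blast
    then have "M \<preceq> T i" using CT[of i] c(3)[of i i] k(1) by auto
    then show "\<exists>N\<in>T ` {..<k}. M \<preceq> N" using i by blast
  qed
  then show "(T(ozero := C)) k = union_model ((T(ozero := C)) ` {..<k})"
    using c(4)[OF k] k(2) by auto
qed

lemma free_replace_zero:
  assumes E: "free \<kappa> T I c E" and C: "C \<in> KL" "C \<preceq> E ozero" "T ozero \<preceq> C"
  shows "free \<kappa> T I c (E(ozero := C))"
  unfolding free_def
proof (intro conjI allI impI)
  note e = freeD[OF E]
  show "chain \<kappa> (E(ozero := C))" by (rule chain_replace_zero[OF e(1) C(1,2)])
  show "T k \<preceq> (E(ozero := C)) k" if "k \<le> \<kappa>" for k using e(2)[OF that] C by auto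
  fix k assume k: "k < \<kappa>" "k \<in> I"
  have "osuc k \<noteq> ozero" using osuc_greater[OF k(1)] by auto
  then show "nf s (T k) ((E(ozero := C)) k) (c k) ((E(ozero := C)) (osuc k))"
    using e(3)[OF k] nf_top[of "T k" "E k" "c k" "E (osuc k)" C] C by auto
qed

text \<open>At a marked step, the symmetric amalgam of the current model with the next member of the
  chain is free in both directions at once, so freeness of \<open>x\<close> and freeness of the
  marked elements are propagated together. During the recursion \<open>X\<close> stays and the
  members \<open>R k\<close> are moved; inverting the final permutation reverses these
  roles.\<close>

lemma free_extension:
  assumes R: "nfchain \<kappa> R I c" and x: "nf s (R ozero) (R ozero) x X"
  obtains R' g where "free \<kappa> R I c R'" "bij g" "over (univ (R ozero)) g" "img g X = R' ozero"
    "\<forall>k\<le>\<kappa>. nf s (R ozero) (R k) (g x) (R' k)"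
proof -
  note r = chainD[OF nfchainD(1)[OF R]] and rn = nfchainD(2)[OF R]
  note cR = nfchainD(1)[OF R]
  define Inv where "Inv k S \<longleftrightarrow> fst S \<in> KL \<and> bij (snd S) \<and> nf s (R ozero) (img (snd S) (R k)) x (fst S)"
    for k and S :: "('a, 'f, 'r) model \<times> ('a \<Rightarrow> 'a)"
  define rel where "rel k l S S' \<longleftrightarrow> fst S \<preceq> fst S' \<and> (\<forall>y\<in>univ (R k). snd S' y = snd S y) \<and>
      (l = osuc k \<longrightarrow> k \<in> I \<longrightarrow> nf s (img (snd S) (R k)) (fst S) (snd S' (c k)) (fst S'))"
    for k l and S S' :: "('a, 'f, 'r) model \<times> ('a \<Rightarrow> 'a)"
  define LimR where "LimR \<alpha> F S \<longleftrightarrow> fst S = union_model ((\<lambda>\<beta>. fst (F \<beta>)) ` {..<\<alpha>})"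
    for \<alpha> :: 'o and F :: "'o \<Rightarrow> ('a, 'f, 'r) model \<times> ('a \<Rightarrow> 'a)"
      and S :: "('a, 'f, 'r) model \<times> ('a \<Rightarrow> 'a)"
  obtain F where F: "F ozero = (X, id)" "\<And>k. k \<in> {..\<kappa>} \<Longrightarrow> Inv k (F k)"
    "\<And>k l. k < l \<Longrightarrow> l \<in> {..\<kappa>} \<Longrightarrow> rel k l (F k) (F l)"
    "\<And>k. k \<in> {..\<kappa>} \<Longrightarrow> olimit k \<Longrightarrow> LimR k F (F k)"
  proof (rule chain_recursion[of "{..\<kappa>}" rel LimR Inv "(X, id)"])
    show "l \<in> {..\<kappa>}" if "k \<in> {..\<kappa>}" "l < k" for k l using that by auto
    show "rel k m S S''" if "k < l" "l < m" "m \<in> {..\<kappa>}" "rel k l S S'" "rel l m S' S''" for k l m S S' S''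
    proof -
      have "univ (R k) \<subseteq> univ (R l)" using le_univ[OF r(3)[of k l]] that by auto
      moreover have "m \<noteq> osuc k" using osuc_le[OF that(1)] that(2) by auto
      moreover have "fst S \<preceq> fst S''" using that(4,5) le_trans unfolding rel_def by blast
      ultimately show ?thesis using that(4,5) unfolding rel_def by auto
    qed
    show "LimR \<alpha> g S" if "\<And>\<beta>. \<beta> < \<alpha> \<Longrightarrow> f \<beta> = g \<beta>" "LimR \<alpha> f S" for \<alpha> f g S
    proof -
      have "(\<lambda>\<beta>. fst (f \<beta>)) ` {..<\<alpha>} = (\<lambda>\<beta>. fst (g \<beta>)) ` {..<\<alpha>}" by (rule image_cong) (auto simp: that(1))
      then show ?thesis using that(2) unfolding LimR_def by simp
    qed
    show "Inv ozero (X, id)" unfolding Inv_def using x nfD(3)[OF x] by (simp add: img_id)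
    show "\<exists>S'. Inv (osuc k) S' \<and> rel k (osuc k) S S'"
      if k: "k < osuc k" "osuc k \<in> {..\<kappa>}" "Inv k S" for k S
    proof -
      obtain W f where S: "S = (W, f)" by (cases S)
      have W: "W \<in> KL" "bij f" "nf s (R ozero) (img f (R k)) x W" using k(3) unfolding Inv_def S by auto
      have kk: "k < \<kappa>" "k \<le> \<kappa>" "osuc k \<le> \<kappa>" using k by auto
      let ?R = "img f (R k)" and ?R' = "img f (R (osuc k))"
      have RR': "?R \<preceq> ?R'" using img_le'[OF r(3)[OF less_imp_le[OF k(1)] kk(3)] W(2)] .
      have R'K: "?R' \<in> KL" using img_KL[OF r(2)[OF kk(3)] W(2)] .
      obtain Z \<pi> where Z: "Z \<in> KL" "W \<preceq> Z" "bij \<pi>" "over (univ ?R) \<pi>" "nf s ?R (img \<pi> ?R') x Z"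
        "k \<in> I \<longrightarrow> nf s ?R W (\<pi> (f (c k))) Z"
      \<comment> \<open>At an unmarked step only \<open>x\<close> has to be kept free from the next
        member, so plain extension replaces the symmetric amalgam.\<close>
      proof (cases "k \<in> I")
        case True
        obtain Z \<pi> where "Z \<in> KL" "W \<preceq> Z" "bij \<pi>" "over (univ ?R) \<pi>" "img \<pi> ?R' \<preceq> Z"
            "nf s ?R W (\<pi> (f (c k))) Z" "nf s ?R (img \<pi> ?R') x Z"
          by (rule symmetric_amalgam[OF nf_selfD[OF W(3)] nf_img[OF rn[OF kk(1) True] W(2)]])
        then show ?thesis using that by blast
      next
        case False
        obtain Z \<pi> where "Z \<in> KL" "W \<preceq> Z" "bij \<pi>" "over (univ ?R) \<pi>" "img \<pi> ?R' \<preceq> Z"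
            "nf s ?R (img \<pi> ?R') x Z"
          by (rule nf_extend[OF nf_selfD[OF W(3)] R'K RR'])
        then show ?thesis using that False by blast
      qed
      have "nf s (R ozero) (img \<pi> ?R') x Z" using nf_trans[OF nf_up[OF W(3) Z(2,1)] Z(5)] .
      then have "Inv (osuc k) (Z, \<pi> \<circ> f)"
        unfolding Inv_def using Z(1) bij_comp[OF W(2) Z(3)] by (simp add: img_comp)
      moreover have "rel k (osuc k) S (Z, \<pi> \<circ> f)"
        using Z(2,4,6) unfolding rel_def S over_def by auto
      ultimately show ?thesis by blast
    qed
    show "\<exists>S. Inv \<alpha> S \<and> (\<forall>\<beta><\<alpha>. rel \<beta> \<alpha> (F \<beta>) S) \<and> LimR \<alpha> F S"
      if a: "olimit \<alpha>" "\<alpha> \<in> {..\<kappa>}" and inv: "\<And>\<beta>. \<beta> < \<alpha> \<Longrightarrow> Inv \<beta> (F \<beta>)"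
        and rl: "\<And>\<beta> \<gamma>. \<beta> < \<gamma> \<Longrightarrow> \<gamma> < \<alpha> \<Longrightarrow> rel \<beta> \<gamma> (F \<beta>) (F \<gamma>)"
        and lm: "\<And>\<beta>. \<beta> < \<alpha> \<Longrightarrow> olimit \<beta> \<Longrightarrow> LimR \<beta> F (F \<beta>)" for \<alpha> F
    proof -
      have ak: "\<alpha> \<le> \<kappa>" using a by simp
      let ?W = "\<lambda>\<beta>. fst (F \<beta>)"
      let ?U = "union_model (?W ` {..<\<alpha>})"
      note U = chain_limit[of \<alpha> ?W, OF a(1) small_mono[OF r(1) ak]]
      have UK: "?U \<in> KL" and WU: "\<And>\<beta>. \<beta> < \<alpha> \<Longrightarrow> ?W \<beta> \<preceq> ?U"
        by (rule U; use inv rl lm in \<open>auto simp: Inv_def rel_def LimR_def\<close>)+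
      obtain \<pi> where pi: "bij \<pi>" "\<forall>\<beta><\<alpha>. \<forall>y\<in>univ (R \<beta>). \<pi> y = snd (F \<beta>) y"
        by (rule glue_perms[OF cR a(1) ak, of "\<lambda>\<beta>. snd (F \<beta>)"]) (use inv rl in \<open>auto simp: Inv_def rel_def\<close>)
      have im: "img \<pi> (R \<beta>) = img (snd (F \<beta>)) (R \<beta>)" if "\<beta> < \<alpha>" for \<beta>
        using img_agree[OF r(2)] pi(2) that ak by auto
      have n: "nf s (R ozero) (img \<pi> (R \<beta>)) x ?U" if "\<beta> < \<alpha>" for \<beta>
        using nf_up[OF _ WU[OF that] UK] inv[OF that] im[OF that] unfolding Inv_def by auto
      have "img \<pi> (R \<alpha>) \<preceq> ?U"
        by (rule chain_le_union[OF chain_img[OF cR pi(1)] a(1) ak]) (use nfD(5)[OF n] in blast)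
      then have "nf s (R ozero) (img \<pi> (R \<alpha>)) x ?U"
        using chain_cont[OF chain_img[OF cR pi(1)] a(1) ak UK] n by blast
      then have "Inv \<alpha> (?U, \<pi>)" unfolding Inv_def using UK pi(1) by simp
      moreover have "rel \<beta> \<alpha> (F \<beta>) (?U, \<pi>)" if "\<beta> < \<alpha>" for \<beta>
        unfolding rel_def using WU[OF that] pi(2) that not_olimit_osuc[of \<beta>] a(1) osuc_greater[OF that] by auto
      ultimately show ?thesis unfolding LimR_def by auto
    qed
  qed (rule that)
  define W where "W k = fst (F k)" for k
  define f where "f = snd (F \<kappa>)"
  have inv: "W k \<in> KL" "bij (snd (F k))" "nf s (R ozero) (img (snd (F k)) (R k)) x (W k)" if "k \<le> \<kappa>" for k
    using F(2)[of k] that unfolding Inv_def W_def by auto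
  have rl: "rel k l (F k) (F l)" if "k < l" "l \<le> \<kappa>" for k l using F(3) that by simp
  \<comment> \<open>The permutations cohere, so the final one serves for every stage.\<close>
  have fk: "snd (F k) y = f y" if "k \<le> \<kappa>" "y \<in> univ (R k)" for k y
    using rl[of k \<kappa>] that unfolding rel_def f_def by (cases "k = \<kappa>") auto
  have imf: "img (snd (F k)) (R k) = img f (R k)" if "k \<le> \<kappa>" for k
    using img_agree[OF r(2)[OF that]] fk[OF that] by blast
  have cW: "chain \<kappa> W"
  proof (rule chainI)
    show "W k = union_model (W ` {..<k})" if "k \<le> \<kappa>" "olimit k" for k
      using F(4)[of k] that unfolding LimR_def W_def by simp
  qed (use r(1) inv rl in \<open>auto simp: rel_def W_def\<close>)
  have bf: "bij f" using inv(2)[of \<kappa>] unfolding f_def by simp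
  have ov: "over (univ (R ozero)) f" using fk[OF ozero_le, symmetric] F(1) unfolding over_def by simp
  have bi: "bij (inv f)" using bf by (rule bij_imp_bij_inv)
  have n1: "nf s (R ozero) (img f (R k)) x (W k)" if "k \<le> \<kappa>" for k using inv(3)[OF that] imf[OF that] by simp
  have fr: "free \<kappa> (\<lambda>k. img f (R k)) I (\<lambda>k. f (c k)) W"
    unfolding free_def
  proof (intro conjI allI impI)
    show "img f (R k) \<preceq> W k" if "k \<le> \<kappa>" for k using nfD(5)[OF n1[OF that]] .
    fix k assume k: "k < \<kappa>" "k \<in> I"
    have sk: "k < osuc k" "osuc k \<le> \<kappa>" using succ_less[OF r(1) k(1)] by auto
    have "nf s (img (snd (F k)) (R k)) (W k) (snd (F (osuc k)) (c k)) (W (osuc k))"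
      using rl[OF sk] k(2) unfolding rel_def W_def by blast
    then show "nf s (img f (R k)) (W k) (f (c k)) (W (osuc k))"
      using imf[of k] fk[OF sk(2) nfD(6)[OF rn[OF k]]] k(1) by simp
  qed (rule cW)
  show ?thesis
  proof (rule that)
    show "free \<kappa> R I c (\<lambda>k. img (inv f) (W k))"
      using free_img[OF fr bi] unfolding img_inv[OF bf] inv_f_f[OF bij_is_inj[OF bf]] .
    show "bij (inv f)" by (rule bi)
    show "over (univ (R ozero)) (inv f)" using over_inv[OF bf ov] .
    show "img (inv f) X = img (inv f) (W ozero)" using F(1) unfolding W_def by simp
    have R0: "img (inv f) (R ozero) = R ozero"
      using img_over[OF KL_K[OF r(2)[OF ozero_le]] over_inv[OF bf ov]] .
    show "\<forall>k\<le>\<kappa>. nf s (R ozero) (R k) (inv f x) (img (inv f) (W k))"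
      using nf_img[OF n1 bi] unfolding img_inv[OF bf] R0 by blast
  qed
qed

section \<open>Grids of free extensions\<close>

lemma union_model_swap:
  "union_model ((\<lambda>i. union_model ((\<lambda>l. F i l) ` B)) ` A) = union_model ((\<lambda>l. union_model ((\<lambda>i. F i l) ` A)) ` B)"
  by (auto simp: union_model_def)

lemma img_le_limit:
  assumes c: "chain \<kappa> R" "olimit \<alpha>" "\<alpha> \<le> \<kappa>" and pi: "bij \<pi>" "\<forall>\<beta><\<alpha>. \<forall>y\<in>univ (R \<beta>). \<pi> y = f \<beta> y"
    and le: "\<And>\<beta>. \<beta> < \<alpha> \<Longrightarrow> img (f \<beta>) (R \<beta>) \<preceq> N"
  shows "img \<pi> (R \<alpha>) \<preceq> N"
proof (rule chain_le_union[OF chain_img[OF c(1) pi(1)] c(2,3)])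
  fix \<beta> assume b: "\<beta> < \<alpha>"
  have "R \<beta> \<in> KL" using chainD(2)[OF c(1), of \<beta>] b c(3) by auto
  then have "img \<pi> (R \<beta>) = img (f \<beta>) (R \<beta>)" using img_agree pi(2) b by blast
  then show "img \<pi> (R \<beta>) \<preceq> N" using le[OF b] by simp
qed

text \<open>Unions are taken at each index separately: exchanging two unions gives continuity along
  the row, and the marked elements stay free by continuity of non-forking.\<close>

lemma free_limit:
  fixes F :: "'o \<Rightarrow> 'o \<Rightarrow> ('a, 'f, 'r) model"
  assumes a: "olimit \<alpha>" "small lam \<alpha>" and fr: "\<And>\<beta>. \<beta> < \<alpha> \<Longrightarrow> free \<kappa> T I c (F \<beta>)"
    and mono: "\<And>\<beta> \<gamma> k. \<beta> < \<gamma> \<Longrightarrow> \<gamma> < \<alpha> \<Longrightarrow> k \<le> \<kappa> \<Longrightarrow> F \<beta> k \<preceq> F \<gamma> k"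
    and cont: "\<And>\<beta> k. \<beta> < \<alpha> \<Longrightarrow> olimit \<beta> \<Longrightarrow> k \<le> \<kappa> \<Longrightarrow> F \<beta> k = union_model ((\<lambda>\<gamma>. F \<gamma> k) ` {..<\<beta>})"
  defines "H \<equiv> \<lambda>k. union_model ((\<lambda>\<beta>. F \<beta> k) ` {..<\<alpha>})"
  shows "free \<kappa> T I c H" "\<And>k \<beta>. k \<le> \<kappa> \<Longrightarrow> \<beta> < \<alpha> \<Longrightarrow> F \<beta> k \<preceq> H k"
proof -
  have z: "ozero < \<alpha>" using olimit_pos a(1) by blast
  have lim: "H k \<in> KL" "\<And>\<beta>. \<beta> < \<alpha> \<Longrightarrow> F \<beta> k \<preceq> H k" "\<And>N. (\<And>\<beta>. \<beta> < \<alpha> \<Longrightarrow> F \<beta> k \<preceq> N) \<Longrightarrow> H k \<preceq> N"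
      "chain \<alpha> ((\<lambda>\<beta>. F \<beta> k)(\<alpha> := H k))" if k: "k \<le> \<kappa>" for k
    unfolding H_def
    by (rule chain_limit[of \<alpha> "\<lambda>\<beta>. F \<beta> k", OF a];
        use chainD(2)[OF freeD(1)[OF fr] k] mono cont k in blast)+
  then show "\<And>k \<beta>. k \<le> \<kappa> \<Longrightarrow> \<beta> < \<alpha> \<Longrightarrow> F \<beta> k \<preceq> H k" by blast
  have cH: "chain \<kappa> H"
  proof (rule chainI)
    show "small lam \<kappa>" using chainD(1)[OF freeD(1)[OF fr[OF z]]] .
    show "H k \<in> KL" if "k \<le> \<kappa>" for k using lim(1)[OF that] .
    show "H k \<preceq> H l" if kl: "k < l" "l \<le> \<kappa>" for k l
    proof (rule lim(3))
      show "k \<le> \<kappa>" using kl by simp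
      fix \<beta> assume b: "\<beta> < \<alpha>"
      show "F \<beta> k \<preceq> H l"
        using le_trans[OF chainD(3)[OF freeD(1)[OF fr[OF b]] less_imp_le[OF kl(1)] kl(2)] lim(2)[OF kl(2) b]] .
    qed
    fix k assume k: "k \<le> \<kappa>" "olimit k"
    have "H k = union_model ((\<lambda>\<beta>. union_model ((\<lambda>l. F \<beta> l) ` {..<k})) ` {..<\<alpha>})"
      unfolding H_def by (intro arg_cong[of _ _ union_model] image_cong)
        (use chainD(4)[OF freeD(1)[OF fr] k] in auto)
    then show "H k = union_model (H ` {..<k})" unfolding H_def union_model_swap[of _ "{..<k}"] .
  qed
  show "free \<kappa> T I c H"
    unfolding free_def
  proof (intro conjI allI impI)
    show "T k \<preceq> H k" if "k \<le> \<kappa>" for k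
      using le_trans[OF freeD(2)[OF fr[OF z] that] lim(2)[OF that z]] .
    fix k assume k: "k < \<kappa>" "k \<in> I"
    have sk: "osuc k \<le> \<kappa>" "k \<le> \<kappa>" using osuc_le[OF k(1)] k(1) by auto
    let ?C = "(\<lambda>\<beta>. F \<beta> k)(\<alpha> := H k)"
    have "nf s (T k) (?C \<alpha>) (c k) (H (osuc k))"
    proof (rule chain_cont[OF lim(4)[OF sk(2)] a(1) order.refl lim(1)[OF sk(1)]])
      show "?C \<alpha> \<preceq> H (osuc k)" using chainD(3)[OF cH _ sk(1), of k] osuc_greater[OF k(1)] by simp
      show "nf s (T k) (?C \<beta>) (c k) (H (osuc k))" if "\<beta> < \<alpha>" for \<beta>
        using nf_up[OF freeD(3)[OF fr[OF that] k] lim(2)[OF sk(1) that] lim(1)[OF sk(1)]]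
          less_imp_neq[OF that] by simp
    qed
    then show "nf s (T k) (H k) (c k) (H (osuc k))" by simp
  qed (rule cH)
qed

text \<open>The grid grows by one row at a time: a step of \<open>X\<close> is realized freely over
  the first member of the last row and then carried along the row by \<open>free_extension\<close>.
  The rows already built are never moved, so a single permutation, placing \<open>X\<close>, is all
  that has to be tracked.\<close>

lemma free_grid:
  assumes X: "nfchain \<iota> X UNIV x" and T: "nfchain \<kappa> T I c" and XT: "X ozero = T ozero"
  obtains H f where "H ozero = T" "\<And>j. j \<le> \<iota> \<Longrightarrow> free \<kappa> T I c (H j)" "\<And>k. k \<le> \<kappa> \<Longrightarrow> chain \<iota> (\<lambda>j. H j k)"
    "bij f" "over (univ (X ozero)) f" "\<And>j. j \<le> \<iota> \<Longrightarrow> img f (X j) \<preceq> H j ozero"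
    "\<And>j k. j < \<iota> \<Longrightarrow> k \<le> \<kappa> \<Longrightarrow> nf s (img f (X j)) (H j k) (f (x j)) (H (osuc j) k)"
proof -
  note cX = nfchainD(1)[OF X] and cT = nfchainD(1)[OF T]
  note r = chainD[OF cX] and rn = nfchainD(2)[OF X, OF _ UNIV_I] and t = chainD[OF cT] and tn = nfchainD(2)[OF T]
  define Inv where "Inv j S \<longleftrightarrow> free \<kappa> T I c (fst S) \<and> bij (snd S) \<and> img (snd S) (X j) \<preceq> fst S ozero"
    for j and S :: "('o \<Rightarrow> ('a, 'f, 'r) model) \<times> ('a \<Rightarrow> 'a)"
  define rel where "rel i j S S' \<longleftrightarrow> (\<forall>k\<le>\<kappa>. fst S k \<preceq> fst S' k) \<and> (\<forall>y\<in>univ (X i). snd S' y = snd S y) \<and>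
      (j = osuc i \<longrightarrow> (\<forall>k\<le>\<kappa>. nf s (img (snd S) (X i)) (fst S k) (snd S' (x i)) (fst S' k)))"
    for i j and S S' :: "('o \<Rightarrow> ('a, 'f, 'r) model) \<times> ('a \<Rightarrow> 'a)"
  define LimR where "LimR \<alpha> F S \<longleftrightarrow> (\<forall>k\<le>\<kappa>. fst S k = union_model ((\<lambda>\<beta>. fst (F \<beta>) k) ` {..<\<alpha>}))"
    for \<alpha> :: 'o and F :: "'o \<Rightarrow> ('o \<Rightarrow> ('a, 'f, 'r) model) \<times> ('a \<Rightarrow> 'a)"
      and S :: "('o \<Rightarrow> ('a, 'f, 'r) model) \<times> ('a \<Rightarrow> 'a)"
  obtain F where F: "F ozero = (T, id)" "\<And>j. j \<in> {..\<iota>} \<Longrightarrow> Inv j (F j)"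
    "\<And>i j. i < j \<Longrightarrow> j \<in> {..\<iota>} \<Longrightarrow> rel i j (F i) (F j)"
    "\<And>j. j \<in> {..\<iota>} \<Longrightarrow> olimit j \<Longrightarrow> LimR j F (F j)"
  proof (rule chain_recursion[of "{..\<iota>}" rel LimR Inv "(T, id)"])
    show "l \<in> {..\<iota>}" if "k \<in> {..\<iota>}" "l < k" for k l using that by auto
    show "rel k m S S''" if "k < l" "l < m" "m \<in> {..\<iota>}" "rel k l S S'" "rel l m S' S''" for k l m S S' S''
    proof -
      have "univ (X k) \<subseteq> univ (X l)" using le_univ[OF r(3)[of k l]] that by auto
      moreover have "m \<noteq> osuc k" using osuc_le[OF that(1)] that(2) by auto
      moreover have "\<forall>k\<le>\<kappa>. fst S k \<preceq> fst S'' k" using that(4,5) le_trans unfolding rel_def by blast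
      ultimately show ?thesis using that(4,5) unfolding rel_def by auto
    qed
    show "LimR \<alpha> g S" if "\<And>\<beta>. \<beta> < \<alpha> \<Longrightarrow> f \<beta> = g \<beta>" "LimR \<alpha> f S" for \<alpha> f g S
    proof -
      have "(\<lambda>\<beta>. fst (f \<beta>) k) ` {..<\<alpha>} = (\<lambda>\<beta>. fst (g \<beta>) k) ` {..<\<alpha>}" for k
        by (rule image_cong) (auto simp: that(1))
      then show ?thesis using that(2) unfolding LimR_def by simp
    qed
    show "Inv ozero (T, id)"
      unfolding Inv_def using free_refl[OF T] XT KL_refl[OF t(2)[OF ozero_le]] by (simp add: img_id)
    show "\<exists>S'. Inv (osuc j) S' \<and> rel j (osuc j) S S'"
      if j: "j < osuc j" "osuc j \<in> {..\<iota>}" "Inv j S" for j S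
    proof -
      obtain H f where S: "S = (H, f)" by (cases S)
      have H: "free \<kappa> T I c H" "bij f" "img f (X j) \<preceq> H ozero" using j(3) unfolding Inv_def S by auto
      note h = freeD[OF H(1)]
      have hz: "H ozero \<in> KL" using chainD(2)[OF h(1) ozero_le] .
      have jj: "j < \<iota>" using j by auto
      obtain X' \<sigma> where X': "X' \<in> KL" "H ozero \<preceq> X'" "bij \<sigma>" "over (univ (img f (X j))) \<sigma>"
          "img \<sigma> (img f (X (osuc j))) \<preceq> X'" "nf s (img f (X j)) (H ozero) (\<sigma> (f (x j))) X'"
        by (rule nf_extend'[OF nf_img[OF rn[OF jj] H(2)] hz H(3)])
      obtain R' g where R': "free \<kappa> H I c R'" "bij g" "over (univ (H ozero)) g" "img g X' = R' ozero"
          "\<forall>k\<le>\<kappa>. nf s (H ozero) (H k) (g (\<sigma> (f (x j)))) (R' k)"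
        by (rule free_extension[OF free_nfchain[OF H(1)] nf_selfD[OF X'(6)]])
      let ?f = "g \<circ> \<sigma> \<circ> f"
      have bf: "bij ?f" using H(2) X'(3) R'(2) by (intro bij_comp)
      have R'0: "R' ozero \<in> KL" using chainD(2)[OF freeD(1)[OF R'(1)] ozero_le] .
      have eq: "?f y = f y" if "y \<in> univ (X j)" for y
      proof -
        have "f y \<in> univ (img f (X j))" using that by simp
        moreover from this have "f y \<in> univ (H ozero)" using le_univ[OF H(3)] by blast
        ultimately show ?thesis using X'(4) R'(3) unfolding over_def by (metis comp_apply)
      qed
      have ie: "img ?f (X j) = img f (X j)" using img_agree[OF r(2)] jj eq by (simp add: less_imp_le)
      have "img ?f (X (osuc j)) \<preceq> R' ozero"
        using img_le'[OF X'(5) R'(2)] unfolding R'(4) by (simp add: img_comp o_assoc)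
      moreover have "free \<kappa> T I c R'" using free_trans[OF H(1) R'(1)] .
      ultimately have "Inv (osuc j) (R', ?f)" unfolding Inv_def using bf by simp
      moreover have "rel j (osuc j) S (R', ?f)"
      proof -
        have ig: "img g (img f (X j)) = img f (X j)"
          using img_over_le[OF H(3) over_le[OF R'(3) H(3)]] .
        have b0: "nf s (img f (X j)) (H ozero) (?f (x j)) (R' ozero)"
        proof -
          have "img g (H ozero) = H ozero" using img_over[OF KL_K[OF hz] R'(3)] .
          then show ?thesis using nf_img[OF X'(6) R'(2)] ig R'(4) by simp
        qed
        \<comment> \<open>Freeness from the first member of the row and freeness along the row are
          joined by transitivity.\<close>
        have "nf s (img f (X j)) (H k) (?f (x j)) (R' k)" if k: "k \<le> \<kappa>" for k
        proof -
          have "nf s (img f (X j)) (H ozero) (?f (x j)) (R' k)"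
            using nf_up[OF b0 chainD(3)[OF freeD(1)[OF R'(1)] ozero_le k] chainD(2)[OF freeD(1)[OF R'(1)] k]] .
          moreover have "nf s (H ozero) (H k) (?f (x j)) (R' k)" using R'(5) k by simp
          ultimately show ?thesis by (rule nf_trans)
        qed
        then show ?thesis unfolding rel_def S using freeD(2)[OF R'(1)] eq by simp
      qed
      ultimately show ?thesis by blast
    qed
    show "\<exists>S. Inv \<alpha> S \<and> (\<forall>\<beta><\<alpha>. rel \<beta> \<alpha> (F \<beta>) S) \<and> LimR \<alpha> F S"
      if a: "olimit \<alpha>" "\<alpha> \<in> {..\<iota>}" and inv: "\<And>\<beta>. \<beta> < \<alpha> \<Longrightarrow> Inv \<beta> (F \<beta>)"
        and rl: "\<And>\<beta> \<gamma>. \<beta> < \<gamma> \<Longrightarrow> \<gamma> < \<alpha> \<Longrightarrow> rel \<beta> \<gamma> (F \<beta>) (F \<gamma>)"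
        and lm: "\<And>\<beta>. \<beta> < \<alpha> \<Longrightarrow> olimit \<beta> \<Longrightarrow> LimR \<beta> F (F \<beta>)" for \<alpha> F
    proof -
      have ai: "\<alpha> \<le> \<iota>" using a by simp
      define H where "H = (\<lambda>k. union_model ((\<lambda>\<beta>. fst (F \<beta>) k) ` {..<\<alpha>}))"
      have fr: "free \<kappa> T I c (fst (F \<beta>))" if "\<beta> < \<alpha>" for \<beta> using inv[OF that] unfolding Inv_def by blast
      have fH: "free \<kappa> T I c H" and lim: "\<And>k \<beta>. k \<le> \<kappa> \<Longrightarrow> \<beta> < \<alpha> \<Longrightarrow> fst (F \<beta>) k \<preceq> H k"
        unfolding H_def
        by (rule free_limit[OF a(1) small_mono[OF r(1) ai] fr];
          use rl lm in \<open>auto simp: rel_def LimR_def\<close>)+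
      obtain \<pi> where pi: "bij \<pi>" "\<forall>\<beta><\<alpha>. \<forall>y\<in>univ (X \<beta>). \<pi> y = snd (F \<beta>) y"
        by (rule glue_perms[OF cX a(1) ai, of "\<lambda>\<beta>. snd (F \<beta>)"]) (use inv rl in \<open>auto simp: Inv_def rel_def\<close>)
      have "img \<pi> (X \<alpha>) \<preceq> H ozero"
      proof (rule img_le_limit[OF cX a(1) ai pi])
        fix \<beta> assume b: "\<beta> < \<alpha>"
        have "img (snd (F \<beta>)) (X \<beta>) \<preceq> fst (F \<beta>) ozero" using inv[OF b] unfolding Inv_def by blast
        then show "img (snd (F \<beta>)) (X \<beta>) \<preceq> H ozero" using le_trans lim[OF ozero_le b] by blast
      qed
      then have "Inv \<alpha> (H, \<pi>)" unfolding Inv_def using fH pi(1) by simp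
      moreover have "rel \<beta> \<alpha> (F \<beta>) (H, \<pi>)" if "\<beta> < \<alpha>" for \<beta>
        unfolding rel_def using lim[OF _ that] pi(2) that not_olimit_osuc[of \<beta>] a(1) osuc_greater[OF that] by auto
      ultimately show ?thesis unfolding LimR_def H_def by auto
    qed
  qed (rule that)
  define H where "H j = fst (F j)" for j
  define f where "f = snd (F \<iota>)"
  have inv: "free \<kappa> T I c (H j)" "bij (snd (F j))" "img (snd (F j)) (X j) \<preceq> H j ozero" if "j \<le> \<iota>" for j
    using F(2)[of j] that unfolding Inv_def H_def by auto
  have rl: "rel i j (F i) (F j)" if "i < j" "j \<le> \<iota>" for i j using F(3) that by simp
  have fj: "snd (F j) y = f y" if "j \<le> \<iota>" "y \<in> univ (X j)" for j y
    using rl[of j \<iota>] that unfolding rel_def f_def by (cases "j = \<iota>") auto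
  have imf: "img (snd (F j)) (X j) = img f (X j)" if "j \<le> \<iota>" for j
    using img_agree[OF r(2)[OF that]] fj[OF that] by blast
  show ?thesis
  proof (rule that)
    show "H ozero = T" using F(1) unfolding H_def by simp
    show "free \<kappa> T I c (H j)" if "j \<le> \<iota>" for j using inv(1)[OF that] .
    show "chain \<iota> (\<lambda>j. H j k)" if k: "k \<le> \<kappa>" for k
    proof (rule chainI)
      show "H j k \<in> KL" if "j \<le> \<iota>" for j using chainD(2)[OF freeD(1)[OF inv(1)[OF that]] k] .
      show "H i k \<preceq> H j k" if "i < j" "j \<le> \<iota>" for i j using rl[OF that] k unfolding rel_def H_def by blast
      show "H j k = union_model ((\<lambda>j. H j k) ` {..<j})" if "j \<le> \<iota>" "olimit j" for j
        using F(4)[of j] that k unfolding LimR_def H_def by simp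
    qed (rule r)
    show "bij f" using inv(2)[of \<iota>] unfolding f_def by simp
    show "over (univ (X ozero)) f" using fj[OF ozero_le, symmetric] F(1) unfolding over_def by simp
    show "img f (X j) \<preceq> H j ozero" if "j \<le> \<iota>" for j using inv(3)[OF that] imf[OF that] by simp
    fix j k assume jk: "j < \<iota>" "k \<le> \<kappa>"
    have sj: "j < osuc j" "osuc j \<le> \<iota>" using succ_less[OF r(1) jk(1)] by auto
    have "nf s (img (snd (F j)) (X j)) (H j k) (snd (F (osuc j)) (x j)) (H (osuc j) k)"
      using rl[OF sj] jk(2) unfolding rel_def H_def by blast
    then show "nf s (img f (X j)) (H j k) (f (x j)) (H (osuc j) k)"
      using imf[of j] fj[OF sj(2) nfD(6)[OF rn[OF jk(1)]]] jk(1) by simp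
  qed
qed

section \<open>Towers of uniqueness triples\<close>

definition uqtower where
  "uqtower \<iota> X x \<longleftrightarrow> chain \<iota> X \<and> (\<forall>j<\<iota>. (X j, X (osuc j), x j) \<in> K3uq lam s)"

lemma uqtowerD:
  assumes "uqtower \<iota> X x"
  shows "chain \<iota> X" "\<And>j. j < \<iota> \<Longrightarrow> (X j, X (osuc j), x j) \<in> K3uq lam s" "nfchain \<iota> X I x"
  using assms uqD(1) unfolding uqtower_def nfchain_def by blast+

lemma uqtower_img: "uqtower \<iota> X x \<Longrightarrow> bij \<pi> \<Longrightarrow> uqtower \<iota> (\<lambda>j. img \<pi> (X j)) (\<lambda>j. \<pi> (x j))"
  using chain_img uq_img unfolding uqtower_def by blast

text \<open>Uniqueness is passed up the tower: at each successor both sides are extended freely from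
  the common model \<open>F\<close>, and \<open>uq_unique\<close> merges the results while aligning
  the two copies of the next member of the tower.\<close>

lemma free_unique:
  assumes X: "uqtower \<iota> X x" and G: "free \<iota> X UNIV x G" and f: "bij f" "over (univ (X ozero)) f"
    and G': "free \<iota> (\<lambda>j. img f (X j)) UNIV (\<lambda>j. f (x j)) G'" and C: "G ozero \<preceq> G' ozero"
  obtains F h where "F \<in> KL" "G \<iota> \<preceq> F" "bij h" "over (univ (G ozero)) h" "img h (G' \<iota>) \<preceq> F"
    "\<forall>y\<in>univ (X \<iota>). h (f y) = y"
proof -
  note cX = uqtowerD(1)[OF X] and cG = freeD(1)[OF G] and cG' = freeD(1)[OF G']
  note r = chainD[OF cX] and g = freeD[OF G] and g' = freeD[OF G']
  \<comment> \<open>\<open>e\<close> places \<open>G j\<close> and \<open>h\<close> places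
    \<open>G' j\<close> in the common model; the last clause makes the two placements agree on the
    tower, of which \<open>f\<close> produces the second copy.\<close>
  define Inv where "Inv j S \<longleftrightarrow> (case S of (F, e, h) \<Rightarrow> F \<in> KL \<and> bij e \<and> bij h \<and> img e (G j) \<preceq> F \<and>
      img h (G' j) \<preceq> F \<and> (\<forall>y\<in>univ (X j). h (f y) = e y))"
    for j and S :: "('a, 'f, 'r) model \<times> ('a \<Rightarrow> 'a) \<times> ('a \<Rightarrow> 'a)"
  define rel where "rel i j S S' \<longleftrightarrow> fst S \<preceq> fst S' \<and> (\<forall>y\<in>univ (G i). fst (snd S') y = fst (snd S) y) \<and>
      (\<forall>y\<in>univ (G' i). snd (snd S') y = snd (snd S) y)"
    for i and j :: 'o and S S' :: "('a, 'f, 'r) model \<times> ('a \<Rightarrow> 'a) \<times> ('a \<Rightarrow> 'a)"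
  define LimR where "LimR \<alpha> F S \<longleftrightarrow> fst S = union_model ((\<lambda>\<beta>. fst (F \<beta>)) ` {..<\<alpha>})"
    for \<alpha> :: 'o and F :: "'o \<Rightarrow> ('a, 'f, 'r) model \<times> ('a \<Rightarrow> 'a) \<times> ('a \<Rightarrow> 'a)"
      and S :: "('a, 'f, 'r) model \<times> ('a \<Rightarrow> 'a) \<times> ('a \<Rightarrow> 'a)"
  obtain F where F: "F ozero = (G' ozero, id, id)" "\<And>j. j \<in> {..\<iota>} \<Longrightarrow> Inv j (F j)"
    "\<And>i j. i < j \<Longrightarrow> j \<in> {..\<iota>} \<Longrightarrow> rel i j (F i) (F j)"
    "\<And>j. j \<in> {..\<iota>} \<Longrightarrow> olimit j \<Longrightarrow> LimR j F (F j)"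
  proof (rule chain_recursion[of "{..\<iota>}" rel LimR Inv "(G' ozero, id, id)"])
    show "l \<in> {..\<iota>}" if "k \<in> {..\<iota>}" "l < k" for k l using that by auto
    show "rel k m S S''" if "k < l" "l < m" "m \<in> {..\<iota>}" "rel k l S S'" "rel l m S' S''" for k l m S S' S''
    proof -
      have "univ (G k) \<subseteq> univ (G l)" "univ (G' k) \<subseteq> univ (G' l)"
        using le_univ[OF chainD(3)[OF cG, of k l]] le_univ[OF chainD(3)[OF cG', of k l]] that by auto
      moreover have "fst S \<preceq> fst S''" using that(4,5) le_trans unfolding rel_def by blast
      ultimately show ?thesis using that(4,5) unfolding rel_def by auto
    qed
    show "LimR \<alpha> g S" if "\<And>\<beta>. \<beta> < \<alpha> \<Longrightarrow> f \<beta> = g \<beta>" "LimR \<alpha> f S" for \<alpha> f g S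
    proof -
      have "(\<lambda>\<beta>. fst (f \<beta>)) ` {..<\<alpha>} = (\<lambda>\<beta>. fst (g \<beta>)) ` {..<\<alpha>}" by (rule image_cong) (auto simp: that(1))
      then show ?thesis using that(2) unfolding LimR_def by simp
    qed
    show "Inv ozero (G' ozero, id, id)"
      using chainD(2)[OF cG' ozero_le] C f(2) KL_refl by (simp add: Inv_def img_id over_def)
    show "\<exists>S'. Inv (osuc j) S' \<and> rel j (osuc j) S S'"
      if j: "j < osuc j" "osuc j \<in> {..\<iota>}" "Inv j S" for j S
    proof -
      obtain F e h where S: "S = (F, e, h)" by (cases S) auto
      have FK: "F \<in> KL" "bij e" "bij h" "img e (G j) \<preceq> F" "img h (G' j) \<preceq> F" "\<forall>y\<in>univ (X j). h (f y) = e y"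
        using j(3) unfolding Inv_def S by auto
      have jj: "j < \<iota>" "j \<le> \<iota>" "osuc j \<le> \<iota>" using j by auto
      have hf: "bij (h \<circ> f)" using f(1) FK(3) by (rule bij_comp)
      have ehf: "img h (img f (X j)) = img e (X j)"
        using img_agree[OF r(2)[OF jj(2)], of "h \<circ> f" e] FK(6) by (simp add: img_comp)
      obtain K1 \<sigma> where K1: "K1 \<in> KL" "F \<preceq> K1" "bij \<sigma>" "over (univ (img e (G j))) \<sigma>" "img \<sigma> (img e (G (osuc j))) \<preceq> K1"
          "nf s (img e (X j)) F (\<sigma> (e (x j))) K1"
        by (rule nf_extend'[OF nf_img[OF g(3)[OF jj(1) UNIV_I] FK(2)] FK(1,4)])
      obtain K2 \<tau> where K2: "K2 \<in> KL" "F \<preceq> K2" "bij \<tau>" "over (univ (img h (G' j))) \<tau>" "img \<tau> (img h (G' (osuc j))) \<preceq> K2"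
          "nf s (img h (img f (X j))) F (\<tau> (h (f (x j)))) K2"
        by (rule nf_extend'[OF nf_img[OF g'(3)[OF jj(1) UNIV_I] FK(3)] FK(1,5)])
      \<comment> \<open>\<open>uq_unique\<close> expects two placements of one triple, here the copy
        under \<open>e\<close>. The permutation \<open>?p2\<close> returns from it to the original
        tower and then follows the second route through \<open>f\<close>, \<open>h\<close> and
        \<tau>.\<close>
      let ?p2 = "\<tau> \<circ> h \<circ> f \<circ> inv e"
      have ie: "inv e (e y) = y" for y using FK(2) by (simp add: bij_is_inj)
      have p2: "bij ?p2" using f(1) FK(3) K2(3) bij_imp_bij_inv[OF FK(2)] by (intro bij_comp)
      have tau: "\<tau> (h (f y)) = e y" if "y \<in> univ (X j)" for y
      proof -
        have "f y \<in> univ (G' j)" using le_univ[OF g'(2)[OF jj(2)]] that by auto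
        then have "h (f y) \<in> univ (img h (G' j))" by simp
        then have "\<tau> (h (f y)) = h (f y)" using K2(4) unfolding over_def by blast
        then show ?thesis using FK(6) that by simp
      qed
      have ov2: "over (univ (img e (X j))) ?p2" unfolding over_def by (auto simp: ie tau)
      have eXG: "img e (X j) \<preceq> img e (G j)" using img_le'[OF g(2)[OF jj(2)] FK(2)] .
      have ov1: "over (univ (img e (X j))) \<sigma>" using over_le[OF K1(4) eXG] .
      have l1: "img \<sigma> (img e (X (osuc j))) \<preceq> K1"
        using le_trans[OF img_le'[OF img_le'[OF g(2)[OF jj(3)] FK(2)] K1(3)] K1(5)] .
      have e1: "img ?p2 (img e (X (osuc j))) = img \<tau> (img h (img f (X (osuc j))))"
        using img_agree[OF r(2)[OF jj(3)], of "?p2 \<circ> e" "\<tau> \<circ> (h \<circ> f)"] by (simp add: img_comp ie o_assoc)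
      have l2: "img ?p2 (img e (X (osuc j))) \<preceq> K2"
        unfolding e1 using le_trans[OF img_le'[OF img_le'[OF g'(2)[OF jj(3)] FK(3)] K2(3)] K2(5)] .
      have n2: "nf s (img e (X j)) F (?p2 (e (x j))) K2" using K2(6) unfolding ehf by (simp add: ie)
      obtain K v where K: "K \<in> KL" "K1 \<preceq> K" "bij v" "over (univ F) v" "img v K2 \<preceq> K"
          "\<forall>z\<in>univ (img e (X (osuc j))). v (?p2 z) = \<sigma> z"
        by (rule uq_unique[OF uq_img[OF uqtowerD(2)[OF X jj(1)] FK(2)] K1(3) p2 ov1 ov2 K1(6) n2 l1 l2])
      have "Inv (osuc j) (K, \<sigma> \<circ> e, v \<circ> \<tau> \<circ> h)"
        unfolding Inv_def prod.case
      proof (intro conjI ballI)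
        show "img (\<sigma> \<circ> e) (G (osuc j)) \<preceq> K" using le_trans[OF K1(5) K(2)] by (simp add: img_comp)
        show "img (v \<circ> \<tau> \<circ> h) (G' (osuc j)) \<preceq> K"
          using le_trans[OF img_le'[OF K2(5) K(3)] K(5)] by (simp add: img_comp o_assoc)
        show "(v \<circ> \<tau> \<circ> h) (f y) = (\<sigma> \<circ> e) y" if "y \<in> univ (X (osuc j))" for y
          using bspec[OF K(6), of "e y"] that by (simp add: ie)
      qed (use K(1) K(3) K1(3) K2(3) FK in \<open>auto intro: bij_comp\<close>)
      moreover have "rel j (osuc j) S (K, \<sigma> \<circ> e, v \<circ> \<tau> \<circ> h)"
      proof -
        have "(v \<circ> \<tau> \<circ> h) y = h y" if "y \<in> univ (G' j)" for y
        proof -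
          have "h y \<in> univ (img h (G' j))" using that by simp
          moreover from this have "h y \<in> univ F" using le_univ[OF FK(5)] by blast
          ultimately show ?thesis using K2(4) K(4) unfolding over_def by (metis comp_apply)
        qed
        moreover have "(\<sigma> \<circ> e) y = e y" if "y \<in> univ (G j)" for y
          using K1(4) that unfolding over_def by simp
        ultimately show ?thesis unfolding rel_def S using le_trans[OF K1(2) K(2)] by simp
      qed
      ultimately show ?thesis by blast
    qed
    show "\<exists>S. Inv \<alpha> S \<and> (\<forall>\<beta><\<alpha>. rel \<beta> \<alpha> (F \<beta>) S) \<and> LimR \<alpha> F S"
      if a: "olimit \<alpha>" "\<alpha> \<in> {..\<iota>}" and inv: "\<And>\<beta>. \<beta> < \<alpha> \<Longrightarrow> Inv \<beta> (F \<beta>)"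
        and rl: "\<And>\<beta> \<gamma>. \<beta> < \<gamma> \<Longrightarrow> \<gamma> < \<alpha> \<Longrightarrow> rel \<beta> \<gamma> (F \<beta>) (F \<gamma>)"
        and lm: "\<And>\<beta>. \<beta> < \<alpha> \<Longrightarrow> olimit \<beta> \<Longrightarrow> LimR \<beta> F (F \<beta>)" for \<alpha> F
    proof -
      have ai: "\<alpha> \<le> \<iota>" using a by simp
      let ?W = "\<lambda>\<beta>. fst (F \<beta>)" and ?e = "\<lambda>\<beta>. fst (snd (F \<beta>))" and ?h = "\<lambda>\<beta>. snd (snd (F \<beta>))"
      let ?U = "union_model (?W ` {..<\<alpha>})"
      have iv: "?W \<beta> \<in> KL" "bij (?e \<beta>)" "bij (?h \<beta>)" "img (?e \<beta>) (G \<beta>) \<preceq> ?W \<beta>" "img (?h \<beta>) (G' \<beta>) \<preceq> ?W \<beta>"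
          "\<forall>y\<in>univ (X \<beta>). ?h \<beta> (f y) = ?e \<beta> y" if "\<beta> < \<alpha>" for \<beta>
        using inv[OF that] unfolding Inv_def by (auto split: prod.splits)
      have UK: "?U \<in> KL" and WU: "\<And>\<beta>. \<beta> < \<alpha> \<Longrightarrow> ?W \<beta> \<preceq> ?U"
        by (rule chain_limit[of \<alpha> ?W, OF a(1) small_mono[OF r(1) ai]];
            use iv(1) rl lm in \<open>auto simp: rel_def LimR_def\<close>)+
      obtain e where e: "bij e" "\<forall>\<beta><\<alpha>. \<forall>y\<in>univ (G \<beta>). e y = ?e \<beta> y"
        by (rule glue_perms[OF cG a(1) ai, of ?e]) (use iv rl in \<open>auto simp: rel_def\<close>)
      obtain h where h: "bij h" "\<forall>\<beta><\<alpha>. \<forall>y\<in>univ (G' \<beta>). h y = ?h \<beta> y"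
        by (rule glue_perms[OF cG' a(1) ai, of ?h]) (use iv rl in \<open>auto simp: rel_def\<close>)
      have "img e (G \<alpha>) \<preceq> ?U"
        by (rule img_le_limit[OF cG a(1) ai e]) (use le_trans[OF iv(4) WU] in blast)
      moreover have "img h (G' \<alpha>) \<preceq> ?U"
        by (rule img_le_limit[OF cG' a(1) ai h]) (use le_trans[OF iv(5) WU] in blast)
      moreover have "h (f y) = e y" if y: "y \<in> univ (X \<alpha>)" for y
      proof -
        obtain \<beta> where b: "\<beta> < \<alpha>" "y \<in> univ (X \<beta>)" using y univ_chain_limit[OF cX a(1) ai] by auto
        have bi: "\<beta> \<le> \<iota>" using b(1) ai by simp
        have "y \<in> univ (G \<beta>)" "f y \<in> univ (G' \<beta>)" using le_univ[OF g(2)[OF bi]] le_univ[OF g'(2)[OF bi]] b(2) by auto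
        then show ?thesis using e(2) h(2) b iv(6)[OF b(1)] by simp
      qed
      ultimately have "Inv \<alpha> (?U, e, h)" unfolding Inv_def using UK e(1) h(1) by simp
      moreover have "rel \<beta> \<alpha> (F \<beta>) (?U, e, h)" if "\<beta> < \<alpha>" for \<beta>
        unfolding rel_def using WU[OF that] e(2) h(2) that by simp
      ultimately show ?thesis unfolding LimR_def by auto
    qed
  qed (rule that)
  obtain F\<iota> e h where Fi: "F \<iota> = (F\<iota>, e, h)" by (cases "F \<iota>") auto
  have i: "F\<iota> \<in> KL" "bij e" "bij h" "img e (G \<iota>) \<preceq> F\<iota>" "img h (G' \<iota>) \<preceq> F\<iota>" "\<forall>y\<in>univ (X \<iota>). h (f y) = e y"
    using F(2)[of \<iota>] unfolding Inv_def Fi by auto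
  have e0: "e y = y" "h y = y" if "y \<in> univ (G ozero)" for y
  proof -
    have "y \<in> univ (G' ozero)" using le_univ[OF C] that by blast
    then show "e y = y" "h y = y"
      using F(3)[of ozero \<iota>] F(1) Fi that ozero_le[of \<iota>] unfolding rel_def by (cases "\<iota> = ozero"; auto)+
  qed
  \<comment> \<open>Undoing \<open>e\<close> puts \<open>G \<iota>\<close> back in place; on
    \<open>G ozero\<close> neither map has moved anything.\<close>
  have be: "bij (inv e)" using i(2) by (rule bij_imp_bij_inv)
  have ie: "inv e (e y) = y" for y using i(2) by (simp add: bij_is_inj)
  show ?thesis
  proof (rule that)
    show "img (inv e) F\<iota> \<in> KL" using img_KL[OF i(1) be] .
    show "G \<iota> \<preceq> img (inv e) F\<iota>" using img_le'[OF i(4) be] unfolding img_inv[OF i(2)] .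
    show "bij (inv e \<circ> h)" using i(3) be by (rule bij_comp)
    show "over (univ (G ozero)) (inv e \<circ> h)" unfolding over_def using e0 ie by (metis comp_apply)
    show "img (inv e \<circ> h) (G' \<iota>) \<preceq> img (inv e) F\<iota>" using img_le'[OF i(5) be] by (simp add: img_comp)
    show "\<forall>y\<in>univ (X \<iota>). (inv e \<circ> h) (f y) = y" using i(6) ie by simp
  qed
qed

section \<open>Free squares\<close>

definition square where
  "square A B C D \<longleftrightarrow> A \<preceq> B \<and> B \<preceq> D \<and> A \<preceq> C \<and> C \<preceq> D \<and> A \<in> KL \<and> B \<in> KL \<and> C \<in> KL \<and> D \<in> KL"

text \<open>
  Two versions of ``\<open>B\<close> and \<open>C\<close> are independent over \<open>A\<close> in \<open>D\<close>''. The existential one uses a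
  tower of uniqueness triples on the side of \<open>B\<close>, the universal one is tested against all
  non-forking chains on the side of \<open>C\<close>.
\<close>

definition NFex where
  "NFex A B C D \<longleftrightarrow> square A B C D \<and> (\<exists>\<iota> X x G N. uqtower \<iota> X x \<and> X ozero = A \<and> B \<preceq> X \<iota> \<and>
     free \<iota> X UNIV x G \<and> G ozero = C \<and> G \<iota> \<preceq> N \<and> D \<preceq> N \<and> N \<in> KL)"

definition NFall where
  "NFall A B C D \<longleftrightarrow> square A B C D \<and> (\<forall>\<kappa> T I c. nfchain \<kappa> T I c \<and> T ozero = A \<and> C \<preceq> T \<kappa> \<longrightarrow>
     (\<exists>E g F. bij g \<and> over (univ C) g \<and> free \<kappa> (\<lambda>k. img g (T k)) I (\<lambda>k. g (c k)) E \<and> E ozero = B \<and>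
        E \<kappa> \<preceq> F \<and> D \<preceq> F \<and> F \<in> KL))"

lemma squareD:
  assumes "square A B C D"
  shows "A \<preceq> B" "B \<preceq> D" "A \<preceq> C" "C \<preceq> D" "A \<in> KL" "B \<in> KL" "C \<in> KL" "D \<in> KL" "square A C B D"
  using assms unfolding square_def by blast+

lemma NFallE:
  assumes "NFall A B C D" "nfchain \<kappa> T I c" "T ozero = A" "C \<preceq> T \<kappa>"
  obtains E g F where "bij g" "over (univ C) g" "free \<kappa> (\<lambda>k. img g (T k)) I (\<lambda>k. g (c k)) E" "E ozero = B"
    "E \<kappa> \<preceq> F" "D \<preceq> F" "F \<in> KL"
  using assms unfolding NFall_def by blast

text \<open>A grid is built from the tower for \<open>B\<close> and the test chain for
  \<open>C\<close>. Its last column is a second free extension of the tower, so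
  \<open>free_unique\<close> matches it with the given one; the last row, moved accordingly, is the
  required extension of the test chain.\<close>

lemma NFex_NFall:
  assumes "NFex A B C D"
  shows "NFall A B C D"
proof -
  obtain \<iota> X x G N where sq: "square A B C D" and X: "uqtower \<iota> X x" "X ozero = A" "B \<preceq> X \<iota>"
      and G: "free \<iota> X UNIV x G" "G ozero = C" "G \<iota> \<preceq> N" and N: "D \<preceq> N" "N \<in> KL"
    using assms unfolding NFex_def by blast
  note q = squareD[OF sq]
  have "\<exists>E g F. bij g \<and> over (univ C) g \<and> free \<kappa> (\<lambda>k. img g (T k)) I (\<lambda>k. g (c k)) E \<and> E ozero = B \<and>
        E \<kappa> \<preceq> F \<and> D \<preceq> F \<and> F \<in> KL" if T: "nfchain \<kappa> T I c" "T ozero = A" "C \<preceq> T \<kappa>" for \<kappa> T I c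
  proof -
    have XT: "X ozero = T ozero" using X(2) T(2) by simp
    obtain H f where H0: "H ozero = T" and H: "\<And>j. j \<le> \<iota> \<Longrightarrow> free \<kappa> T I c (H j)"
        "\<And>k. k \<le> \<kappa> \<Longrightarrow> chain \<iota> (\<lambda>j. H j k)" and f: "bij f" "over (univ (X ozero)) f"
        and fX: "\<And>j. j \<le> \<iota> \<Longrightarrow> img f (X j) \<preceq> H j ozero"
        and Hn: "\<And>j k. j < \<iota> \<Longrightarrow> k \<le> \<kappa> \<Longrightarrow> nf s (img f (X j)) (H j k) (f (x j)) (H (osuc j) k)"
      by (rule free_grid[OF uqtowerD(3)[OF X(1)] T(1) XT]) blast
    have G': "free \<iota> (\<lambda>j. img f (X j)) UNIV (\<lambda>j. f (x j)) (\<lambda>j. H j \<kappa>)"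
      unfolding free_def
    proof (intro conjI allI impI)
      show "chain \<iota> (\<lambda>j. H j \<kappa>)" using H(2) by blast
      show "img f (X j) \<preceq> H j \<kappa>" if "j \<le> \<iota>" for j
        using le_trans[OF fX[OF that] chainD(3)[OF freeD(1)[OF H(1)[OF that]] ozero_le order.refl]] .
    qed (use Hn in blast)
    have C0: "G ozero \<preceq> H ozero \<kappa>" using G(2) H0 T(3) by simp
    obtain F1 h where F1: "F1 \<in> KL" "G \<iota> \<preceq> F1" "bij h" "over (univ (G ozero)) h" "img h (H \<iota> \<kappa>) \<preceq> F1"
        "\<forall>y\<in>univ (X \<iota>). h (f y) = y"
      by (rule free_unique[OF X(1) G(1) f G' C0])
    have GK: "G \<iota> \<in> KL" using chainD(2)[OF freeD(1)[OF G(1)]] by blast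
    \<comment> \<open>\<open>free_unique\<close> yields a model above \<open>G \<iota>\<close> only;
      amalgamating it with \<open>N\<close> brings in \<open>D\<close>.\<close>
    obtain F \<rho> where F: "F \<in> KL" "N \<preceq> F" "bij \<rho>" "over (univ (G \<iota>)) \<rho>" "img \<rho> F1 \<preceq> F"
      by (rule amalgam[OF GK N(2) F1(1) G(3) F1(2)])
    let ?g = "\<rho> \<circ> h"
    have bg: "bij ?g" using F1(3) F(3) by (rule bij_comp)
    have CG: "C \<preceq> G \<iota>" using chainD(3)[OF freeD(1)[OF G(1)] ozero_le order.refl] G(2) by simp
    have ovC: "over (univ C) ?g"
      using over_comp[OF over_le[OF F(4) CG]] F1(4) G(2) by simp
    have gf: "?g (f y) = y" if y: "y \<in> univ (X \<iota>)" for y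
    proof -
      have "y \<in> univ (G \<iota>)" using le_univ[OF freeD(2)[OF G(1) order.refl]] y by blast
      then show ?thesis using F1(6) F(4) y unfolding over_def by simp
    qed
    have XK: "X \<iota> \<in> KL" using chainD(2)[OF uqtowerD(1)[OF X(1)]] by blast
    have "img ?g (img f (X \<iota>)) = X \<iota>"
      unfolding img_comp[of ?g f] using img_over[OF KL_K[OF XK], of "?g \<circ> f"] gf unfolding over_def by simp
    then have XH: "X \<iota> \<preceq> img ?g (H \<iota> ozero)" using img_le'[OF fX[OF order.refl] bg] by simp
    \<comment> \<open>The row starts with a model containing the top of the tower, whereas
      \<open>NFall\<close> demands \<open>B\<close> as first member; shrinking the first member
      preserves freeness.\<close>
    let ?E = "(\<lambda>k. img ?g (H \<iota> k))(ozero := B)"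
    have gT0: "img ?g (T ozero) = T ozero"
      using img_over_le[OF q(3) over_le[OF ovC q(3)]] T(2) by simp
    have "free \<kappa> (\<lambda>k. img ?g (T k)) I (\<lambda>k. ?g (c k)) ?E"
      by (rule free_replace_zero[OF free_img[OF H(1)[OF order.refl] bg] q(6)])
        (use le_trans[OF X(3) XH] gT0 q(1) T(2) in auto)
    moreover have "?E \<kappa> \<preceq> F"
    \<comment> \<open>In a chain of length zero the first member is also the last, so the
      replacement has changed \<open>?E \<kappa>\<close> to \<open>B\<close>.\<close>
    proof (cases "\<kappa> = ozero")
      case True
      then show ?thesis using le_trans[OF le_trans[OF q(2) N(1)] F(2)] by simp
    next
      case False
      then show ?thesis using le_trans[OF img_le'[OF F1(5) F(3)] F(5)] by (simp add: img_comp)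
    qed
    moreover have "D \<preceq> F" using le_trans[OF N(1) F(2)] .
    ultimately show ?thesis using bg ovC F(1)
      by (intro exI[of _ ?E] exI[of _ ?g] exI[of _ F]) auto
  qed
  then show ?thesis unfolding NFall_def using sq by blast
qed

text \<open>As long as tower and target differ, density gives a basic type realized in the target,
  and a uniqueness triple for it is added while the target grows to hold it. Because the target
  keeps moving, \<open>exhaustion\<close> is what shows that the tower catches up.\<close>

lemma decomposition:
  assumes A: "A \<in> KL" "C \<in> KL" "A \<preceq> C"
  obtains \<kappa> T x where "uqtower \<kappa> T x" "T ozero = A" "C \<preceq> T \<kappa>"
proof -
  let ?D = "{i :: 'o. small lam i}"
  define Inv where "Inv i S \<longleftrightarrow> fst S \<preceq> snd S \<and> fst S \<in> KL \<and> snd S \<in> KL"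
    for i :: 'o and S :: "('a, 'f, 'r) model \<times> ('a, 'f, 'r) model"
  define rel where "rel i j S S' \<longleftrightarrow> fst S \<preceq> fst S' \<and> snd S \<preceq> snd S' \<and>
      (j = osuc i \<longrightarrow> fst S \<noteq> snd S \<longrightarrow> (\<exists>x\<in>univ (snd S). (fst S, fst S', x) \<in> K3uq lam s))"
    for i j :: 'o and S S' :: "('a, 'f, 'r) model \<times> ('a, 'f, 'r) model"
  define LimR where "LimR \<alpha> F S \<longleftrightarrow> fst S = union_model ((\<lambda>\<beta>. fst (F \<beta>)) ` {..<\<alpha>}) \<and>
      snd S = union_model ((\<lambda>\<beta>. snd (F \<beta>)) ` {..<\<alpha>})"
    for \<alpha> :: 'o and F :: "'o \<Rightarrow> ('a, 'f, 'r) model \<times> ('a, 'f, 'r) model"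
      and S :: "('a, 'f, 'r) model \<times> ('a, 'f, 'r) model"
  obtain F where F: "F ozero = (A, C)" "\<And>j. j \<in> ?D \<Longrightarrow> Inv j (F j)"
    "\<And>i j. i < j \<Longrightarrow> j \<in> ?D \<Longrightarrow> rel i j (F i) (F j)"
    "\<And>j. j \<in> ?D \<Longrightarrow> olimit j \<Longrightarrow> LimR j F (F j)"
  proof (rule chain_recursion[of ?D rel LimR Inv "(A, C)"])
    show "l \<in> ?D" if "k \<in> ?D" "l < k" for k l using that small_mono[of lam k l] by auto
    show "rel k m S S''" if "k < l" "l < m" "m \<in> ?D" "rel k l S S'" "rel l m S' S''" for k l m S S' S''
    proof -
      have "m \<noteq> osuc k" using osuc_le[OF that(1)] that(2) by auto
      then show ?thesis using that(4,5) le_trans unfolding rel_def by blast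
    qed
    show "LimR \<alpha> g S" if "\<And>\<beta>. \<beta> < \<alpha> \<Longrightarrow> f \<beta> = g \<beta>" "LimR \<alpha> f S" for \<alpha> f g S
    proof -
      have "(\<lambda>\<beta>. fst (f \<beta>)) ` {..<\<alpha>} = (\<lambda>\<beta>. fst (g \<beta>)) ` {..<\<alpha>}"
        "(\<lambda>\<beta>. snd (f \<beta>)) ` {..<\<alpha>} = (\<lambda>\<beta>. snd (g \<beta>)) ` {..<\<alpha>}"
        by (rule image_cong; auto simp: that(1))+
      then show ?thesis using that(2) unfolding LimR_def by simp
    qed
    show "Inv ozero (A, C)" unfolding Inv_def using A by simp
    show "\<exists>S'. Inv (osuc j) S' \<and> rel j (osuc j) S S'"
      if j: "j < osuc j" "osuc j \<in> ?D" "Inv j S" for j S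
    proof -
      obtain T C' where S: "S = (T, C')" by (cases S)
      have TC: "T \<preceq> C'" "T \<in> KL" "C' \<in> KL" using j(3) unfolding Inv_def S by auto
      show ?thesis
      proof (cases "T = C'")
        case True
        then have "rel j (osuc j) S S" unfolding rel_def S using KL_refl[OF TC(2)] by simp
        then show ?thesis using j(3) unfolding Inv_def by blast
      next
        case False
        obtain x where x: "nf s T T x C'" by (rule nf_density[OF TC(2,3,1) False])
        obtain U N' where U: "N' \<in> KL" "C' \<preceq> N'" "U \<preceq> N'" "(T, U, x) \<in> K3uq lam s"
          by (rule uq_in_extension[OF x])
        have "Inv (osuc j) (U, N')" unfolding Inv_def using U uqD(3)[OF U(4)] by simp
        moreover have "rel j (osuc j) S (U, N')"
          unfolding rel_def S using U(2,4) uqD(4)[OF U(4)] nfD(6)[OF x] by auto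
        ultimately show ?thesis by blast
      qed
    qed
    show "\<exists>S. Inv \<alpha> S \<and> (\<forall>\<beta><\<alpha>. rel \<beta> \<alpha> (F \<beta>) S) \<and> LimR \<alpha> F S"
      if a: "olimit \<alpha>" "\<alpha> \<in> ?D" and inv: "\<And>\<beta>. \<beta> < \<alpha> \<Longrightarrow> Inv \<beta> (F \<beta>)"
        and rl: "\<And>\<beta> \<gamma>. \<beta> < \<gamma> \<Longrightarrow> \<gamma> < \<alpha> \<Longrightarrow> rel \<beta> \<gamma> (F \<beta>) (F \<gamma>)"
        and lm: "\<And>\<beta>. \<beta> < \<alpha> \<Longrightarrow> olimit \<beta> \<Longrightarrow> LimR \<beta> F (F \<beta>)" for \<alpha> F
    proof -
      let ?U = "union_model ((\<lambda>\<beta>. fst (F \<beta>)) ` {..<\<alpha>})" and ?V = "union_model ((\<lambda>\<beta>. snd (F \<beta>)) ` {..<\<alpha>})"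
      have sm: "small lam \<alpha>" using a by simp
      have V: "?V \<in> KL" "\<And>\<beta>. \<beta> < \<alpha> \<Longrightarrow> snd (F \<beta>) \<preceq> ?V"
        by (rule chain_limit[of \<alpha> "\<lambda>\<beta>. snd (F \<beta>)", OF a(1) sm]; use inv rl lm in \<open>auto simp: Inv_def rel_def LimR_def\<close>)+
      have U: "?U \<in> KL" "\<And>\<beta>. \<beta> < \<alpha> \<Longrightarrow> fst (F \<beta>) \<preceq> ?U" "\<And>N. (\<And>\<beta>. \<beta> < \<alpha> \<Longrightarrow> fst (F \<beta>) \<preceq> N) \<Longrightarrow> ?U \<preceq> N"
        by (rule chain_limit[of \<alpha> "\<lambda>\<beta>. fst (F \<beta>)", OF a(1) sm]; use inv rl lm in \<open>auto simp: Inv_def rel_def LimR_def\<close>)+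
      have "?U \<preceq> ?V" by (rule U(3)) (use inv V(2) le_trans in \<open>unfold Inv_def, blast\<close>)
      then have "Inv \<alpha> (?U, ?V)" unfolding Inv_def using U(1) V(1) by simp
      moreover have "rel \<beta> \<alpha> (F \<beta>) (?U, ?V)" if "\<beta> < \<alpha>" for \<beta>
        unfolding rel_def using U(2)[OF that] V(2)[OF that] not_olimit_osuc[OF osuc_greater[OF that]] a(1) by auto
      ultimately show ?thesis unfolding LimR_def by auto
    qed
  qed (rule that)
  define T where "T i = fst (F i)" for i
  define D where "D i = snd (F i)" for i
  have inv: "T i \<preceq> D i" "T i \<in> KL" "D i \<in> KL" if "small lam i" for i
    using F(2)[of i] that unfolding Inv_def T_def D_def by auto
  have rl: "T i \<preceq> T j" "D i \<preceq> D j" if "i < j" "small lam j" for i j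
    using F(3)[of i j] that unfolding rel_def T_def D_def by auto
  have lm: "T i = union_model (T ` {..<i})" "D i = union_model (D ` {..<i})" if "olimit i" "small lam i" for i
    using F(4)[of i] that unfolding LimR_def T_def D_def by auto
  have st: "\<exists>x\<in>univ (D i). (T i, T (osuc i), x) \<in> K3uq lam s" if "T i \<noteq> D i" "small lam i" for i
    using F(3)[OF small_greater(1)[OF lam lam_o that(2)]] small_greater(2)[OF lam lam_o that(2)] that(1)
    unfolding rel_def T_def D_def by auto
  have "\<exists>i. small lam i \<and> univ (T i) = univ (D i)"
  proof (rule exhaustion[OF lam lam_o, of "\<lambda>i. univ (D i)" "\<lambda>i. univ (T i)"])
    show "|univ (D i)| \<le>o lam" if "small lam i" for i using KL_ordLeq[OF inv(3)[OF that]] .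
    show "univ (D i) \<subseteq> univ (D j)" "univ (T i) \<subseteq> univ (T j)" if "i \<le> j" "small lam j" for i j
      using rl[of i j] that le_univ by (cases "i = j"; auto)+
    show "univ (D i) = (\<Union>j<i. univ (D j))" if "small lam i" "olimit i" for i
      using lm(2)[OF that(2,1)] by simp
    fix i assume i: "small lam i" "univ (T i) \<noteq> univ (D i)"
    then have "T i \<noteq> D i" by auto
    then obtain x where x: "x \<in> univ (D i)" "(T i, T (osuc i), x) \<in> K3uq lam s" using st i(1) by blast
    then show "\<exists>c. c \<in> univ (D i) \<and> c \<in> univ (T (osuc i)) \<and> c \<notin> univ (T i)"
      using nfD(6,7)[OF uqD(1)[OF x(2)]] by blast
  qed
  then have ex: "\<exists>i. small lam i \<and> T i = D i" using inv(1) le_eqI by blast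
  \<comment> \<open>Taking the least such stage guarantees that every earlier step was a genuine
    uniqueness triple.\<close>
  define \<kappa> where "\<kappa> = (LEAST i. small lam i \<and> T i = D i)"
  have k: "small lam \<kappa>" "T \<kappa> = D \<kappa>" unfolding \<kappa>_def using LeastI_ex[OF ex] by auto
  have nk: "T j \<noteq> D j" if "j < \<kappa>" for j
    using not_less_Least[of j "\<lambda>i. small lam i \<and> T i = D i"] small_mono[OF k(1) less_imp_le[OF that]] that
    unfolding \<kappa>_def by blast
  define x where "x j = (SOME x. (T j, T (osuc j), x) \<in> K3uq lam s)" for j
  have sj: "small lam j" if "j \<le> \<kappa>" for j using small_mono[OF k(1) that] .
  have "uqtower \<kappa> T x"
    unfolding uqtower_def
  proof (intro conjI allI impI)
    show "chain \<kappa> T" by (rule chainI) (use k(1) inv(2) rl(1) lm(1) sj in auto)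
    fix j assume j: "j < \<kappa>"
    have "\<exists>x. (T j, T (osuc j), x) \<in> K3uq lam s"
      using st[OF nk[OF j] sj[OF less_imp_le[OF j]]] by blast
    then show "(T j, T (osuc j), x j) \<in> K3uq lam s" unfolding x_def by (rule someI_ex)
  qed
  moreover have "T ozero = A" "D ozero = C" unfolding T_def D_def F(1) by auto
  moreover have "D ozero \<preceq> D \<kappa>"
    using rl(2)[OF _ k(1), of ozero] ozero_le[of \<kappa>] KL_refl[OF inv(3)[OF k(1)]] by (cases "\<kappa> = ozero") auto
  ultimately show ?thesis using that[of \<kappa> T x] k(2) by simp
qed

text \<open>The universal condition, tested on a tower of uniqueness triples covering
  \<open>C\<close>, returns exactly a free extension of that tower starting with \<open>B\<close>:
  the existential condition with the sides exchanged.\<close>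

lemma NFall_flip:
  assumes "NFall A B C D"
  shows "NFall A C B D"
proof -
  have sq: "square A B C D" using assms unfolding NFall_def by blast
  note q = squareD[OF sq]
  obtain \<kappa> T x where T: "uqtower \<kappa> T x" "T ozero = A" "C \<preceq> T \<kappa>"
    by (rule decomposition[OF q(5,7,3)])
  obtain E g F where E: "bij g" "over (univ C) g" "free \<kappa> (\<lambda>k. img g (T k)) UNIV (\<lambda>k. g (x k)) E" "E ozero = B"
      "E \<kappa> \<preceq> F" "D \<preceq> F" "F \<in> KL"
    by (rule NFallE[OF assms uqtowerD(3)[OF T(1)] T(2,3)])
  have "img g (T ozero) = A" using img_over_le[OF q(3) over_le[OF E(2) q(3)]] T(2) by simp
  moreover have "C \<preceq> img g (T \<kappa>)"
    using img_le'[OF T(3) E(1)] img_over[OF KL_K[OF q(7)] E(2)] by simp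
  ultimately have "NFex A C B D"
    unfolding NFex_def using q(9) uqtower_img[OF T(1) E(1)] E(3-7) by blast
  then show ?thesis by (rule NFex_NFall)
qed

lemma NFall_img:
  assumes nf: "NFall A B C D" and p: "bij \<pi>"
  shows "NFall (img \<pi> A) (img \<pi> B) (img \<pi> C) (img \<pi> D)"
  unfolding NFall_def
proof (intro conjI allI impI)
  have sq: "square A B C D" using nf unfolding NFall_def by blast
  show "square (img \<pi> A) (img \<pi> B) (img \<pi> C) (img \<pi> D)"
    using squareD[OF sq] img_le'[OF _ p] img_KL[OF _ p] unfolding square_def by blast
  fix \<kappa> T I c assume T: "nfchain \<kappa> T I c \<and> T ozero = img \<pi> A \<and> img \<pi> C \<preceq> T \<kappa>"
  have q: "bij (inv \<pi>)" using p by (rule bij_imp_bij_inv)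
  have ip: "inv \<pi> (\<pi> y) = y" for y using p by (simp add: bij_is_inj)
  have n: "nfchain \<kappa> (\<lambda>k. img (inv \<pi>) (T k)) I (\<lambda>k. inv \<pi> (c k))" using nfchain_img[OF _ q] T by blast
  have t0: "img (inv \<pi>) (T ozero) = A" using T img_inv[OF p] by simp
  have tk: "C \<preceq> img (inv \<pi>) (T \<kappa>)" using img_le'[OF _ q, of "img \<pi> C" "T \<kappa>"] T unfolding img_inv[OF p] by blast
  obtain E g F where E: "bij g" "over (univ C) g"
      "free \<kappa> (\<lambda>k. img g (img (inv \<pi>) (T k))) I (\<lambda>k. g (inv \<pi> (c k))) E" "E ozero = B"
      "E \<kappa> \<preceq> F" "D \<preceq> F" "F \<in> KL"
    by (rule NFallE[OF nf n t0 tk])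
  let ?g = "\<pi> \<circ> g \<circ> inv \<pi>"
  show "\<exists>E g F. bij g \<and> over (univ (img \<pi> C)) g \<and> free \<kappa> (\<lambda>k. img g (T k)) I (\<lambda>k. g (c k)) E \<and>
      E ozero = img \<pi> B \<and> E \<kappa> \<preceq> F \<and> img \<pi> D \<preceq> F \<and> F \<in> KL"
  proof (intro exI conjI)
    show "bij ?g" using E(1) p q by (intro bij_comp)
    show "over (univ (img \<pi> C)) ?g" using over_conj[OF p E(2)] .
    show "free \<kappa> (\<lambda>k. img ?g (T k)) I (\<lambda>k. ?g (c k)) (\<lambda>k. img \<pi> (E k))"
      using free_img[OF E(3) p] by (simp add: img_comp o_assoc)
    show "img \<pi> (E ozero) = img \<pi> B" using E(4) by simp
    show "img \<pi> (E \<kappa>) \<preceq> img \<pi> F" using img_le'[OF E(5) p] .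
    show "img \<pi> D \<preceq> img \<pi> F" using img_le'[OF E(6) p] .
    show "img \<pi> F \<in> KL" using img_KL[OF E(7) p] .
  qed
qed

section \<open>Transitivity of free squares\<close>

lemma chain_max: "chain \<kappa> T \<Longrightarrow> \<alpha> \<le> \<kappa> \<Longrightarrow> chain \<kappa> (\<lambda>i. T (max \<alpha> i))"
  unfolding chain_def using inc_cont_max[of "{..\<kappa>}" T \<alpha>] by auto

lemma chain_extend:
  assumes T: "chain \<kappa> T" and M: "T \<kappa> \<preceq> M" "M \<in> KL"
  shows "chain (osuc \<kappa>) (T(osuc \<kappa> := M))"
proof (rule chainI)
  note c = chainD[OF T]
  note k = small_greater[OF lam lam_o c(1)]
  have l: "l \<le> \<kappa>" if "l \<le> osuc \<kappa>" "l \<noteq> osuc \<kappa>" for l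
    using that less_osuc_iff[OF k(1), of l] by (simp add: le_less)
  show "small lam (osuc \<kappa>)" by (rule k)
  show "(T(osuc \<kappa> := M)) l \<in> KL" if "l \<le> osuc \<kappa>" for l using l[OF that] c(2) M by auto
  show "(T(osuc \<kappa> := M)) i \<preceq> (T(osuc \<kappa> := M)) j" if ij: "i < j" "j \<le> osuc \<kappa>" for i j
  proof (cases "j = osuc \<kappa>")
    case True
    then have "i \<le> \<kappa>" "i \<noteq> osuc \<kappa>" using ij l[of i] by auto
    then show ?thesis using le_trans[OF c(3)[of i \<kappa>] M(1)] True by simp
  next
    case False
    then show ?thesis using c(3)[of i j] ij l[of j] by auto
  qed
  fix j assume j: "j \<le> osuc \<kappa>" "olimit j"
  then have jn: "j \<noteq> osuc \<kappa>" using not_olimit_osuc[OF k(1)] by auto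
  have "(T(osuc \<kappa> := M)) ` {..<j} = T ` {..<j}"
    by (rule image_cong) (use jn j in auto)
  then show "(T(osuc \<kappa> := M)) j = union_model ((T(osuc \<kappa> := M)) ` {..<j})"
    using c(4)[OF l[OF j(1) jn] j(2)] jn by simp
qed

text \<open>Marks from \<kappa> on carried no condition in the old chain; they are cut off so that
  the added step is marked exactly when this is intended.\<close>

lemma nfchain_extend:
  assumes T: "nfchain \<kappa> T I c" and M: "T \<kappa> \<preceq> M" "M \<in> KL"
  shows "nfchain (osuc \<kappa>) (T(osuc \<kappa> := M)) (I \<inter> {..<\<kappa>}) c"
    and "nf s (T \<kappa>) (T \<kappa>) b M \<Longrightarrow> nfchain (osuc \<kappa>) (T(osuc \<kappa> := M)) (insert \<kappa> (I \<inter> {..<\<kappa>})) (c(\<kappa> := b))"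
proof -
  note cT = nfchainD(1)[OF T]
  note k = small_greater[OF lam lam_o chainD(1)[OF cT]]
  have old: "nf s ((T(osuc \<kappa> := M)) j) ((T(osuc \<kappa> := M)) j) (c j) ((T(osuc \<kappa> := M)) (osuc j))"
    if "j < \<kappa>" "j \<in> I" for j
  proof -
    have "osuc j \<le> \<kappa>" using osuc_le[OF that(1)] .
    then have "osuc j \<noteq> osuc \<kappa>" "j \<noteq> osuc \<kappa>" using k(1) that(1) by auto
    then show ?thesis using nfchainD(2)[OF T that] by simp
  qed
  show "nfchain (osuc \<kappa>) (T(osuc \<kappa> := M)) (I \<inter> {..<\<kappa>}) c"
    unfolding nfchain_def
  proof (intro conjI allI impI)
    fix j assume "j < osuc \<kappa>" "j \<in> I \<inter> {..<\<kappa>}"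
    then show "nf s ((T(osuc \<kappa> := M)) j) ((T(osuc \<kappa> := M)) j) (c j) ((T(osuc \<kappa> := M)) (osuc j))"
      using old[of j] by blast
  qed (rule chain_extend[OF cT M])
  assume b: "nf s (T \<kappa>) (T \<kappa>) b M"
  have "\<kappa> \<noteq> osuc \<kappa>" using k(1) by auto
  then show "nfchain (osuc \<kappa>) (T(osuc \<kappa> := M)) (insert \<kappa> (I \<inter> {..<\<kappa>})) (c(\<kappa> := b))"
    unfolding nfchain_def
  proof (intro conjI allI impI)
    fix j assume j: "j < osuc \<kappa>" "j \<in> insert \<kappa> (I \<inter> {..<\<kappa>})"
    show "nf s ((T(osuc \<kappa> := M)) j) ((T(osuc \<kappa> := M)) j) ((c(\<kappa> := b)) j) ((T(osuc \<kappa> := M)) (osuc j))"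
    proof (cases "j = \<kappa>")
      case True
      then show ?thesis using b \<open>\<kappa> \<noteq> osuc \<kappa>\<close> by simp
    next
      case False
      then have "j < \<kappa>" "j \<in> I" using j by auto
      then show ?thesis unfolding fun_upd_other[OF False, of c b] by (rule old)
    qed
  qed (rule chain_extend[OF cT M])
qed

text \<open>The last step is unmarked, so only monotonicity constrains the top model, which may thus
  be enlarged.\<close>

lemma free_replace_top:
  assumes E: "free (osuc \<kappa>) T I c E" and I: "\<kappa> \<notin> I" and k: "\<kappa> < osuc \<kappa>" and F: "E (osuc \<kappa>) \<preceq> F" "F \<in> KL"
  shows "free (osuc \<kappa>) T I c (E(osuc \<kappa> := F))"
  unfolding free_def
proof (intro conjI allI impI)
  note e = freeD[OF E]
  have "E \<kappa> \<preceq> F" using le_trans[OF chainD(3)[OF e(1) less_imp_le[OF k] order.refl] F(1)] .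
  then show "chain (osuc \<kappa>) (E(osuc \<kappa> := F))"
    using chain_extend[OF chain_mono[OF e(1) less_imp_le[OF k]] _ F(2)] by blast
  show "T j \<preceq> (E(osuc \<kappa> := F)) j" if "j \<le> osuc \<kappa>" for j
    using e(2)[OF that] le_trans[OF e(2)[OF order.refl] F(1)] by simp
  fix j assume j: "j < osuc \<kappa>" "j \<in> I"
  then have "j < \<kappa>" using less_osuc_iff[OF k] I by (auto simp: le_less)
  then have "osuc j \<noteq> osuc \<kappa>" "j \<noteq> osuc \<kappa>" using osuc_le[of j \<kappa>] k by auto
  then show "nf s (T j) ((E(osuc \<kappa> := F)) j) (c j) ((E(osuc \<kappa> := F)) (osuc j))"
    using e(3)[OF j] by simp
qed

text \<open>A copy of the test chain, placed over \<open>C\<close> by amalgamating its top with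
  \<open>D\<close>, is its own free extension.\<close>

lemma NFall_triv:
  assumes "A \<preceq> C" "C \<preceq> D" "A \<in> KL" "C \<in> KL" "D \<in> KL"
  shows "NFall A A C D"
  unfolding NFall_def
proof (intro conjI allI impI)
  show "square A A C D" unfolding square_def using assms KL_refl le_trans by blast
  fix \<kappa> T I c assume T: "nfchain \<kappa> T I c \<and> T ozero = A \<and> C \<preceq> T \<kappa>"
  then have TK: "T \<kappa> \<in> KL" using chainD(2)[OF nfchainD(1), of \<kappa> T I c \<kappa>] by auto
  obtain N \<pi> where N: "N \<in> KL" "D \<preceq> N" "bij \<pi>" "over (univ C) \<pi>" "img \<pi> (T \<kappa>) \<preceq> N"
    by (rule amalgam[OF assms(4,5) TK assms(2)]) (use T in blast)
  have "img \<pi> (T ozero) = A" using img_over_le[OF assms(1) over_le[OF N(4) assms(1)]] T by simp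
  then show "\<exists>E g F. bij g \<and> over (univ C) g \<and> free \<kappa> (\<lambda>k. img g (T k)) I (\<lambda>k. g (c k)) E \<and> E ozero = A \<and>
        E \<kappa> \<preceq> F \<and> D \<preceq> F \<and> F \<in> KL"
    using free_refl[OF nfchain_img[of \<kappa> T I c \<pi>]] T N
    by (intro exI[of _ "\<lambda>k. img \<pi> (T k)"] exI[of _ \<pi>] exI[of _ N]) auto
qed

text \<open>The test chain is lifted through the squares one after another, each lift being the test
  chain of the next square. A square only promises a model \<open>F\<close> above both the lifted
  chain and the next member of \<open>D\<close>, whereas the next square wants that member below the
  top of the chain; a spare unmarked last step, whose top can be enlarged to \<open>F\<close>,
  closes this gap.\<close>

lemma NFall_chain:
  assumes B: "chain \<iota> B" and D: "chain \<iota> D" and BD: "B ozero \<preceq> D ozero"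
    and nf: "\<And>i. i < \<iota> \<Longrightarrow> NFall (B i) (B (osuc i)) (D i) (D (osuc i))"
  shows "NFall (B ozero) (B \<iota>) (D ozero) (D \<iota>)"
proof -
  note b = chainD[OF B] and d = chainD[OF D]
  have le: "B i \<preceq> D i" if "i \<le> \<iota>" for i
    using that
  proof (induction i rule: less_induct)
    case (less i)
    show ?case
    proof (cases i rule: ord_cases)
      case 1
      then show ?thesis using BD by simp
    next
      case (2 j)
      then have "NFall (B j) (B i) (D j) (D i)" using nf[of j] less.prems by simp
      then show ?thesis unfolding NFall_def square_def by blast
    next
      case 3
      show ?thesis
      proof (rule chain_le_union[OF B 3 less.prems])
        fix \<beta> assume "\<beta> < i"
        then show "B \<beta> \<preceq> D i" using le_trans[OF less.IH d(3)[of \<beta> i]] less.prems by simp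
      qed
    qed
  qed
  have z\<iota>: "ozero \<le> \<iota>" by (rule ozero_le)
  have sq: "square (B ozero) (B \<iota>) (D ozero) (D \<iota>)"
    unfolding square_def using b(2,3) d(2,3) z\<iota> le BD by auto
  have "\<exists>E g F. bij g \<and> over (univ (D ozero)) g \<and> free \<kappa> (\<lambda>k. img g (T k)) I (\<lambda>k. g (c k)) E \<and>
      E ozero = B \<iota> \<and> E \<kappa> \<preceq> F \<and> D \<iota> \<preceq> F \<and> F \<in> KL"
    if T0: "nfchain \<kappa> T I c" "T ozero = B ozero" "D ozero \<preceq> T \<kappa>" for \<kappa> T I c
  proof -
    \<comment> \<open>The spare last step; at first it repeats \<open>T \<kappa>\<close>.\<close>
    let ?k = "osuc \<kappa>" and ?I = "I \<inter> {..<\<kappa>}"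
    let ?T = "T(?k := T \<kappa>)"
    note k = small_greater[OF lam lam_o chainD(1)[OF nfchainD(1)[OF T0(1)]]]
    have k0: "?k \<noteq> ozero" using k(1) by auto
    have TK: "T \<kappa> \<in> KL" using chainD(2)[OF nfchainD(1)[OF T0(1)]] by blast
    have T: "nfchain ?k ?T ?I c" by (rule nfchain_extend(1)[OF T0(1) KL_refl[OF TK] TK])
    define Inv where "Inv i S \<longleftrightarrow> free ?k ?T ?I c (fst S) \<and> bij (snd S) \<and> fst S ozero = img (snd S) (B i) \<and>
        img (snd S) (D i) \<preceq> fst S ?k" for i and S :: "('o \<Rightarrow> ('a, 'f, 'r) model) \<times> ('a \<Rightarrow> 'a)"
    define rel where "rel i j S S' \<longleftrightarrow> (\<forall>k\<le>?k. fst S k \<preceq> fst S' k) \<and> (\<forall>y\<in>univ (D i). snd S' y = snd S y)"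
      for i and j :: 'o and S S' :: "('o \<Rightarrow> ('a, 'f, 'r) model) \<times> ('a \<Rightarrow> 'a)"
    define LimR where "LimR \<alpha> F S \<longleftrightarrow> (\<forall>k\<le>?k. fst S k = union_model ((\<lambda>\<beta>. fst (F \<beta>) k) ` {..<\<alpha>}))"
      for \<alpha> :: 'o and F :: "'o \<Rightarrow> ('o \<Rightarrow> ('a, 'f, 'r) model) \<times> ('a \<Rightarrow> 'a)"
        and S :: "('o \<Rightarrow> ('a, 'f, 'r) model) \<times> ('a \<Rightarrow> 'a)"
    obtain F where F: "F ozero = (?T, id)" "\<And>j. j \<in> {..\<iota>} \<Longrightarrow> Inv j (F j)"
      "\<And>i j. i < j \<Longrightarrow> j \<in> {..\<iota>} \<Longrightarrow> rel i j (F i) (F j)"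
      "\<And>j. j \<in> {..\<iota>} \<Longrightarrow> olimit j \<Longrightarrow> LimR j F (F j)"
    proof (rule chain_recursion[of "{..\<iota>}" rel LimR Inv "(?T, id)"])
      show "l \<in> {..\<iota>}" if "k \<in> {..\<iota>}" "l < k" for k l using that by auto
      show "rel k m S S''" if "k < l" "l < m" "m \<in> {..\<iota>}" "rel k l S S'" "rel l m S' S''" for k l m S S' S''
      proof -
        have "univ (D k) \<subseteq> univ (D l)" using le_univ[OF d(3)[of k l]] that by auto
        moreover have "\<forall>k\<le>?k. fst S k \<preceq> fst S'' k" using that(4,5) le_trans unfolding rel_def by blast
        ultimately show ?thesis using that(4,5) unfolding rel_def by auto
      qed
      show "LimR \<alpha> g S" if "\<And>\<beta>. \<beta> < \<alpha> \<Longrightarrow> f \<beta> = g \<beta>" "LimR \<alpha> f S" for \<alpha> f g S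
      proof -
        have "(\<lambda>\<beta>. fst (f \<beta>) k) ` {..<\<alpha>} = (\<lambda>\<beta>. fst (g \<beta>) k) ` {..<\<alpha>}" for k
          by (rule image_cong) (auto simp: that(1))
        then show ?thesis using that(2) unfolding LimR_def by simp
      qed
      show "Inv ozero (?T, id)"
        unfolding Inv_def using free_refl[OF T] T0(2,3) k0 by (simp add: img_id)
      show "\<exists>S'. Inv (osuc j) S' \<and> rel j (osuc j) S S'"
        if j: "j < osuc j" "osuc j \<in> {..\<iota>}" "Inv j S" for j S
      proof -
        obtain E h where S: "S = (E, h)" by (cases S)
        have E: "free ?k ?T ?I c E" "bij h" "E ozero = img h (B j)" "img h (D j) \<preceq> E ?k"
          using j(3) unfolding Inv_def S by auto
        have jj: "j < \<iota>" using j by auto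
        obtain E1 g F where E1: "bij g" "over (univ (img h (D j))) g"
            "free ?k (\<lambda>k. img g (E k)) ?I (\<lambda>k. g (c k)) E1" "E1 ozero = img h (B (osuc j))"
            "E1 ?k \<preceq> F" "img h (D (osuc j)) \<preceq> F" "F \<in> KL"
          by (rule NFallE[OF NFall_img[OF nf[OF jj] E(2)] free_nfchain[OF E(1)] E(3,4)])
        have fr: "free ?k (\<lambda>k. img g (E k)) ?I (\<lambda>k. g (c k)) (E1(?k := F))"
          by (rule free_replace_top[OF E1(3) _ k(1) E1(5,7)]) simp
        have bi: "bij (inv g)" using E1(1) by (rule bij_imp_bij_inv)
        have ig: "inv g (g y) = y" for y using E1(1) by (simp add: bij_is_inj)
        let ?E = "\<lambda>k. img (inv g) ((E1(?k := F)) k)"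
        have fr2: "free ?k E ?I c ?E"
          using free_img[OF fr bi] unfolding img_inv[OF E1(1)] ig .
        have bh: "bij (inv g \<circ> h)" using E(2) bi by (rule bij_comp)
        have "Inv (osuc j) (?E, inv g \<circ> h)"
          unfolding Inv_def fst_conv snd_conv
        proof (intro conjI)
          show "free ?k ?T ?I c ?E" using free_trans[OF E(1) fr2] .
          show "?E ozero = img (inv g \<circ> h) (B (osuc j))" using k0 E1(4) by (simp add: img_comp)
          show "img (inv g \<circ> h) (D (osuc j)) \<preceq> ?E ?k" using img_le'[OF E1(6) bi] by (simp add: img_comp)
        qed (rule bh)
        moreover have "rel j (osuc j) S (?E, inv g \<circ> h)"
        proof -
          have "(inv g \<circ> h) y = h y" if "y \<in> univ (D j)" for y
            using over_inv[OF E1(1,2)] that unfolding over_def by simp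
          then show ?thesis unfolding rel_def S using freeD(2)[OF fr2] by simp
        qed
        ultimately show ?thesis by blast
      qed
      show "\<exists>S. Inv \<alpha> S \<and> (\<forall>\<beta><\<alpha>. rel \<beta> \<alpha> (F \<beta>) S) \<and> LimR \<alpha> F S"
        if a: "olimit \<alpha>" "\<alpha> \<in> {..\<iota>}" and inv: "\<And>\<beta>. \<beta> < \<alpha> \<Longrightarrow> Inv \<beta> (F \<beta>)"
          and rl: "\<And>\<beta> \<gamma>. \<beta> < \<gamma> \<Longrightarrow> \<gamma> < \<alpha> \<Longrightarrow> rel \<beta> \<gamma> (F \<beta>) (F \<gamma>)"
          and lm: "\<And>\<beta>. \<beta> < \<alpha> \<Longrightarrow> olimit \<beta> \<Longrightarrow> LimR \<beta> F (F \<beta>)" for \<alpha> F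
      proof -
        have ai: "\<alpha> \<le> \<iota>" using a by simp
        define H where "H = (\<lambda>k. union_model ((\<lambda>\<beta>. fst (F \<beta>) k) ` {..<\<alpha>}))"
        have fr: "free ?k ?T ?I c (fst (F \<beta>))" if "\<beta> < \<alpha>" for \<beta> using inv[OF that] unfolding Inv_def by blast
        have fH: "free ?k ?T ?I c H" and lim: "\<And>k \<beta>. k \<le> ?k \<Longrightarrow> \<beta> < \<alpha> \<Longrightarrow> fst (F \<beta>) k \<preceq> H k"
          unfolding H_def
          by (rule free_limit[OF a(1) small_mono[OF b(1) ai] fr];
            use rl lm in \<open>auto simp: rel_def LimR_def\<close>)+
        obtain \<pi> where pi: "bij \<pi>" "\<forall>\<beta><\<alpha>. \<forall>y\<in>univ (D \<beta>). \<pi> y = snd (F \<beta>) y"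
          by (rule glue_perms[OF D a(1) ai, of "\<lambda>\<beta>. snd (F \<beta>)"]) (use inv rl in \<open>auto simp: Inv_def rel_def\<close>)
        have "img \<pi> (D \<alpha>) \<preceq> H ?k"
        proof (rule img_le_limit[OF D a(1) ai pi])
          fix \<beta> assume bb: "\<beta> < \<alpha>"
          have "img (snd (F \<beta>)) (D \<beta>) \<preceq> fst (F \<beta>) ?k" using inv[OF bb] unfolding Inv_def by blast
          then show "img (snd (F \<beta>)) (D \<beta>) \<preceq> H ?k" using le_trans lim[OF order.refl bb] by blast
        qed
        moreover have "H ozero = img \<pi> (B \<alpha>)"
        proof -
          have "fst (F \<beta>) ozero = img \<pi> (B \<beta>)" if bb: "\<beta> < \<alpha>" for \<beta>
          proof -
            have bi: "\<beta> \<le> \<iota>" using bb ai by simp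
            have "\<forall>y\<in>univ (B \<beta>). snd (F \<beta>) y = \<pi> y" using pi(2) bb le_univ[OF le[OF bi]] by auto
            then show ?thesis using inv[OF bb] img_agree[OF b(2)[OF bi]] unfolding Inv_def by simp
          qed
          then have "(\<lambda>\<beta>. fst (F \<beta>) ozero) ` {..<\<alpha>} = img \<pi> ` B ` {..<\<alpha>}" by (auto simp: image_image)
          then show ?thesis unfolding H_def using b(4)[OF ai a(1)] by (simp add: img_union_model)
        qed
        ultimately have "Inv \<alpha> (H, \<pi>)" unfolding Inv_def using fH pi(1) by simp
        moreover have "rel \<beta> \<alpha> (F \<beta>) (H, \<pi>)" if "\<beta> < \<alpha>" for \<beta>
          unfolding rel_def using lim[OF _ that] pi(2) that by simp
        ultimately show ?thesis unfolding LimR_def H_def by auto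
      qed
    qed (rule that)
    obtain E h where Eh: "F \<iota> = (E, h)" by (cases "F \<iota>")
    have E: "free ?k ?T ?I c E" "bij h" "E ozero = img h (B \<iota>)" "img h (D \<iota>) \<preceq> E ?k"
      using F(2)[of \<iota>] unfolding Inv_def Eh by auto
    have h0: "over (univ (D ozero)) h"
      using F(3)[of ozero \<iota>] F(1) Eh z\<iota> unfolding rel_def over_def by (cases "\<iota> = ozero") auto
    have bi: "bij (inv h)" using E(2) by (rule bij_imp_bij_inv)
    let ?E = "\<lambda>k. img (inv h) (E k)"
    have fE: "free ?k (\<lambda>k. img (inv h) (?T k)) ?I (\<lambda>k. inv h (c k)) ?E" using free_img[OF E(1) bi] .
    note fD = freeD[OF fE]
    \<comment> \<open>The spare step is dropped again; its top survives as the model above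
      \<open>D \<iota>\<close>.\<close>
    have "free \<kappa> (\<lambda>k. img (inv h) (T k)) I (\<lambda>k. inv h (c k)) ?E"
      unfolding free_def
    proof (intro conjI allI impI)
      show "chain \<kappa> ?E" using chain_mono[OF fD(1) less_imp_le[OF k(1)]] .
      show "img (inv h) (T j) \<preceq> ?E j" if "j \<le> \<kappa>" for j
      proof -
        have "j < ?k" using that k(1) by simp
        then have "j \<noteq> ?k" "j \<le> ?k" by auto
        then show ?thesis using fD(2)[of j] by (simp only: fun_upd_def if_False simp_thms)
      qed
      fix j assume j: "j < \<kappa>" "j \<in> I"
      then have jk: "j < ?k" using k(1) by simp
      then show "nf s (img (inv h) (T j)) (?E j) (inv h (c j)) (?E (osuc j))" using fD(3)[OF jk] j by (simp add: less_imp_neq)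
    qed
    moreover have "?E ozero = B \<iota>" using E(3) img_inv[OF E(2)] by simp
    moreover have "?E \<kappa> \<preceq> ?E ?k" using chainD(3)[OF fD(1) less_imp_le[OF k(1)] order.refl] .
    moreover have "D \<iota> \<preceq> ?E ?k" using img_le'[OF E(4) bi] unfolding img_inv[OF E(2)] .
    moreover have "?E ?k \<in> KL" using chainD(2)[OF fD(1)] by blast
    moreover have "over (univ (D ozero)) (inv h)" using over_inv[OF E(2) h0] .
    ultimately show ?thesis using bi by blast
  qed
  then show ?thesis unfolding NFall_def using sq by blast
qed

section \<open>Resolving an extension along a chain\<close>

text \<open>By local character \<open>d\<close> is free from \<open>P \<delta>\<close> over some
  early \<open>P m0\<close>. From the next index on, a chain capturing \<open>d\<close> is built
  freely above the given one; below that index the chain is left unchanged and the squares are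
  trivial.\<close>

lemma free_chain_step:
  assumes P: "chain \<delta> P" "olimit \<delta>" and d: "nf s (P \<delta>) (P \<delta>) d U"
  obtains W U' where "chain \<delta> W" "\<And>\<alpha>. \<alpha> \<le> \<delta> \<Longrightarrow> P \<alpha> \<preceq> W \<alpha>" "U \<preceq> U'" "W \<delta> \<preceq> U'" "U' \<in> KL" "d \<in> univ (W \<delta>)"
    "\<And>\<alpha>. \<alpha> < \<delta> \<Longrightarrow> NFall (P \<alpha>) (W \<alpha>) (P \<delta>) (W \<delta>)"
proof -
  note p = chainD[OF P(1)]
  have "\<exists>\<alpha><\<delta>. nf s (P \<alpha>) (P \<delta>) d U"
    by (rule nf_local[OF P(2)]) (use P(1) d in \<open>auto simp: chain_def\<close>)
  then obtain m0 where m0: "m0 < \<delta>" "nf s (P m0) (P \<delta>) d U" by blast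
  \<comment> \<open>A successor index is taken because the final chain switches from
    \<open>P\<close> to the new models at \<open>m\<close>; at a limit the switch would in general
    break continuity.\<close>
  define m where "m = osuc m0"
  have m: "m0 < m" "m < \<delta>" "\<not> olimit m" "m \<noteq> ozero"
    unfolding m_def using olimit_osuc[OF P(2) m0(1)] osuc_greater[OF m0(1)] not_olimit_osuc by auto
  have Pm: "P m \<in> KL" "P m \<preceq> P \<delta>" using p(2,3) m(2) by auto
  have dm: "nf s (P m) (P \<delta>) d U"
    using nf_base[OF m0(2) p(3)[of m0 m] Pm(2,1)] m by simp
  define Q where "Q \<alpha> = P (max m \<alpha>)" for \<alpha>
  have cQ: "chain \<delta> Q" unfolding Q_def using chain_max[OF P(1)] m(2) by simp
  note q = chainD[OF cQ]
  have Q0: "Q ozero = P m" unfolding Q_def using max.absorb1[OF ozero_le[of m]] by simp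
  have Qd: "Q \<delta> = P \<delta>" unfolding Q_def using m(2) by (simp add: max_def)
  define Inv where "Inv k S \<longleftrightarrow> fst S \<in> KL \<and> bij (snd S) \<and> nf s (P m) (img (snd S) (Q k)) d (fst S)"
    for k and S :: "('a, 'f, 'r) model \<times> ('a \<Rightarrow> 'a)"
  define rel where "rel k l S S' \<longleftrightarrow> fst S \<preceq> fst S' \<and> (\<forall>y\<in>univ (Q k). snd S' y = snd S y) \<and>
      (l = osuc k \<longrightarrow> NFall (img (snd S) (Q k)) (img (snd S') (Q l)) (fst S) (fst S'))"
    for k l and S S' :: "('a, 'f, 'r) model \<times> ('a \<Rightarrow> 'a)"
  define LimR where "LimR \<alpha> F S \<longleftrightarrow> fst S = union_model ((\<lambda>\<beta>. fst (F \<beta>)) ` {..<\<alpha>})"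
    for \<alpha> :: 'o and F :: "'o \<Rightarrow> ('a, 'f, 'r) model \<times> ('a \<Rightarrow> 'a)"
      and S :: "('a, 'f, 'r) model \<times> ('a \<Rightarrow> 'a)"
  \<comment> \<open>\<open>U\<close> serves here merely as an extension of \<open>P m\<close>
    containing \<open>d\<close>. The later members of the chain are replaced by copies added freely
    to it; afterwards these copies are moved back.\<close>
  obtain F where F: "F ozero = (U, id)" "\<And>k. k \<in> {..\<delta>} \<Longrightarrow> Inv k (F k)"
    "\<And>k l. k < l \<Longrightarrow> l \<in> {..\<delta>} \<Longrightarrow> rel k l (F k) (F l)"
    "\<And>k. k \<in> {..\<delta>} \<Longrightarrow> olimit k \<Longrightarrow> LimR k F (F k)"
  proof (rule chain_recursion[of "{..\<delta>}" rel LimR Inv "(U, id)"])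
    show "l \<in> {..\<delta>}" if "k \<in> {..\<delta>}" "l < k" for k l using that by auto
    show "rel k m S S''" if "k < l" "l < m" "m \<in> {..\<delta>}" "rel k l S S'" "rel l m S' S''" for k l m S S' S''
    proof -
      have "univ (Q k) \<subseteq> univ (Q l)" using le_univ[OF q(3)[of k l]] that by auto
      moreover have "m \<noteq> osuc k" using osuc_le[OF that(1)] that(2) by auto
      moreover have "fst S \<preceq> fst S''" using that(4,5) le_trans unfolding rel_def by blast
      ultimately show ?thesis using that(4,5) unfolding rel_def by auto
    qed
    show "LimR \<alpha> g S" if "\<And>\<beta>. \<beta> < \<alpha> \<Longrightarrow> f \<beta> = g \<beta>" "LimR \<alpha> f S" for \<alpha> f g S
    proof -
      have "(\<lambda>\<beta>. fst (f \<beta>)) ` {..<\<alpha>} = (\<lambda>\<beta>. fst (g \<beta>)) ` {..<\<alpha>}" by (rule image_cong) (auto simp: that(1))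
      then show ?thesis using that(2) unfolding LimR_def by simp
    qed
    show "Inv ozero (U, id)"
      unfolding Inv_def using nf_top[OF dm KL_refl[OF Pm(1)] Pm(2,1)] nfD(3)[OF d] Q0 by (simp add: img_id)
    show "\<exists>S'. Inv (osuc k) S' \<and> rel k (osuc k) S S'"
      if k: "k < osuc k" "osuc k \<in> {..\<delta>}" "Inv k S" for k S
    proof -
      obtain W f where S: "S = (W, f)" by (cases S)
      have W: "W \<in> KL" "bij f" "nf s (P m) (img f (Q k)) d W" using k(3) unfolding Inv_def S by auto
      have kk: "k \<le> \<delta>" "osuc k \<le> \<delta>" using k by auto
      let ?R = "img f (Q k)" and ?Q = "img f (Q (osuc k))"
      have RQ: "?R \<preceq> ?Q" using img_le'[OF q(3)[OF less_imp_le[OF k(1)] kk(2)] W(2)] .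
      have RK: "?R \<in> KL" "?Q \<in> KL" using img_KL[OF q(2) W(2)] kk by auto
      \<comment> \<open>A tower of uniqueness triples covering the next member makes the new square
        an instance of \<open>NFex\<close>, and \<open>free_extension\<close> keeps \<open>d\<close>
        free from that member at the same time.\<close>
      obtain \<kappa> Y y where Y: "uqtower \<kappa> Y y" "Y ozero = ?R" "?Q \<preceq> Y \<kappa>" by (rule decomposition[OF RK RQ])
      have n: "nf s (Y ozero) (Y ozero) d W" using nf_selfD[OF W(3)] Y(2) by simp
      obtain R' g where R': "free \<kappa> Y UNIV y R'" "bij g" "over (univ (Y ozero)) g" "img g W = R' ozero"
          "\<forall>k\<le>\<kappa>. nf s (Y ozero) (Y k) (g d) (R' k)"
        by (rule free_extension[OF uqtowerD(3)[OF Y(1)] n])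
      have bi: "bij (inv g)" using R'(2) by (rule bij_imp_bij_inv)
      have ig: "inv g (g z) = z" for z using R'(2) by (simp add: bij_is_inj)
      have ovi: "over (univ ?R) (inv g)" using over_inv[OF R'(2,3)] Y(2) by simp
      have iR: "img (inv g) ?R = ?R" using img_over[OF KL_K[OF RK(1)] ovi] .
      let ?Y = "\<lambda>j. img (inv g) (Y j)" and ?E = "\<lambda>j. img (inv g) (R' j)" and ?f = "inv g \<circ> f"
      have tY: "uqtower \<kappa> ?Y (\<lambda>j. inv g (y j))" using uqtower_img[OF Y(1) bi] .
      have fE: "free \<kappa> ?Y UNIV (\<lambda>j. inv g (y j)) ?E" using free_img[OF R'(1) bi] .
      have E0: "?E ozero = W" using R'(4) img_inv[OF R'(2), of W] by simp
      have EK: "?E \<kappa> \<in> KL" using chainD(2)[OF freeD(1)[OF fE]] by blast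
      have WE: "W \<preceq> ?E \<kappa>" using chainD(3)[OF freeD(1)[OF fE] ozero_le order.refl] E0 by simp
      have bf: "bij ?f" using W(2) bi by (rule bij_comp)
      have QY: "img ?f (Q (osuc k)) \<preceq> ?Y \<kappa>" using img_le'[OF Y(3) bi] by (simp add: img_comp)
      have QK: "img ?f (Q (osuc k)) \<in> KL" using img_KL[OF q(2)[OF kk(2)] bf] .
      have RQ': "?R \<preceq> img ?f (Q (osuc k))" using img_le'[OF RQ bi] unfolding iR by (simp add: img_comp)
      have YE: "?Y \<kappa> \<preceq> ?E \<kappa>" using freeD(2)[OF fE order.refl] .
      have "nf s ?R (Y \<kappa>) (g d) (R' \<kappa>)" using R'(5) Y(2) by simp
      then have "nf s ?R (?Y \<kappa>) d (?E \<kappa>)" using nf_img[of ?R "Y \<kappa>" "g d" "R' \<kappa>", OF _ bi] iR ig by simp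
      then have "nf s ?R (img ?f (Q (osuc k))) d (?E \<kappa>)" using nf_top RQ' QY QK by blast
      then have "nf s (P m) (img ?f (Q (osuc k))) d (?E \<kappa>)" using nf_trans[OF nf_up[OF W(3) WE EK]] by blast
      then have "Inv (osuc k) (?E \<kappa>, ?f)" unfolding Inv_def using EK bf by simp
      moreover have "rel k (osuc k) S (?E \<kappa>, ?f)"
      proof -
        have "square ?R (img ?f (Q (osuc k))) W (?E \<kappa>)"
          unfolding square_def using RQ' le_trans[OF QY YE] nfD(5)[OF W(3)] WE RK(1) QK W(1) EK by blast
        then have "NFex ?R (img ?f (Q (osuc k))) W (?E \<kappa>)"
          unfolding NFex_def using tY iR Y(2) QY fE E0 KL_refl[OF EK] EK
          by (intro conjI exI[of _ \<kappa>] exI[of _ ?Y] exI[of _ "\<lambda>j. inv g (y j)"] exI[of _ ?E] exI[of _ "?E \<kappa>"]) auto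
        moreover have "?f z = f z" if "z \<in> univ (Q k)" for z using ovi that unfolding over_def by simp
        ultimately show ?thesis unfolding rel_def S using WE NFex_NFall by simp
      qed
      ultimately show ?thesis by blast
    qed
    show "\<exists>S. Inv \<alpha> S \<and> (\<forall>\<beta><\<alpha>. rel \<beta> \<alpha> (F \<beta>) S) \<and> LimR \<alpha> F S"
      if a: "olimit \<alpha>" "\<alpha> \<in> {..\<delta>}" and inv: "\<And>\<beta>. \<beta> < \<alpha> \<Longrightarrow> Inv \<beta> (F \<beta>)"
        and rl: "\<And>\<beta> \<gamma>. \<beta> < \<gamma> \<Longrightarrow> \<gamma> < \<alpha> \<Longrightarrow> rel \<beta> \<gamma> (F \<beta>) (F \<gamma>)"
        and lm: "\<And>\<beta>. \<beta> < \<alpha> \<Longrightarrow> olimit \<beta> \<Longrightarrow> LimR \<beta> F (F \<beta>)" for \<alpha> F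
    proof -
      have ak: "\<alpha> \<le> \<delta>" using a by simp
      let ?W = "\<lambda>\<beta>. fst (F \<beta>)"
      let ?U = "union_model (?W ` {..<\<alpha>})"
      have UK: "?U \<in> KL" and WU: "\<And>\<beta>. \<beta> < \<alpha> \<Longrightarrow> ?W \<beta> \<preceq> ?U"
        by (rule chain_limit[of \<alpha> ?W, OF a(1) small_mono[OF q(1) ak]];
            use inv rl lm in \<open>auto simp: Inv_def rel_def LimR_def\<close>)+
      obtain \<pi> where pi: "bij \<pi>" "\<forall>\<beta><\<alpha>. \<forall>y\<in>univ (Q \<beta>). \<pi> y = snd (F \<beta>) y"
        by (rule glue_perms[OF cQ a(1) ak, of "\<lambda>\<beta>. snd (F \<beta>)"]) (use inv rl in \<open>auto simp: Inv_def rel_def\<close>)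
      have n: "nf s (P m) (img \<pi> (Q \<beta>)) d ?U" if "\<beta> < \<alpha>" for \<beta>
      proof -
        have "img \<pi> (Q \<beta>) = img (snd (F \<beta>)) (Q \<beta>)"
          using img_agree[OF q(2)] pi(2) that ak by auto
        then show ?thesis using nf_up[OF _ WU[OF that] UK] inv[OF that] unfolding Inv_def by auto
      qed
      have "img \<pi> (Q \<alpha>) \<preceq> ?U"
        by (rule chain_le_union[OF chain_img[OF cQ pi(1)] a(1) ak]) (use nfD(5)[OF n] in blast)
      then have "nf s (P m) (img \<pi> (Q \<alpha>)) d ?U"
        using chain_cont[OF chain_img[OF cQ pi(1)] a(1) ak UK] n by blast
      then have "Inv \<alpha> (?U, \<pi>)" unfolding Inv_def using UK pi(1) by simp
      moreover have "rel \<beta> \<alpha> (F \<beta>) (?U, \<pi>)" if "\<beta> < \<alpha>" for \<beta>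
        unfolding rel_def using WU[OF that] pi(2) that not_olimit_osuc[OF osuc_greater[OF that]] a(1) by auto
      ultimately show ?thesis unfolding LimR_def by auto
    qed
  qed (rule that)
  define W where "W k = fst (F k)" for k
  define f where "f = snd (F \<delta>)"
  have inv: "W k \<in> KL" "bij (snd (F k))" "nf s (P m) (img (snd (F k)) (Q k)) d (W k)" if "k \<le> \<delta>" for k
    using F(2)[of k] that unfolding Inv_def W_def by auto
  have rl: "rel k l (F k) (F l)" if "k < l" "l \<le> \<delta>" for k l using F(3) that by simp
  have fk: "snd (F k) y = f y" if "k \<le> \<delta>" "y \<in> univ (Q k)" for k y
    using rl[of k \<delta>] that unfolding rel_def f_def by (cases "k = \<delta>") auto
  have imf: "img (snd (F k)) (Q k) = img f (Q k)" if "k \<le> \<delta>" for k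
    using img_agree[OF q(2)[OF that]] fk[OF that] by blast
  have cW: "chain \<delta> W"
  proof (rule chainI)
    show "W k = union_model (W ` {..<k})" if "k \<le> \<delta>" "olimit k" for k
      using F(4)[of k] that unfolding LimR_def W_def by simp
  qed (use q(1) inv rl in \<open>auto simp: rel_def W_def\<close>)
  have bf: "bij f" using inv(2)[of \<delta>] unfolding f_def by simp
  have W0: "W ozero = U" using F(1) unfolding W_def by simp
  have ovf: "over (univ (P m)) f" using fk[OF ozero_le, symmetric] F(1) Q0 unfolding over_def by simp
  define A where "A k = img f (Q k)" for k
  have cA: "chain \<delta> A" unfolding A_def using chain_img[OF cQ bf] .
  have nW: "nf s (P m) (A k) d (W k)" if "k \<le> \<delta>" for k using inv(3)[OF that] imf[OF that] unfolding A_def by simp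
  have step: "NFall (A k) (A (osuc k)) (W k) (W (osuc k))" if "k < \<delta>" for k
  proof -
    have sk: "k < osuc k" "osuc k \<le> \<delta>" using succ_less[OF q(1) that] by auto
    have "NFall (img (snd (F k)) (Q k)) (img (snd (F (osuc k))) (Q (osuc k))) (W k) (W (osuc k))"
      using rl[OF sk] unfolding rel_def W_def by simp
    then show ?thesis unfolding A_def using imf[of k] imf[OF sk(2)] that by simp
  qed
  have NFA: "NFall (A \<alpha>) (W \<alpha>) (A \<delta>) (W \<delta>)" if al: "\<alpha> \<le> \<delta>" for \<alpha>
  proof -
    have AW: "A \<alpha> \<preceq> W \<alpha>" using nfD(5)[OF nW[OF al]] .
    have "NFall (A (max \<alpha> ozero)) (A (max \<alpha> \<delta>)) (W (max \<alpha> ozero)) (W (max \<alpha> \<delta>))"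
    proof (rule NFall_chain[OF chain_max[OF cA al] chain_max[OF cW al]])
      show "A (max \<alpha> ozero) \<preceq> W (max \<alpha> ozero)" using AW by (simp add: max.absorb1[OF ozero_le])
      fix i assume i: "i < \<delta>"
      show "NFall (A (max \<alpha> i)) (A (max \<alpha> (osuc i))) (W (max \<alpha> i)) (W (max \<alpha> (osuc i)))"
      proof (cases "i < \<alpha>")
        case True
        then have "max \<alpha> i = \<alpha>" "max \<alpha> (osuc i) = \<alpha>" using osuc_le[OF True] by auto
        then show ?thesis
          using NFall_triv[OF AW KL_refl] chainD(2)[OF cA al] inv(1)[OF al] by simp
      next
        case False
        then have "max \<alpha> i = i" "max \<alpha> (osuc i) = osuc i"
          using succ_less(1)[OF q(1) i] by (auto simp: max_def)
        then show ?thesis using step[OF i] by simp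
      qed
    qed
    then have "NFall (A \<alpha>) (A \<delta>) (W \<alpha>) (W \<delta>)" using al by (simp add: max.absorb1[OF ozero_le] max.absorb2)
    then show ?thesis by (rule NFall_flip)
  qed
  have bi: "bij (inv f)" using bf by (rule bij_imp_bij_inv)
  define V where "V k = img (inv f) (W k)" for k
  have iA: "img (inv f) (A k) = Q k" for k unfolding A_def using img_inv[OF bf] .
  have NFV: "NFall (Q \<alpha>) (V \<alpha>) (P \<delta>) (V \<delta>)" if "\<alpha> \<le> \<delta>" for \<alpha>
    using NFall_img[OF NFA[OF that] bi] unfolding iA Qd V_def .
  have cV: "chain \<delta> V" unfolding V_def using chain_img[OF cW bi] .
  have ovi: "over (univ (P m)) (inv f)" using over_inv[OF bf ovf] .
  \<comment> \<open>Moving back has displaced \<open>d\<close> to \<open>d'\<close>. Both are free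
    from \<open>P \<delta>\<close> over \<open>P m\<close> and have the same type there, so by
    uniqueness they have the same type over \<open>P \<delta>\<close>, and one more move over
    \<open>P \<delta>\<close> makes them equal.\<close>
  define d' where "d' = inv f d"
  have n': "nf s (P m) (P \<delta>) d' (V \<delta>)"
    using nf_img[OF nW[OF order.refl] bi] img_over[OF KL_K[OF Pm(1)] ovi] iA[of \<delta>] Qd
    unfolding V_def d'_def by simp
  note m' = nfD[OF n'] and mm = nfD[OF dm]
  have UV: "img (inv f) U \<preceq> V \<delta>"
    using img_le'[OF chainD(3)[OF cW ozero_le order.refl] bi] unfolding W0 V_def .
  have "same_type (P m) d U d' (V \<delta>)"
    unfolding same_type_def d'_def using m'(3) KL_refl[OF m'(3)] bi ovi UV by blast
  then have "tp s d (P m) U = tp s d' (P m) (V \<delta>)"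
    using same_type_iff[OF Pm(1) mm(3) m'(3)] le_trans[OF mm(4,5)] le_trans[OF m'(4,5)] mm(6) m'(6) by blast
  then have "same_type (P \<delta>) d' (V \<delta>) d U" using nf_unique[OF n' dm] by simp
  then obtain U' \<pi> where U': "U' \<in> KL" "U \<preceq> U'" "bij \<pi>" "over (univ (P \<delta>)) \<pi>" "img \<pi> (V \<delta>) \<preceq> U'" "\<pi> d' = d"
    unfolding same_type_def by blast
  define Z where "Z k = img \<pi> (V k)" for k
  have cZ: "chain \<delta> Z" unfolding Z_def using chain_img[OF cV U'(3)] .
  note z = chainD[OF cZ]
  have iQ: "img \<pi> (Q k) = Q k" if "k \<le> \<delta>" for k
    using img_over_le[OF q(3)[OF that order.refl]] over_le[OF U'(4)] q(3)[OF that order.refl] Qd by simp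
  have NFZ: "NFall (Q \<alpha>) (Z \<alpha>) (P \<delta>) (Z \<delta>)" if "\<alpha> \<le> \<delta>" for \<alpha>
    using NFall_img[OF NFV[OF that] U'(3)] iQ[OF that] iQ[of \<delta>] unfolding Z_def Qd by simp
  have QZ: "Q \<alpha> \<preceq> Z \<alpha>" if "\<alpha> \<le> \<delta>" for \<alpha> using NFZ[OF that] unfolding NFall_def square_def by blast
  have PQ: "P \<alpha> \<preceq> Q \<alpha>" if "\<alpha> \<le> \<delta>" for \<alpha> unfolding Q_def using p(3)[of \<alpha> "max m \<alpha>"] that m(2) by simp
  have PZ: "P \<alpha> \<preceq> Z \<alpha>" if "\<alpha> \<le> \<delta>" for \<alpha> using le_trans[OF PQ[OF that] QZ[OF that]] .
  define Y where "Y k = (if k < m then P k else Z k)" for k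
  have cY: "chain \<delta> Y"
  proof (rule chainI)
    show "small lam \<delta>" by (rule p)
    show "Y k \<in> KL" if "k \<le> \<delta>" for k unfolding Y_def using p(2)[OF that] z(2)[OF that] by simp
    show "Y k \<preceq> Y l" if kl: "k < l" "l \<le> \<delta>" for k l
      unfolding Y_def using p(3)[of k l] z(3)[of k l] le_trans[OF p(3)[of k l] PZ[of l]] kl by auto
    fix k assume k: "k \<le> \<delta>" "olimit k"
    show "Y k = union_model (Y ` {..<k})"
    proof (cases "k < m")
      case True
      then have "Y ` {..<k} = P ` {..<k}" unfolding Y_def by (intro image_cong) auto
      then show ?thesis using p(4)[OF k] True unfolding Y_def by simp
    next
      case False
      then have mk: "m < k" using m(3) k(2) by (metis not_less_iff_gr_or_eq)
      have "union_model (Z ` {..<k}) = union_model (Y ` {..<k})"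
      proof (rule union_model_cofinal)
        fix M assume "M \<in> Z ` {..<k}"
        then obtain i where i: "i < k" "M = Z i" by blast
        then have "max m i < k" using mk by simp
        moreover have "M \<preceq> Y (max m i)" unfolding Y_def using z(3)[of i "max m i"] i less_imp_le[OF m(2)] less_le_trans[OF i(1) k(1)] by simp
        ultimately show "\<exists>N\<in>Y ` {..<k}. M \<preceq> N" by blast
      next
        fix M assume "M \<in> Y ` {..<k}"
        then obtain i where i: "i < k" "M = Y i" by blast
        then have "M \<preceq> Z i" unfolding Y_def using PZ[of i] z(3)[of i i] less_le_trans[OF i(1) k(1)] i(2) by simp
        then show "\<exists>N\<in>Z ` {..<k}. M \<preceq> N" using i by blast
      qed
      then show ?thesis using z(4)[OF k] mk unfolding Y_def by simp
    qed
  qed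
  have Yd: "Y \<delta> = Z \<delta>" unfolding Y_def using m(2) by simp
  show ?thesis
  proof (rule that[OF cY _ U'(2) _ U'(1)])
    show "P \<alpha> \<preceq> Y \<alpha>" if "\<alpha> \<le> \<delta>" for \<alpha> unfolding Y_def using PZ[OF that] p(3)[OF order.refl that] by simp
    show "Y \<delta> \<preceq> U'" unfolding Yd Z_def using U'(5) .
    show "d \<in> univ (Y \<delta>)" unfolding Yd Z_def using m'(6) U'(6) by force
    fix \<alpha> assume a: "\<alpha> < \<delta>"
    show "NFall (P \<alpha>) (Y \<alpha>) (P \<delta>) (Y \<delta>)"
    proof (cases "\<alpha> < m")
      case True
      have "NFall (P \<alpha>) (P \<alpha>) (P \<delta>) (Z \<delta>)"
        by (rule NFall_triv) (use p(2,3) PZ z(2) a in auto)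
      then show ?thesis using True unfolding Yd by (simp add: Y_def)
    next
      case False
      then have "Q \<alpha> = P \<alpha>" unfolding Q_def by (simp add: max_def)
      then show ?thesis using NFZ[of \<alpha>] a False unfolding Yd by (simp add: Y_def)
    qed
  qed
qed

text \<open>
  Every extension of the top of a chain of limit length becomes, after a further extension, the
  union of a chain that is freely built over the given one. This replaces the finite character of
  non-forking: a finite set lies in a single member of the resolution.
\<close>

lemma resolution:
  assumes M: "chain \<delta> M" "olimit \<delta>" and N: "N \<in> KL" "M \<delta> \<preceq> N"
  obtains W where "chain \<delta> W" "N \<preceq> W \<delta>" "\<And>\<alpha>. \<alpha> < \<delta> \<Longrightarrow> NFall (M \<alpha>) (W \<alpha>) (M \<delta>) (W \<delta>)"
proof -
  \<comment> \<open>With no marked steps \<open>free\<close> reduces to a chain lying above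
    \<open>M\<close>, and the element function is an arbitrary filler.\<close>
  let ?D = "{i :: 'o. small lam i}" and ?c = "\<lambda>_ :: 'o. undefined :: 'a"
  have nfM: "nfchain \<delta> M {} ?c" unfolding nfchain_def using M(1) by simp
  define Inv where "Inv i S \<longleftrightarrow> free \<delta> M {} ?c (fst S) \<and> fst S \<delta> \<preceq> snd S \<and> snd S \<in> KL"
    for i :: 'o and S :: "('o \<Rightarrow> ('a, 'f, 'r) model) \<times> ('a, 'f, 'r) model"
  \<comment> \<open>A state is a row above \<open>M\<close> together with a growing target for the
    top of the row. Unless the top has caught up, a successor step absorbs a new element of the
    target by \<open>free_chain_step\<close>.\<close>
  define rel where "rel i j S S' \<longleftrightarrow> (\<forall>k\<le>\<delta>. fst S k \<preceq> fst S' k) \<and> snd S \<preceq> snd S' \<and>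
      (j = osuc i \<longrightarrow> fst S \<delta> \<noteq> snd S \<longrightarrow> (\<forall>\<alpha><\<delta>. NFall (fst S \<alpha>) (fst S' \<alpha>) (fst S \<delta>) (fst S' \<delta>)) \<and>
        (\<exists>x\<in>univ (snd S). x \<in> univ (fst S' \<delta>) \<and> x \<notin> univ (fst S \<delta>)))"
    for i j :: 'o and S S' :: "('o \<Rightarrow> ('a, 'f, 'r) model) \<times> ('a, 'f, 'r) model"
  define LimR where "LimR \<alpha> F S \<longleftrightarrow> (\<forall>k\<le>\<delta>. fst S k = union_model ((\<lambda>\<beta>. fst (F \<beta>) k) ` {..<\<alpha>})) \<and>
      snd S = union_model ((\<lambda>\<beta>. snd (F \<beta>)) ` {..<\<alpha>})"
    for \<alpha> :: 'o and F :: "'o \<Rightarrow> ('o \<Rightarrow> ('a, 'f, 'r) model) \<times> ('a, 'f, 'r) model"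
      and S :: "('o \<Rightarrow> ('a, 'f, 'r) model) \<times> ('a, 'f, 'r) model"
  obtain F where F: "F ozero = (M, N)" "\<And>j. j \<in> ?D \<Longrightarrow> Inv j (F j)"
    "\<And>i j. i < j \<Longrightarrow> j \<in> ?D \<Longrightarrow> rel i j (F i) (F j)"
    "\<And>j. j \<in> ?D \<Longrightarrow> olimit j \<Longrightarrow> LimR j F (F j)"
  proof (rule chain_recursion[of ?D rel LimR Inv "(M, N)"])
    show "l \<in> ?D" if "k \<in> ?D" "l < k" for k l using that small_mono[of lam k l] by auto
    show "rel k m S S''" if "k < l" "l < m" "m \<in> ?D" "rel k l S S'" "rel l m S' S''" for k l m S S' S''
    proof -
      have "m \<noteq> osuc k" using osuc_le[OF that(1)] that(2) by auto
      then show ?thesis using that(4,5) le_trans unfolding rel_def by blast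
    qed
    show "LimR \<alpha> g S" if "\<And>\<beta>. \<beta> < \<alpha> \<Longrightarrow> f \<beta> = g \<beta>" "LimR \<alpha> f S" for \<alpha> f g S
    proof -
      have "(\<lambda>\<beta>. fst (f \<beta>) k) ` {..<\<alpha>} = (\<lambda>\<beta>. fst (g \<beta>) k) ` {..<\<alpha>}"
        "(\<lambda>\<beta>. snd (f \<beta>)) ` {..<\<alpha>} = (\<lambda>\<beta>. snd (g \<beta>)) ` {..<\<alpha>}" for k
        by (rule image_cong; auto simp: that(1))+
      then show ?thesis using that(2) unfolding LimR_def by simp
    qed
    show "Inv ozero (M, N)" unfolding Inv_def using free_refl[OF nfM] N by simp
    show "\<exists>S'. Inv (osuc j) S' \<and> rel j (osuc j) S S'"
      if j: "j < osuc j" "osuc j \<in> ?D" "Inv j S" for j S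
    proof -
      obtain P U where S: "S = (P, U)" by (cases S)
      have P: "free \<delta> M {} ?c P" "P \<delta> \<preceq> U" "U \<in> KL" using j(3) unfolding Inv_def S by auto
      note p = freeD[OF P(1)]
      have PK: "P \<delta> \<in> KL" using chainD(2)[OF p(1)] by blast
      show ?thesis
      proof (cases "P \<delta> = U")
        case True
        then have "rel j (osuc j) S S"
          unfolding rel_def S using KL_refl[OF P(3)] KL_refl[OF chainD(2)[OF p(1)]] by simp
        then show ?thesis using j(3) unfolding Inv_def by blast
      next
        case False
        obtain d where d: "nf s (P \<delta>) (P \<delta>) d U" by (rule nf_density[OF PK P(3,2) False])
        obtain W U' where W: "chain \<delta> W" "\<And>\<alpha>. \<alpha> \<le> \<delta> \<Longrightarrow> P \<alpha> \<preceq> W \<alpha>" "U \<preceq> U'" "W \<delta> \<preceq> U'" "U' \<in> KL" "d \<in> univ (W \<delta>)"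
            "\<And>\<alpha>. \<alpha> < \<delta> \<Longrightarrow> NFall (P \<alpha>) (W \<alpha>) (P \<delta>) (W \<delta>)"
          by (rule free_chain_step[OF p(1) M(2) d]) blast
        have "free \<delta> M {} ?c W"
          unfolding free_def using W(1) le_trans[OF p(2) W(2)] by simp
        then have "Inv (osuc j) (W, U')" unfolding Inv_def using W(4,5) by simp
        moreover have "rel j (osuc j) S (W, U')"
          unfolding rel_def S using W(2,3,6,7) nfD(6,7)[OF d] by auto
        ultimately show ?thesis by blast
      qed
    qed
    show "\<exists>S. Inv \<alpha> S \<and> (\<forall>\<beta><\<alpha>. rel \<beta> \<alpha> (F \<beta>) S) \<and> LimR \<alpha> F S"
      if a: "olimit \<alpha>" "\<alpha> \<in> ?D" and inv: "\<And>\<beta>. \<beta> < \<alpha> \<Longrightarrow> Inv \<beta> (F \<beta>)"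
        and rl: "\<And>\<beta> \<gamma>. \<beta> < \<gamma> \<Longrightarrow> \<gamma> < \<alpha> \<Longrightarrow> rel \<beta> \<gamma> (F \<beta>) (F \<gamma>)"
        and lm: "\<And>\<beta>. \<beta> < \<alpha> \<Longrightarrow> olimit \<beta> \<Longrightarrow> LimR \<beta> F (F \<beta>)" for \<alpha> F
    proof -
      define H where "H = (\<lambda>k. union_model ((\<lambda>\<beta>. fst (F \<beta>) k) ` {..<\<alpha>}))"
      let ?V = "union_model ((\<lambda>\<beta>. snd (F \<beta>)) ` {..<\<alpha>})"
      have sm: "small lam \<alpha>" using a by simp
      have fr: "free \<delta> M {} ?c (fst (F \<beta>))" if "\<beta> < \<alpha>" for \<beta> using inv[OF that] unfolding Inv_def by blast
      have fH: "free \<delta> M {} ?c H" and lim: "\<And>k \<beta>. k \<le> \<delta> \<Longrightarrow> \<beta> < \<alpha> \<Longrightarrow> fst (F \<beta>) k \<preceq> H k"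
        unfolding H_def
        by (rule free_limit[OF a(1) sm fr]; use rl lm in \<open>auto simp: rel_def LimR_def\<close>)+
      have V: "?V \<in> KL" "\<And>\<beta>. \<beta> < \<alpha> \<Longrightarrow> snd (F \<beta>) \<preceq> ?V"
        by (rule chain_limit[of \<alpha> "\<lambda>\<beta>. snd (F \<beta>)", OF a(1) sm]; use inv rl lm in \<open>auto simp: Inv_def rel_def LimR_def\<close>)+
      have "H \<delta> \<preceq> ?V"
        unfolding H_def
      proof (rule chain_limit(3)[of \<alpha> "\<lambda>\<beta>. fst (F \<beta>) \<delta>", OF a(1) sm])
        show "fst (F \<beta>) \<delta> \<preceq> ?V" if "\<beta> < \<alpha>" for \<beta>
          using le_trans[OF _ V(2)[OF that]] inv[OF that] unfolding Inv_def by blast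
        show "fst (F \<beta>) \<delta> \<in> KL" if "\<beta> < \<alpha>" for \<beta> using chainD(2)[OF freeD(1)[OF fr[OF that]]] by blast
      qed (use rl lm in \<open>auto simp: rel_def LimR_def\<close>)
      then have "Inv \<alpha> (H, ?V)" unfolding Inv_def using fH V(1) by simp
      moreover have "rel \<beta> \<alpha> (F \<beta>) (H, ?V)" if "\<beta> < \<alpha>" for \<beta>
        unfolding rel_def using lim[OF _ that] V(2)[OF that] not_olimit_osuc[OF osuc_greater[OF that]] a(1) by auto
      ultimately show ?thesis unfolding LimR_def H_def by auto
    qed
  qed (rule that)
  define P where "P i = fst (F i)" for i
  define U where "U i = snd (F i)" for i
  have inv: "chain \<delta> (P i)" "\<And>k. k \<le> \<delta> \<Longrightarrow> M k \<preceq> P i k" "P i \<delta> \<preceq> U i" "U i \<in> KL" if "small lam i" for i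
    using F(2)[of i] that unfolding Inv_def P_def U_def free_def by auto
  have rl: "\<And>k. k \<le> \<delta> \<Longrightarrow> P i k \<preceq> P j k" "U i \<preceq> U j" if "i < j" "small lam j" for i j
    using F(3)[of i j] that unfolding rel_def P_def U_def by auto
  have lm: "\<And>k. k \<le> \<delta> \<Longrightarrow> P i k = union_model ((\<lambda>j. P j k) ` {..<i})" "U i = union_model (U ` {..<i})"
    if "olimit i" "small lam i" for i
    using F(4)[of i] that unfolding LimR_def P_def U_def by auto
  have st: "\<forall>\<alpha><\<delta>. NFall (P i \<alpha>) (P (osuc i) \<alpha>) (P i \<delta>) (P (osuc i) \<delta>)"
      "\<exists>x\<in>univ (U i). x \<in> univ (P (osuc i) \<delta>) \<and> x \<notin> univ (P i \<delta>)" if "P i \<delta> \<noteq> U i" "small lam i" for i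
    using F(3)[OF small_greater(1)[OF lam lam_o that(2)]] small_greater(2)[OF lam lam_o that(2)] that(1)
    unfolding rel_def P_def U_def by auto
  have "\<exists>i. small lam i \<and> univ (P i \<delta>) = univ (U i)"
  proof (rule exhaustion[OF lam lam_o, of "\<lambda>i. univ (U i)" "\<lambda>i. univ (P i \<delta>)"])
    show "|univ (U i)| \<le>o lam" if "small lam i" for i using KL_ordLeq[OF inv(4)[OF that]] .
    show "univ (U i) \<subseteq> univ (U j)" "univ (P i \<delta>) \<subseteq> univ (P j \<delta>)" if "i \<le> j" "small lam j" for i j
      using rl[of i j] that le_univ by (cases "i = j"; auto)+
    show "univ (U i) = (\<Union>j<i. univ (U j))" if "small lam i" "olimit i" for i
      using lm(2)[OF that(2,1)] by simp
    fix i assume i: "small lam i" "univ (P i \<delta>) \<noteq> univ (U i)"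
    then have "P i \<delta> \<noteq> U i" by auto
    then show "\<exists>c. c \<in> univ (U i) \<and> c \<in> univ (P (osuc i) \<delta>) \<and> c \<notin> univ (P i \<delta>)" using st(2) i(1) by blast
  qed
  then have ex: "\<exists>i. small lam i \<and> P i \<delta> = U i" using inv(3) le_eqI by blast
  define \<kappa> where "\<kappa> = (LEAST i. small lam i \<and> P i \<delta> = U i)"
  have k: "small lam \<kappa>" "P \<kappa> \<delta> = U \<kappa>" unfolding \<kappa>_def using LeastI_ex[OF ex] by auto
  have nk: "P j \<delta> \<noteq> U j" if "j < \<kappa>" for j
    using not_less_Least[of j "\<lambda>i. small lam i \<and> P i \<delta> = U i"] small_mono[OF k(1) less_imp_le[OF that]] that
    unfolding \<kappa>_def by blast
  have sj: "small lam j" if "j \<le> \<kappa>" for j using small_mono[OF k(1) that] .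
  have col: "chain \<kappa> (\<lambda>i. P i a)" if "a \<le> \<delta>" for a
    by (rule chainI) (use k(1) chainD(2)[OF inv(1) that] rl(1)[OF _ _ that] lm(1)[OF _ _ that] sj in auto)
  have P0: "P ozero = M" "U ozero = N" unfolding P_def U_def F(1) by auto
  show ?thesis
  proof (rule that)
    show "chain \<delta> (P \<kappa>)" using inv(1)[OF k(1)] .
    show "N \<preceq> P \<kappa> \<delta>"
      using rl(2)[OF _ k(1), of ozero] ozero_le[of \<kappa>] KL_refl[OF inv(4)[OF k(1)]] k(2) P0
      by (cases "\<kappa> = ozero") auto
    fix \<alpha> assume a: "\<alpha> < \<delta>"
    \<comment> \<open>For fixed \<alpha> the squares between consecutive rows compose, from the
      given chain to the last row.\<close>
    have "NFall (P ozero \<alpha>) (P \<kappa> \<alpha>) (P ozero \<delta>) (P \<kappa> \<delta>)"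
    proof (rule NFall_chain[OF col[OF less_imp_le[OF a]] col[OF order.refl]])
      show "P ozero \<alpha> \<preceq> P ozero \<delta>" unfolding P0 using chainD(3)[OF M(1) less_imp_le[OF a] order.refl] .
      show "NFall (P i \<alpha>) (P (osuc i) \<alpha>) (P i \<delta>) (P (osuc i) \<delta>)" if "i < \<kappa>" for i
        using st(1)[OF nk[OF that] sj] that a by auto
    qed
    then show "NFall (M \<alpha>) (P \<kappa> \<alpha>) (M \<delta>) (P \<kappa> \<delta>)" unfolding P0 .
  qed
qed

section \<open>Finite independent sequences\<close>

text \<open>The extensions \<open>N'\<close> make the notion insensitive to shrinking \<open>N\<close>.\<close>

fun indl where
  "indl M A [] N \<longleftrightarrow> M \<in> KL \<and> A \<in> KL \<and> N \<in> KL \<and> M \<preceq> A \<and> A \<preceq> N"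
| "indl M A (b # bs) N \<longleftrightarrow> A \<preceq> N \<and> N \<in> KL \<and> (\<exists>N' Q. N \<preceq> N' \<and> nf s M A b Q \<and> indl M Q bs N')"

lemma indl_ConsE:
  assumes "indl M A (b # bs) N"
  obtains N' Q where "N \<preceq> N'" "nf s M A b Q" "indl M Q bs N'"
  using assms by auto

lemma indlD:
  assumes "indl M A bs N"
  shows "M \<in> KL" "A \<in> KL" "N \<in> KL" "M \<preceq> A" "A \<preceq> N"
  using assms by (cases bs; auto dest: nfD)+

lemma indl_img: "indl M A bs N \<Longrightarrow> bij \<pi> \<Longrightarrow> indl (img \<pi> M) (img \<pi> A) (map \<pi> bs) (img \<pi> N)"
proof (induction bs arbitrary: A N)
  case Nil
  then show ?case by (auto intro: img_KL img_le')
next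
  case (Cons b bs)
  obtain N' Q where q: "N \<preceq> N'" "nf s M A b Q" "indl M Q bs N'" by (rule indl_ConsE[OF Cons.prems(1)])
  have "indl (img \<pi> M) (img \<pi> Q) (map \<pi> bs) (img \<pi> N')" by (rule Cons.IH[OF q(3) Cons.prems(2)])
  then show ?case
    using img_le'[OF q(1) Cons.prems(2)] nf_img[OF q(2) Cons.prems(2)]
      img_le'[OF indlD(5)[OF Cons.prems(1)] Cons.prems(2)] img_KL[OF indlD(3)[OF Cons.prems(1)] Cons.prems(2)]
    by auto
qed

lemma indl_fixed:
  assumes "indl M A bs N" "bij \<pi>" "over (univ M) \<pi>" "over (set bs) \<pi>"
  shows "indl M (img \<pi> A) bs (img \<pi> N)"
proof -
  have "map \<pi> bs = bs" using assms(4) unfolding over_def by (simp add: map_idI)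
  then show ?thesis
    using indl_img[OF assms(1,2)] img_over[OF KL_K[OF indlD(1)[OF assms(1)]] assms(3)] by simp
qed

lemma indl_shrink:
  assumes "indl M A bs N" "N0 \<preceq> N" "A \<preceq> N0" "N0 \<in> KL"
  shows "indl M A bs N0"
proof (cases bs)
  case Nil
  then show ?thesis using assms by simp
next
  case (Cons b bs')
  then have i: "indl M A (b # bs') N" using assms(1) by simp
  obtain N' Q where q: "N \<preceq> N'" "nf s M A b Q" "indl M Q bs' N'" by (rule indl_ConsE[OF i])
  show ?thesis unfolding Cons using q assms(3,4) le_trans[OF assms(2) q(1)] by auto
qed

lemma indl_lower:
  assumes "indl M A bs N" "M \<preceq> A0" "A0 \<preceq> A" "A0 \<in> KL"
  shows "indl M A0 bs N"
proof (cases bs)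
  case Nil
  then show ?thesis using assms le_trans[OF assms(3) indlD(5)[OF assms(1)]] by simp
next
  case (Cons b bs')
  then have i: "indl M A (b # bs') N" using assms(1) by simp
  obtain N' Q where q: "N \<preceq> N'" "nf s M A b Q" "indl M Q bs' N'" by (rule indl_ConsE[OF i])
  show ?thesis
    unfolding Cons
    using q nf_top[OF q(2) assms(2,3,4)] le_trans[OF assms(3) indlD(5)[OF assms(1)]] indlD(3)[OF assms(1)] by auto
qed

text \<open>The witnessing models have to be amalgamated with \<open>N1\<close> over
  \<open>N\<close>; since the elements lie in \<open>N\<close>, the sequence itself stays
  fixed.\<close>

lemma indl_extend:
  "indl M A bs N \<Longrightarrow> set bs \<subseteq> univ N \<Longrightarrow> N \<preceq> N1 \<Longrightarrow> N1 \<in> KL \<Longrightarrow> indl M A bs N1"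
proof (induction bs arbitrary: A N N1)
  case Nil
  then show ?case using le_trans[of A N N1] by simp
next
  case (Cons b bs)
  note d = indlD[OF Cons.prems(1)]
  obtain N' Q where q: "N \<preceq> N'" "nf s M A b Q" "indl M Q bs N'" by (rule indl_ConsE[OF Cons.prems(1)])
  obtain N2 \<pi> where N2: "N2 \<in> KL" "N1 \<preceq> N2" "bij \<pi>" "over (univ N) \<pi>" "img \<pi> N' \<preceq> N2"
    by (rule amalgam[OF d(3) Cons.prems(4) indlD(3)[OF q(3)] Cons.prems(3) q(1)])
  have b: "over (set bs) \<pi>" "\<pi> b = b" using N2(4) Cons.prems(2) unfolding over_def by auto
  have NN: "N \<preceq> img \<pi> N'" using img_le'[OF q(1) N2(3)] img_over[OF KL_K[OF d(3)] N2(4)] by simp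
  have M: "over (univ M) \<pi>" using over_le[OF N2(4) le_trans[OF d(4,5)]] .
  have "indl M (img \<pi> Q) bs N2"
    by (rule Cons.IH[OF indl_fixed[OF q(3) N2(3) M b(1)] _ N2(5,1)]) (use Cons.prems(2) le_univ[OF NN] in auto)
  moreover have "nf s M A b (img \<pi> Q)"
    using nf_img[OF q(2) N2(3)] img_over_le[OF le_trans[OF d(4,5)] M] img_over_le[OF d(5) over_le[OF N2(4) d(5)]] b(2) by simp
  ultimately show ?case using N2(2) le_trans[OF d(5) Cons.prems(3)] Cons.prems(4) by auto
qed

text \<open>The base is enlarged freely under the first element, and the model that then holds both
  is the enlarged base for the rest of the sequence.\<close>

lemma indl_extend_base:
  "indl M R bs N \<Longrightarrow> R \<preceq> S \<Longrightarrow> S \<in> KL \<Longrightarrow>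
    \<exists>\<sigma> N1. bij \<sigma> \<and> over (univ R) \<sigma> \<and> N \<preceq> N1 \<and> indl M (img \<sigma> S) bs N1"
proof (induction bs arbitrary: R N S)
  case Nil
  note d = indlD[OF Nil.prems(1)]
  obtain N1 \<sigma> where N1: "N1 \<in> KL" "N \<preceq> N1" "bij \<sigma>" "over (univ R) \<sigma>" "img \<sigma> S \<preceq> N1"
    by (rule amalgam[OF d(2,3) Nil.prems(3) d(5) Nil.prems(2)])
  have "R \<preceq> img \<sigma> S" using img_le'[OF Nil.prems(2) N1(3)] img_over[OF KL_K[OF d(2)] N1(4)] by simp
  then have "indl M (img \<sigma> S) [] N1" using d(1) N1 img_KL[OF Nil.prems(3) N1(3)] le_trans[OF d(4)] by simp
  then show ?case using N1 by blast
next
  case (Cons b bs)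
  note d = indlD[OF Cons.prems(1)]
  obtain N' Q where q: "N \<preceq> N'" "nf s M R b Q" "indl M Q bs N'" by (rule indl_ConsE[OF Cons.prems(1)])
  obtain N1 \<sigma> where N1: "N1 \<in> KL" "Q \<preceq> N1" "bij \<sigma>" "over (univ R) \<sigma>" "img \<sigma> S \<preceq> N1" "nf s M (img \<sigma> S) b N1"
    by (rule nf_extend[OF q(2) Cons.prems(3,2)])
  obtain \<tau> N2 where N2: "bij \<tau>" "over (univ Q) \<tau>" "N' \<preceq> N2" "indl M (img \<tau> N1) bs N2"
    using Cons.IH[OF q(3) N1(2,1)] by blast
  note n = nfD[OF q(2)] and e = indlD[OF N2(4)]
  have fx: "img \<tau> M = M" "\<tau> b = b"
    using img_over_le[OF le_trans[OF n(4,5)] over_le[OF N2(2) le_trans[OF n(4,5)]]] n(6) N2(2) unfolding over_def by auto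
  have nf: "nf s M (img (\<tau> \<circ> \<sigma>) S) b (img \<tau> N1)"
    using nf_img[OF N1(6) N2(1)] fx by (simp add: img_comp)
  then have "img (\<tau> \<circ> \<sigma>) S \<preceq> N2" using le_trans[OF nfD(5) e(5)] by blast
  then have "indl M (img (\<tau> \<circ> \<sigma>) S) (b # bs) N2" using nf N2(4) e(3) KL_refl[OF e(3)] by auto
  moreover have "over (univ R) (\<tau> \<circ> \<sigma>)" using over_comp[OF over_le[OF N2(2) n(5)] N1(4)] .
  ultimately show ?case using bij_comp[OF N1(3) N2(1)] le_trans[OF q(1) N2(3)] by blast
qed

text \<open>Symmetry produces \<open>C\<close> containing \<open>c\<close> with \<open>b\<close>
  free from \<open>C\<close> inside \<open>N'\<close>, which gives the order \<open>c\<close>,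
  \<open>b\<close>. As \<open>N'\<close> is larger than the base \<open>Q2\<close> of the remaining
  sequence, that base is first enlarged to a copy of \<open>N'\<close>.\<close>

lemma indl_swap:
  assumes "indl M A (b # c # bs) N"
  shows "indl M A (c # b # bs) N"
proof -
  note d = indlD[OF assms]
  obtain N1 Q1 where q1: "N \<preceq> N1" "nf s M A b Q1" "indl M Q1 (c # bs) N1" by (rule indl_ConsE[OF assms])
  obtain N2 Q2 where q2: "N1 \<preceq> N2" "nf s M Q1 c Q2" "indl M Q2 bs N2" by (rule indl_ConsE[OF q1(3)])
  note n1 = nfD[OF q1(2)] and n2 = nfD[OF q2(2)]
  have b2: "nf s M A b Q2" using nf_up[OF q1(2) n2(5,3)] .
  obtain C N' where C: "C \<in> KL" "N' \<in> KL" "c \<in> univ C" "A \<preceq> C" "C \<preceq> N'" "Q2 \<preceq> N'" "nf s A C b N'"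
    by (rule nf_symmetric[OF nf_selfD[OF b2] n1(5,6) nf_base[OF q2(2) n1(4,5,2)]])
  have bC: "nf s M C b N'" using nf_trans[OF nf_up[OF b2 C(6,2)] C(7)] .
  have cC: "nf s M A c C" using nf_down[OF nf_up[OF nf_top[OF q2(2) n1(4,5,2)] C(6,2)] C(5,1,4,3)] .
  obtain \<sigma> N3 where N3: "bij \<sigma>" "over (univ Q2) \<sigma>" "N2 \<preceq> N3" "indl M (img \<sigma> N') bs N3"
    using indl_extend_base[OF q2(3) C(6,2)] by blast
  note e = indlD[OF N3(4)]
  have AQ: "A \<preceq> Q2" using le_trans[OF n1(5) n2(5)] .
  have fx: "img \<sigma> M = M" "img \<sigma> A = A" "\<sigma> b = b" "\<sigma> c = c"
    using img_over_le[OF le_trans[OF n1(4) AQ] over_le[OF N3(2) le_trans[OF n1(4) AQ]]] img_over_le[OF AQ over_le[OF N3(2) AQ]] N3(2) n2(6)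
      le_univ[OF n2(5)] n1(6) unfolding over_def by auto
  have nb: "nf s M (img \<sigma> C) b (img \<sigma> N')" and nc: "nf s M A c (img \<sigma> C)"
    using nf_img[OF bC N3(1)] nf_img[OF cC N3(1)] fx by simp_all
  have "indl M (img \<sigma> C) (b # bs) N3"
    using nb N3(4) KL_refl[OF e(3)] le_trans[OF nfD(5)[OF nb] e(5)] e(3) by auto
  then show ?thesis using nc le_trans[OF q1(1) le_trans[OF q2(1) N3(3)]] d(3,5) by auto
qed

lemma indl_Cons_mono:
  assumes "indl M A (b # xs) N" "\<And>Q N. indl M Q xs N \<Longrightarrow> indl M Q ys N"
  shows "indl M A (b # ys) N"
  using assms by auto

lemma indl_move: "indl M A (ys @ x # zs) N \<Longrightarrow> indl M A (x # ys @ zs) N"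
proof (induction ys arbitrary: A N)
  case (Cons y ys)
  then have i: "indl M A (y # ys @ x # zs) N" by simp
  have "indl M A (y # x # ys @ zs) N" by (rule indl_Cons_mono[OF i]) (rule Cons.IH)
  then show ?case using indl_swap by simp
qed (simp del: indl.simps)

text \<open>Repeatedly bringing the next wanted element to the front reorders the sequence; once
  nothing more is wanted, the rest is discarded.\<close>

lemma indl_subset:
  "indl M A xs N \<Longrightarrow> distinct ys \<Longrightarrow> set ys \<subseteq> set xs \<Longrightarrow> indl M A ys N"
proof (induction ys arbitrary: xs A N)
  case Nil
  then show ?case using indlD[OF Nil.prems(1)] by simp
next
  case (Cons y ys)
  obtain as bs where xs: "xs = as @ y # bs" using Cons.prems(3) split_list[of y xs] by auto
  have "set ys \<subseteq> set (as @ bs)" using Cons.prems(2,3) xs by auto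
  then show ?case
    using indl_Cons_mono[OF indl_move[OF Cons.prems(1)[unfolded xs]] Cons.IH] Cons.prems(2)
    by (simp del: indl.simps)
qed

text \<open>Seen from its end, the sequence places \<open>b\<close> free over a model containing all
  other elements. This form allows comparison with a uniqueness triple for \<open>b\<close>.\<close>

lemma indl_snocD:
  "indl M A (bs @ [b]) N \<Longrightarrow> \<exists>Q N'. N \<preceq> N' \<and> nf s M Q b N' \<and> A \<preceq> Q \<and> indl M A bs Q \<and> set bs \<subseteq> univ Q"
proof (induction bs arbitrary: A N)
  case Nil
  then have i: "indl M A (b # []) N" by simp
  note d = indlD[OF i]
  obtain N' Q where q: "N \<preceq> N'" "nf s M A b Q" "indl M Q [] N'" by (rule indl_ConsE[OF i])
  have "nf s M A b N'" using nf_up[OF q(2)] indlD[OF q(3)] by blast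
  then show ?case using q(1) d KL_refl by auto
next
  case (Cons c bs)
  then have i: "indl M A (c # bs @ [b]) N" by simp
  obtain N1 Q1 where q: "N \<preceq> N1" "nf s M A c Q1" "indl M Q1 (bs @ [b]) N1" by (rule indl_ConsE[OF i])
  obtain Q N' where Q: "N1 \<preceq> N'" "nf s M Q b N'" "Q1 \<preceq> Q" "indl M Q1 bs Q" "set bs \<subseteq> univ Q"
    using Cons.IH[OF q(3)] by blast
  note n = nfD[OF q(2)]
  have AQ: "A \<preceq> Q" using le_trans[OF n(5) Q(3)] .
  have QK: "Q \<in> KL" using nfD(2)[OF Q(2)] .
  have "indl M A (c # bs) Q" using AQ QK KL_refl[OF QK] q(2) Q(4) by auto
  moreover have "c \<in> univ Q" using n(6) le_univ[OF Q(3)] by blast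
  ultimately show ?case using le_trans[OF q(1) Q(1)] Q(2,5) AQ by auto
qed

text \<open>The witnesses for \<open>ks\<close> may lie in an extension of \<open>W\<close>; the
  type of \<open>b\<close> is therefore extended freely to a copy of that extension before the
  induction continues.\<close>

lemma indl_snocI:
  "indl M A ks W \<Longrightarrow> set ks \<subseteq> univ W \<Longrightarrow> nf s M W b D \<Longrightarrow> indl M A (ks @ [b]) D"
proof (induction ks arbitrary: A W D)
  case Nil
  note d = indlD[OF Nil.prems(1)] and n = nfD[OF Nil.prems(3)]
  have "nf s M A b D" using nf_top[OF Nil.prems(3) d(4,5,2)] .
  moreover have "indl M D [] D" using d(1) n(3) KL_refl[OF n(3)] le_trans[OF n(4,5)] by simp
  ultimately show ?case using KL_refl[OF n(3)] le_trans[OF d(5) n(5)] n(3) by auto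
next
  case (Cons c ks)
  note d = indlD[OF Cons.prems(1)] and n = nfD[OF Cons.prems(3)]
  obtain W' Q where q: "W \<preceq> W'" "nf s M A c Q" "indl M Q ks W'" by (rule indl_ConsE[OF Cons.prems(1)])
  obtain D' \<sigma> where D: "D' \<in> KL" "D \<preceq> D'" "bij \<sigma>" "over (univ W) \<sigma>" "img \<sigma> W' \<preceq> D'" "nf s M (img \<sigma> W') b D'"
    by (rule nf_extend[OF Cons.prems(3) indlD(3)[OF q(3)] q(1)])
  have ks: "over (set ks) \<sigma>" "\<sigma> c = c" using D(4) Cons.prems(2) unfolding over_def by auto
  have M: "over (univ M) \<sigma>" using over_le[OF D(4) n(4)] .
  have WW: "W \<preceq> img \<sigma> W'" using img_le'[OF q(1) D(3)] img_over[OF KL_K[OF n(2)] D(4)] by simp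
  have "indl M (img \<sigma> Q) (ks @ [b]) D'"
    by (rule Cons.IH[OF indl_fixed[OF q(3) D(3) M ks(1)] _ D(6)]) (use Cons.prems(2) le_univ[OF WW] in auto)
  moreover have "nf s M A c (img \<sigma> Q)"
    using nf_img[OF q(2) D(3)] img_over_le[OF n(4) M] img_over_le[OF d(5) over_le[OF D(4) d(5)]] ks(2) by simp
  ultimately show ?case using D(2) le_trans[OF d(5) n(5)] n(3) by auto
qed

text \<open>The witnesses of a finite independent sequence are laid out as marked steps of a
  non-forking chain, so that \<open>NFall\<close> applies to it. The last clause reads the sequence
  back from any free extension of a copy that fixes \<open>M\<close> and the elements. An initial
  chain \<open>T\<close> is carried along for the induction on the list.\<close>

lemma indl_nfchain:
  "indl M A bs N \<Longrightarrow> nfchain \<kappa> T I c \<Longrightarrow> T \<kappa> = A \<Longrightarrow>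
    \<exists>\<kappa>' T' I' c'. \<kappa> \<le> \<kappa>' \<and> (\<forall>j\<le>\<kappa>. T' j = T j) \<and> (\<forall>j<\<kappa>. (j \<in> I' \<longleftrightarrow> j \<in> I) \<and> c' j = c j) \<and>
      nfchain \<kappa>' T' I' c' \<and> N \<preceq> T' \<kappa>' \<and>
      (\<forall>g E. bij g \<and> over (univ M) g \<and> over (set bs) g \<and>
        free \<kappa>' (\<lambda>k. img g (T' k)) I' (\<lambda>k. g (c' k)) E \<longrightarrow> indl M (E \<kappa>) bs (E \<kappa>'))"
proof (induction bs arbitrary: A N \<kappa> T I c)
  case Nil
  note d = indlD[OF Nil.prems(1)] and cT = nfchainD(1)[OF Nil.prems(2)]
  note k = small_greater[OF lam lam_o chainD(1)[OF cT]]
  \<comment> \<open>The empty sequence still contributes one unmarked step, by which the chain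
    reaches \<open>N\<close>.\<close>
  let ?T = "T(osuc \<kappa> := N)" and ?I = "I \<inter> {..<\<kappa>}"
  have T: "nfchain (osuc \<kappa>) ?T ?I c"
    by (rule nfchain_extend(1)[OF Nil.prems(2)]) (use d Nil.prems(3) in auto)
  have "indl M (E \<kappa>) [] (E (osuc \<kappa>))"
    if g: "bij g" "over (univ M) g" "free (osuc \<kappa>) (\<lambda>k. img g (?T k)) ?I (\<lambda>k. g (c k)) E" for g E
  proof -
    note e = freeD[OF g(3)]
    have "img g A \<preceq> E \<kappa>" using e(2)[OF less_imp_le[OF k(1)]] Nil.prems(3) k(1) by (simp add: less_imp_neq)
    moreover have "M \<preceq> img g A" using img_le'[OF d(4) g(1)] img_over[OF KL_K[OF d(1)] g(2)] by simp
    ultimately show ?thesis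
      using le_trans[of M "img g A" "E \<kappa>"] d(1) chainD(2)[OF e(1)] chainD(3)[OF e(1) _ order.refl] less_imp_le[OF k(1)] by simp
  qed
  moreover have "\<forall>j\<le>\<kappa>. ?T j = T j" using k(1) by auto
  moreover have "\<forall>j<\<kappa>. (j \<in> ?I \<longleftrightarrow> j \<in> I) \<and> c j = c j" by simp
  moreover have "N \<preceq> ?T (osuc \<kappa>)" using KL_refl[OF d(3)] by simp
  ultimately show ?case
    using T less_imp_le[OF k(1)]
    by (intro exI[of _ "osuc \<kappa>"] exI[of _ ?T] exI[of _ ?I] exI[of _ c] conjI allI impI) blast+
next
  case (Cons b bs)
  note d = indlD[OF Cons.prems(1)] and cT = nfchainD(1)[OF Cons.prems(2)]
  note k = small_greater[OF lam lam_o chainD(1)[OF cT]]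
  obtain N' Q where q: "N \<preceq> N'" "nf s M A b Q" "indl M Q bs N'" by (rule indl_ConsE[OF Cons.prems(1)])
  note n = nfD[OF q(2)]
  let ?T = "T(osuc \<kappa> := Q)" and ?I = "insert \<kappa> (I \<inter> {..<\<kappa>})" and ?c = "c(\<kappa> := b)"
  have T: "nfchain (osuc \<kappa>) ?T ?I ?c"
    by (rule nfchain_extend(2)[OF Cons.prems(2) _ n(3)]) (use n(5) nf_selfD[OF q(2)] Cons.prems(3) in auto)
  obtain \<kappa>' T' I' c' where k': "osuc \<kappa> \<le> \<kappa>'" "\<forall>j\<le> osuc \<kappa>. T' j = ?T j"
      "\<forall>j < osuc \<kappa>. (j \<in> I' \<longleftrightarrow> j \<in> ?I) \<and> c' j = ?c j" "nfchain \<kappa>' T' I' c'" "N' \<preceq> T' \<kappa>'"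
      and k'': "\<forall>g E. bij g \<and> over (univ M) g \<and> over (set bs) g \<and>
        free \<kappa>' (\<lambda>k. img g (T' k)) I' (\<lambda>k. g (c' k)) E \<longrightarrow> indl M (E (osuc \<kappa>)) bs (E \<kappa>')"
    using Cons.IH[OF q(3) T fun_upd_same] by (elim exE conjE) (rule that; assumption)
  have kk: "\<kappa> < \<kappa>'" using less_le_trans[OF k(1) k'(1)] .
  have Tk: "T' \<kappa> = A" "T' (osuc \<kappa>) = Q" "\<kappa> \<in> I'" "c' \<kappa> = b"
    using k'(2,3) k(1) Cons.prems(3) by (auto simp: less_imp_neq)
  have "indl M (E \<kappa>) (b # bs) (E \<kappa>')"
    if g: "bij g" "over (univ M) g" "over (set (b # bs)) g" "free \<kappa>' (\<lambda>k. img g (T' k)) I' (\<lambda>k. g (c' k)) E" for g E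
  proof -
    note e = freeD[OF g(4)]
    have i: "indl M (E (osuc \<kappa>)) bs (E \<kappa>')" using k'' g by (auto simp: over_def)
    have gb: "g b = b" "img g M = M" using g(3) img_over[OF KL_K[OF d(1)] g(2)] by (auto simp: over_def)
    have "nf s (img g A) (E \<kappa>) b (E (osuc \<kappa>))" using e(3)[OF kk] Tk gb(1) by simp
    moreover have "nf s M (img g A) b (E (osuc \<kappa>))"
      using nf_up[OF nf_img[OF q(2) g(1)], of "E (osuc \<kappa>)"] e(2)[OF k'(1)] chainD(2)[OF e(1) k'(1)] Tk gb by simp
    ultimately have "nf s M (E \<kappa>) b (E (osuc \<kappa>))" by (rule nf_trans[rotated])
    moreover have "E \<kappa>' \<in> KL" using chainD(2)[OF e(1)] by blast
    ultimately show ?thesis using i KL_refl chainD(3)[OF e(1) less_imp_le[OF kk] order.refl] by auto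
  qed
  moreover have "\<forall>j\<le>\<kappa>. T' j = T j" using k'(2) k(1) by auto
  moreover have "\<forall>j<\<kappa>. (j \<in> I' \<longleftrightarrow> j \<in> I) \<and> c' j = c j" using k'(3) k(1) by auto
  moreover have "N \<preceq> T' \<kappa>'" using le_trans[OF q(1) k'(5)] .
  ultimately show ?case
    using k'(4) less_imp_le[OF kk]
    by (intro exI[of _ \<kappa>'] exI[of _ T'] exI[of _ I'] exI[of _ c'] conjI allI impI) blast+
qed

text \<open>After exchanging the sides, \<open>B\<close> is covered by the chain of witnesses for
  \<open>bs\<close>, and this chain is lifted to start at \<open>C\<close>. The permutation involved
  fixes \<open>B\<close>, and with it \<open>M\<close> and \<open>bs\<close>.\<close>

lemma NFall_indl:
  assumes nf: "NFall A B C D" and bs: "set bs \<subseteq> univ B" "indl M A bs B"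
  shows "indl M C bs D"
proof -
  note d = indlD[OF bs(2)]
  have fl: "NFall A C B D" using NFall_flip[OF nf] .
  have sq: "square A B C D" using nf unfolding NFall_def by blast
  note q = squareD[OF sq]
  have T0: "nfchain ozero (\<lambda>_. A) {} (\<lambda>_. undefined)"
    unfolding nfchain_def by (simp, rule chainI) (use small_ozero[OF lam] d(2) ozero_le in \<open>auto simp: le_less\<close>)
  obtain \<kappa> T I c where T: "\<forall>j\<le> ozero. T j = A" "nfchain \<kappa> T I c" "B \<preceq> T \<kappa>"
      "\<forall>g E. bij g \<and> over (univ M) g \<and> over (set bs) g \<and>
        free \<kappa> (\<lambda>k. img g (T k)) I (\<lambda>k. g (c k)) E \<longrightarrow> indl M (E ozero) bs (E \<kappa>)"
    using indl_nfchain[OF bs(2) T0 refl] by (elim exE conjE) (rule that; assumption)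
  obtain E g F where E: "bij g" "over (univ B) g" "free \<kappa> (\<lambda>k. img g (T k)) I (\<lambda>k. g (c k)) E" "E ozero = C"
      "E \<kappa> \<preceq> F" "D \<preceq> F" "F \<in> KL"
    by (rule NFallE[OF fl T(2) _ T(3)]) (use T(1) in auto)
  have "over (univ M) g" using over_le[OF E(2) le_trans[OF d(4,5)]] .
  moreover have "over (set bs) g" using E(2) bs(1) unfolding over_def by auto
  ultimately have "indl M (E ozero) bs (E \<kappa>)" using T(4) E(1,3) by blast
  moreover have "univ B \<subseteq> univ (E \<kappa>)"
    using le_univ[OF le_trans[OF img_le'[OF T(3) E(1)] freeD(2)[OF E(3) order.refl]]]
      img_over[OF KL_K[OF q(6)] E(2)] by simp
  ultimately have "indl M C bs F" using indl_extend[OF _ _ E(5,7)] bs(1) E(4) by auto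
  then show ?thesis by (rule indl_shrink[OF _ E(6) q(4,8)])
qed

section \<open>Finite independence of a set\<close>

text \<open>Lists without repetitions stand for finite subsets; by \<open>indl_subset\<close> the
  order of a list is immaterial.\<close>

definition fin_indep where
  "fin_indep J M A N \<longleftrightarrow> (\<forall>bs. distinct bs \<and> set bs \<subseteq> J \<longrightarrow> indl M A bs N)"

lemma fin_indepD: "fin_indep J M A N \<Longrightarrow> distinct bs \<Longrightarrow> set bs \<subseteq> J \<Longrightarrow> indl M A bs N"
  unfolding fin_indep_def by blast

section \<open>Finite independence over unions of chains\<close>

lemma finite_subset_chain_member:
  assumes "chain \<delta> W" "olimit \<delta>" "finite B" "B \<subseteq> univ (W \<delta>)"
  obtains \<alpha> where "\<alpha> < \<delta>" "B \<subseteq> univ (W \<alpha>)"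
proof -
  note w = chainD[OF assms(1)]
  have "\<exists>\<alpha><\<delta>. B \<subseteq> univ (W \<alpha>)"
    using assms(3,4)
  proof (induction B rule: finite_induct)
    case empty
    then show ?case using olimit_pos[OF assms(2)] by blast
  next
    case (insert b B)
    then obtain \<alpha> \<beta> where "\<alpha> < \<delta>" "B \<subseteq> univ (W \<alpha>)" "\<beta> < \<delta>" "b \<in> univ (W \<beta>)"
      using univ_chain_limit[OF assms(1,2) order.refl] by auto
    moreover from this have "max \<alpha> \<beta> \<le> \<delta>" by (simp add: less_imp_le)
    then have "univ (W \<alpha>) \<subseteq> univ (W (max \<alpha> \<beta>))" "univ (W \<beta>) \<subseteq> univ (W (max \<alpha> \<beta>))"
      using le_univ[OF w(3)[of _ "max \<alpha> \<beta>"]] by simp_all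
    ultimately show ?case by (intro exI[of _ "max \<alpha> \<beta>"]) auto
  qed
  then show ?thesis using that by blast
qed

text \<open>In a resolution of \<open>N\<close> the finite set is contained in one member
  \<open>W \<alpha>\<close>; independence over \<open>Ms \<alpha>\<close> then lifts along the free
  square to \<open>Ms \<delta>\<close>.\<close>

lemma indl_limit:
  assumes c: "chain \<delta> Ms" "olimit \<delta>" and N: "Ms \<delta> \<preceq> N" "N \<in> KL" and bs: "set bs \<subseteq> univ N"
    and i: "\<And>\<alpha>. \<alpha> < \<delta> \<Longrightarrow> indl M (Ms \<alpha>) bs N"
  shows "indl M (Ms \<delta>) bs N"
proof -
  obtain W where W: "chain \<delta> W" "N \<preceq> W \<delta>" "\<And>\<alpha>. \<alpha> < \<delta> \<Longrightarrow> NFall (Ms \<alpha>) (W \<alpha>) (Ms \<delta>) (W \<delta>)"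
    by (rule resolution[OF c N(2,1)]) blast
  have "set bs \<subseteq> univ (W \<delta>)" using bs le_univ[OF W(2)] by blast
  then obtain \<alpha> where a: "\<alpha> < \<delta>" "set bs \<subseteq> univ (W \<alpha>)"
    by (rule finite_subset_chain_member[OF W(1) c(2) finite_set])
  note w = chainD[OF W(1)]
  have sq: "square (Ms \<alpha>) (W \<alpha>) (Ms \<delta>) (W \<delta>)" using W(3)[OF a(1)] unfolding NFall_def by blast
  note q = squareD[OF sq]
  have "indl M (Ms \<alpha>) bs (W \<alpha>)"
    using indl_shrink[OF indl_extend[OF i[OF a(1)] bs W(2) q(8)] q(2,1,6)] .
  then show ?thesis using indl_shrink[OF NFall_indl[OF W(3)[OF a(1)] a(2)] W(2) N] by blast
qed

text \<open>With \<gamma> the least upper bound of \<open>G\<close>, either \<gamma> belongs to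
  \<open>G\<close> and its model absorbs the others, or \<gamma> is a limit in which
  \<open>G\<close> is cofinal.\<close>

lemma inc_cont_union:
  assumes Ms: "inc_cont s {..\<delta>} Ms" and G: "G \<subseteq> {..\<delta>}" "G \<noteq> {}"
  shows "union_model (Ms ` G) \<in> Ms ` {..\<delta>}"
proof -
  define \<gamma> where "\<gamma> = (LEAST \<gamma>. \<forall>\<beta>\<in>G. \<beta> \<le> \<gamma>)"
  have ub: "\<forall>\<beta>\<in>G. \<beta> \<le> \<delta>" using G by auto
  have g: "\<forall>\<beta>\<in>G. \<beta> \<le> \<gamma>" "\<gamma> \<le> \<delta>" unfolding \<gamma>_def using LeastI[of "\<lambda>\<gamma>. \<forall>\<beta>\<in>G. \<beta> \<le> \<gamma>", OF ub] Least_le[of "\<lambda>\<gamma>. \<forall>\<beta>\<in>G. \<beta> \<le> \<gamma>", OF ub] by auto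
  have above: "\<exists>\<beta>\<in>G. x < \<beta>" if "x < \<gamma>" for x
    using not_less_Least[OF that[unfolded \<gamma>_def]] by (auto simp: not_le)
  have le: "Ms \<alpha> \<preceq> Ms \<beta>" if "\<alpha> \<le> \<beta>" "\<beta> \<le> \<gamma>" for \<alpha> \<beta>
    using inc_cont_le[OF Ms _ _ that(1)] that g(2) by auto
  have "union_model (Ms ` G) = Ms \<gamma>"
  proof (cases "\<gamma> \<in> G")
    case True
    have "union_model (Ms ` G) = union_model {Ms \<gamma>}"
      by (rule union_model_cofinal) (use True g le in auto)
    then show ?thesis by simp
  next
    case False
    then have lt: "\<beta> < \<gamma>" if "\<beta> \<in> G" for \<beta> using g(1) that by (metis le_less)
    have lim: "olimit \<gamma>"
      unfolding olimit_def using G(2) above lt by blast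
    have "union_model (Ms ` G) = union_model (Ms ` {..<\<gamma>})"
    proof (rule union_model_cofinal)
      fix M assume "M \<in> Ms ` G"
      then obtain \<beta> where "\<beta> \<in> G" "M = Ms \<beta>" by blast
      then show "\<exists>N\<in>Ms ` {..<\<gamma>}. M \<preceq> N" using lt[of \<beta>] le[of \<beta> \<beta>] g(1) by auto
    next
      fix M assume "M \<in> Ms ` {..<\<gamma>}"
      then obtain x where x: "x < \<gamma>" "M = Ms x" by blast
      obtain \<beta> where b: "\<beta> \<in> G" "x < \<beta>" using above[OF x(1)] by blast
      then have "M \<preceq> Ms \<beta>" using le[OF less_imp_le[OF b(2)]] g(1) x(2) by simp
      then show "\<exists>N\<in>Ms ` G. M \<preceq> N" using b(1) by blast
    qed
    then show ?thesis using inc_cont_lim[OF Ms _ lim] g(2) by simp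
  qed
  then show ?thesis using g(2) by auto
qed

text \<open>
  An increasing continuous sequence of arbitrary length that does not become stationary before its
  limit has a cofinal subsequence of length less than \<open>lam\<^sup>+\<close>, because it consists of models of size \<open>lam\<close>.
\<close>

lemma cofinal_chain:
  assumes Ms: "inc_cont s {..\<delta>} Ms" "\<And>\<alpha>. \<alpha> \<le> \<delta> \<Longrightarrow> Ms \<alpha> \<in> KL" and d: "olimit \<delta>"
    and ns: "\<And>\<alpha>. \<alpha> < \<delta> \<Longrightarrow> Ms \<alpha> \<noteq> Ms \<delta>"
  obtains \<kappa> T where "chain \<kappa> T" "olimit \<kappa>" "T \<kappa> = Ms \<delta>" "\<forall>i<\<kappa>. T i \<in> Ms ` {..<\<delta>}"
proof -
  let ?D = "{i :: 'o. small lam i}"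
  have le: "Ms \<alpha> \<preceq> Ms \<beta>" if "\<alpha> \<le> \<beta>" "\<beta> \<le> \<delta>" for \<alpha> \<beta>
    using inc_cont_le[OF Ms(1) _ _ that(1)] that by auto
  define Inv where "Inv i A \<longleftrightarrow> A \<in> Ms ` {..\<delta>}" for i :: 'o and A
  \<comment> \<open>A successor step moves properly but never onto the last model, so the last model
    can be reached only at a limit stage.\<close>
  define rel where "rel i j A B \<longleftrightarrow> A \<preceq> B \<and> (j = osuc i \<longrightarrow> A \<noteq> Ms \<delta> \<longrightarrow> A \<noteq> B \<and> B \<noteq> Ms \<delta>)"
    for i j :: 'o and A B
  define LimR where "LimR \<alpha> F A \<longleftrightarrow> A = union_model (F ` {..<\<alpha>})"
    for \<alpha> :: 'o and F :: "'o \<Rightarrow> ('a, 'f, 'r) model" and A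
  obtain T where T: "T ozero = Ms ozero" "\<And>j. j \<in> ?D \<Longrightarrow> Inv j (T j)"
    "\<And>i j. i < j \<Longrightarrow> j \<in> ?D \<Longrightarrow> rel i j (T i) (T j)"
    "\<And>j. j \<in> ?D \<Longrightarrow> olimit j \<Longrightarrow> LimR j T (T j)"
  proof (rule chain_recursion[of ?D rel LimR Inv "Ms ozero"])
    show "l \<in> ?D" if "k \<in> ?D" "l < k" for k l using that small_mono[of lam k l] by auto
    show "rel k m A C" if "k < l" "l < m" "m \<in> ?D" "rel k l A B" "rel l m B C" for k l m A B C
    proof -
      have "m \<noteq> osuc k" using osuc_le[OF that(1)] that(2) by auto
      then show ?thesis using that(4,5) le_trans unfolding rel_def by blast
    qed
    show "LimR \<alpha> g A" if "\<And>\<beta>. \<beta> < \<alpha> \<Longrightarrow> f \<beta> = g \<beta>" "LimR \<alpha> f A" for \<alpha> f g A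
    proof -
      have "f ` {..<\<alpha>} = g ` {..<\<alpha>}" by (rule image_cong) (auto simp: that(1))
      then show ?thesis using that(2) unfolding LimR_def by simp
    qed
    show "Inv ozero (Ms ozero)" unfolding Inv_def using ozero_le by auto
    show "\<exists>B. Inv (osuc j) B \<and> rel j (osuc j) A B" if j: "Inv j A" for j A
    proof -
      obtain \<alpha> where a: "\<alpha> \<le> \<delta>" "A = Ms \<alpha>" using j unfolding Inv_def by auto
      show ?thesis
      proof (cases "\<forall>\<beta>. \<alpha> \<le> \<beta> \<and> \<beta> < \<delta> \<longrightarrow> Ms \<beta> = A")
        \<comment> \<open>A sequence that is constant from \<alpha> up to the limit has that
          constant value at the limit too, so no proper step being possible means that the last
          model has been reached.\<close>
        case True
        have "A = Ms \<delta>"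
        proof (rule ccontr)
          assume n: "A \<noteq> Ms \<delta>"
          then have ad: "\<alpha> < \<delta>" using a by (auto simp: le_less)
          have "Ms \<delta> = union_model (Ms ` {..<\<delta>})" using inc_cont_lim[OF Ms(1) _ d] by simp
          also have "\<dots> = union_model {A}"
          proof (rule union_model_cofinal)
            fix M assume "M \<in> Ms ` {..<\<delta>}"
            then obtain x where x: "x < \<delta>" "M = Ms x" by blast
            then have "M \<preceq> Ms (max x \<alpha>)" using le[of x "max x \<alpha>"] ad by (simp add: less_imp_le)
            then show "\<exists>N\<in>{A}. M \<preceq> N" using True x ad by simp
          next
            fix M assume "M \<in> {A}"
            then show "\<exists>N\<in>Ms ` {..<\<delta>}. M \<preceq> N" using ad a le[of \<alpha> \<alpha>] by auto
          qed
          finally show False using n by simp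
        qed
        then have "rel j (osuc j) A A" using KL_refl[OF Ms(2)[OF a(1)]] a(2) unfolding rel_def by simp
        then show ?thesis using j unfolding Inv_def by (intro exI[of _ A] conjI)
      next
        case False
        then obtain \<beta> where b: "\<alpha> \<le> \<beta>" "\<beta> < \<delta>" "Ms \<beta> \<noteq> A" by blast
        then have "rel j (osuc j) A (Ms \<beta>)" unfolding rel_def using le[of \<alpha> \<beta>] a ns[of \<beta>] by auto
        moreover have "Ms \<beta> \<in> Ms ` {..\<delta>}" using b(2) by simp
        ultimately show ?thesis unfolding Inv_def by (intro exI[of _ "Ms \<beta>"] conjI)
      qed
    qed
    show "\<exists>A. Inv \<alpha> A \<and> (\<forall>\<beta><\<alpha>. rel \<beta> \<alpha> (F \<beta>) A) \<and> LimR \<alpha> F A"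
      if a: "olimit \<alpha>" "\<alpha> \<in> ?D" and inv: "\<And>\<beta>. \<beta> < \<alpha> \<Longrightarrow> Inv \<beta> (F \<beta>)"
        and rl: "\<And>\<beta> \<gamma>. \<beta> < \<gamma> \<Longrightarrow> \<gamma> < \<alpha> \<Longrightarrow> rel \<beta> \<gamma> (F \<beta>) (F \<gamma>)"
        and lm: "\<And>\<beta>. \<beta> < \<alpha> \<Longrightarrow> olimit \<beta> \<Longrightarrow> LimR \<beta> F (F \<beta>)" for \<alpha> F
    proof -
      let ?U = "union_model (F ` {..<\<alpha>})"
      have "F ` {..<\<alpha>} \<subseteq> Ms ` {..\<delta>}" using inv unfolding Inv_def by auto
      then obtain G where G: "G \<subseteq> {..\<delta>}" "F ` {..<\<alpha>} = Ms ` G" by (auto simp: subset_image_iff)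
      have "F ` {..<\<alpha>} \<noteq> {}" using olimit_pos[OF a(1)] by auto
      then have "G \<noteq> {}" using G(2) by auto
      then have U: "Inv \<alpha> ?U" unfolding Inv_def G(2) using inc_cont_union[OF Ms(1) G(1)] by blast
      have FK: "F \<beta> \<in> KL" if "\<beta> < \<alpha>" for \<beta> using inv[OF that] Ms(2) unfolding Inv_def by auto
      have FU: "F \<beta> \<preceq> ?U" if "\<beta> < \<alpha>" for \<beta>
        by (rule chain_limit(2)[of \<alpha> F, OF a(1) _ FK _ _ that]) (use a(2) rl lm in \<open>auto simp: rel_def LimR_def\<close>)
      have "rel \<beta> \<alpha> (F \<beta>) ?U" if "\<beta> < \<alpha>" for \<beta>
        unfolding rel_def using FU[OF that] not_olimit_osuc[OF osuc_greater[OF that]] a(1) by auto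
      then show ?thesis using U unfolding LimR_def by blast
    qed
  qed (rule that)
  have TK: "T i \<in> KL" "T i \<preceq> Ms \<delta>" "T i \<in> Ms ` {..\<delta>}" if "small lam i" for i
    using T(2)[of i] that Ms(2) le unfolding Inv_def by auto
  have TT: "T i \<preceq> T j" if "i \<le> j" "small lam j" for i j
    using T(3)[of i j] that KL_refl[OF TK(1)[of j]] unfolding rel_def by (cases "i = j") auto
  have "\<exists>i. small lam i \<and> univ (T i) = univ (Ms \<delta>)"
  proof (rule exhaustion[OF lam lam_o, of "\<lambda>_. univ (Ms \<delta>)" "\<lambda>i. univ (T i)"])
    show "|univ (Ms \<delta>)| \<le>o lam" using KL_ordLeq[OF Ms(2)] by blast
    show "univ (T i) \<subseteq> univ (T j)" if "i \<le> j" "small lam j" for i j using le_univ[OF TT[OF that]] .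
    show "univ (Ms \<delta>) = (\<Union>j<i. univ (Ms \<delta>))" if "olimit i" for i using olimit_pos[OF that] by auto
    fix i assume i: "small lam i" "univ (T i) \<noteq> univ (Ms \<delta>)"
    note g = small_greater[OF lam lam_o i(1)]
    have "T i \<preceq> T (osuc i)" "T i \<noteq> T (osuc i)" using T(3)[OF g(1)] g(2) i(2) unfolding rel_def by auto
    then have "univ (T i) \<subset> univ (T (osuc i))" using le_univ le_eqI by blast
    then show "\<exists>c. c \<in> univ (Ms \<delta>) \<and> c \<in> univ (T (osuc i)) \<and> c \<notin> univ (T i)"
      using le_univ[OF TK(2)[OF g(2)]] by blast
  qed simp
  then have ex: "\<exists>i. small lam i \<and> T i = Ms \<delta>" using TK(2) le_eqI by blast
  define \<kappa> where "\<kappa> = (LEAST i. small lam i \<and> T i = Ms \<delta>)"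
  have k: "small lam \<kappa>" "T \<kappa> = Ms \<delta>" unfolding \<kappa>_def using LeastI_ex[OF ex] by auto
  have sj: "small lam j" if "j \<le> \<kappa>" for j using small_mono[OF k(1) that] .
  have nk: "T j \<noteq> Ms \<delta>" if "j < \<kappa>" for j
    using not_less_Least[of j "\<lambda>i. small lam i \<and> T i = Ms \<delta>"] sj[OF less_imp_le[OF that]] that
    unfolding \<kappa>_def by blast
  have "olimit \<kappa>"
  proof (cases \<kappa> rule: ord_cases)
    case 1
    then show ?thesis using k(2) T(1) ns[OF olimit_pos[OF d]] by simp
  next
    case (2 j)
    then show ?thesis using T(3)[of j \<kappa>] k nk[of j] unfolding rel_def by auto
  qed
  moreover have "chain \<kappa> T"
    by (rule chainI) (use k(1) TK(1) TT T(4) sj in \<open>auto simp: LimR_def\<close>)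
  moreover have "T i \<in> Ms ` {..<\<delta>}" if "i < \<kappa>" for i
    using TK(3)[OF sj[OF less_imp_le[OF that]]] nk[OF that] by (auto simp: le_less)
  ultimately show ?thesis using that k(2) by blast
qed

text \<open>The length \<delta> is arbitrary, while \<open>indl_limit\<close> treats lengths below
  \<open>lam\<^sup>+\<close>. If the last model does not occur earlier, \<open>cofinal_chain\<close>
  mediates.\<close>

lemma fin_indep_limit:
  assumes Ms: "inc_cont s {..\<delta>} Ms" "\<And>\<alpha>. \<alpha> \<le> \<delta> \<Longrightarrow> Ms \<alpha> \<in> KL" and d: "olimit \<delta>"
    and N: "Ms \<delta> \<preceq> N" "N \<in> KL" and J: "J \<subseteq> univ N" and i: "\<And>\<alpha>. \<alpha> < \<delta> \<Longrightarrow> fin_indep J M (Ms \<alpha>) N"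
  shows "fin_indep J M (Ms \<delta>) N"
proof (cases "\<exists>\<alpha><\<delta>. Ms \<alpha> = Ms \<delta>")
  case True
  then obtain \<alpha> where "\<alpha> < \<delta>" "Ms \<alpha> = Ms \<delta>" by blast
  then show ?thesis using i[of \<alpha>] by simp
next
  case False
  obtain \<kappa> T where T: "chain \<kappa> T" "olimit \<kappa>" "T \<kappa> = Ms \<delta>" "\<forall>i<\<kappa>. T i \<in> Ms ` {..<\<delta>}"
    by (rule cofinal_chain[OF Ms d]) (use False in blast)+
  show ?thesis
    unfolding fin_indep_def
  proof (intro allI impI)
    fix bs assume bs: "distinct bs \<and> set bs \<subseteq> J"
    have "indl M (T \<kappa>) bs N"
    proof (rule indl_limit[OF T(1,2) _ N(2)])
      fix j assume "j < \<kappa>"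
      then obtain \<alpha> where "\<alpha> < \<delta>" "T j = Ms \<alpha>" using T(4) by auto
      then show "indl M (T j) bs N" using fin_indepD[OF i] bs by auto
    qed (use N(1) T(3) J bs in auto)
    then show "indl M (Ms \<delta>) bs N" using T(3) by simp
  qed
qed

end

text \<open>New elements of \<open>J\<close> are chosen as long as there are any; this must stop,
  since otherwise \<open>'o\<close> would be injected into \<open>J\<close>.\<close>

lemma ordinal_enumeration:
  assumes J: "|J| <o |UNIV :: 'o::wellorder set|"
  obtains \<alpha>s :: "'o::wellorder" and a where "bij_betw a {..<\<alpha>s} J"
proof -
  have "\<exists>f. \<forall>\<alpha>\<in>UNIV. J \<subseteq> f ` {..<\<alpha>} \<or> f \<alpha> \<in> J - f ` {..<\<alpha> :: 'o}"
  proof (rule transfinite_choice[of "\<lambda>\<alpha> f x. J \<subseteq> f ` {..<\<alpha>} \<or> x \<in> J - f ` {..<\<alpha>}"])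
    fix \<alpha> :: 'o and f g x assume fg: "\<And>\<beta>. \<beta> < \<alpha> \<Longrightarrow> f \<beta> = g \<beta>" and f: "J \<subseteq> f ` {..<\<alpha>} \<or> x \<in> J - f ` {..<\<alpha>}"
    have "f ` {..<\<alpha>} = g ` {..<\<alpha>}" by (rule image_cong) (auto simp: fg)
    then show "J \<subseteq> g ` {..<\<alpha>} \<or> x \<in> J - g ` {..<\<alpha>}" using f by simp
  qed auto
  then obtain f where f: "\<And>\<alpha> :: 'o. J \<subseteq> f ` {..<\<alpha>} \<or> f \<alpha> \<in> J - f ` {..<\<alpha>}" by blast
  have inj: "inj_on f A" if "\<And>\<alpha>. \<alpha> \<in> A \<Longrightarrow> \<not> J \<subseteq> f ` {..<\<alpha>}" for A
  proof (rule inj_onI)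
    fix \<alpha> \<beta> assume ab: "\<alpha> \<in> A" "\<beta> \<in> A" "f \<alpha> = f \<beta>"
    have "f \<beta> \<notin> f ` {..<\<alpha>}" "f \<alpha> \<notin> f ` {..<\<beta>}" using f[of \<alpha>] f[of \<beta>] that ab by auto
    then have "\<not> \<beta> < \<alpha>" "\<not> \<alpha> < \<beta>" by blast+
    then show "\<alpha> = \<beta>" by simp
  qed
  have "\<exists>\<alpha>. J \<subseteq> f ` {..<\<alpha>}"
  proof (rule ccontr)
    assume n: "\<nexists>\<alpha>. J \<subseteq> f ` {..<\<alpha>}"
    then have "f ` UNIV \<subseteq> J" using f by auto
    then have "|UNIV :: 'o set| \<le>o |J|" using inj[of UNIV] n card_of_ordLeq by blast
    then show False using J not_ordLess_ordLeq by blast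
  qed
  then have ex: "J \<subseteq> f ` {..<LEAST \<alpha>. J \<subseteq> f ` {..<\<alpha>}}" by (rule LeastI_ex)
  define \<alpha>s where "\<alpha>s = (LEAST \<alpha>. J \<subseteq> f ` {..<\<alpha>})"
  have n: "\<not> J \<subseteq> f ` {..<\<alpha>}" if "\<alpha> < \<alpha>s" for \<alpha> using not_less_Least that unfolding \<alpha>s_def by blast
  then have "f ` {..<\<alpha>s} \<subseteq> J" using f by auto
  then have "bij_betw f {..<\<alpha>s} J"
    using ex inj[of "{..<\<alpha>s}"] n unfolding bij_betw_def \<alpha>s_def[symmetric] by auto
  then show ?thesis using that by blast
qed

section \<open>Independent sequences from finite independence and back\<close>

context frame_with_uq
begin

lemma indl_single:
  assumes "indl M A [b] N" "b \<in> univ N"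
  shows "nf s M A b N"
proof -
  obtain N' Q where q: "N \<preceq> N'" "nf s M A b Q" "indl M Q [] N'" by (rule indl_ConsE[OF assms(1)])
  then have "nf s M A b N'" using nf_up by simp
  then show ?thesis using nf_down[OF _ q(1)] indlD[OF assms(1)] assms(2) by blast
qed

text \<open>One model \<open>A'\<close> has to serve all finite sequences from \<open>J\<close> at
  once. A uniqueness triple does so: for each sequence, \<open>b\<close> is free over some model
  \<open>Q\<close> containing it, and the triple makes the square of \<open>A'\<close> and
  \<open>Q\<close> over \<open>A\<close> free, whatever \<open>Q\<close> is.\<close>

lemma fin_indep_insert:
  assumes i: "fin_indep (insert b J) M A U" and b: "b \<notin> J" "insert b J \<subseteq> univ U"
  obtains A' U' where "U \<preceq> U'" "nf s M A b A'" "fin_indep J M A' U'"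
proof -
  have n: "nf s M A b U" using indl_single[OF fin_indepD[OF i, of "[b]"]] b(2) by simp
  note d = nfD[OF n]
  obtain A' U' where U': "U' \<in> KL" "U \<preceq> U'" "A' \<preceq> U'" "(A, A', b) \<in> K3uq lam s"
    by (rule uq_in_extension[OF nf_selfD[OF n]])
  note uq = uqD[OF U'(4)] and bA = nfD(6)[OF uqD(1)[OF U'(4)]]
  have n': "nf s M A b A'" using nf_down[OF nf_up[OF n U'(2,1)] U'(3) uq(3,4) bA] .
  have "indl M A' ks U'" if ks: "distinct ks" "set ks \<subseteq> J" for ks
  proof -
    \<comment> \<open>Putting \<open>b\<close> last exhibits it as free from a model containing
      \<open>ks\<close>.\<close>
    have "indl M A (ks @ [b]) U" by (rule fin_indepD[OF i]) (use ks b(1) in auto)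
    then have "indl M A (ks @ [b]) U'" by (rule indl_extend[OF _ _ U'(2,1)]) (use ks(2) b(2) in auto)
    then obtain Q V where Q: "U' \<preceq> V" "nf s M Q b V" "A \<preceq> Q" "indl M A ks Q" "set ks \<subseteq> univ Q"
      using indl_snocD by blast
    note q = nfD[OF Q(2)]
    have nA: "nf s A Q b V" using nf_base[OF Q(2) d(4) Q(3) d(2)] .
    have AV: "A' \<preceq> V" using le_trans[OF U'(3) Q(1)] .
    have sq: "square A A' Q V" unfolding square_def using uq(2-4) AV Q(3) q(2,3,5) by blast
    have z: "ozero < osuc (ozero::'o)" "small lam (osuc (ozero::'o))"
      using small_greater[OF lam lam_o small_ozero[OF lam]] by auto
    have l: "k = ozero" if "k < osuc ozero" for k :: 'o
      using that less_osuc_iff[OF z(1), of k] ozero_le[of k] by auto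
    have l2: "k = ozero \<or> k = osuc ozero" if "k \<le> osuc ozero" for k :: 'o
      using that l[of k] by (auto simp: le_less)
    have two: "chain (osuc ozero) (\<lambda>k::'o. if k = ozero then C else D)" if "C \<preceq> D" "C \<in> KL" "D \<in> KL" for C D
    proof (rule chainI[OF z(2)])
      show "(if k = ozero then C else D) = union_model ((\<lambda>k. if k = ozero then C else D) ` {..<k})"
        if "k \<le> osuc ozero" "olimit k" for k :: 'o
        using l2[OF that(1)] that(2) not_olimit_osuc[OF z(1)] by auto
    qed (use that KL_refl[OF that(3)] in auto)
    \<comment> \<open>A tower of length one, with \<open>A\<close> at index zero and
      \<open>A'\<close> at its successor, and above it the free extension from \<open>Q\<close> to
      \<open>V\<close>.\<close>
    let ?X = "\<lambda>k::'o. if k = ozero then A else A'" and ?G = "\<lambda>k::'o. if k = ozero then Q else V"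
    have "uqtower (osuc ozero) ?X (\<lambda>_. b)"
      unfolding uqtower_def using two[OF uq(4,2,3)] l z(1) U'(4) by fastforce
    moreover have "free (osuc ozero) ?X UNIV (\<lambda>_. b) ?G"
      unfolding free_def using two[OF q(5,2,3)] l z(1) nA Q(3) AV by fastforce
    ultimately have "NFex A A' Q V"
      unfolding NFex_def using sq z(1) KL_refl[OF uq(3)] KL_refl[OF q(3)] q(3)
      by (intro conjI exI[of _ "osuc ozero"] exI[of _ ?X] exI[of _ "\<lambda>_. b"] exI[of _ ?G] exI[of _ V]) auto
    then have "NFall A Q A' V" using NFall_flip NFex_NFall by blast
    then have "indl M A' ks V" using NFall_indl Q(4,5) by blast
    then show ?thesis using indl_shrink[OF _ Q(1) U'(3,1)] by blast
  qed
  then show ?thesis using that[OF U'(2) n'] unfolding fin_indep_def by blast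
qed

text \<open>The elements are added in the given order; the invariant keeps the tail of the
  enumeration finitely independent over the current model, and \<open>indl_limit\<close> restores it
  at limits. Any order will do, since finite independence is insensitive to order.\<close>

lemma fin_indep_seq:
  fixes a :: "'o \<Rightarrow> 'a"
  assumes i: "fin_indep J M M0 N" and J: "J \<subseteq> univ N" and a: "bij_betw a {..<\<alpha>s} J"
  shows "indep_seq lam s a \<alpha>s M M0 N" "small lam \<alpha>s"
proof -
  have d0: "indl M M0 [] N" by (rule fin_indepD[OF i]) simp_all
  note d = indlD[OF d0]
  have "|J| \<le>o lam" using subset_ordLeq[OF J KL_ordLeq[OF d(3)]] .
  then show sm: "small lam \<alpha>s"
    unfolding small_def using card_of_ordIso ordIso_ordLeq_trans a by blast
  have aJ: "a k \<in> J" if "k < \<alpha>s" for k using a that unfolding bij_betw_def by auto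
  have inj: "a k \<noteq> a l" if "k < l" "l < \<alpha>s" for k l
    using a that less_trans[OF that] unfolding bij_betw_def inj_on_def by (metis lessThan_iff less_irrefl)
  define R where "R k = a ` {k..<\<alpha>s}" for k
  have RJ: "R k \<subseteq> J" for k unfolding R_def using aJ by auto
  define Inv where "Inv k S \<longleftrightarrow> fin_indep (R k) M (fst S) (snd S) \<and> J \<subseteq> univ (snd S)"
    for k and S :: "('a, 'f, 'r) model \<times> ('a, 'f, 'r) model"
  define rel where "rel k l S S' \<longleftrightarrow> fst S \<preceq> fst S' \<and> snd S \<preceq> snd S' \<and>
      (l = osuc k \<longrightarrow> nf s M (fst S) (a k) (fst S'))"
    for k l and S S' :: "('a, 'f, 'r) model \<times> ('a, 'f, 'r) model"
  define LimR where "LimR \<alpha> F S \<longleftrightarrow> fst S = union_model ((\<lambda>\<beta>. fst (F \<beta>)) ` {..<\<alpha>}) \<and>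
      snd S = union_model ((\<lambda>\<beta>. snd (F \<beta>)) ` {..<\<alpha>})"
    for \<alpha> :: 'o and F :: "'o \<Rightarrow> ('a, 'f, 'r) model \<times> ('a, 'f, 'r) model"
      and S :: "('a, 'f, 'r) model \<times> ('a, 'f, 'r) model"
  have InvD: "fst S \<in> KL" "snd S \<in> KL" "fst S \<preceq> snd S" if "Inv k S" for k S
    using fin_indepD[of "R k" M "fst S" "snd S" "[]"] that unfolding Inv_def by simp_all
  obtain F where F: "F ozero = (M0, N)" "\<And>j. j \<in> {..\<alpha>s} \<Longrightarrow> Inv j (F j)"
    "\<And>i j. i < j \<Longrightarrow> j \<in> {..\<alpha>s} \<Longrightarrow> rel i j (F i) (F j)"
    "\<And>j. j \<in> {..\<alpha>s} \<Longrightarrow> olimit j \<Longrightarrow> LimR j F (F j)"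
  proof (rule chain_recursion[of "{..\<alpha>s}" rel LimR Inv "(M0, N)"])
    show "l \<in> {..\<alpha>s}" if "k \<in> {..\<alpha>s}" "l < k" for k l using that by auto
    show "rel k m S S''" if "k < l" "l < m" "m \<in> {..\<alpha>s}" "rel k l S S'" "rel l m S' S''" for k l m S S' S''
    proof -
      have "m \<noteq> osuc k" using osuc_le[OF that(1)] that(2) by auto
      then show ?thesis using that(4,5) le_trans unfolding rel_def by blast
    qed
    show "LimR \<alpha> g S" if "\<And>\<beta>. \<beta> < \<alpha> \<Longrightarrow> f \<beta> = g \<beta>" "LimR \<alpha> f S" for \<alpha> f g S
    proof -
      have "(\<lambda>\<beta>. fst (f \<beta>)) ` {..<\<alpha>} = (\<lambda>\<beta>. fst (g \<beta>)) ` {..<\<alpha>}"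
        "(\<lambda>\<beta>. snd (f \<beta>)) ` {..<\<alpha>} = (\<lambda>\<beta>. snd (g \<beta>)) ` {..<\<alpha>}"
        by (rule image_cong; auto simp: that(1))+
      then show ?thesis using that(2) unfolding LimR_def by simp
    qed
    show "Inv ozero (M0, N)" unfolding Inv_def using i J RJ[of ozero] unfolding fin_indep_def by auto
    show "\<exists>S'. Inv (osuc j) S' \<and> rel j (osuc j) S S'"
      if j: "j < osuc j" "osuc j \<in> {..\<alpha>s}" "Inv j S" for j S
    proof -
      obtain A U where S: "S = (A, U)" by (cases S)
      have jj: "j < \<alpha>s" using j by auto
      have I: "fin_indep (R j) M A U" "J \<subseteq> univ U" using j(3) unfolding Inv_def S by auto
      have "{j..<\<alpha>s} = insert j {osuc j..<\<alpha>s}"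
      proof (intro equalityI subsetI)
        fix x assume "x \<in> {j..<\<alpha>s}"
        then show "x \<in> insert j {osuc j..<\<alpha>s}" using osuc_le[of j x] by (auto simp: le_less)
      qed (use jj j(1) in auto)
      then have RR: "R j = insert (a j) (R (osuc j))" unfolding R_def by simp
      have "a j \<noteq> a x" if "osuc j \<le> x" "x < \<alpha>s" for x using inj[of j x] less_le_trans[OF j(1) that(1)] that(2) by blast
      then have nj: "a j \<notin> R (osuc j)" unfolding R_def by (metis atLeastLessThan_iff imageE)
      have "insert (a j) (R (osuc j)) \<subseteq> univ U" using I(2) RJ[of "osuc j"] aJ[OF jj] by blast
      then obtain A' U' where "U \<preceq> U'" "nf s M A (a j) A'" "fin_indep (R (osuc j)) M A' U'"
        by (rule fin_indep_insert[OF I(1)[unfolded RR] nj])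
      then have "Inv (osuc j) (A', U')" "rel j (osuc j) S (A', U')"
        unfolding Inv_def rel_def S using I(2) le_univ[of U U'] nfD(5)[of M A "a j" A'] by auto
      then show ?thesis by blast
    qed
    show "\<exists>S. Inv \<alpha> S \<and> (\<forall>\<beta><\<alpha>. rel \<beta> \<alpha> (F \<beta>) S) \<and> LimR \<alpha> F S"
      if a: "olimit \<alpha>" "\<alpha> \<in> {..\<alpha>s}" and inv: "\<And>\<beta>. \<beta> < \<alpha> \<Longrightarrow> Inv \<beta> (F \<beta>)"
        and rl: "\<And>\<beta> \<gamma>. \<beta> < \<gamma> \<Longrightarrow> \<gamma> < \<alpha> \<Longrightarrow> rel \<beta> \<gamma> (F \<beta>) (F \<gamma>)"
        and lm: "\<And>\<beta>. \<beta> < \<alpha> \<Longrightarrow> olimit \<beta> \<Longrightarrow> LimR \<beta> F (F \<beta>)" for \<alpha> F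
    proof -
      let ?A = "union_model ((\<lambda>\<beta>. fst (F \<beta>)) ` {..<\<alpha>})" and ?U = "union_model ((\<lambda>\<beta>. snd (F \<beta>)) ` {..<\<alpha>})"
      have sa: "small lam \<alpha>" using small_mono[OF sm] a(2) by simp
      have A: "\<And>\<beta>. \<beta> < \<alpha> \<Longrightarrow> fst (F \<beta>) \<preceq> ?A" "\<And>N. (\<And>\<beta>. \<beta> < \<alpha> \<Longrightarrow> fst (F \<beta>) \<preceq> N) \<Longrightarrow> ?A \<preceq> N"
          "chain \<alpha> ((\<lambda>\<beta>. fst (F \<beta>))(\<alpha> := ?A))"
        by (rule chain_limit[of \<alpha> "\<lambda>\<beta>. fst (F \<beta>)", OF a(1) sa]; use InvD[OF inv] rl lm in \<open>simp add: rel_def LimR_def\<close>)+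
      have U: "?U \<in> KL" "\<And>\<beta>. \<beta> < \<alpha> \<Longrightarrow> snd (F \<beta>) \<preceq> ?U"
        by (rule chain_limit[of \<alpha> "\<lambda>\<beta>. snd (F \<beta>)", OF a(1) sa]; use InvD[OF inv] rl lm in \<open>simp add: rel_def LimR_def\<close>)+
      have AU: "?A \<preceq> ?U" using A(2) le_trans[OF InvD(3)[OF inv] U(2)] by blast
      have JU: "J \<subseteq> univ ?U"
        using inv[OF olimit_pos[OF a(1)]] le_univ[OF U(2)[OF olimit_pos[OF a(1)]]] unfolding Inv_def by blast
      have "indl M ?A bs ?U" if bs: "distinct bs" "set bs \<subseteq> R \<alpha>" for bs
      proof -
        have "indl M (((\<lambda>\<beta>. fst (F \<beta>))(\<alpha> := ?A)) \<alpha>) bs ?U"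
        proof (rule indl_limit[OF A(3) a(1) _ U(1)])
          show "set bs \<subseteq> univ ?U" using bs(2) RJ JU by blast
          fix \<beta> assume b: "\<beta> < \<alpha>"
          have "R \<alpha> \<subseteq> R \<beta>" unfolding R_def using b by auto
          then have "indl M (fst (F \<beta>)) bs (snd (F \<beta>))" "set bs \<subseteq> univ (snd (F \<beta>))"
            using inv[OF b] bs RJ[of \<beta>] unfolding Inv_def fin_indep_def by blast+
          then show "indl M (((\<lambda>\<beta>. fst (F \<beta>))(\<alpha> := ?A)) \<beta>) bs ?U"
            using indl_extend[OF _ _ U(2)[OF b] U(1)] b by simp
        qed (use AU in simp)
        then show ?thesis by simp
      qed
      then have "Inv \<alpha> (?A, ?U)" unfolding Inv_def fin_indep_def using JU by simp
      moreover have "rel \<beta> \<alpha> (F \<beta>) (?A, ?U)" if "\<beta> < \<alpha>" for \<beta>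
        unfolding rel_def using A(1)[OF that] U(2)[OF that] not_olimit_osuc[OF osuc_greater[OF that]] a(1) by auto
      ultimately show ?thesis unfolding LimR_def by auto
    qed
  qed (rule that)
  have c: "chain \<alpha>s (\<lambda>k. fst (F k))"
    by (rule chainI) (use sm InvD(1)[OF F(2)] F(3,4) in \<open>auto simp: rel_def LimR_def\<close>)
  have nf: "nf s M (fst (F k)) (a k) (fst (F (osuc k)))" if "k < \<alpha>s" for k
    using F(3)[of k "osuc k"] succ_less[OF sm that] unfolding rel_def by auto
  have "indep_over lam s M (\<lambda>k. fst (F k)) a \<alpha>s"
    unfolding indep_over_def using c nf d F(1) unfolding chain_def by simp
  moreover have "N \<preceq> snd (F \<alpha>s)"
    using F(3)[of ozero \<alpha>s] ozero_le[of \<alpha>s] F(1) KL_refl[OF d(3)] unfolding rel_def by (cases "\<alpha>s = ozero") auto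
  ultimately show "indep_seq lam s a \<alpha>s M M0 N"
    unfolding indep_seq_def using F(1) InvD(2,3)[OF F(2)[of \<alpha>s]]
    by (intro exI[of _ "\<lambda>k. fst (F k)"] bexI[of _ "snd (F \<alpha>s)"]) auto
qed

text \<open>Indices skipped between selected elements are bridged by lowering the base from
  \<open>Ms j\<close> to the smaller \<open>Ms k\<close>.\<close>

lemma indep_over_indl:
  fixes Ms :: "'o \<Rightarrow> ('a, 'f, 'r) model"
  assumes i: "indep_over lam s M Ms a \<alpha>s" and N: "Ms \<alpha>s \<preceq> N" "N \<in> KL"
  shows "sorted_wrt (<) is \<Longrightarrow> \<forall>i\<in>set is. k \<le> i \<and> i < \<alpha>s \<Longrightarrow> k \<le> \<alpha>s \<Longrightarrow> indl M (Ms k) (map a is) N"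
proof (induction "is" arbitrary: k)
  have le: "Ms k \<preceq> Ms l" if "k \<le> l" "l \<le> \<alpha>s" for k l
    using inc_cont_le[of "{..\<alpha>s}" Ms k l] i that unfolding indep_over_def by auto
  have M: "M \<in> KL" "Ms k \<in> KL" "M \<preceq> Ms k" "Ms k \<preceq> N" if "k \<le> \<alpha>s" for k
    using i le_trans[OF _ le[OF ozero_le that], of M] le_trans[OF le[OF that order.refl] N(1)] that
    unfolding indep_over_def by auto
  {
    case Nil
    then show ?case using M[OF Nil(3)] N(2) by simp
  next
    case (Cons j "is")
    have j: "k \<le> j" "j < \<alpha>s" "osuc j \<le> \<alpha>s" using Cons.prems(2) osuc_le[of j \<alpha>s] by auto
    have "\<forall>i\<in>set is. osuc j \<le> i \<and> i < \<alpha>s" using Cons.prems(1,2) osuc_le by auto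
    then have "indl M (Ms (osuc j)) (map a is) N" using Cons.IH Cons.prems(1) j(3) by simp
    moreover have "nf s M (Ms j) (a j) (Ms (osuc j))" using i j(2) unfolding indep_over_def by blast
    ultimately have "indl M (Ms j) (map a (j # is)) N"
      using M(4)[OF less_imp_le[OF j(2)]] N(2) KL_refl[OF N(2)] by auto
    then show ?case using indl_lower M(2,3)[OF Cons.prems(3)] le[OF j(1) less_imp_le[OF j(2)]] by blast
  }
qed

text \<open>The witnessing sequence may leave \<open>N\<close>, hence the extension
  \<open>N'\<close>. A finite subset is first listed by increasing index, where independence is
  inherited, and then rearranged by \<open>indl_subset\<close>.\<close>

lemma indep_set_fin_indep:
  assumes i: "indep_set TYPE('o) lam s J M (univ M0) N" and M: "M0 \<in> KL" "N \<in> KL" "M \<preceq> M0" "M0 \<preceq> N"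
  obtains N' where "N \<preceq> N'" "J \<subseteq> univ N'" "fin_indep J M M0 N'"
proof -
  obtain \<alpha>s :: 'o and Ms a N' where c: "indep_over lam s M Ms a \<alpha>s" "J = a ` {..<\<alpha>s}"
      "univ M0 \<subseteq> univ (Ms ozero)" "Ms \<alpha>s \<preceq> N'" "N \<preceq> N'" "N' \<in> KL"
    using i unfolding indep_set_def by blast
  have le: "Ms k \<preceq> N'" if "k \<le> \<alpha>s" for k
    using inc_cont_le[of "{..\<alpha>s}" Ms k \<alpha>s] c(1) that le_trans[OF _ c(4)] unfolding indep_over_def by auto
  have M0: "M0 \<preceq> Ms ozero" using le_coherent[OF le_trans[OF M(4) c(5)] le[OF ozero_le] c(3)] .
  have "J \<subseteq> univ N'"
  proof
    fix x assume "x \<in> J"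
    then obtain k where k: "k < \<alpha>s" "x = a k" using c(2) by blast
    then have "nf s M (Ms k) (a k) (Ms (osuc k))" using c(1) unfolding indep_over_def by blast
    then show "x \<in> univ N'" using nfD(6) k(2) le_univ[OF le[OF osuc_le[OF k(1)]]] by blast
  qed
  moreover have "indl M M0 bs N'" if bs: "distinct bs" "set bs \<subseteq> J" for bs
  proof -
    obtain I where I: "I \<subseteq> {..<\<alpha>s}" "finite I" "set bs = a ` I"
      using finite_subset_image[OF finite_set bs(2)[unfolded c(2)]] by blast
    have "indl M (Ms ozero) (map a (sorted_list_of_set I)) N'"
      by (rule indep_over_indl[OF c(1,4,6)]) (use I ozero_le in auto)
    then have "indl M (Ms ozero) bs N'" using indl_subset[OF _ bs(1)] I by simp
    then show ?thesis using indl_lower[OF _ M(3) M0 M(1)] by blast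
  qed
  ultimately show ?thesis using that[OF c(5)] unfolding fin_indep_def by blast
qed

lemma fin_indep_shrink:
  assumes "fin_indep J M M0 N'" "N \<preceq> N'" "M0 \<preceq> N" "N \<in> KL"
  shows "fin_indep J M M0 N"
  using assms(1) indl_shrink[OF _ assms(2,3,4)] unfolding fin_indep_def by blast

lemma fin_indep_indep_set:
  assumes "fin_indep J M M0 N" "J \<subseteq> univ N"
  shows "indep_set TYPE('o) lam s J M (univ M0) N"
proof -
  obtain \<alpha>s :: 'o and a where a: "bij_betw a {..<\<alpha>s} J"
    by (rule ordinal_enumeration[OF ordLeq_ordLess_trans[OF card_of_mono1[OF subset_UNIV] a_o]])
  have "indep_seq lam s a \<alpha>s M M0 N" by (rule fin_indep_seq[OF assms a])
  then show ?thesis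
    unfolding indep_seq_def indep_set_def using a unfolding bij_betw_def
    by (metis subset_refl)
qed

end

section \<open>Counting finite subsets\<close>

lemma card_of_lists_ordLeq:
  assumes A: "infinite A"
  shows "|lists A| \<le>o |A|"
proof -
  define L where "L n = {xs \<in> lists A. length xs = n}" for n
  have L: "|L n| \<le>o |A|" for n
  proof (induction n)
    case 0
    have "L 0 = {[]}" unfolding L_def by auto
    then show ?case using A by (simp add: card_of_singl_ordLeq infinite_imp_nonempty)
  next
    case (Suc n)
    have "L (Suc n) \<subseteq> (\<lambda>(x, xs). x # xs) ` (A \<times> L n)"
      unfolding L_def by (auto simp: length_Suc_conv image_iff)
    then have "|L (Suc n)| \<le>o |A \<times> L n|" using ordLeq_transitive[OF card_of_mono1 card_of_image] by blast
    moreover have "|A \<times> L n| \<le>o |A \<times> A|" using card_of_Times_mono2 Suc.IH by blast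
    moreover have "|A \<times> A| =o |A|" using card_of_Times_same_infinite A by blast
    ultimately show ?case using ordLeq_transitive ordLeq_ordIso_trans by blast
  qed
  have "lists A = (\<Union>n. L n)" unfolding L_def by auto
  then show ?thesis
    using card_of_UNION_ordLeq_infinite[OF A, of UNIV L] L infinite_iff_card_of_nat A by auto
qed

text \<open>A pigeonhole argument: an infinite \<open>I\<close> has no more finite subsets than
  elements, a finite \<open>I\<close> has finitely many. If all fibers were finite, \<open>J\<close>
  would be no larger than \<open>I\<close> in the first case and finite in the second.\<close>

lemma infinite_fiber:
  assumes J: "infinite J" "|I| <o |J|" and f: "\<And>b. b \<in> J - I \<Longrightarrow> f b \<in> Fpow I"
  shows "\<exists>K\<in>Fpow I. infinite {b \<in> J - I. f b = K}"
proof (rule ccontr)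
  assume n: "\<not> (\<exists>K\<in>Fpow I. infinite {b \<in> J - I. f b = K})"
  then have fin: "finite {b \<in> J - I. f b = K}" if "K \<in> Fpow I" for K using that by blast
  have U: "J - I = (\<Union>K\<in>Fpow I. {b \<in> J - I. f b = K})" using f by auto
  show False
  proof (cases "finite I")
    case True
    then have "finite (Fpow I)" using finite_subset[OF Fpow_subset_Pow] by auto
    then have "finite (\<Union>K\<in>Fpow I. {b \<in> J - I. f b = K})" using fin by blast
    then have "finite (J - I)" unfolding U[symmetric] .
    then show False using J(1) True by simp
  next
    case False
    have "Fpow I \<subseteq> set ` lists I" unfolding Fpow_def using finite_list by fastforce
    then have FI: "|Fpow I| \<le>o |I|"
      using ordLeq_transitive[OF card_of_mono1 ordLeq_transitive[OF card_of_image card_of_lists_ordLeq[OF False]]] by blast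
    have "|{b \<in> J - I. f b = K}| \<le>o |I|" if "K \<in> Fpow I" for K
      by (rule ordLess_imp_ordLeq[OF finite_ordLess_infinite])
        (use fin[OF that] False in \<open>auto simp: Field_card_of card_of_well_order_on\<close>)
    then have "|J - I| \<le>o |I|"
      by (subst U) (intro card_of_UNION_ordLeq_infinite[OF False FI] ballI)
    moreover have "Cinfinite |I|" using False by (simp add: cinfinite_def Field_card_of card_of_card_order_on)
    ultimately have "|I \<union> (J - I)| \<le>o |I|" using Un_ordLeq_Cinfinite card_of_mono1[OF order.refl] by blast
    moreover have "|J| \<le>o |I \<union> (J - I)|" by (rule card_of_mono1) blast
    ultimately have "|J| \<le>o |I|" by (rule ordLeq_transitive[rotated])
    then show False using J(2) not_ordLess_ordLeq by blast
  qed
qed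

section \<open>Independent sets as finitely independent sets\<close>

context frame_with_uq
begin

lemma fin_indep_set_fin_indep:
  assumes i: "fin_indep_set TYPE('o) lam s J M (univ M0) N" and M: "M0 \<in> KL" "N \<in> KL" "M \<preceq> M0" "M0 \<preceq> N"
  shows "fin_indep J M M0 N"
  unfolding fin_indep_def
proof (intro allI impI)
  fix bs assume bs: "distinct bs \<and> set bs \<subseteq> J"
  then have "indep_set TYPE('o) lam s (set bs) M (univ M0) N" using i unfolding fin_indep_set_def by simp
  then obtain N' where N': "N \<preceq> N'" "set bs \<subseteq> univ N'" "fin_indep (set bs) M M0 N'"
    by (rule indep_set_fin_indep[OF _ M])
  show "indl M M0 bs N"
    by (rule fin_indepD[OF fin_indep_shrink[OF N'(3,1) M(4,2)]]) (use bs in auto)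
qed

lemma indep_set_iff:
  assumes "M0 \<in> KL" "N \<in> KL" "M \<preceq> M0" "M0 \<preceq> N" "J \<subseteq> univ N"
  shows "indep_set TYPE('o) lam s J M (univ M0) N \<longleftrightarrow> fin_indep J M M0 N"
proof
  assume "indep_set TYPE('o) lam s J M (univ M0) N"
  then obtain N' where "N \<preceq> N'" "fin_indep J M M0 N'" by (rule indep_set_fin_indep[OF _ assms(1-4)])
  then show "fin_indep J M M0 N" using fin_indep_shrink assms(2,4) by blast
qed (rule fin_indep_indep_set[OF _ assms(5)])

section \<open>Maximal independent sets and dimension\<close>

lemma fin_indep_subset: "fin_indep J M A N \<Longrightarrow> I \<subseteq> J \<Longrightarrow> fin_indep I M A N"
  unfolding fin_indep_def by blast

text \<open>
  By resolution, a finite set cannot depend on infinitely many members of an independent set: it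
  lies in some \<open>W \<alpha>\<close>, over which \<open>a \<alpha>\<close> does not fork over \<open>M\<close>.
\<close>

lemma fin_indep_snoc:
  assumes ks: "indl M M ks N" "set ks \<subseteq> univ N" and B: "infinite B" "B \<subseteq> univ N" "fin_indep B M M N"
  shows "\<exists>b\<in>B. indl M M (ks @ [b]) N"
proof -
  note d = indlD[OF ks(1)]
  obtain \<alpha>s :: 'o and a where a: "bij_betw a {..<\<alpha>s} B"
    by (rule ordinal_enumeration[OF ordLeq_ordLess_trans[OF card_of_mono1[OF subset_UNIV] a_o]])
  have sm: "small lam \<alpha>s" by (rule fin_indep_seq(2)[OF B(3,2) a])
  obtain Ms N' where Ms: "Ms ozero = M" "indep_over lam s M Ms a \<alpha>s" "N \<preceq> N'" "Ms \<alpha>s \<preceq> N'" "N' \<in> KL"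
    using fin_indep_seq(1)[OF B(3,2) a] unfolding indep_seq_def by blast
  have c: "chain \<alpha>s Ms" using Ms(2) sm unfolding indep_over_def chain_def by blast
  have inf: "infinite {..<\<alpha>s}" using B(1) bij_betw_finite[OF a] by simp
  \<comment> \<open>The initial segment of length \<omega> of the enumeration of \<open>B\<close>
    suffices; the least index with infinitely many predecessors is a limit, as
    \<open>resolution\<close> requires.\<close>
  define \<omega> :: 'o where "\<omega> = (LEAST \<alpha>. infinite {..<\<alpha>})"
  have w: "infinite {..<\<omega>}" "\<omega> \<le> \<alpha>s" unfolding \<omega>_def
    using LeastI[of "\<lambda>\<alpha>. infinite {..<\<alpha>}", OF inf] Least_le[of "\<lambda>\<alpha>. infinite {..<\<alpha>}", OF inf] by auto
  have lim: "olimit \<omega>"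
  proof (cases \<omega> rule: ord_cases)
    case 1
    have "{..<\<omega>} = {}" unfolding 1 by auto
    then show ?thesis using w(1) by simp
  next
    case (2 \<beta>)
    have "finite {..<\<beta>}" using not_less_Least 2(1) unfolding \<omega>_def by blast
    moreover have "{..<\<omega>} = insert \<beta> {..<\<beta>}" using less_osuc_iff[OF 2(3)] 2(2) by (auto simp: le_less)
    ultimately show ?thesis using w(1) by simp
  qed
  note cw = chain_mono[OF c w(2)]
  note cD = chainD[OF c]
  have wN: "Ms \<omega> \<preceq> N'" using le_trans[OF cD(3)[OF w(2) order.refl] Ms(4)] .
  obtain W where W: "chain \<omega> W" "N' \<preceq> W \<omega>" "\<And>\<alpha>. \<alpha> < \<omega> \<Longrightarrow> NFall (Ms \<alpha>) (W \<alpha>) (Ms \<omega>) (W \<omega>)"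
    by (rule resolution[OF cw lim Ms(5) wN]) blast
  have NW: "N \<preceq> W \<omega>" using le_trans[OF Ms(3) W(2)] .
  have "set ks \<subseteq> univ (W \<omega>)" using ks(2) le_univ[OF NW] by blast
  then obtain \<alpha> where al: "\<alpha> < \<omega>" "set ks \<subseteq> univ (W \<alpha>)"
    by (rule finite_subset_chain_member[OF W(1) lim finite_set])
  \<comment> \<open>The square is used with its sides exchanged: \<open>a \<alpha>\<close> is free
    over \<open>Ms \<alpha>\<close> inside \<open>Ms \<omega>\<close>, and this freeness lifts to
    \<open>W \<alpha>\<close>, which contains \<open>ks\<close>.\<close>
  have fl: "NFall (Ms \<alpha>) (Ms \<omega>) (W \<alpha>) (W \<omega>)" using NFall_flip[OF W(3)[OF al(1)]] .
  have sq: "square (Ms \<alpha>) (Ms \<omega>) (W \<alpha>) (W \<omega>)" using fl unfolding NFall_def by blast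
  note q = squareD[OF sq]
  have "nf s M (Ms \<alpha>) (a \<alpha>) (Ms (osuc \<alpha>))"
    using Ms(2) less_le_trans[OF al(1) w(2)] unfolding indep_over_def by blast
  then have n: "nf s M (Ms \<alpha>) (a \<alpha>) (Ms \<omega>)" using nf_up cD(3)[OF osuc_le[OF al(1)] w(2)] q(6) by blast
  then have "indl M (Ms \<alpha>) [a \<alpha>] (Ms \<omega>)"
    using nfD(1,4)[OF n] q(1,6) KL_refl[OF q(6)] le_trans[OF nfD(4)[OF n] q(1)] by auto
  moreover have aw: "a \<alpha> \<in> univ (Ms \<omega>)" using nfD(6)[OF n] .
  ultimately have "indl M (W \<alpha>) [a \<alpha>] (W \<omega>)" using NFall_indl[OF fl, of "[a \<alpha>]" M] by simp
  then have nW: "nf s M (W \<alpha>) (a \<alpha>) (W \<omega>)" using indl_single aw le_univ[OF q(2)] by blast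
  have MW: "M \<preceq> W \<alpha>" using nfD(4)[OF nW] .
  have "indl M M ks (W \<alpha>)" using indl_shrink[OF indl_extend[OF ks NW q(8)] q(4) MW q(7)] .
  then have "indl M M (ks @ [a \<alpha>]) (W \<omega>)" using indl_snocI[OF _ al(2) nW] by blast
  then have "indl M M (ks @ [a \<alpha>]) N" using indl_shrink NW d(3,5) by blast
  moreover have "a \<alpha> \<in> B" using a less_le_trans[OF al(1) w(2)] unfolding bij_betw_def by auto
  ultimately show ?thesis by blast
qed

text \<open>By maximality every \<open>b\<close> in \<open>J\<close> outside \<open>I\<close>
  depends on a finite subset of \<open>I\<close>. If \<open>J\<close> were larger than
  \<open>I\<close>, infinitely many \<open>b\<close> would depend on the same finite set, which
  \<open>fin_indep_snoc\<close> excludes.\<close>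

lemma max_indep_ordLeq:
  assumes M: "M \<preceq> N" "M \<in> KL" "N \<in> KL"
    and I: "max_indep_subset_in TYPE('o) lam s M P N I" and J: "indep_subset_in TYPE('o) lam s M P N J" "infinite J"
  shows "|J| \<le>o |I|"
proof (rule ccontr)
  assume "\<not> |J| \<le>o |I|"
  then have lt: "|I| <o |J|" by (simp add: not_ordLeq_iff_ordLess card_of_Well_order)
  have I': "indep_subset_in TYPE('o) lam s M P N I" using I unfolding max_indep_subset_in_def by blast
  have fin: "J' \<subseteq> univ N \<Longrightarrow> indep_set TYPE('o) lam s J' M (univ M) N \<longleftrightarrow> fin_indep J' M M N" for J'
    using indep_set_iff[OF M(2,3) KL_refl[OF M(2)] M(1)] by blast
  have IN: "I \<subseteq> univ N" "fin_indep I M M N" and JN: "J \<subseteq> univ N" "fin_indep J M M N"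
    using I' J(1) fin unfolding indep_subset_in_def by auto
  have "\<exists>K. K \<in> Fpow I \<and> (\<forall>ks. set ks = K \<longrightarrow> \<not> indl M M (ks @ [b]) N)" if b: "b \<in> J - I" for b
  proof -
    have "\<not> indep_subset_in TYPE('o) lam s M P N (insert b I)"
      using I b unfolding max_indep_subset_in_def by blast
    moreover have "insert b I \<subseteq> univ N" "\<forall>a\<in>insert b I. tp s a M N \<in> P"
      using I' J(1) b unfolding indep_subset_in_def by auto
    ultimately have "\<not> fin_indep (insert b I) M M N" using fin unfolding indep_subset_in_def by blast
    then obtain bs where bs: "distinct bs" "set bs \<subseteq> insert b I" "\<not> indl M M bs N" unfolding fin_indep_def by blast
    have "\<not> indl M M (ks @ [b]) N" if "set ks = set bs - {b}" for ks
      using indl_subset[OF _ bs(1), of M M "ks @ [b]" N] bs(3) that by auto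
    then show ?thesis using bs(2) by (intro exI[of _ "set bs - {b}"]) (auto simp: Fpow_def)
  qed
  then obtain f where f: "\<And>b. b \<in> J - I \<Longrightarrow> f b \<in> Fpow I"
      "\<And>b ks. b \<in> J - I \<Longrightarrow> set ks = f b \<Longrightarrow> \<not> indl M M (ks @ [b]) N"
    by metis
  obtain K where K: "K \<in> Fpow I" "infinite {b \<in> J - I. f b = K}"
    using infinite_fiber[OF J(2) lt, of f] f(1) by blast
  obtain ks where ks: "set ks = K" "distinct ks" using K(1) finite_distinct_list unfolding Fpow_def by blast
  have "indl M M ks N" by (rule fin_indepD[OF IN(2) ks(2)]) (use K(1) ks in \<open>auto simp: Fpow_def\<close>)
  moreover have "set ks \<subseteq> univ N" using K(1) ks(1) IN(1) unfolding Fpow_def by blast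
  ultimately obtain b where "b \<in> {b \<in> J - I. f b = K}" "indl M M (ks @ [b]) N"
    using fin_indep_snoc[OF _ _ K(2) _ fin_indep_subset[OF JN(2)]] JN(1) by blast
  then show False using f(2) ks(1) by blast
qed

end

text \<open>The minimum defining \<open>dim\<close> is attained by some maximal set, which is no
  larger than \<open>J\<close>. A finite \<open>J\<close> thus makes both cardinals finite, and for
  an infinite \<open>J\<close> the second assumption gives the reverse inequality.\<close>

lemma dim_dichotomy:
  assumes "max_indep_subset_in ord lam s M P N J"
    and "\<And>I. max_indep_subset_in ord lam s M P N I \<Longrightarrow> infinite J \<Longrightarrow> |J| \<le>o |I|"
  shows "dim ord lam s M P N =o |J| \<or> dim ord lam s M P N +c |J| <o natLeq"
proof -
  let ?C = "{|J| | J. max_indep_subset_in ord lam s M P N J}"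
  have "?C \<noteq> {}" "\<forall>r\<in>?C. Card_order r" using assms(1) card_of_Card_order by blast+
  then have "\<exists>\<kappa>. \<kappa> \<in> ?C \<and> (\<forall>\<mu>\<in>?C. \<kappa> \<le>o \<mu>)" using exists_minim_Card_order[of ?C] unfolding Bex_def by simp
  then have d: "dim ord lam s M P N \<in> ?C \<and> (\<forall>\<mu>\<in>?C. dim ord lam s M P N \<le>o \<mu>)"
    unfolding dim_def ord_min_def by (rule someI_ex)
  obtain I where I: "dim ord lam s M P N = |I|" "max_indep_subset_in ord lam s M P N I"
    using conjunct1[OF d] by auto
  have "|J| \<in> ?C" using assms(1) by (intro CollectI exI[of _ J] conjI refl)
  then have IJ: "|I| \<le>o |J|" using conjunct2[OF d, THEN bspec] I(1) by simp
  show ?thesis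
  proof (cases "finite J")
    case True
    then have "finite (I <+> J)" using card_of_ordLeq_finite[OF IJ] by simp
    then show ?thesis unfolding I(1) csum_def Field_card_of by (simp add: finite_iff_ordLess_natLeq)
  next
    case False
    then show ?thesis using assms(2)[OF I(2)] IJ unfolding I(1) ordIso_iff_ordLeq by simp
  qed
qed

theorem theorem4p13:
  fixes lam :: "'l rel" and s :: "('a, 'f, 'r) frame"
  assumes "Cinfinite lam"
    and "lam <o |UNIV :: 'a set|"
    and "|UNIV :: 'a set| <o |UNIV :: 'o::wellorder set|"
    and "good_frame_minus_stability TYPE('o) lam s"
    and "conjugation lam s"
    and "K3uq_existence lam s"
  shows
    "(\<forall>M\<in>K_at s lam. \<forall>M0\<in>K_at s lam. \<forall>N\<in>K_at s lam. \<forall>J.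
        le s M M0 \<and> le s M0 N \<and> J \<subseteq> univ N \<longrightarrow>
        (indep_set TYPE('o) lam s J M (univ M0) N \<longleftrightarrow>
         fin_indep_set TYPE('o) lam s J M (univ M0) N)) \<and>
     (\<forall>M\<in>K_at s lam. \<forall>M0\<in>K_at s lam. \<forall>N\<in>K_at s lam. \<forall>J (a :: 'o \<Rightarrow> 'a) \<alpha>s.
        le s M M0 \<and> le s M0 N \<and> indep_set TYPE('o) lam s J M (univ M0) N \<and>
        bij_betw a {..<\<alpha>s} J \<longrightarrow>
        indep_seq lam s a \<alpha>s M M0 N) \<and>
     (\<forall>M\<in>K_at s lam. \<forall>N\<in>K_at s lam. \<forall>J (\<delta>::'o) Ms.
        olimit \<delta> \<and> inc_cont s {..\<delta>} Ms \<and> (\<forall>\<alpha>\<le>\<delta>. Ms \<alpha> \<in> K_at s lam) \<and>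
        le s M (Ms ozero) \<and> le s (Ms \<delta>) N \<and> J \<subseteq> univ N \<and>
        (\<forall>\<alpha><\<delta>. indep_set TYPE('o) lam s J M (univ (Ms \<alpha>)) N) \<longrightarrow>
        indep_set TYPE('o) lam s J M (univ (Ms \<delta>)) N) \<and>
     (\<forall>M\<in>K_at s lam. \<forall>N\<in>K_at s lam. \<forall>P J.
        le s M N \<and> P \<subseteq> Sbs s M \<and> max_indep_subset_in TYPE('o) lam s M P N J \<longrightarrow>
        dim TYPE('o) lam s M P N =o |J| \<or> dim TYPE('o) lam s M P N +c |J| <o natLeq)"
proof -
  interpret frame_with_uq lam s "TYPE('o)"
    using assms by unfold_locales
  show ?thesis
  proof (intro conjI ballI allI impI; (elim conjE)?)
    fix M M0 N J
    assume K: "M0 \<in> KL" "N \<in> KL" and le: "M \<preceq> M0" "M0 \<preceq> N" and J: "J \<subseteq> univ N"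
    have "fin_indep_set TYPE('o) lam s J M (univ M0) N" if "fin_indep J M M0 N"
      unfolding fin_indep_set_def
      using indep_set_iff[OF K le] fin_indep_subset[OF that] J by (meson subset_trans)
    then show "indep_set TYPE('o) lam s J M (univ M0) N \<longleftrightarrow> fin_indep_set TYPE('o) lam s J M (univ M0) N"
      using fin_indep_set_fin_indep[OF _ K le] indep_set_iff[OF K le J] by blast
  next
    fix M M0 N J and a :: "'o \<Rightarrow> 'a" and \<alpha>s
    assume K: "M0 \<in> KL" "N \<in> KL" and le: "M \<preceq> M0" "M0 \<preceq> N"
      and J: "indep_set TYPE('o) lam s J M (univ M0) N" and a: "bij_betw a {..<\<alpha>s} J"
    \<comment> \<open>\<open>J\<close> need not be contained in \<open>N\<close>, so the enumeration
      is treated in a larger \<open>N'\<close>; the conclusion passes down to \<open>N\<close>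
      because it only asks for a common extension.\<close>
    obtain N' where N': "N \<preceq> N'" "J \<subseteq> univ N'" "fin_indep J M M0 N'" by (rule indep_set_fin_indep[OF J K le])
    have "indep_seq lam s a \<alpha>s M M0 N'" by (rule fin_indep_seq[OF N'(3,2) a])
    then show "indep_seq lam s a \<alpha>s M M0 N" unfolding indep_seq_def using le_trans[OF N'(1)] by blast
  next
    fix M N J Ms and \<delta> :: 'o
    assume K: "M \<in> KL" "N \<in> KL" "\<forall>\<alpha>\<le>\<delta>. Ms \<alpha> \<in> KL" and d: "olimit \<delta>" "inc_cont s {..\<delta>} Ms"
      and le: "M \<preceq> Ms ozero" "Ms \<delta> \<preceq> N" and J: "J \<subseteq> univ N"
      and i: "\<forall>\<alpha><\<delta>. indep_set TYPE('o) lam s J M (univ (Ms \<alpha>)) N"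
    have lM: "M \<preceq> Ms \<alpha>" "Ms \<alpha> \<preceq> N" if "\<alpha> \<le> \<delta>" for \<alpha>
      using le_trans[OF le(1) inc_cont_le[OF d(2)]] le_trans[OF inc_cont_le[OF d(2)] le(2)] ozero_le that by auto
    have "fin_indep J M (Ms \<delta>) N"
    proof (rule fin_indep_limit[OF d(2) _ d(1) le(2) K(2) J])
      show "fin_indep J M (Ms \<alpha>) N" if "\<alpha> < \<delta>" for \<alpha>
        using i that indep_set_iff[OF _ K(2) lM J] K(3) less_imp_le[OF that] by blast
    qed (use K(3) in blast)
    then show "indep_set TYPE('o) lam s J M (univ (Ms \<delta>)) N" by (rule fin_indep_indep_set[OF _ J])
  next
    fix M N P J
    assume K: "M \<in> KL" "N \<in> KL" "M \<preceq> N" and J: "max_indep_subset_in TYPE('o) lam s M P N J"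
    have "indep_subset_in TYPE('o) lam s M P N J" using J unfolding max_indep_subset_in_def by (rule conjunct1)
    then show "dim TYPE('o) lam s M P N =o |J| \<or> dim TYPE('o) lam s M P N +c |J| <o natLeq"
      by (intro dim_dichotomy[OF J] max_indep_ordLeq[OF K(3,1,2)])
  qed
qed

end
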